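(* Let $\mathcal{M}$ be a smooth manifold. The following data are equivalent: (1) a bracket $\{\cdot,\cdot\}$ on $\Omega^*(\mathcal{M})$ making $\Omega^*(\mathcal{M})$, with its usual $d$ and $\wedge$, a differential graded Poisson algebra; (2) a Poisson structure on $\mathcal{M}$ together with a flat, torsion-free contravariant connection $\mathcal{D}$ whose metacurvature vanishes, $M=0$. The correspondence is such that the Poisson bracket of functions in (2) is the restriction of the bracket in (1) to degree $0$, and $\mathcal{D}_{df}\alpha=\{f,\alpha\}$ for $f\in C^\infty(\mathcal{M})$ and $\alpha\in\Omega^1(\mathcal{M})$; the data in each of (1) and (2) determine the data in the other.
   Context: A differential graded Poisson algebra is a graded vector space $\Omega^*$ with operations $d$, $\wedge$, $\{\cdot,\cdot\}$ such that: (1) $d:\Omega^k\to\Omega^{k+1}$ is linear and $d^2=0$; (2) $(\Omega^*,\wedge)$ is an associative graded-commutative algebra; (3) $\{\cdot,\cdot\}$ is bilinear, of degree $0$, $\{\sigma,\rho\}=-(-1)^{\deg\sigma\deg\rho}\{\rho,\sigma\}$, and $\{\{\sigma,\rho\},\lambda\}=\{\sigma,\{\rho,\lambda\}\}-(-1)^{\deg\sigma\deg\rho}\{\rho,\{\sigma,\lambda\}\}$; (4) $d(\sigma\wedge\rho)=d\sigma\wedge\rho+(-1)^{\deg\sigma}\sigma\wedge d\rho$; (5) $d\{\sigma,\rho\}=\{d\sigma,\rho\}+(-1)^{\deg\sigma}\{\sigma,d\rho\}$; (6) $\{\sigma,\rho\wedge\lambda\}=\{\sigma,\rho\}\wedge\lambda+(-1)^{\deg\sigma\deg\rho}\rho\wedge\{\sigma,\lambda\}$.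 All brackets and connections considered preserve real forms. A Poisson structure is a bivector $\pi$ whose bracket $\{f,g\}=\pi^{ij}\partial_if\,\partial_jg$ satisfies the Jacobi identity. The anchor is $(\#\alpha)^i=\pi^{ji}\alpha_j$. The Koszul bracket $[\cdot,\cdot]_\pi$ on $\Omega^1(\mathcal{M})$ is the unique Lie bracket with $[\alpha,f\beta]_\pi=f[\alpha,\beta]_\pi+(\#\alpha)(f)\beta$ and $[df,dg]_\pi=d\{f,g\}$. A contravariant connection is a bilinear map $(\alpha,\beta)\mapsto\mathcal{D}_\alpha\beta$ on $\Omega^1(\mathcal{M})$ with $\mathcal{D}_{f\alpha}\beta=f\mathcal{D}_\alpha\beta$ and $\mathcal{D}_\alpha(f\beta)=f\mathcal{D}_\alpha\beta+(\#\alpha)(f)\beta$; it is flat if $\mathcal{D}_\alpha\mathcal{D}_\beta-\mathcal{D}_\beta\mathcal{D}_\alpha-\mathcal{D}_{[\alpha,\beta]_\pi}=0$ and torsion-free if $\mathcal{D}_\alpha\beta-\mathcal{D}_\beta\alpha=[\alpha,\beta]_\pi$. It extends to tensors by the Leibniz rule, with $\mathcal{D}_\alpha f=(\#\alpha)(f)$. Metacurvature: given a flat torsion-free $\mathcal{D}$, put $\{f,\sigma\}:=\mathcal{D}_{df}\sigma$ for functions $f$ and forms $\sigma$, and let $\{\alpha,\beta\}\in\Omega^2(\mathcal{M})$, for $1$-forms $\alpha,\beta$, be the unique symmetric bilinear bracket with $\{f\alpha,\beta\}=f\{\alpha,\beta\}+\alpha\wedge\{f,\beta\}$ and $d\{f,\beta\}=\{df,\beta\}+\{f,d\beta\}$.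 The metacurvature is the tensor $M$ ($C^\infty(\mathcal{M})$-trilinear from $1$-forms to $2$-forms) with $M(df,\beta,\gamma)=\{f,\{\beta,\gamma\}\}-\{\{f,\beta\},\gamma\}-\{\{f,\gamma\},\beta\}$. *)

theory Defs
  imports "HOL-Analysis.Analysis" "HOL-Library.Function_Algebras"
begin

section \<open>Differential graded Poisson algebras\<close>

text \<open>
  A graded vector space is given by its homogeneous components \<open>V k\<close>, which are independent
  subspaces of an ambient real vector space with scalar multiplication \<open>sc\<close>; its elements
  are the finite sums of homogeneous ones, \<open>total V\<close>.
\<close>

definition total :: "(nat \<Rightarrow> 'v::ab_group_add set) \<Rightarrow> 'v set" where
  "total V = {x. \<exists>n y. (\<forall>k<n. y k \<in> V k) \<and> x = (\<Sum>k<n. y k)}"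

definition graded_vector_space ::
  "(real \<Rightarrow> 'v \<Rightarrow> 'v) \<Rightarrow> (nat \<Rightarrow> 'v::ab_group_add set) \<Rightarrow> bool" where
  "graded_vector_space sc V \<longleftrightarrow>
     vector_space sc \<and>
     (\<forall>k. module.subspace sc (V k)) \<and>
     (\<forall>n y. (\<forall>k<n. y k \<in> V k) \<and> (\<Sum>k<n. y k) = 0 \<longrightarrow> (\<forall>k<n. y k = 0))"

definition linear_on ::
  "(real \<Rightarrow> 'v \<Rightarrow> 'v) \<Rightarrow> 'v::ab_group_add set \<Rightarrow> ('v \<Rightarrow> 'v) \<Rightarrow> bool" where
  "linear_on sc S f \<longleftrightarrow>
     (\<forall>x\<in>S. \<forall>y\<in>S. f (x + y) = f x + f y) \<and> (\<forall>c. \<forall>x\<in>S. f (sc c x) = sc c (f x))"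

definition bilinear_on ::
  "(real \<Rightarrow> 'v \<Rightarrow> 'v) \<Rightarrow> 'v::ab_group_add set \<Rightarrow> ('v \<Rightarrow> 'v \<Rightarrow> 'v) \<Rightarrow> bool" where
  "bilinear_on sc S b \<longleftrightarrow>
     (\<forall>y\<in>S. linear_on sc S (\<lambda>x. b x y)) \<and> (\<forall>x\<in>S. linear_on sc S (b x))"

definition dg_poisson_algebra ::
  "(real \<Rightarrow> 'v \<Rightarrow> 'v) \<Rightarrow> (nat \<Rightarrow> 'v::ab_group_add set) \<Rightarrow>
   ('v \<Rightarrow> 'v) \<Rightarrow> ('v \<Rightarrow> 'v \<Rightarrow> 'v) \<Rightarrow> ('v \<Rightarrow> 'v \<Rightarrow> 'v) \<Rightarrow> bool" where
  "dg_poisson_algebra sc V d w b \<longleftrightarrow>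
     graded_vector_space sc V \<and>
     \<comment> \<open>(1) differential\<close>
     linear_on sc (total V) d \<and>
     (\<forall>k. \<forall>x\<in>V k. d x \<in> V (Suc k)) \<and>
     (\<forall>x\<in>total V. d (d x) = 0) \<and>
     \<comment> \<open>(2) graded-commutative algebra\<close>
     bilinear_on sc (total V) w \<and>
     (\<forall>k l. \<forall>x\<in>V k. \<forall>y\<in>V l. w x y \<in> V (k + l)) \<and>
     (\<forall>x\<in>total V. \<forall>y\<in>total V. \<forall>z\<in>total V. w (w x y) z = w x (w y z)) \<and>
     (\<forall>k l. \<forall>x\<in>V k. \<forall>y\<in>V l. w x y = sc ((- 1) ^ (k * l)) (w y x)) \<and>
     \<comment> \<open>(3) graded Lie bracket of degree 0\<close>
     bilinear_on sc (total V) b \<and>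
     (\<forall>k l. \<forall>x\<in>V k. \<forall>y\<in>V l. b x y \<in> V (k + l)) \<and>
     (\<forall>k l. \<forall>x\<in>V k. \<forall>y\<in>V l. b x y = - sc ((- 1) ^ (k * l)) (b y x)) \<and>
     (\<forall>k l. \<forall>x\<in>V k. \<forall>y\<in>V l. \<forall>z\<in>total V.
        b (b x y) z = b x (b y z) - sc ((- 1) ^ (k * l)) (b y (b x z))) \<and>
     \<comment> \<open>(4) Leibniz rule for \<open>d\<close> and the product\<close>
     (\<forall>k. \<forall>x\<in>V k. \<forall>y\<in>total V. d (w x y) = w (d x) y + sc ((- 1) ^ k) (w x (d y))) \<and>
     \<comment> \<open>(5) Leibniz rule for \<open>d\<close> and the bracket\<close>
     (\<forall>k. \<forall>x\<in>V k. \<forall>y\<in>total V. d (b x y) = b (d x) y + sc ((- 1) ^ k) (b x (d y))) \<and>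
     \<comment> \<open>(6) Leibniz rule for the bracket and the product\<close>
     (\<forall>k l. \<forall>x\<in>V k. \<forall>y\<in>V l. \<forall>z\<in>total V.
        b x (w y z) = w (b x y) z + sc ((- 1) ^ (k * l)) (w y (b x z)))"


section \<open>Smooth manifolds\<close>

text \<open>
  For finite-dimensional \<open>'a\<close> and open \<open>S\<close>, \<open>Ck_on n f S\<close> says that all iterated directional
  derivatives of order at most \<open>n\<close> exist and are continuous on \<open>S\<close>.
\<close>

primrec Ck_on ::
  "nat \<Rightarrow> ('a::real_normed_vector \<Rightarrow> 'b::real_normed_vector) \<Rightarrow> 'a set \<Rightarrow> bool" where
  "Ck_on 0 f S \<longleftrightarrow> continuous_on S f"
| "Ck_on (Suc n) f S \<longleftrightarrow>
     (\<forall>x\<in>S. f differentiable (at x)) \<and>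
     (\<forall>v. Ck_on n (\<lambda>x. frechet_derivative f (at x) v) S)"

definition smooth_on :: "('a::real_normed_vector \<Rightarrow> 'b::real_normed_vector) \<Rightarrow> 'a set \<Rightarrow> bool" where
  "smooth_on f S \<longleftrightarrow> (\<forall>n. Ck_on n f S)"

type_synonym ('m, 'e) chart = "'m set \<times> ('m \<Rightarrow> 'e)"

text \<open>
  The manifold is the whole type \<open>'m\<close>, with a (not necessarily maximal) smooth atlas \<open>A\<close>
  modelled on a finite-dimensional Euclidean vector space \<open>'e\<close>. Working with \<^class>\<open>real_inner\<close>
  and an explicit finiteness condition instead of \<^class>\<open>euclidean_space\<close> only serves to
  include manifolds of dimension 0.
\<close>

definition smooth_manifold ::
  "('m::{t2_space, second_countable_topology}, 'e::real_inner) chart set \<Rightarrow> bool" where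
  "smooth_manifold A \<longleftrightarrow>
     (\<exists>B::'e set. finite B \<and> span B = UNIV) \<and>
     (\<forall>(U, \<phi>)\<in>A. open U \<and> open (\<phi> ` U) \<and> homeomorphism U (\<phi> ` U) \<phi> (inv_into U \<phi>)) \<and>
     (\<Union>(U, \<phi>)\<in>A. U) = UNIV \<and>
     (\<forall>(U, \<phi>)\<in>A. \<forall>(W, \<psi>)\<in>A. smooth_on (\<psi> \<circ> inv_into U \<phi>) (\<phi> ` (U \<inter> W)))"


section \<open>Functions, vector fields and differential forms\<close>

text \<open>
  Vector fields are the derivations of the algebra of smooth functions, and \<open>k\<close>-forms are the
  alternating maps in \<open>k\<close> vector fields that are multilinear over the smooth functions. An
  inhomogeneous form is a function on lists of vector fields, its component of degree \<open>k\<close>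
  being its restriction to lists of length \<open>k\<close>. Maps on a carrier set are normalised to vanish
  outside of it, so that equality of maps is equality on the carrier. Sums and products of
  functions are pointwise.
\<close>

type_synonym 'm vfield = "('m \<Rightarrow> real) \<Rightarrow> ('m \<Rightarrow> real)"
type_synonym 'm form = "'m vfield list \<Rightarrow> ('m \<Rightarrow> real)"

text \<open>Multiplication of a vector field or a form by a function and by a real scalar.\<close>

definition fmul :: "('m \<Rightarrow> real) \<Rightarrow> ('a \<Rightarrow> 'm \<Rightarrow> real) \<Rightarrow> 'a \<Rightarrow> 'm \<Rightarrow> real" (infixr "\<cdot>" 75) where
  "f \<cdot> \<omega> = (\<lambda>x. f * \<omega> x)"

definition sc :: "real \<Rightarrow> 'm form \<Rightarrow> 'm form" where
  "sc c \<omega> = (\<lambda>_. c) \<cdot> \<omega>"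

text \<open>A function as a form of degree 0.\<close>

definition zero_form :: "('m \<Rightarrow> real) \<Rightarrow> 'm form" where
  "zero_form f = (\<lambda>Xs. if Xs = [] then f else 0)"

definition lie_bracket :: "'m vfield \<Rightarrow> 'm vfield \<Rightarrow> 'm vfield" where
  "lie_bracket X Y = (\<lambda>f. X (Y f) - Y (X f))"

text \<open>
  The shuffle formula. The set \<open>I\<close> collects the positions of the arguments of \<open>\<sigma>\<close>; the
  exponent counts the inversions of the corresponding shuffle.
\<close>

definition wedge :: "'m form \<Rightarrow> 'm form \<Rightarrow> 'm form" (infixr "\<and>\<^sub>\<Omega>" 70) where
  "\<sigma> \<and>\<^sub>\<Omega> \<rho> = (\<lambda>Xs p. \<Sum>I\<in>Pow {..<length Xs}.
     (- 1) ^ card {(i, j). i \<in> I \<and> j \<notin> I \<and> j < i} * \<sigma> (nths Xs I) p * \<rho> (nths Xs (- I)) p)"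

context
  fixes A :: "('m::topological_space, 'e::real_normed_vector) chart set"
begin

definition smooth_functions :: "('m \<Rightarrow> real) set" where
  "smooth_functions = {f. \<forall>(U, \<phi>)\<in>A. smooth_on (f \<circ> inv_into U \<phi>) (\<phi> ` U)}"

definition vector_fields :: "'m vfield set" where
  "vector_fields = {X.
     (\<forall>f\<in>smooth_functions. X f \<in> smooth_functions) \<and>
     (\<forall>f\<in>smooth_functions. \<forall>g\<in>smooth_functions. X (f + g) = X f + X g) \<and>
     (\<forall>c. \<forall>f\<in>smooth_functions. X ((\<lambda>_. c) * f) = (\<lambda>_. c) * X f) \<and>
     (\<forall>f\<in>smooth_functions. \<forall>g\<in>smooth_functions. X (f * g) = X f * g + f * X g) \<and>
     (\<forall>f. f \<notin> smooth_functions \<longrightarrow> X f = 0)}"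

definition forms :: "nat \<Rightarrow> 'm form set" where
  "forms k = {\<omega>.
     (\<forall>Xs. length Xs \<noteq> k \<or> \<not> set Xs \<subseteq> vector_fields \<longrightarrow> \<omega> Xs = 0) \<and>
     (\<forall>Xs. length Xs = k \<and> set Xs \<subseteq> vector_fields \<longrightarrow>
        \<omega> Xs \<in> smooth_functions \<and>
        (\<forall>i<k. \<forall>X\<in>vector_fields. \<forall>Y\<in>vector_fields.
           \<omega> (Xs[i := X + Y]) = \<omega> (Xs[i := X]) + \<omega> (Xs[i := Y])) \<and>
        (\<forall>i<k. \<forall>f\<in>smooth_functions. \<forall>X\<in>vector_fields.
           \<omega> (Xs[i := f \<cdot> X]) = f * \<omega> (Xs[i := X])) \<and>
        (\<forall>i<k. \<forall>j<k. i \<noteq> j \<and> Xs ! i = Xs ! j \<longrightarrow> \<omega> Xs = 0))}"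

text \<open>
  The exterior derivative
  \<open>d\<omega>(X\<^sub>0,\<dots>,X\<^sub>k) = \<Sum>\<^sub>i (-1)\<^sup>i X\<^sub>i(\<omega>(\<dots>)) + \<Sum>\<^sub>i\<^sub><\<^sub>j (-1)\<^sup>i\<^sup>+\<^sup>j \<omega>([X\<^sub>i,X\<^sub>j],\<dots>)\<close>, where the dots stand for the
  remaining vector fields in their order.
\<close>

definition ext_d :: "'m form \<Rightarrow> 'm form" where
  "ext_d \<omega> = (\<lambda>Xs. if set Xs \<subseteq> vector_fields then
     (\<lambda>p. (\<Sum>i<length Xs. (- 1) ^ i * (Xs ! i) (\<omega> (nths Xs (- {i}))) p) +
          (\<Sum>j<length Xs. \<Sum>i<j. (- 1) ^ (i + j) *
             \<omega> (lie_bracket (Xs ! i) (Xs ! j) # nths Xs (- {i, j})) p))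
     else 0)"

abbreviation differential :: "('m \<Rightarrow> real) \<Rightarrow> 'm form" where
  "differential f \<equiv> ext_d (zero_form f)"

text \<open>
  The set of data (1): brackets making the de Rham algebra a differential graded Poisson
  algebra.
\<close>

definition dgp_brackets :: "('m form \<Rightarrow> 'm form \<Rightarrow> 'm form) set" where
  "dgp_brackets = {b. dg_poisson_algebra sc forms ext_d wedge b \<and>
     (\<forall>\<sigma> \<rho>. \<sigma> \<notin> total forms \<or> \<rho> \<notin> total forms \<longrightarrow> b \<sigma> \<rho> = 0)}"


section \<open>Poisson structures\<close>

text \<open>A bivector is given by its evaluation \<open>\<pi>(\<alpha>, \<beta>) = \<pi>\<^sup>i\<^sup>j \<alpha>\<^sub>i \<beta>\<^sub>j\<close> on 1-forms.\<close>

definition bivector :: "('m form \<Rightarrow> 'm form \<Rightarrow> 'm \<Rightarrow> real) \<Rightarrow> bool" where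
  "bivector \<pi> \<longleftrightarrow>
     (\<forall>\<alpha>\<in>forms 1. \<forall>\<beta>\<in>forms 1. \<pi> \<alpha> \<beta> \<in> smooth_functions \<and> \<pi> \<alpha> \<beta> = - \<pi> \<beta> \<alpha>) \<and>
     (\<forall>\<alpha>\<in>forms 1. \<forall>\<beta>\<in>forms 1. \<forall>\<gamma>\<in>forms 1. \<pi> (\<alpha> + \<beta>) \<gamma> = \<pi> \<alpha> \<gamma> + \<pi> \<beta> \<gamma>) \<and>
     (\<forall>f\<in>smooth_functions. \<forall>\<alpha>\<in>forms 1. \<forall>\<beta>\<in>forms 1. \<pi> (f \<cdot> \<alpha>) \<beta> = f * \<pi> \<alpha> \<beta>) \<and>
     (\<forall>\<alpha> \<beta>. \<alpha> \<notin> forms 1 \<or> \<beta> \<notin> forms 1 \<longrightarrow> \<pi> \<alpha> \<beta> = 0)"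

definition function_bracket ::
  "('m form \<Rightarrow> 'm form \<Rightarrow> 'm \<Rightarrow> real) \<Rightarrow> ('m \<Rightarrow> real) \<Rightarrow> ('m \<Rightarrow> real) \<Rightarrow> 'm \<Rightarrow> real" where
  "function_bracket \<pi> f g = \<pi> (differential f) (differential g)"

definition poisson_structure :: "('m form \<Rightarrow> 'm form \<Rightarrow> 'm \<Rightarrow> real) \<Rightarrow> bool" where
  "poisson_structure \<pi> \<longleftrightarrow> bivector \<pi> \<and>
     (\<forall>f\<in>smooth_functions. \<forall>g\<in>smooth_functions. \<forall>h\<in>smooth_functions.
        function_bracket \<pi> f (function_bracket \<pi> g h) +
        function_bracket \<pi> g (function_bracket \<pi> h f) +
        function_bracket \<pi> h (function_bracket \<pi> f g) = 0)"

text \<open>The vector field \<open>(#\<alpha>)\<^sup>i = \<pi>\<^sup>j\<^sup>i \<alpha>\<^sub>j\<close> acts on functions by \<open>(#\<alpha>)(g) = \<pi>(\<alpha>, dg)\<close>.\<close>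

definition anchor :: "('m form \<Rightarrow> 'm form \<Rightarrow> 'm \<Rightarrow> real) \<Rightarrow> 'm form \<Rightarrow> 'm vfield" where
  "anchor \<pi> \<alpha> = (\<lambda>g. if g \<in> smooth_functions then \<pi> \<alpha> (differential g) else 0)"

definition is_koszul_bracket ::
  "('m form \<Rightarrow> 'm form \<Rightarrow> 'm \<Rightarrow> real) \<Rightarrow> ('m form \<Rightarrow> 'm form \<Rightarrow> 'm form) \<Rightarrow> bool" where
  "is_koszul_bracket \<pi> K \<longleftrightarrow>
     bilinear_on sc (forms 1) K \<and>
     (\<forall>\<alpha>\<in>forms 1. \<forall>\<beta>\<in>forms 1. K \<alpha> \<beta> \<in> forms 1 \<and> K \<alpha> \<beta> = - K \<beta> \<alpha>) \<and>
     (\<forall>\<alpha>\<in>forms 1. \<forall>\<beta>\<in>forms 1. \<forall>\<gamma>\<in>forms 1.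
        K \<alpha> (K \<beta> \<gamma>) + K \<beta> (K \<gamma> \<alpha>) + K \<gamma> (K \<alpha> \<beta>) = 0) \<and>
     (\<forall>f\<in>smooth_functions. \<forall>\<alpha>\<in>forms 1. \<forall>\<beta>\<in>forms 1.
        K \<alpha> (f \<cdot> \<beta>) = f \<cdot> K \<alpha> \<beta> + anchor \<pi> \<alpha> f \<cdot> \<beta>) \<and>
     (\<forall>f\<in>smooth_functions. \<forall>g\<in>smooth_functions.
        K (differential f) (differential g) = differential (function_bracket \<pi> f g)) \<and>
     (\<forall>\<alpha> \<beta>. \<alpha> \<notin> forms 1 \<or> \<beta> \<notin> forms 1 \<longrightarrow> K \<alpha> \<beta> = 0)"

definition koszul_bracket ::
  "('m form \<Rightarrow> 'm form \<Rightarrow> 'm \<Rightarrow> real) \<Rightarrow> 'm form \<Rightarrow> 'm form \<Rightarrow> 'm form" where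
  "koszul_bracket \<pi> = (THE K. is_koszul_bracket \<pi> K)"


section \<open>Contravariant connections and metacurvature\<close>

definition contravariant_connection ::
  "('m form \<Rightarrow> 'm form \<Rightarrow> 'm \<Rightarrow> real) \<Rightarrow> ('m form \<Rightarrow> 'm form \<Rightarrow> 'm form) \<Rightarrow> bool" where
  "contravariant_connection \<pi> D \<longleftrightarrow>
     bilinear_on sc (forms 1) D \<and>
     (\<forall>\<alpha>\<in>forms 1. \<forall>\<beta>\<in>forms 1. D \<alpha> \<beta> \<in> forms 1) \<and>
     (\<forall>f\<in>smooth_functions. \<forall>\<alpha>\<in>forms 1. \<forall>\<beta>\<in>forms 1.
        D (f \<cdot> \<alpha>) \<beta> = f \<cdot> D \<alpha> \<beta> \<and>
        D \<alpha> (f \<cdot> \<beta>) = f \<cdot> D \<alpha> \<beta> + anchor \<pi> \<alpha> f \<cdot> \<beta>) \<and>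
     (\<forall>\<alpha> \<beta>. \<alpha> \<notin> forms 1 \<or> \<beta> \<notin> forms 1 \<longrightarrow> D \<alpha> \<beta> = 0)"

definition flat ::
  "('m form \<Rightarrow> 'm form \<Rightarrow> 'm \<Rightarrow> real) \<Rightarrow> ('m form \<Rightarrow> 'm form \<Rightarrow> 'm form) \<Rightarrow> bool" where
  "flat \<pi> D \<longleftrightarrow> (\<forall>\<alpha>\<in>forms 1. \<forall>\<beta>\<in>forms 1. \<forall>\<gamma>\<in>forms 1.
     D \<alpha> (D \<beta> \<gamma>) - D \<beta> (D \<alpha> \<gamma>) - D (koszul_bracket \<pi> \<alpha> \<beta>) \<gamma> = 0)"

definition torsion_free ::
  "('m form \<Rightarrow> 'm form \<Rightarrow> 'm \<Rightarrow> real) \<Rightarrow> ('m form \<Rightarrow> 'm form \<Rightarrow> 'm form) \<Rightarrow> bool" where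
  "torsion_free \<pi> D \<longleftrightarrow> (\<forall>\<alpha>\<in>forms 1. \<forall>\<beta>\<in>forms 1.
     D \<alpha> \<beta> - D \<beta> \<alpha> = koszul_bracket \<pi> \<alpha> \<beta>)"

text \<open>
  Extension of \<open>D\<close> to vector fields by the Leibniz rule for the pairing,
  \<open>(#\<alpha>)(X g) = (D\<^sub>\<alpha> dg)(X) + (D\<^sub>\<alpha> X) g\<close>, and then to forms \<open>\<sigma>\<close> by the Leibniz rule for the evaluation
  \<open>\<sigma>(X\<^sub>1,\<dots>,X\<^sub>k)\<close>. For \<open>k = 0\<close> the latter is \<open>D\<^sub>\<alpha> f = (#\<alpha>)(f)\<close>.
\<close>

definition connection_on_vfield ::
  "('m form \<Rightarrow> 'm form \<Rightarrow> 'm \<Rightarrow> real) \<Rightarrow> ('m form \<Rightarrow> 'm form \<Rightarrow> 'm form) \<Rightarrow>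
   'm form \<Rightarrow> 'm vfield \<Rightarrow> 'm vfield" where
  "connection_on_vfield \<pi> D \<alpha> X = (\<lambda>g. if g \<in> smooth_functions
     then anchor \<pi> \<alpha> (X g) - D \<alpha> (differential g) [X] else 0)"

definition connection_on_form ::
  "('m form \<Rightarrow> 'm form \<Rightarrow> 'm \<Rightarrow> real) \<Rightarrow> ('m form \<Rightarrow> 'm form \<Rightarrow> 'm form) \<Rightarrow>
   'm form \<Rightarrow> 'm form \<Rightarrow> 'm form" where
  "connection_on_form \<pi> D \<alpha> \<sigma> = (\<lambda>Xs. if set Xs \<subseteq> vector_fields
     then anchor \<pi> \<alpha> (\<sigma> Xs) -
       (\<Sum>i<length Xs. \<sigma> (Xs[i := connection_on_vfield \<pi> D \<alpha> (Xs ! i)]))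
     else 0)"

text \<open>\<open>{f, \<sigma>} = D\<^sub>d\<^sub>f \<sigma>\<close> for a function \<open>f\<close> and a form \<open>\<sigma>\<close>.\<close>

definition function_form_bracket ::
  "('m form \<Rightarrow> 'm form \<Rightarrow> 'm \<Rightarrow> real) \<Rightarrow> ('m form \<Rightarrow> 'm form \<Rightarrow> 'm form) \<Rightarrow>
   ('m \<Rightarrow> real) \<Rightarrow> 'm form \<Rightarrow> 'm form" where
  "function_form_bracket \<pi> D f \<sigma> = connection_on_form \<pi> D (differential f) \<sigma>"

definition is_one_form_bracket ::
  "('m form \<Rightarrow> 'm form \<Rightarrow> 'm \<Rightarrow> real) \<Rightarrow> ('m form \<Rightarrow> 'm form \<Rightarrow> 'm form) \<Rightarrow>
   ('m form \<Rightarrow> 'm form \<Rightarrow> 'm form) \<Rightarrow> bool" where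
  "is_one_form_bracket \<pi> D B \<longleftrightarrow>
     bilinear_on sc (forms 1) B \<and>
     (\<forall>\<alpha>\<in>forms 1. \<forall>\<beta>\<in>forms 1. B \<alpha> \<beta> \<in> forms 2 \<and> B \<alpha> \<beta> = B \<beta> \<alpha>) \<and>
     (\<forall>f\<in>smooth_functions. \<forall>\<alpha>\<in>forms 1. \<forall>\<beta>\<in>forms 1.
        B (f \<cdot> \<alpha>) \<beta> = f \<cdot> B \<alpha> \<beta> + \<alpha> \<and>\<^sub>\<Omega> function_form_bracket \<pi> D f \<beta>) \<and>
     (\<forall>f\<in>smooth_functions. \<forall>\<beta>\<in>forms 1.
        ext_d (function_form_bracket \<pi> D f \<beta>) =
        B (differential f) \<beta> + function_form_bracket \<pi> D f (ext_d \<beta>)) \<and>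
     (\<forall>\<alpha> \<beta>. \<alpha> \<notin> forms 1 \<or> \<beta> \<notin> forms 1 \<longrightarrow> B \<alpha> \<beta> = 0)"

definition one_form_bracket ::
  "('m form \<Rightarrow> 'm form \<Rightarrow> 'm \<Rightarrow> real) \<Rightarrow> ('m form \<Rightarrow> 'm form \<Rightarrow> 'm form) \<Rightarrow>
   'm form \<Rightarrow> 'm form \<Rightarrow> 'm form" where
  "one_form_bracket \<pi> D = (THE B. is_one_form_bracket \<pi> D B)"

definition function_linear :: "('m form \<Rightarrow> 'm form) \<Rightarrow> bool" where
  "function_linear L \<longleftrightarrow>
     (\<forall>\<alpha>\<in>forms 1. \<forall>\<beta>\<in>forms 1. L (\<alpha> + \<beta>) = L \<alpha> + L \<beta>) \<and>
     (\<forall>f\<in>smooth_functions. \<forall>\<alpha>\<in>forms 1. L (f \<cdot> \<alpha>) = f \<cdot> L \<alpha>)"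

definition is_metacurvature ::
  "('m form \<Rightarrow> 'm form \<Rightarrow> 'm \<Rightarrow> real) \<Rightarrow> ('m form \<Rightarrow> 'm form \<Rightarrow> 'm form) \<Rightarrow>
   ('m form \<Rightarrow> 'm form \<Rightarrow> 'm form \<Rightarrow> 'm form) \<Rightarrow> bool" where
  "is_metacurvature \<pi> D M \<longleftrightarrow>
     (\<forall>\<alpha>\<in>forms 1. \<forall>\<beta>\<in>forms 1. \<forall>\<gamma>\<in>forms 1. M \<alpha> \<beta> \<gamma> \<in> forms 2) \<and>
     (\<forall>\<beta>\<in>forms 1. \<forall>\<gamma>\<in>forms 1. function_linear (\<lambda>\<alpha>. M \<alpha> \<beta> \<gamma>)) \<and>
     (\<forall>\<alpha>\<in>forms 1. \<forall>\<gamma>\<in>forms 1. function_linear (\<lambda>\<beta>. M \<alpha> \<beta> \<gamma>)) \<and>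
     (\<forall>\<alpha>\<in>forms 1. \<forall>\<beta>\<in>forms 1. function_linear (\<lambda>\<gamma>. M \<alpha> \<beta> \<gamma>)) \<and>
     (\<forall>f\<in>smooth_functions. \<forall>\<beta>\<in>forms 1. \<forall>\<gamma>\<in>forms 1.
        M (differential f) \<beta> \<gamma> =
          function_form_bracket \<pi> D f (one_form_bracket \<pi> D \<beta> \<gamma>)
          - one_form_bracket \<pi> D (function_form_bracket \<pi> D f \<beta>) \<gamma>
          - one_form_bracket \<pi> D (function_form_bracket \<pi> D f \<gamma>) \<beta>) \<and>
     (\<forall>\<alpha> \<beta> \<gamma>. \<alpha> \<notin> forms 1 \<or> \<beta> \<notin> forms 1 \<or> \<gamma> \<notin> forms 1 \<longrightarrow> M \<alpha> \<beta> \<gamma> = 0)"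

definition metacurvature ::
  "('m form \<Rightarrow> 'm form \<Rightarrow> 'm \<Rightarrow> real) \<Rightarrow> ('m form \<Rightarrow> 'm form \<Rightarrow> 'm form) \<Rightarrow>
   'm form \<Rightarrow> 'm form \<Rightarrow> 'm form \<Rightarrow> 'm form" where
  "metacurvature \<pi> D = (THE M. is_metacurvature \<pi> D M)"

text \<open>The set of data (2).\<close>

definition poisson_connections ::
  "(('m form \<Rightarrow> 'm form \<Rightarrow> 'm \<Rightarrow> real) \<times> ('m form \<Rightarrow> 'm form \<Rightarrow> 'm form)) set" where
  "poisson_connections = {(\<pi>, D).
     poisson_structure \<pi> \<and> contravariant_connection \<pi> D \<and> flat \<pi> D \<and> torsion_free \<pi> D \<and>
     (\<forall>\<alpha>\<in>forms 1. \<forall>\<beta>\<in>forms 1. \<forall>\<gamma>\<in>forms 1. metacurvature \<pi> D \<alpha> \<beta> \<gamma> = 0)}"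

definition corresponds ::
  "('m form \<Rightarrow> 'm form \<Rightarrow> 'm form) \<Rightarrow>
   ('m form \<Rightarrow> 'm form \<Rightarrow> 'm \<Rightarrow> real) \<times> ('m form \<Rightarrow> 'm form \<Rightarrow> 'm form) \<Rightarrow> bool" where
  "corresponds b = (\<lambda>(\<pi>, D).
     (\<forall>f\<in>smooth_functions. \<forall>g\<in>smooth_functions.
        b (zero_form f) (zero_form g) = zero_form (function_bracket \<pi> f g)) \<and>
     (\<forall>f\<in>smooth_functions. \<forall>\<alpha>\<in>forms 1. D (differential f) \<alpha> = b (zero_form f) \<alpha>))"

end

end

theory Submission
  imports Defs
begin

text \<open>
  Locally, forms are generated by functions and exact 1-forms. An operator on forms that obeys
  a graded Leibniz rule is therefore determined by its values on functions \<open>f\<close> and on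
  differentials \<open>df\<close> (\<open>gd_eqI\<close>), and an identity between such operators holds as soon as it holds
  there. This principle carries the whole proof. To use it with global functions and vector
  fields, near each point there must be finitely many functions \<open>g\<^sub>e\<close> and vector fields \<open>Y\<^sub>e\<close>, and a
  function \<open>w\<close> that does not vanish at the point, with \<open>w \<cdot> X = \<Sum>\<^sub>e X(g\<^sub>e) \<cdot> Y\<^sub>e\<close> for every vector
  field \<open>X\<close> (\<open>local_frame_exists\<close>). As vector fields are derivations here, this is Hadamard's
  lemma in a chart, multiplied by a cutoff function.

  From a bracket to a connection. The brackets of functions give \<open>\<pi>\<close>. For a 1-form \<open>\<beta>\<close> the map
  \<open>g \<mapsto> {g, \<beta>}(X)\<close> is a derivation, that is, a vector field \<open>V\<close>, and \<open>(D\<^sub>\<alpha> \<beta>)(X) = \<alpha>(V)\<close> is the only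
  connection with \<open>D\<^sub>d\<^sub>f \<beta> = {f, \<beta>}\<close>. On exact forms, flatness is the Jacobi identity for two
  functions and a 1-form, and vanishing of the torsion is \<open>d{f, g} = {df, g} + {f, dg}\<close>. The
  bracket of two 1-forms has the properties that characterise \<open>{\<alpha>, \<beta>}\<close> in the definition of the
  metacurvature, so that \<open>M(df, \<beta>, \<gamma>) = 0\<close> is the Jacobi identity for \<open>f, \<beta>, \<gamma>\<close>.

  From a connection to a bracket. For a \<open>k\<close>-form \<open>\<sigma>\<close>, a bracket with \<open>{g, \<sigma>} = D\<^sub>d\<^sub>g \<sigma>\<close> must satisfy
  \<open>{\<sigma>, g} = - D\<^sub>d\<^sub>g \<sigma>\<close> and \<open>{\<sigma>, dg} = (-1)\<^sup>k (D\<^sub>d\<^sub>g d\<sigma> - d(D\<^sub>d\<^sub>g \<sigma>))\<close>, which makes it unique. Both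
  right-hand sides are derivations in \<open>g\<close>. In particular \<open>g \<mapsto> D\<^sub>d\<^sub>g \<sigma>\<close> is a \<open>k\<close>-form \<open>H\<^sub>\<sigma>\<close> with values in
  vector fields, and contraction with such a form is a graded derivation (\<open>contr_wedge\<close>). With
  \<open>L = i d + (-1)\<^sup>k d i\<close> for the Lie derivative belonging to a contraction \<open>i\<close>, the formula
  \<open>{\<sigma>, \<rho>} = (-1)\<^sup>k i(H\<^sub>d\<^sub>\<sigma>) \<rho> - L(H\<^sub>\<sigma>) \<rho>\<close> is a derivation in \<open>\<rho>\<close> with the two required values. That \<open>d\<close> is a
  derivation of this bracket is a direct computation. The Leibniz rule in \<open>\<sigma>\<close>, graded
  antisymmetry and the Jacobi identity are identities between graded derivations and need to be
  checked on \<open>f\<close> and \<open>df\<close> only: antisymmetry comes down to the vanishing of the torsion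
  (\<open>brk_swap\<close>), and the Jacobi identity to flatness for two functions and to vanishing
  metacurvature for one function and two exact 1-forms (\<open>brk_jacobi\<close>).
\<close>

section \<open>Functions of class \<open>C\<^sup>k\<close>\<close>

lemma Ck_on_cong:
  assumes "open S" "\<And>x. x \<in> S \<Longrightarrow> f x = g x" "Ck_on n f S"
  shows "Ck_on n g S"
  using assms(2,3)
proof (induction n arbitrary: f g)
  case 0
  then show ?case using continuous_on_cong[of S S f g] by simp
next
  case (Suc n)
  have ev: "eventually (\<lambda>y. f y = g y) (nhds x)" if "x \<in> S" for x
    using assms(1) Suc.prems(1) that eventually_nhds by blast
  have D: "(g has_derivative frechet_derivative f (at x)) (at x)" if "x \<in> S" for x
  proof -
    have "(f has_derivative frechet_derivative f (at x)) (at x)"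
      using Suc.prems(2) that by (simp add: frechet_derivative_works)
    then show ?thesis
      by (rule has_derivative_transform_within_open[OF _ assms(1) that]) (use Suc.prems(1) in auto)
  qed
  have "frechet_derivative g (at x) = frechet_derivative f (at x)" if "x \<in> S" for x
    using frechet_derivative_at[OF D[OF that]] by simp
  then have "Ck_on n (\<lambda>x. frechet_derivative g (at x) v) S" for v
    using Suc.IH[of "\<lambda>x. frechet_derivative f (at x) v"] Suc.prems(2) by simp
  moreover have "g differentiable at x" if "x \<in> S" for x
    using D[OF that] differentiableI by blast
  ultimately show ?case by simp
qed

lemma Ck_on_subset: "Ck_on n f S \<Longrightarrow> T \<subseteq> S \<Longrightarrow> Ck_on n f T"
  by (induction n arbitrary: f) (auto intro: continuous_on_subset)

text \<open>
  Being \<open>C\<^sup>k\<close> is a local property; this is what makes functions that are glued from a chart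
  and a constant smooth.
\<close>

lemma Ck_on_local:
  assumes "\<And>x. x \<in> S \<Longrightarrow> \<exists>T. open T \<and> x \<in> T \<and> Ck_on n f T"
  shows "Ck_on n f S"
  using assms
proof (induction n arbitrary: f)
  case 0
  then have "isCont f x" if "x \<in> S" for x
    using that by (metis Ck_on.simps(1) continuous_on_eq_continuous_at)
  then show ?case by (simp add: continuous_at_imp_continuous_on)
next
  case (Suc n)
  then show ?case by (metis Ck_on.simps(2))
qed

lemma Ck_on_SucD: "Ck_on (Suc n) f S \<Longrightarrow> Ck_on n f S"
proof (induction n arbitrary: f)
  case 0
  then show ?case
    by (simp add: continuous_at_imp_continuous_on differentiable_imp_continuous_within)
qed simp

lemma Ck_on_has_derivative:
  "Ck_on (Suc n) f S \<Longrightarrow> x \<in> S \<Longrightarrow> (f has_derivative frechet_derivative f (at x)) (at x)"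
  by (simp add: frechet_derivative_works)

text \<open>
  Replaces the Frechet derivative, which is a choice operator, by any explicitly given
  derivative.
\<close>

lemma Ck_on_SucI:
  assumes "open S" "\<And>x. x \<in> S \<Longrightarrow> (f has_derivative f' x) (at x)" "\<And>v. Ck_on n (\<lambda>x. f' x v) S"
  shows "Ck_on (Suc n) f S"
proof -
  have "f' x = frechet_derivative f (at x)" if "x \<in> S" for x
    using assms(2)[OF that] frechet_derivative_at by blast
  then have "Ck_on n (\<lambda>x. frechet_derivative f (at x) v) S" for v
    using Ck_on_cong[OF assms(1) _ assms(3)[of v]] by simp
  then show ?thesis using assms(2) differentiableI by fastforce
qed

lemma Ck_on_const: "open S \<Longrightarrow> Ck_on n (\<lambda>x. c) S"
proof (induction n arbitrary: c)
  case (Suc n)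
  show ?case by (rule Ck_on_SucI[where f'="\<lambda>x v. 0"]) (use Suc in auto)
qed simp

lemma Ck_on_bounded_linear:
  assumes "open S" "bounded_linear L" shows "Ck_on n L S"
proof (cases n)
  case 0
  then show ?thesis using assms by (simp add: linear_continuous_on)
next
  case (Suc m)
  show ?thesis unfolding Suc
    by (rule Ck_on_SucI[where f'="\<lambda>x. L"])
       (use assms Ck_on_const in \<open>auto intro: bounded_linear_imp_has_derivative\<close>)
qed

lemma Ck_on_linear_comp:
  assumes "open S" "bounded_linear L"
  shows "Ck_on n g S \<Longrightarrow> Ck_on n (\<lambda>x. L (g x)) S"
proof (induction n arbitrary: g)
  case 0
  then show ?case using assms(2) by (simp add: bounded_linear.continuous_on)
next
  case (Suc n)
  show ?case
    by (rule Ck_on_SucI[OF assms(1), where f'="\<lambda>x v. L (frechet_derivative g (at x) v)"])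
       (use Suc bounded_linear.has_derivative[OF assms(2) Ck_on_has_derivative[OF Suc.prems]] in auto)
qed

lemma Ck_on_add:
  assumes "open S" shows "Ck_on n f S \<Longrightarrow> Ck_on n g S \<Longrightarrow> Ck_on n (\<lambda>x. f x + g x) S"
proof (induction n arbitrary: f g)
  case 0 then show ?case by (simp add: continuous_on_add)
next
  case (Suc n)
  show ?case
    by (rule Ck_on_SucI[OF assms(1), where f'="\<lambda>x v. frechet_derivative f (at x) v + frechet_derivative g (at x) v"])
       (use Suc Ck_on_has_derivative[OF Suc.prems(1)] Ck_on_has_derivative[OF Suc.prems(2)]
         in \<open>auto intro!: derivative_eq_intros\<close>)
qed

lemma Ck_on_mult:
  fixes f g :: "'a::real_normed_vector \<Rightarrow> real"
  assumes "open S" shows "Ck_on n f S \<Longrightarrow> Ck_on n g S \<Longrightarrow> Ck_on n (\<lambda>x. f x * g x) S"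
proof (induction n arbitrary: f g)
  case 0 then show ?case by (simp add: continuous_on_mult)
next
  case (Suc n)
  show ?case
  proof (rule Ck_on_SucI[OF assms(1), where
        f'="\<lambda>x v. f x * frechet_derivative g (at x) v + frechet_derivative f (at x) v * g x"])
    show "((\<lambda>x. f x * g x) has_derivative
        (\<lambda>v. f x * frechet_derivative g (at x) v + frechet_derivative f (at x) v * g x)) (at x)"
      if "x \<in> S" for x
      using Ck_on_has_derivative[OF Suc.prems(1) that] Ck_on_has_derivative[OF Suc.prems(2) that]
      by (rule has_derivative_mult)
    show "Ck_on n (\<lambda>x. f x * frechet_derivative g (at x) v + frechet_derivative f (at x) v * g x) S" for v
    proof -
      have "Ck_on n f S" "Ck_on n g S" by (rule Ck_on_SucD, fact Suc.prems)+
      moreover have "Ck_on n (\<lambda>x. frechet_derivative f (at x) v) S"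
        "Ck_on n (\<lambda>x. frechet_derivative g (at x) v) S" using Suc.prems by auto
      ultimately show ?thesis by (intro Ck_on_add[OF assms] Suc.IH)
    qed
  qed
qed

lemma Ck_on_sum:
  assumes "open S" "finite I" "\<And>i. i \<in> I \<Longrightarrow> Ck_on n (f i) S"
  shows "Ck_on n (\<lambda>x. \<Sum>i\<in>I. f i x) S"
  using assms(2,3) by (induction I rule: finite_induct) (auto simp: Ck_on_const Ck_on_add assms(1))

section \<open>Finite-dimensional inner product spaces\<close>

text \<open>
  The model space is of class \<^class>\<open>real_inner\<close> and need not be a \<^class>\<open>euclidean_space\<close>, so coordinates are taken in an
  orthonormal basis obtained by orthogonalisation.
\<close>

definition orthonormal_basis :: "'a::real_inner set \<Rightarrow> bool" where
  "orthonormal_basis E \<longleftrightarrow> finite E \<and> (\<forall>x. x = (\<Sum>e\<in>E. (x \<bullet> e) *\<^sub>R e)) \<and> (\<forall>e\<in>E. norm e = 1)"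

lemma orthonormal_basis_exists:
  fixes B :: "'a::real_inner set"
  assumes "finite B" "span B = UNIV"
  shows "\<exists>E::'a set. orthonormal_basis E"
proof -
  obtain C where C: "finite C" "span C = span B" "pairwise orthogonal C"
    using basis_orthogonal[OF assms(1)] by blast
  define D where "D = C - {0}"
  have D: "finite D" "span D = UNIV" "pairwise orthogonal D" "0 \<notin> D"
    using C assms(2) by (auto simp: D_def pairwise_def)
  have orth: "a \<bullet> b = 0" if "a \<in> D" "b \<in> D" "a \<noteq> b" for a b
    using D(3) that by (auto simp: pairwise_def orthogonal_def)
  define E where "E = (\<lambda>c. c /\<^sub>R norm c) ` D"
  have inj: "inj_on (\<lambda>c. c /\<^sub>R norm c) D"
  proof (rule inj_onI, rule ccontr)
    fix a b assume ab: "a \<in> D" "b \<in> D" "a /\<^sub>R norm a = b /\<^sub>R norm b" "a \<noteq> b"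
    have "(a /\<^sub>R norm a) \<bullet> (b /\<^sub>R norm b) = 0" using orth[OF ab(1,2,4)] by simp
    then have "(a /\<^sub>R norm a) \<bullet> (a /\<^sub>R norm a) = 0" using ab(3) by simp
    then show False using ab(1) D(4) by auto
  qed
  have exp: "x = (\<Sum>c\<in>D. ((x \<bullet> c) / (c \<bullet> c)) *\<^sub>R c)" for x
  proof -
    have "x \<in> span D" using D(2) by simp
    then obtain u where u: "x = (\<Sum>c\<in>D. u c *\<^sub>R c)"
      using span_finite[OF D(1)] by auto
    have "x \<bullet> c = u c * (c \<bullet> c)" if "c \<in> D" for c
    proof -
      have "x \<bullet> c = (\<Sum>a\<in>D. u a * (a \<bullet> c))" by (subst u) (simp add: inner_sum_left)
      also have "\<dots> = (\<Sum>a\<in>D. if a = c then u c * (c \<bullet> c) else 0)"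
        by (rule sum.cong) (use orth that in auto)
      finally show ?thesis using D(1) that by simp
    qed
    then have "(x \<bullet> c) / (c \<bullet> c) = u c" if "c \<in> D" for c
      using that D(4) by auto
    then show ?thesis using u by simp
  qed
  have "x = (\<Sum>e\<in>E. (x \<bullet> e) *\<^sub>R e)" for x
  proof -
    have "(\<Sum>e\<in>E. (x \<bullet> e) *\<^sub>R e) = (\<Sum>c\<in>D. ((x \<bullet> c) / (c \<bullet> c)) *\<^sub>R c)"
      unfolding E_def sum.reindex[OF inj] o_def
      by (rule sum.cong) (auto simp: dot_square_norm power2_eq_square field_simps)
    then show ?thesis using exp by simp
  qed
  moreover have "norm e = 1" if "e \<in> E" for e
  proof -
    from that obtain c where "c \<in> D" "e = c /\<^sub>R norm c" by (auto simp: E_def)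
    moreover have "c \<noteq> 0" using D(4) \<open>c \<in> D\<close> by blast
    ultimately show ?thesis by (metis norm_scaleR abs_inverse abs_norm_cancel left_inverse norm_eq_zero)
  qed
  ultimately show ?thesis using D(1) unfolding orthonormal_basis_def E_def by blast
qed

lemma linear_orthonormal:
  assumes "orthonormal_basis E" "linear (L :: 'e::real_inner \<Rightarrow> real)"
  shows "L v = (\<Sum>e\<in>E. (v \<bullet> e) * L e)"
proof -
  have "v = (\<Sum>e\<in>E. (v \<bullet> e) *\<^sub>R e)"
    using assms(1) unfolding orthonormal_basis_def by blast
  then have "L v = L (\<Sum>e\<in>E. (v \<bullet> e) *\<^sub>R e)" by (rule arg_cong)
  then show ?thesis using assms(2) by (simp add: linear_sum linear_scale)
qed

text \<open>
  A closed ball is a closed subset of a finite Minkowski sum of compact segments.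
\<close>

lemma compact_cball_orthonormal:
  fixes E :: "'e::real_inner set"
  assumes "orthonormal_basis E"
  shows "compact (cball (a::'e) r)"
proof -
  have fin: "finite E" and one: "\<And>e. e \<in> E \<Longrightarrow> norm e = 1"
    and ex: "\<And>x. x = (\<Sum>e\<in>E. (x \<bullet> e) *\<^sub>R e)"
    using assms unfolding orthonormal_basis_def by blast+
  have comp: "compact {x. \<exists>c. (\<forall>e\<in>F. \<bar>c e\<bar> \<le> s) \<and> x = (\<Sum>e\<in>F. c e *\<^sub>R e)}"
    if "finite F" for F :: "'e set" and s
    using that
  proof (induction F rule: finite_induct)
    case empty
    then show ?case by simp
  next
    case (insert b F)
    let ?K = "{x. \<exists>c. (\<forall>e\<in>F. \<bar>c e\<bar> \<le> s) \<and> x = (\<Sum>e\<in>F. c e *\<^sub>R e)}"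
    have "compact ((\<lambda>t. t *\<^sub>R b) ` {-s..s})"
      by (intro compact_continuous_image continuous_intros) simp
    then have "compact {x + y |x y. x \<in> (\<lambda>t. t *\<^sub>R b) ` {-s..s} \<and> y \<in> ?K}"
      using insert.IH compact_sums by blast
    also have "{x + y |x y. x \<in> (\<lambda>t. t *\<^sub>R b) ` {-s..s} \<and> y \<in> ?K} =
      {x. \<exists>c. (\<forall>e\<in>insert b F. \<bar>c e\<bar> \<le> s) \<and> x = (\<Sum>e\<in>insert b F. c e *\<^sub>R e)}" (is "?L = ?R")
    proof
      show "?L \<subseteq> ?R"
      proof clarify
        fix t and c :: "'e \<Rightarrow> real" assume t: "t \<in> {-s..s}" and c: "\<forall>e\<in>F. \<bar>c e\<bar> \<le> s"
        have "(\<Sum>e\<in>F. c e *\<^sub>R e) = (\<Sum>e\<in>F. (c(b := t)) e *\<^sub>R e)"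
          using insert.hyps by (intro sum.cong) auto
        then show "\<exists>c'. (\<forall>e\<in>insert b F. \<bar>c' e\<bar> \<le> s) \<and>
            t *\<^sub>R b + (\<Sum>e\<in>F. c e *\<^sub>R e) = (\<Sum>e\<in>insert b F. c' e *\<^sub>R e)"
          using t c insert.hyps by (intro exI[of _ "c(b := t)"]) auto
      qed
      show "?R \<subseteq> ?L"
      proof clarify
        fix c :: "'e \<Rightarrow> real" assume c: "\<forall>e\<in>insert b F. \<bar>c e\<bar> \<le> s"
        have "(\<Sum>e\<in>insert b F. c e *\<^sub>R e) = c b *\<^sub>R b + (\<Sum>e\<in>F. c e *\<^sub>R e)"
          using insert.hyps by simp
        moreover have "c b \<in> {-s..s}" using c by (simp add: abs_le_iff)
        then have "c b *\<^sub>R b \<in> (\<lambda>t. t *\<^sub>R b) ` {-s..s}" by blast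
        moreover have "(\<Sum>e\<in>F. c e *\<^sub>R e) \<in> ?K"
          by (intro CollectI exI[of _ c] conjI refl) (use c in blast)
        ultimately show "\<exists>x y. (\<Sum>e\<in>insert b F. c e *\<^sub>R e) = x + y \<and> x \<in> (\<lambda>t. t *\<^sub>R b) ` {-s..s} \<and> y \<in> ?K"
          by (intro exI conjI)
      qed
    qed
    finally show ?case .
  qed
  let ?K = "{x. \<exists>c. (\<forall>e\<in>E. \<bar>c e\<bar> \<le> r + norm a) \<and> x = (\<Sum>e\<in>E. c e *\<^sub>R e)}"
  have "cball a r \<subseteq> ?K"
  proof
    fix x assume "x \<in> cball a r"
    then have "norm x \<le> r + norm a"
      using norm_triangle_sub[of x a] by (simp add: dist_norm norm_minus_commute)
    moreover have "\<bar>x \<bullet> e\<bar> \<le> norm x" if "e \<in> E" for e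
      using Cauchy_Schwarz_ineq2[of x e] one[OF that] by simp
    ultimately have "\<forall>e\<in>E. \<bar>x \<bullet> e\<bar> \<le> r + norm a" by force
    then show "x \<in> ?K"
      using ex[of x] by blast
  qed
  then have "?K \<inter> cball a r = cball a r" by blast
  then show ?thesis
    using compact_Int_closed[OF comp[OF fin, of "r + norm a"] closed_cball[of a r]] by (simp only:)
qed

text \<open>
  By the chain rule the derivative of a composition is a derivative of \<open>f\<close> in a direction
  that depends on the point. Expanding the direction in the basis turns it into a sum of
  products, to which the induction hypothesis applies.
\<close>

lemma Ck_on_compose:
  fixes f :: "'e::real_inner \<Rightarrow> real" and g :: "'a::real_normed_vector \<Rightarrow> 'e"
  assumes E: "orthonormal_basis (E::'e set)" and "open S" "g ` S \<subseteq> T"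
  shows "Ck_on n f T \<Longrightarrow> Ck_on n g S \<Longrightarrow> Ck_on n (\<lambda>x. f (g x)) S"
proof (induction n arbitrary: f)
  case 0
  then show ?case using assms(3) by (auto intro: continuous_on_compose2)
next
  case (Suc n)
  show ?case
  proof (rule Ck_on_SucI[OF assms(2), where f'="\<lambda>x v. \<Sum>e\<in>E.
        (frechet_derivative g (at x) v \<bullet> e) * frechet_derivative f (at (g x)) e"])
    fix x assume x: "x \<in> S"
    then have gx: "g x \<in> T" using assms(3) by auto
    note f = Ck_on_has_derivative[OF Suc.prems(1) gx]
    have "((f \<circ> g) has_derivative frechet_derivative f (at (g x)) \<circ> frechet_derivative g (at x)) (at x)"
      by (rule diff_chain_at[OF Ck_on_has_derivative[OF Suc.prems(2) x] f])
    moreover have "frechet_derivative f (at (g x)) \<circ> frechet_derivative g (at x) =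
      (\<lambda>v. \<Sum>e\<in>E. (frechet_derivative g (at x) v \<bullet> e) * frechet_derivative f (at (g x)) e)"
      unfolding o_def by (rule ext, rule linear_orthonormal[OF E has_derivative_linear[OF f]])
    ultimately show "((\<lambda>x. f (g x)) has_derivative (\<lambda>v. \<Sum>e\<in>E.
        (frechet_derivative g (at x) v \<bullet> e) * frechet_derivative f (at (g x)) e)) (at x)"
      by (simp add: o_def)
  next
    fix v
    have "Ck_on n (\<lambda>x. frechet_derivative f (at (g x)) e) S" for e
      by (rule Suc.IH[of "\<lambda>y. frechet_derivative f (at y) e", OF _ Ck_on_SucD[OF Suc.prems(2)]])
         (use Suc.prems(1) in simp)
    moreover have "Ck_on n (\<lambda>x. frechet_derivative g (at x) v \<bullet> e) S" for e
      by (rule Ck_on_linear_comp[OF assms(2) bounded_linear_inner_left]) (use Suc.prems(2) in simp)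
    moreover have "finite E" using E by (simp add: orthonormal_basis_def)
    ultimately show "Ck_on n (\<lambda>x. \<Sum>e\<in>E.
        (frechet_derivative g (at x) v \<bullet> e) * frechet_derivative f (at (g x)) e) S"
      by (intro Ck_on_sum Ck_on_mult assms(2)) auto
  qed
qed

section \<open>A flat function\<close>

text \<open>
  The powers of \<open>1/t\<close> make the family closed under differentiation, so that smoothness
  follows by induction on the order.
\<close>

definition flat_exp :: "nat \<Rightarrow> real \<Rightarrow> real" where
  "flat_exp m t = (if t > 0 then exp (- inverse t) * inverse t ^ m else 0)"

lemma flat_exp_tendsto_0: "(flat_exp m \<longlongrightarrow> 0) (at 0)"
proof -
  have "((\<lambda>x::real. x ^ m / exp x) \<longlongrightarrow> 0) at_top" by (rule tendsto_power_div_exp_0)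
  then have "((\<lambda>t::real. inverse t ^ m / exp (inverse t)) \<longlongrightarrow> 0) (at_right 0)"
    by (rule filterlim_compose[OF _ filterlim_inverse_at_top_right])
  then have R: "(flat_exp m \<longlongrightarrow> 0) (at_right 0)"
    by (rule Lim_transform_eventually)
       (auto simp: eventually_at_filter flat_exp_def exp_minus field_simps)
  have L: "(flat_exp m \<longlongrightarrow> 0) (at_left 0)"
    by (rule Lim_transform_eventually[OF tendsto_const])
       (auto simp: eventually_at_filter flat_exp_def)
  from filterlim_split_at_real[OF L R] show ?thesis .
qed

lemma flat_exp_has_derivative:
  "(flat_exp m has_real_derivative (flat_exp (m+2) t - m * flat_exp (m+1) t)) (at t)"
proof (cases t "0::real" rule: linorder_cases)
  case less
  have "((\<lambda>_. 0) has_real_derivative 0) (at t)" by simp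
  then have "(flat_exp m has_real_derivative 0) (at t)"
    by (rule DERIV_cong_ev[THEN iffD1, OF refl _ refl, rotated])
       (use eventually_nhds_in_open[of "{..<0}" t] less in \<open>auto elim!: eventually_mono simp: flat_exp_def\<close>)
  then show ?thesis using less by (simp add: flat_exp_def)
next
  case equal
  have "((\<lambda>h. flat_exp m h / h) \<longlongrightarrow> 0) (at 0)"
    by (rule Lim_transform_eventually[OF flat_exp_tendsto_0[of "Suc m"]])
       (auto simp: flat_exp_def eventually_at_filter field_simps)
  then show ?thesis using equal by (simp add: DERIV_def flat_exp_def)
next
  case greater
  have "((\<lambda>t. exp (- inverse t) * inverse t ^ m) has_real_derivative
      (flat_exp (m+2) t - m * flat_exp (m+1) t)) (at t)"
  proof -
    have "((\<lambda>t. exp (- inverse t) * inverse t ^ m) has_real_derivative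
      exp (- inverse t) * (inverse t)\<^sup>2 * inverse t ^ m +
      (real m * inverse t ^ (m - 1) * (- (inverse t)\<^sup>2)) * exp (- inverse t)) (at t)"
      using greater by (intro DERIV_mult) (auto intro!: derivative_eq_intros simp: power2_eq_square)
    moreover have "exp (- inverse t) * (inverse t)\<^sup>2 * inverse t ^ m +
      (real m * inverse t ^ (m - 1) * (- (inverse t)\<^sup>2)) * exp (- inverse t) =
      flat_exp (m+2) t - m * flat_exp (m+1) t"
      using greater by (cases m) (simp_all add: flat_exp_def power2_eq_square mult_ac)
    ultimately show ?thesis by simp
  qed
  then show ?thesis
    by (rule DERIV_cong_ev[THEN iffD1, OF refl _ refl, rotated])
       (use eventually_nhds_in_open[of "{0<..}" t] greater in \<open>auto elim!: eventually_mono simp: flat_exp_def\<close>)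
qed

lemma Ck_on_flat_exp: "Ck_on n (flat_exp m) UNIV"
proof (induction n arbitrary: m)
  case 0
  have "isCont (flat_exp m) t" for t
    using flat_exp_has_derivative DERIV_isCont by blast
  then show ?case by (simp add: continuous_at_imp_continuous_on)
next
  case (Suc n)
  show ?case
  proof (rule Ck_on_SucI[where f'="\<lambda>t v. (flat_exp (m+2) t - m * flat_exp (m+1) t) * v"])
    show "(flat_exp m has_derivative (\<lambda>v. (flat_exp (m+2) t - m * flat_exp (m+1) t) * v)) (at t)" for t
      using flat_exp_has_derivative has_field_derivative_def by blast
    have "Ck_on n (\<lambda>t. (flat_exp (m+2) t + (- real m) * flat_exp (m+1) t) * v) UNIV" for v
      by (intro Ck_on_mult Ck_on_add Ck_on_const Suc) auto
    then show "Ck_on n (\<lambda>t. (flat_exp (m+2) t - m * flat_exp (m+1) t) * v) UNIV" for v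
      by simp
  qed simp
qed

section \<open>Hadamard's lemma\<close>

text \<open>
  Differentiation under the integral sign along rays from \<open>y\<close>. The power \<open>t\<^sup>m\<close> absorbs the
  factor \<open>t\<close> that each differentiation produces, so that the statement can be iterated.
\<close>

lemma has_derivative_param_integral:
  fixes G :: "'e::real_inner \<Rightarrow> real" and E :: "'e set"
  assumes E: "orthonormal_basis E" and B: "open B" "convex B" "x \<in> B" "y \<in> B"
    and G: "\<And>z. z \<in> B \<Longrightarrow> (G has_derivative G' z) (at z)"
    and cont: "\<And>e. continuous_on B (\<lambda>z. G' z e)"
  shows "((\<lambda>x. integral {0..1} (\<lambda>t. t ^ m * G (y + t *\<^sub>R (x - y)))) has_derivative
          (\<lambda>v. integral {0..1} (\<lambda>t. t ^ Suc m * G' (y + t *\<^sub>R (x - y)) v))) (at x)"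
    (is "(?H has_derivative ?H') _")
proof -
  have finE: "finite E" and normE: "\<And>e. e \<in> E \<Longrightarrow> norm e = 1"
    using E unfolding orthonormal_basis_def by blast+
  have inB: "y + t *\<^sub>R (z - y) \<in> B" if "z \<in> B" "t \<in> {0..1}" for z t
  proof -
    have "y + t *\<^sub>R (z - y) = (1 - t) *\<^sub>R y + t *\<^sub>R z" by (simp add: algebra_simps)
    then show ?thesis using B that by (simp add: convexD)
  qed
  have lin: "linear (G' z)" if "z \<in> B" for z using has_derivative_linear[OF G[OF that]] .
  have G'sum: "G' z v = (\<Sum>e\<in>E. (v \<bullet> e) * G' z e)" if "z \<in> B" for z v
    using linear_orthonormal[OF E lin[OF that]] .
  have contG: "continuous_on B G"
    using G by (meson continuous_at_imp_continuous_on has_derivative_continuous)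
  have cG: "continuous_on {0..1} (\<lambda>t. G (y + t *\<^sub>R (z - y)))" if "z \<in> B" for z
    by (rule continuous_on_compose2[OF contG]) (auto intro!: continuous_intros inB that)
  have cG': "continuous_on {0..1} (\<lambda>t. G' (y + t *\<^sub>R (z - y)) e)" if "z \<in> B" for z e
    by (rule continuous_on_compose2[OF cont]) (auto intro!: continuous_intros inB that)
  have bl: "bounded_linear ?H'"
  proof -
    have "?H' = (\<lambda>v. \<Sum>e\<in>E. (v \<bullet> e) * integral {0..1} (\<lambda>t. t ^ Suc m * G' (y + t *\<^sub>R (x - y)) e))"
    proof
      fix v
      have "?H' v = integral {0..1} (\<lambda>t. \<Sum>e\<in>E. (v \<bullet> e) * (t ^ Suc m * G' (y + t *\<^sub>R (x - y)) e))"
        by (rule integral_cong, subst G'sum)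
           (use inB B in \<open>auto simp: sum_distrib_left algebra_simps\<close>)
      also have "\<dots> = (\<Sum>e\<in>E. integral {0..1} (\<lambda>t. (v \<bullet> e) * (t ^ Suc m * G' (y + t *\<^sub>R (x - y)) e)))"
        using finE by (intro integral_sum integrable_continuous_interval continuous_intros cG' B)
      finally show "?H' v = (\<Sum>e\<in>E. (v \<bullet> e) * integral {0..1} (\<lambda>t. t ^ Suc m * G' (y + t *\<^sub>R (x - y)) e))"
        by simp
    qed
    moreover have "bounded_linear (\<lambda>v::'e. \<Sum>e\<in>E. (v \<bullet> e) * c e)" for c
      by (intro bounded_linear_sum bounded_linear_mult_left[THEN bounded_linear_compose]
          bounded_linear_inner_left)
    ultimately show ?thesis by simp
  qed
  \<comment> \<open>By compactness of the unit interval the partial derivatives of \<open>G\<close> are close to their values at \<open>z = x\<close>, uniformly in \<open>t\<close>; the mean value theorem then bounds the integrand.\<close>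
  have "\<exists>d>0. \<forall>z. norm (z - x) < d \<longrightarrow> norm (?H z - ?H x - ?H' (z - x)) \<le> \<epsilon> * norm (z - x)"
    if "\<epsilon> > 0" for \<epsilon>
  proof -
    define \<psi> where "\<psi> = (\<lambda>(z, t). \<Sum>e\<in>E. \<bar>G' (y + t *\<^sub>R (z - y)) e - G' (y + t *\<^sub>R (x - y)) e\<bar>)"
    have "continuous_on (B \<times> {0..1}) \<psi>"
      unfolding \<psi>_def case_prod_beta
      by (intro continuous_intros continuous_on_compose2[OF cont])
         (auto intro!: continuous_intros inB B)
    from continuous_on_prod_compactE[OF this compact_Icc B(3) that]
    obtain X0 where X0: "x \<in> X0" "open X0"
      "\<forall>z\<in>X0 \<inter> B. \<forall>t\<in>{0..1}. dist (\<psi> (z, t)) (\<psi> (x, t)) \<le> \<epsilon>" by blast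
    have "open (X0 \<inter> B)" "x \<in> X0 \<inter> B" using X0 B by auto
    then obtain d where d: "d > 0" "ball x d \<subseteq> X0 \<inter> B" using open_contains_ball by blast
    have psi: "(\<Sum>e\<in>E. \<bar>G' (y + t *\<^sub>R (z - y)) e - G' (y + t *\<^sub>R (x - y)) e\<bar>) \<le> \<epsilon>"
      if "z \<in> ball x d" "t \<in> {0..1}" for z t
      using X0(3) d(2) that by (fastforce simp: \<psi>_def dist_real_def)
    have "norm (?H z - ?H x - ?H' (z - x)) \<le> \<epsilon> * norm (z - x)" if z: "norm (z - x) < d" for z
    proof -
      have zb: "z \<in> ball x d" using z by (simp add: dist_norm norm_minus_commute)
      then have zB: "z \<in> B" using d by auto
      have bound: "\<bar>G (y + t *\<^sub>R (z - y)) - G (y + t *\<^sub>R (x - y)) - t * G' (y + t *\<^sub>R (x - y)) (z - x)\<bar>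
          \<le> \<epsilon> * norm (z - x)" if t: "t \<in> {0..1}" for t
      proof -
        let ?a = "y + t *\<^sub>R (x - y)" and ?b = "y + t *\<^sub>R (z - y)"
        let ?S = "(\<lambda>w. y + t *\<^sub>R (w - y)) ` (ball x d)"
        have SB: "?S \<subseteq> B" using inB t d by blast
        have on: "onorm (G' w - G' ?a) \<le> \<epsilon>" if w: "w \<in> ?S" for w
        proof (rule onorm_bound)
          show "0 \<le> \<epsilon>" using \<open>\<epsilon> > 0\<close> by simp
          fix v
          obtain u where u: "u \<in> ball x d" "w = y + t *\<^sub>R (u - y)" using w by blast
          have "w \<in> B" using SB w by blast
          have "(G' w - G' ?a) v = (\<Sum>e\<in>E. (v \<bullet> e) * G' w e) - (\<Sum>e\<in>E. (v \<bullet> e) * G' ?a e)"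
            using G'sum[OF \<open>w \<in> B\<close>, of v] G'sum[OF inB[OF B(3) t], of v] by simp
          also have "\<dots> = (\<Sum>e\<in>E. (v \<bullet> e) * (G' w e - G' ?a e))"
            by (simp add: sum_subtractf right_diff_distrib)
          also have "\<bar>\<dots>\<bar> \<le> (\<Sum>e\<in>E. norm v * \<bar>G' w e - G' ?a e\<bar>)"
          proof (rule order_trans[OF sum_abs sum_mono])
            fix e assume "e \<in> E"
            then have "\<bar>v \<bullet> e\<bar> \<le> norm v" using Cauchy_Schwarz_ineq2[of v e] normE by simp
            then show "\<bar>(v \<bullet> e) * (G' w e - G' ?a e)\<bar> \<le> norm v * \<bar>G' w e - G' ?a e\<bar>"
              by (simp add: abs_mult mult_right_mono)
          qed
          also have "\<dots> \<le> norm v * \<epsilon>"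
            using psi[OF u(1) t] by (simp add: sum_distrib_left[symmetric] u(2) mult_left_mono)
          finally show "norm ((G' w - G' ?a) v) \<le> \<epsilon> * norm v" by (simp add: mult.commute)
        qed
        have "norm (G ?b - G ?a - G' ?a (?b - ?a)) \<le> norm (?b - ?a) * \<epsilon>"
        proof (rule differentiable_bound_linearization[where S="?S" and f'="G'"])
          fix s :: real assume s: "s \<in> {0..1}"
          have "x + s *\<^sub>R (z - x) \<in> ball x d"
          proof -
            have "norm (s *\<^sub>R (z - x)) \<le> norm (z - x)"
              using s mult_right_mono[of "\<bar>s\<bar>" 1 "norm (z - x)"] by simp
            then show ?thesis using z by (simp add: dist_norm)
          qed
          moreover have "?a + s *\<^sub>R (?b - ?a) = y + t *\<^sub>R (x + s *\<^sub>R (z - x) - y)"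
            by (simp add: algebra_simps)
          ultimately show "?a + s *\<^sub>R (?b - ?a) \<in> ?S" by blast
        next
          show "(G has_derivative G' w) (at w within ?S)" if "w \<in> ?S" for w
            using G SB that has_derivative_at_withinI by blast
          show "onorm (G' w - G' ?a) \<le> \<epsilon>" if "w \<in> ?S" for w using on[OF that] .
          show "?a \<in> ?S" using d(1) by (intro imageI) simp
        qed
        moreover have "?b - ?a = t *\<^sub>R (z - x)" by (simp add: algebra_simps)
        moreover have "G' ?a (t *\<^sub>R (z - x)) = t * G' ?a (z - x)"
          using lin[OF inB[OF B(3) t]] by (simp add: linear_scale)
        moreover have "norm (t *\<^sub>R (z - x)) * \<epsilon> \<le> \<epsilon> * norm (z - x)"
          using t \<open>\<epsilon> > 0\<close> by (simp add: mult.commute[of _ \<epsilon>] mult_left_le_one_le)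
        ultimately show ?thesis by simp
      qed
      have c2: "continuous_on {0..1} (\<lambda>t. G' (y + t *\<^sub>R (x - y)) v)" for v using cG'[OF B(3)] .
      have "?H z - ?H x - ?H' (z - x) = integral {0..1} (\<lambda>t. t ^ m * G (y + t *\<^sub>R (z - y))
          - t ^ m * G (y + t *\<^sub>R (x - y)) - t ^ Suc m * G' (y + t *\<^sub>R (x - y)) (z - x))"
        by (subst integral_diff integral_diff[symmetric],
            auto intro!: integrable_continuous_interval continuous_intros cG cG' B zB)+
      also have "norm \<dots> \<le> integral {0..1} (\<lambda>t::real. \<epsilon> * norm (z - x))"
      proof (rule integral_norm_bound_integral)
        show "(\<lambda>t. t ^ m * G (y + t *\<^sub>R (z - y)) - t ^ m * G (y + t *\<^sub>R (x - y))
            - t ^ Suc m * G' (y + t *\<^sub>R (x - y)) (z - x)) integrable_on {0..1}"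
          by (intro integrable_continuous_interval continuous_intros cG cG' B zB)
        show "norm (t ^ m * G (y + t *\<^sub>R (z - y)) - t ^ m * G (y + t *\<^sub>R (x - y))
            - t ^ Suc m * G' (y + t *\<^sub>R (x - y)) (z - x)) \<le> \<epsilon> * norm (z - x)" if t: "t \<in> {0..1}" for t
        proof -
          have "t ^ m * G (y + t *\<^sub>R (z - y)) - t ^ m * G (y + t *\<^sub>R (x - y))
              - t ^ Suc m * G' (y + t *\<^sub>R (x - y)) (z - x) =
            t ^ m * (G (y + t *\<^sub>R (z - y)) - G (y + t *\<^sub>R (x - y)) - t * G' (y + t *\<^sub>R (x - y)) (z - x))"
            by (simp add: algebra_simps)
          moreover have "\<bar>t ^ m\<bar> \<le> 1" using t by (simp add: power_le_one)
          ultimately show ?thesis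
            using bound[OF t] mult_mono[of "\<bar>t ^ m\<bar>" 1 _ "\<epsilon> * norm (z - x)"] by (simp add: abs_mult)
        qed
      qed auto
      finally show ?thesis by simp
    qed
    then show ?thesis using d(1) by blast
  qed
  then show ?thesis unfolding has_derivative_at_alt using bl by blast
qed

lemma Ck_on_param_integral:
  fixes G :: "'e::real_inner \<Rightarrow> real" and E :: "'e set"
  assumes E: "orthonormal_basis E" and B: "open B" "convex B" "y \<in> B"
  shows "Ck_on n G B \<Longrightarrow> Ck_on n (\<lambda>x. integral {0..1} (\<lambda>t. t ^ m * G (y + t *\<^sub>R (x - y)))) B"
proof (induction n arbitrary: G m)
  case 0
  then have cG: "continuous_on B G" by simp
  have inB: "y + t *\<^sub>R (z - y) \<in> B" if "z \<in> B" "t \<in> {0..1}" for z t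
  proof -
    have "y + t *\<^sub>R (z - y) = (1 - t) *\<^sub>R y + t *\<^sub>R z" by (simp add: algebra_simps)
    then show ?thesis using B that by (simp add: convexD)
  qed
  have "continuous_on (B \<times> cbox 0 1) (\<lambda>(x, t). t ^ m * G (y + t *\<^sub>R (x - y)))"
    unfolding case_prod_beta
    by (intro continuous_intros continuous_on_compose2[OF cG]) (auto intro!: continuous_intros inB)
  from integral_continuous_on_param[OF this] show ?case by simp
next
  case (Suc n)
  show ?case
  proof (rule Ck_on_SucI[OF B(1), where f'="\<lambda>x v. integral {0..1} (\<lambda>t. t ^ Suc m *
        frechet_derivative G (at (y + t *\<^sub>R (x - y))) v)"])
    have "Ck_on n (\<lambda>z. frechet_derivative G (at z) e) B" for e using Suc.prems by simp
    then have "Ck_on 0 (\<lambda>z. frechet_derivative G (at z) e) B" for e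
      by (induction n) (blast intro: Ck_on_SucD)+
    then show "((\<lambda>x. integral {0..1} (\<lambda>t. t ^ m * G (y + t *\<^sub>R (x - y)))) has_derivative
          (\<lambda>v. integral {0..1} (\<lambda>t. t ^ Suc m * frechet_derivative G (at (y + t *\<^sub>R (x - y))) v))) (at x)"
      if "x \<in> B" for x
      using Ck_on_has_derivative[OF Suc.prems]
      by (intro has_derivative_param_integral[OF E B(1,2) that B(3)]) auto
    show "Ck_on n (\<lambda>x. integral {0..1} (\<lambda>t. t ^ Suc m * frechet_derivative G (at (y + t *\<^sub>R (x - y))) v)) B" for v
      by (rule Suc.IH) (use Suc.prems in simp)
  qed
qed

text \<open>
  The \<open>h e\<close> are the integrals of the partial derivatives over the segment from \<open>y\<close> to \<open>x\<close>.
\<close>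

lemma hadamard:
  fixes F :: "'e::real_inner \<Rightarrow> real" and E :: "'e set"
  assumes E: "orthonormal_basis E" and B: "open B" "convex B" "y \<in> B" and F: "smooth_on F B"
  shows "\<exists>h. (\<forall>e. smooth_on (h e) B \<and> h e y = frechet_derivative F (at y) e) \<and>
             (\<forall>x\<in>B. F x = F y + (\<Sum>e\<in>E. ((x - y) \<bullet> e) * h e x))"
proof -
  define h where "h = (\<lambda>e x. integral {0..1} (\<lambda>t. t ^ 0 * frechet_derivative F (at (y + t *\<^sub>R (x - y))) e))"
  have finE: "finite E" using E unfolding orthonormal_basis_def by blast
  have Fn: "Ck_on n F B" for n using F by (simp add: smooth_on_def)
  have dF: "(F has_derivative frechet_derivative F (at z)) (at z)" if "z \<in> B" for z
    using Ck_on_has_derivative[OF Fn[of "Suc 0"] that] .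
  have "Ck_on n (\<lambda>z. frechet_derivative F (at z) e) B" for n e using Fn[of "Suc n"] by simp
  then have "smooth_on (h e) B" for e
    unfolding smooth_on_def h_def using Ck_on_param_integral[OF E B] by blast
  moreover have "h e y = frechet_derivative F (at y) e" for e
    by (simp add: h_def)
  moreover have "F x = F y + (\<Sum>e\<in>E. ((x - y) \<bullet> e) * h e x)" if x: "x \<in> B" for x
  proof -
    have inB: "y + t *\<^sub>R (x - y) \<in> B" if "t \<in> {0..1}" for t
    proof -
      have "y + t *\<^sub>R (x - y) = (1 - t) *\<^sub>R y + t *\<^sub>R x" by (simp add: algebra_simps)
      then show ?thesis using B x that by (simp add: convexD)
    qed
    have cF': "continuous_on B (\<lambda>z. frechet_derivative F (at z) e)" for e
      using Fn[of "Suc 0"] by simp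
    have c: "continuous_on {0..1} (\<lambda>t. frechet_derivative F (at (y + t *\<^sub>R (x - y))) e)" for e
      by (rule continuous_on_compose2[OF cF']) (auto intro!: continuous_intros inB)
    have "((\<lambda>t. F (y + t *\<^sub>R (x - y))) has_vector_derivative
        frechet_derivative F (at (y + t *\<^sub>R (x - y))) (x - y)) (at t within {0..1})"
      if t: "t \<in> {0..1}" for t
    proof -
      have "((\<lambda>t. y + t *\<^sub>R (x - y)) has_derivative (\<lambda>s. s *\<^sub>R (x - y))) (at t within {0..1})"
        by (auto intro!: derivative_eq_intros)
      from has_derivative_compose[OF this dF[OF inB[OF t]]]
      show ?thesis
        using has_derivative_linear[OF dF[OF inB[OF t]]]
        by (simp add: has_vector_derivative_def linear_scale)
    qed
    from fundamental_theorem_of_calculus[OF _ this]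
    have "((\<lambda>t. frechet_derivative F (at (y + t *\<^sub>R (x - y))) (x - y)) has_integral F x - F y) {0..1}"
      by simp
    then have "F x - F y = integral {0..1} (\<lambda>t. frechet_derivative F (at (y + t *\<^sub>R (x - y))) (x - y))"
      by (simp add: integral_unique)
    also have "\<dots> = integral {0..1} (\<lambda>t. \<Sum>e\<in>E. ((x - y) \<bullet> e) * frechet_derivative F (at (y + t *\<^sub>R (x - y))) e)"
      by (rule integral_cong, rule linear_orthonormal[OF E])
         (use has_derivative_linear dF inB in blast)
    also have "\<dots> = (\<Sum>e\<in>E. integral {0..1} (\<lambda>t. ((x - y) \<bullet> e) * frechet_derivative F (at (y + t *\<^sub>R (x - y))) e))"
      using finE by (intro integral_sum integrable_continuous_interval continuous_intros c)
    also have "\<dots> = (\<Sum>e\<in>E. ((x - y) \<bullet> e) * h e x)" by (simp add: h_def)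
    finally show ?thesis by simp
  qed
  ultimately show ?thesis by blast
qed

section \<open>Local frames\<close>

lemma sum_fun_apply: "(\<Sum>i\<in>I. f i) x = (\<Sum>i\<in>I. f i x)"
  by (induction I rule: infinite_finite_induct) simp_all

lemma smooth_onD: "smooth_on f S \<Longrightarrow> Ck_on n f S" by (simp add: smooth_on_def)

lemma smooth_functions_const: "smooth_manifold A \<Longrightarrow> (\<lambda>_. c) \<in> smooth_functions A"
  by (auto simp: smooth_functions_def smooth_on_def smooth_manifold_def o_def Ck_on_const split: prod.splits)

lemma smooth_functions_add:
  assumes "smooth_manifold A" "f \<in> smooth_functions A" "g \<in> smooth_functions A"
  shows "f + g \<in> smooth_functions A"
  using assms Ck_on_add
  unfolding smooth_functions_def smooth_on_def smooth_manifold_def o_def plus_fun_def by fast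

lemma smooth_functions_mult:
  assumes "smooth_manifold A" "f \<in> smooth_functions A" "g \<in> smooth_functions A"
  shows "f * g \<in> smooth_functions A"
  using assms Ck_on_mult
  unfolding smooth_functions_def smooth_on_def smooth_manifold_def o_def times_fun_def by fast

lemma vector_fieldD:
  assumes "X \<in> vector_fields A"
  shows "f \<in> smooth_functions A \<Longrightarrow> X f \<in> smooth_functions A"
    "f \<in> smooth_functions A \<Longrightarrow> g \<in> smooth_functions A \<Longrightarrow> X (f + g) = X f + X g"
    "f \<in> smooth_functions A \<Longrightarrow> X ((\<lambda>_. c) * f) = (\<lambda>_. c) * X f"
    "f \<in> smooth_functions A \<Longrightarrow> g \<in> smooth_functions A \<Longrightarrow> X (f * g) = X f * g + f * X g"
    "f \<notin> smooth_functions A \<Longrightarrow> X f = 0"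
  using assms by (auto simp: vector_fields_def)

text \<open>
  A derivation acts on global functions only. Take a bump function \<open>g\<^sub>0\<close> supported in a
  coordinate ball and the functions \<open>g\<^sub>e = g\<^sub>0 \<cdot> x\<^sub>e\<close>. For \<open>y\<close> in the ball, Hadamard's lemma
  gives \<open>g\<^sub>0\<^sup>2 f = f(y) g\<^sub>0\<^sup>2 + \<Sum>\<^sub>e (g\<^sub>e - y\<^sub>e g\<^sub>0) \<cdot> g\<^sub>0 h\<^sub>e\<close>, an identity between global functions.
  Applying the derivation \<open>X\<close> and evaluating at \<open>y\<close> yields \<open>g\<^sub>0\<^sup>2 X f = \<Sum>\<^sub>e (X g\<^sub>e - y\<^sub>e X g\<^sub>0) \<cdot>
  g\<^sub>0 \<partial>\<^sub>e f\<close>, which is a frame indexed by the basis and one additional element for \<open>g\<^sub>0\<close>.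
\<close>

lemma local_frame_exists:
  fixes A :: "('m::{t2_space, second_countable_topology}, 'e::real_inner) chart set" and p :: 'm
  assumes A: "smooth_manifold A"
  shows "\<exists>w (J :: 'e set) g Y. w \<in> smooth_functions A \<and> w p \<noteq> 0 \<and> finite J \<and>
    (\<forall>e\<in>J. g e \<in> smooth_functions A \<and> Y e \<in> vector_fields A) \<and>
    (\<forall>X\<in>vector_fields A. w \<cdot> X = (\<Sum>e\<in>J. X (g e) \<cdot> Y e))"
proof -
  let ?C = "smooth_functions A"
  have "\<exists>B::'e set. finite B \<and> span B = UNIV"
    using A unfolding smooth_manifold_def by (rule conjunct1)
  then obtain E :: "'e set" where E: "orthonormal_basis E"
    using orthonormal_basis_exists by metis
  have finE: "finite E" and normE: "\<And>e. e \<in> E \<Longrightarrow> norm e = 1"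
    using E unfolding orthonormal_basis_def by blast+
  have E0: "0 \<notin> E" using normE by force
  have "p \<in> (\<Union>(U, \<phi>)\<in>A. U)" using A by (simp add: smooth_manifold_def)
  then obtain U \<phi> where U: "(U, \<phi>) \<in> A" "p \<in> U" by auto
  have chart: "open W" "open (\<psi> ` W)" "homeomorphism W (\<psi> ` W) \<psi> (inv_into W \<psi>)"
    if "(W, \<psi>) \<in> A" for W \<psi>
    using A that unfolding smooth_manifold_def by blast+
  have trans: "smooth_on (\<psi> \<circ> inv_into W \<theta>) (\<theta> ` (W \<inter> V))" if "(W, \<theta>) \<in> A" "(V, \<psi>) \<in> A" for W \<theta> V \<psi>
    using A that unfolding smooth_manifold_def by blast
  have inv: "inv_into W \<psi> (\<psi> q) = q" if "(W, \<psi>) \<in> A" "q \<in> W" for W \<psi> q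
    using chart(3)[OF that(1)] that(2) by (simp add: homeomorphism_def)
  have contU: "continuous_on U \<phi>" using chart(3)[OF U(1)] by (simp add: homeomorphism_def)
  define x0 where "x0 = \<phi> p"
  have "x0 \<in> \<phi> ` U" using U by (simp add: x0_def)
  then obtain r where r: "r > 0" "ball x0 r \<subseteq> \<phi> ` U"
    using chart(2)[OF U(1)] open_contains_ball by blast
  define B where "B = ball x0 r"
  have B: "open B" "convex B" "x0 \<in> B" using r by (auto simp: B_def)
  \<comment> \<open>\<open>\<eta>\<close> is a bump function on the ball; it vanishes outside of the ball of half the radius.\<close>
  define \<eta> where "\<eta> = (\<lambda>x. flat_exp 0 ((r/2)\<^sup>2 - (x - x0) \<bullet> (x - x0)))"
  have \<eta>_smooth: "Ck_on n \<eta> S" if "open S" for n S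
  proof -
    have real: "orthonormal_basis {1::real}" by (simp add: orthonormal_basis_def)
    have "Ck_on n (\<lambda>x. (r/2)\<^sup>2 + (-1) * (\<Sum>e\<in>E. (x \<bullet> e + - (x0 \<bullet> e)) * (x \<bullet> e + - (x0 \<bullet> e)))) S"
      by (intro Ck_on_add Ck_on_mult Ck_on_const Ck_on_sum Ck_on_bounded_linear
          bounded_linear_inner_left that finE)
    moreover have "(x - x0) \<bullet> (x - x0) = (\<Sum>e\<in>E. (x \<bullet> e + - (x0 \<bullet> e)) * (x \<bullet> e + - (x0 \<bullet> e)))" for x
    proof -
      have "(x - x0) \<bullet> (x - x0) = (\<Sum>e\<in>E. ((x - x0) \<bullet> e) * ((x - x0) \<bullet> e))"
        by (rule linear_orthonormal[OF E]) (simp add: bounded_linear.linear bounded_linear_inner_right)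
      then show ?thesis by (simp add: inner_diff_left)
    qed
    ultimately have "Ck_on n (\<lambda>x. (r/2)\<^sup>2 - (x - x0) \<bullet> (x - x0)) S" by simp
    from Ck_on_compose[OF real that _ Ck_on_flat_exp this] show ?thesis by (simp add: \<eta>_def)
  qed
  have \<eta>_zero: "\<eta> x = 0" if "x \<notin> cball x0 (r/2)" for x
  proof -
    have "r/2 < norm (x - x0)" using that by (simp add: dist_norm norm_minus_commute)
    then have "(r/2)\<^sup>2 < (norm (x - x0))\<^sup>2" using r(1) by (intro power_strict_mono) auto
    then show ?thesis by (simp add: \<eta>_def flat_exp_def dot_square_norm)
  qed
  define V where "V = {q \<in> U. \<phi> q \<in> B}"
  have V: "open V" "p \<in> V" "V \<subseteq> U"
    using continuous_open_preimage[OF contU chart(1)[OF U(1)] B(1)] U B(3)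
    by (auto simp: V_def x0_def vimage_def Int_def conj_commute)
  \<comment> \<open>\<open>K\<close> contains the support of the bump function. It is closed because it is compact, so functions that are cut off by \<open>\<eta>\<close> extend by 0.\<close>
  define K where "K = inv_into U \<phi> ` cball x0 (r/2)"
  have "cball x0 (r/2) \<subseteq> B" using r(1) by (auto simp: B_def)
  then have "continuous_on (cball x0 (r/2)) (inv_into U \<phi>)"
    using chart(3)[OF U(1)] r(2) unfolding homeomorphism_def B_def
    by (meson continuous_on_subset order_trans)
  then have K: "closed K"
    unfolding K_def using compact_cball_orthonormal[OF E]
    by (intro compact_imp_closed compact_continuous_image) auto
  have KV: "K \<subseteq> V"
  proof
    fix q assume "q \<in> K"
    then obtain x where x: "x \<in> cball x0 (r/2)" "q = inv_into U \<phi> x" by (auto simp: K_def)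
    then have "x \<in> B" using \<open>cball x0 (r/2) \<subseteq> B\<close> by blast
    moreover then have "x \<in> \<phi> ` U" using r(2) by (auto simp: B_def)
    ultimately show "q \<in> V" using x by (simp add: V_def inv_into_into f_inv_into_f)
  qed
  define ext where "ext = (\<lambda>u q. if q \<in> V then \<eta> (\<phi> q) * u (\<phi> q) else (0::real))"
  have ext_smooth: "ext u \<in> ?C" if u: "smooth_on u B" for u
    unfolding smooth_functions_def
  proof (clarify)
    fix W \<psi> assume W: "(W, \<psi>) \<in> A"
    have imW: "open (\<psi> ` (W \<inter> O'))" if "open O'" for O'
    proof -
      have "\<psi> ` (W \<inter> O') = \<psi> ` W \<inter> inv_into W \<psi> -` O'" using inv[OF W] by auto
      moreover have "continuous_on (\<psi> ` W) (inv_into W \<psi>)"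
        using chart(3)[OF W] by (simp add: homeomorphism_def)
      ultimately show ?thesis using continuous_open_preimage[OF _ chart(2)[OF W] that] by simp
    qed
    show "smooth_on (ext u \<circ> inv_into W \<psi>) (\<psi> ` W)"
      unfolding smooth_on_def
    proof (intro allI Ck_on_local)
      fix n z assume "z \<in> \<psi> ` W"
      then obtain q where q: "q \<in> W" "z = \<psi> q" by blast
      show "\<exists>T. open T \<and> z \<in> T \<and> Ck_on n (ext u \<circ> inv_into W \<psi>) T"
      proof (cases "q \<in> V")
        case True
        let ?T = "\<psi> ` (W \<inter> V)"
        have T: "open ?T" by (rule imW[OF V(1)])
        have "Ck_on n (\<phi> \<circ> inv_into W \<psi>) ?T"
          by (rule Ck_on_subset[OF smooth_onD[OF trans[OF W U(1)]]]) (use V in auto)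
        moreover have "(\<phi> \<circ> inv_into W \<psi>) ` ?T \<subseteq> B"
          by (auto simp: inv[OF W] V_def)
        moreover have "Ck_on n (\<lambda>x. \<eta> x * u x) B"
          by (intro Ck_on_mult \<eta>_smooth B smooth_onD[OF u])
        ultimately have "Ck_on n (\<lambda>x. \<eta> ((\<phi> \<circ> inv_into W \<psi>) x) * u ((\<phi> \<circ> inv_into W \<psi>) x)) ?T"
          using Ck_on_compose[OF E T] by blast
        then have "Ck_on n (ext u \<circ> inv_into W \<psi>) ?T"
          by (rule Ck_on_cong[OF T, rotated]) (auto simp: ext_def inv[OF W])
        then show ?thesis using T q True by blast
      next
        case False
        let ?T = "\<psi> ` (W \<inter> - K)"
        have T: "open ?T" by (rule imW) (use K in auto)
        have "Ck_on n (ext u \<circ> inv_into W \<psi>) ?T"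
        proof (rule Ck_on_cong[OF T _ Ck_on_const[OF T]])
          fix x assume "x \<in> ?T"
          then obtain q where q: "q \<in> W" "q \<notin> K" "x = \<psi> q" by blast
          have "\<eta> (\<phi> q) = 0" if "q \<in> V"
          proof (rule \<eta>_zero)
            have "q = inv_into U \<phi> (\<phi> q)" using inv[OF U(1)] V that by auto
            then show "\<phi> q \<notin> cball x0 (r/2)" using q(2) unfolding K_def by blast
          qed
          then show "0 = (ext u \<circ> inv_into W \<psi>) x" using q inv[OF W] by (simp add: ext_def)
        qed
        moreover have "q \<notin> K" using False KV by blast
        ultimately show ?thesis using T q by blast
      qed
    qed
  qed
  define cr where "cr = (\<lambda>f. f \<circ> inv_into U \<phi> :: 'e \<Rightarrow> real)"
  define pd where "pd = (\<lambda>e f x. frechet_derivative (cr f) (at x) e)"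
  have cr_smooth: "smooth_on (cr f) B" if "f \<in> ?C" for f
    using that U(1) r(2) unfolding smooth_functions_def smooth_on_def cr_def B_def
    by (blast intro: Ck_on_subset)
  have pd_smooth: "smooth_on (pd e f) B" if "f \<in> ?C" for f e
    using smooth_onD[OF cr_smooth[OF that], of "Suc _"] by (simp add: smooth_on_def pd_def)
  have cr_der: "(cr f has_derivative frechet_derivative (cr f) (at x)) (at x)"
    if "f \<in> ?C" "x \<in> B" for f x
    using Ck_on_has_derivative[OF smooth_onD[OF cr_smooth[OF that(1)]] that(2)] .
  have pd_add: "pd e (f + g) x = pd e f x + pd e g x" if "f \<in> ?C" "g \<in> ?C" "x \<in> B" for e f g x
  proof -
    have "cr (f + g) = (\<lambda>x. cr f x + cr g x)" by (auto simp: cr_def)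
    then show ?thesis
      using frechet_derivative_at[OF has_derivative_add[OF cr_der[OF that(1,3)] cr_der[OF that(2,3)]], symmetric]
      by (simp add: pd_def)
  qed
  have pd_mult: "pd e (f * g) x = pd e f x * cr g x + cr f x * pd e g x"
    if "f \<in> ?C" "g \<in> ?C" "x \<in> B" for e f g x
  proof -
    have "cr (f * g) = (\<lambda>x. cr f x * cr g x)" by (auto simp: cr_def)
    then show ?thesis
      using frechet_derivative_at[OF has_derivative_mult[OF cr_der[OF that(1,3)] cr_der[OF that(2,3)]], symmetric]
      by (simp add: pd_def)
  qed
  have pd_const: "pd e (\<lambda>_. c) x = 0" for e c x
    by (simp add: pd_def cr_def o_def)
  have cr_V: "cr f (\<phi> q) = f q" if "q \<in> V" for f q
    using inv[OF U(1)] V that by (auto simp: cr_def)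
  \<comment> \<open>The index 0, which is not a basis vector, stands for the bump function itself.\<close>
  define g where "g = (\<lambda>e. if e = 0 then ext (\<lambda>_. 1) else ext (\<lambda>x. x \<bullet> e))"
  define Y where "Y = (\<lambda>e f. if f \<notin> ?C then 0 else if e = 0 then ext (\<lambda>x. - (\<Sum>e\<in>E. (x \<bullet> e) * pd e f x))
      else ext (pd e f))"
  have gC: "g e \<in> ?C" for e
    unfolding g_def using Ck_on_const[OF B(1)] Ck_on_bounded_linear[OF B(1) bounded_linear_inner_left]
    by (auto intro!: ext_smooth simp: smooth_on_def)
  have YV: "Y e \<in> vector_fields A" if "e \<in> insert 0 E" for e
  proof -
    have main: "(\<lambda>f. if f \<notin> ?C then 0 else ext (\<lambda>x. \<Sum>e\<in>E. c e x * pd e f x)) \<in> vector_fields A"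
      if c: "\<And>e. smooth_on (c e) B" for c :: "'e \<Rightarrow> 'e \<Rightarrow> real"
    proof -
      have "smooth_on (\<lambda>x. \<Sum>e\<in>E. c e x * pd e f x) B" if "f \<in> ?C" for f
        using c pd_smooth[OF that] unfolding smooth_on_def
        by (intro allI Ck_on_sum Ck_on_mult B finE) auto
      moreover have "ext (\<lambda>x. \<Sum>e\<in>E. c e x * pd e (f + g) x) =
          ext (\<lambda>x. \<Sum>e\<in>E. c e x * pd e f x) + ext (\<lambda>x. \<Sum>e\<in>E. c e x * pd e g x)"
        if "f \<in> ?C" "g \<in> ?C" for f g
        by (auto simp: ext_def fun_eq_iff V_def pd_add that sum.distrib algebra_simps)
      moreover have "ext (\<lambda>x. \<Sum>e\<in>E. c e x * pd e (f * g) x) =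
          ext (\<lambda>x. \<Sum>e\<in>E. c e x * pd e f x) * g + f * ext (\<lambda>x. \<Sum>e\<in>E. c e x * pd e g x)"
        if "f \<in> ?C" "g \<in> ?C" for f g
      proof
        fix q
        show "ext (\<lambda>x. \<Sum>e\<in>E. c e x * pd e (f * g) x) q =
          (ext (\<lambda>x. \<Sum>e\<in>E. c e x * pd e f x) * g + f * ext (\<lambda>x. \<Sum>e\<in>E. c e x * pd e g x)) q"
        proof (cases "q \<in> V")
          case True
          then have "\<phi> q \<in> B" by (simp add: V_def)
          then show ?thesis
            using True by (simp add: ext_def pd_mult that cr_V sum.distrib sum_distrib_left sum_distrib_right algebra_simps)
        qed (simp add: ext_def)
      qed
      moreover have "(\<lambda>_. s) * f \<in> ?C" if "f \<in> ?C" for s f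
        using smooth_functions_mult[OF A smooth_functions_const[OF A] that] .
      moreover have "ext (\<lambda>x. \<Sum>e\<in>E. c e x * pd e (\<lambda>_. s) x) = 0" for s
        by (simp add: pd_const ext_def fun_eq_iff)
      ultimately show ?thesis
        unfolding vector_fields_def
        using ext_smooth smooth_functions_add[OF A] smooth_functions_mult[OF A] smooth_functions_const[OF A]
        by simp
    qed
    show ?thesis
    proof (cases "e \<in> E")
      case True
      have "(\<Sum>a\<in>E. (if a = e then 1 else 0) * h a) = h e" for h :: "'e \<Rightarrow> real"
      proof -
        have "(\<Sum>a\<in>E. (if a = e then 1 else 0) * h a) = (\<Sum>a\<in>E. if a = e then h a else 0)"
          by (rule sum.cong) auto
        then show ?thesis using True finE by simp
      qed
      then have "Y e = (\<lambda>f. if f \<notin> ?C then 0 else ext (\<lambda>x. \<Sum>a\<in>E. (\<lambda>x. if a = e then 1 else 0) x * pd a f x))"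
        using True E0 by (auto simp: Y_def fun_eq_iff)
      then show ?thesis using main[of "\<lambda>a x. if a = e then 1 else 0"]
          Ck_on_const[OF B(1)] by (auto simp: smooth_on_def)
    next
      case F: False
      have e: "e = 0" using that F by blast
      have "Y e = (\<lambda>f. if f \<notin> ?C then 0 else ext (\<lambda>x. \<Sum>a\<in>E. ((-1) * (x \<bullet> a)) * pd a f x))"
        using e by (auto simp: Y_def fun_eq_iff sum_negf)
      moreover have "smooth_on (\<lambda>x. (-1) * (x \<bullet> a)) B" for a
        unfolding smooth_on_def
        by (intro allI Ck_on_mult Ck_on_const Ck_on_bounded_linear bounded_linear_inner_left B)
      ultimately show ?thesis using main[of "\<lambda>a x. (-1) * (x \<bullet> a)"] by simp
    qed
  qed
  have frame: "(g 0 * g 0) \<cdot> X = (\<Sum>e\<in>insert 0 E. X (g e) \<cdot> Y e)" if X: "X \<in> vector_fields A" for X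
  proof (intro ext)
    fix f q
    note XD = vector_fieldD[OF X]
    have sumE: "(\<Sum>e\<in>insert 0 E. (X (g e) \<cdot> Y e)) f q =
        X (g 0) q * Y 0 f q + (\<Sum>e\<in>E. X (g e) q * Y e f q)"
      using E0 finE by (simp add: fmul_def sum_fun_apply)
    show "((g 0 * g 0) \<cdot> X) f q = (\<Sum>e\<in>insert 0 E. X (g e) \<cdot> Y e) f q"
    proof (cases "f \<in> ?C \<and> q \<in> V")
      case False
      have "g 0 q = 0" "\<forall>e. Y e f q = 0" if "q \<notin> V"
        using that by (auto simp: g_def Y_def ext_def)
      moreover have "X f = 0" "\<forall>e. Y e f = 0" if "f \<notin> ?C"
        using that XD(5) by (auto simp: Y_def)
      ultimately show ?thesis unfolding sumE using False by (auto simp: fmul_def)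
    next
      case True
      then have f: "f \<in> ?C" and q: "q \<in> V" by auto
      define y where "y = \<phi> q"
      have y: "y \<in> B" using q by (simp add: V_def y_def)
      obtain h where h: "\<And>e. smooth_on (h e) B" "\<And>e. h e y = pd e f y"
        "\<And>x. x \<in> B \<Longrightarrow> cr f x = cr f y + (\<Sum>e\<in>E. ((x - y) \<bullet> e) * h e x)"
        using hadamard[OF E B(1,2) y cr_smooth[OF f]] unfolding pd_def by blast
      define H where "H = (\<lambda>e. ext (h e))"
      have H: "H e \<in> ?C" for e unfolding H_def by (rule ext_smooth[OF h(1)])
      define k where "k = (\<lambda>e. g e + (\<lambda>_. - (y \<bullet> e)) * g 0)"
      have kC: "k e \<in> ?C" for e
        unfolding k_def by (intro smooth_functions_add smooth_functions_mult smooth_functions_const A gC)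
      have sumC: "sum s F \<in> ?C \<and> X (sum s F) = (\<Sum>e\<in>F. X (s e))"
        if "finite F" "\<And>e. s e \<in> ?C" for s :: "'e \<Rightarrow> 'm \<Rightarrow> real" and F
        using that(1)
      proof (induction F rule: finite_induct)
        case empty
        have z: "(0::'m \<Rightarrow> real) \<in> ?C" using smooth_functions_const[OF A, of 0] by (simp add: zero_fun_def)
        have "X ((\<lambda>_. 0) * 0) = (\<lambda>_. 0) * X 0" by (rule XD(3)[OF z])
        moreover have "(\<lambda>_. 0) * f = 0" for f :: "'m \<Rightarrow> real" by (simp add: fun_eq_iff)
        ultimately have "X 0 = 0" by metis
        then show ?case unfolding sum.empty using z by blast
      next
        case (insert x F)
        then show ?case unfolding sum.insert[OF insert.hyps]
          using smooth_functions_add[OF A] XD(2) that(2) by metis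
      qed
      have "g 0 * (g 0 * f) = (\<lambda>_. f q) * (g 0 * g 0) + (\<Sum>e\<in>E. k e * H e)"
      proof
        fix a
        show "(g 0 * (g 0 * f)) a = ((\<lambda>_. f q) * (g 0 * g 0) + (\<Sum>e\<in>E. k e * H e)) a"
        proof (cases "a \<in> V")
          case a: True
          have "f a = f q + (\<Sum>e\<in>E. ((\<phi> a - y) \<bullet> e) * h e (\<phi> a))"
            using h(3)[of "\<phi> a"] a q by (simp add: cr_V V_def y_def)
          moreover have "k e a * H e a = \<eta> (\<phi> a) * \<eta> (\<phi> a) * (((\<phi> a - y) \<bullet> e) * h e (\<phi> a))" if "e \<in> E" for e
            using that E0 a by (auto simp: k_def g_def H_def ext_def inner_diff_left algebra_simps)
          ultimately have "(\<Sum>e\<in>E. k e * H e) a = \<eta> (\<phi> a) * \<eta> (\<phi> a) * (f a - f q)"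
            by (simp add: sum_fun_apply sum_distrib_left)
          then show ?thesis
            using a by (simp add: g_def ext_def algebra_simps)
        qed (simp add: g_def ext_def k_def H_def sum_fun_apply)
      qed
      then have "X (g 0 * (g 0 * f)) q = X ((\<lambda>_. f q) * (g 0 * g 0) + (\<Sum>e\<in>E. k e * H e)) q" by (rule arg_cong)
      also have "X ((\<lambda>_. f q) * (g 0 * g 0) + (\<Sum>e\<in>E. k e * H e)) =
          X ((\<lambda>_. f q) * (g 0 * g 0)) + X (\<Sum>e\<in>E. k e * H e)"
        by (intro XD(2) smooth_functions_mult[OF A] smooth_functions_const[OF A] gC
            conjunct1[OF sumC[OF finE]] kC H)
      also have "X (\<Sum>e\<in>E. k e * H e) = (\<Sum>e\<in>E. X (k e * H e))"
        by (intro conjunct2[OF sumC[OF finE]] smooth_functions_mult[OF A] kC H)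
      also have "\<dots> = (\<Sum>e\<in>E. X (k e) * H e + k e * X (H e))"
        by (rule sum.cong[OF refl], rule XD(4)[OF kC H])
      also have "X ((\<lambda>_. f q) * (g 0 * g 0)) = (\<lambda>_. f q) * (X (g 0) * g 0 + g 0 * X (g 0))"
        using XD(3)[OF smooth_functions_mult[OF A gC gC]] XD(4)[OF gC gC] by metis
      also have "X (g 0 * (g 0 * f)) = X (g 0) * (g 0 * f) + g 0 * (X (g 0) * f + g 0 * X f)"
        using XD(4)[OF gC smooth_functions_mult[OF A gC f]] XD(4)[OF gC f] by metis
      finally have 1: "(X (g 0) * (g 0 * f) + g 0 * (X (g 0) * f + g 0 * X f)) q =
         ((\<lambda>_. f q) * (X (g 0) * g 0 + g 0 * X (g 0)) + (\<Sum>e\<in>E. X (k e) * H e + k e * X (H e))) q" .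
      have "k e q = 0" if "e \<in> E" for e
        using that E0 q by (auto simp: k_def g_def ext_def y_def)
      moreover have "X (k e) = X (g e) + (\<lambda>_. - (y \<bullet> e)) * X (g 0)" for e
        unfolding k_def using XD(2)[OF gC] XD(3)[OF gC] smooth_functions_mult[OF A smooth_functions_const[OF A] gC]
        by metis
      moreover have "H e q = g 0 q * pd e f y" for e
        using q h(2) by (simp add: H_def g_def ext_def y_def)
      ultimately have "g 0 q * (g 0 q * X f q) =
          (\<Sum>e\<in>E. (X (g e) q - (y \<bullet> e) * X (g 0) q) * (g 0 q * pd e f y))"
        using 1 by (simp add: sum_fun_apply algebra_simps)
      moreover have "Y 0 f q = - (\<Sum>e\<in>E. g 0 q * ((y \<bullet> e) * pd e f y))"
        using f q by (simp add: Y_def g_def ext_def y_def sum_distrib_left)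
      moreover have "Y e f q = g 0 q * pd e f y" if "e \<in> E" for e
        using f q that E0 by (auto simp: Y_def g_def ext_def y_def)
      ultimately show ?thesis
        unfolding sumE by (simp add: fmul_def sum_distrib_left sum_subtractf algebra_simps)
    qed
  qed
  have "g 0 p \<noteq> 0"
    using V(2) r(1) by (simp add: g_def ext_def \<eta>_def x0_def flat_exp_def)
  then show ?thesis
    using frame gC YV finE smooth_functions_mult[OF A gC gC]
    by (intro exI[of _ "g 0 * g 0"] exI[of _ "insert 0 E"] exI[of _ g] exI[of _ Y]) auto
qed

section \<open>The wedge product\<close>

lemma fmul_apply [simp]: "(f \<cdot> \<omega>) x p = f p * \<omega> x p"
  by (simp add: fmul_def)

lemma sc_apply [simp]: "sc c \<omega> Xs p = c * \<omega> Xs p"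
  by (simp add: sc_def)

text \<open>
  Contraction with a vector field. All properties of the wedge product and of the exterior
  derivative are derived from their behaviour under contraction, by induction on the
  argument list.
\<close>

definition ins :: "'m vfield \<Rightarrow> 'm form \<Rightarrow> 'm form" where
  "ins X \<omega> = (\<lambda>Xs. \<omega> (X # Xs))"

text \<open>
  The sign \<open>(-1)\<^sup>k\<close> in degree \<open>k\<close>. As an operator on all forms it lets the rules below be
  stated without degrees.
\<close>

definition par :: "'m form \<Rightarrow> 'm form" where
  "par \<omega> = (\<lambda>Xs p. (- 1) ^ length Xs * \<omega> Xs p)"

lemma wedge_Nil: "(\<sigma> \<and>\<^sub>\<Omega> \<rho>) [] = \<sigma> [] * \<rho> []"
  by (simp add: wedge_def fun_eq_iff)

text \<open>
  A shuffle either puts the first argument into \<open>\<sigma>\<close>, where it creates no inversions, or into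
  \<open>\<rho>\<close>, where it creates one inversion with each argument of \<open>\<sigma>\<close>.
\<close>

lemma wedge_Cons:
  fixes \<sigma> \<rho> :: "'m form"
  shows "(\<sigma> \<and>\<^sub>\<Omega> \<rho>) (X # Xs) = (ins X \<sigma> \<and>\<^sub>\<Omega> \<rho>) Xs + (par \<sigma> \<and>\<^sub>\<Omega> ins X \<rho>) Xs"
proof
  fix p :: 'm
  let ?n = "length Xs"
  let ?inv = "\<lambda>I. {(i, j). i \<in> I \<and> j \<notin> I \<and> j < i} :: (nat \<times> nat) set"
  let ?t = "\<lambda>(\<sigma> :: 'm form) (\<rho> :: 'm form) Xs I. (- 1) ^ card (?inv I) * \<sigma> (nths Xs I) p * \<rho> (nths Xs (- I)) p :: real"
  have inj: "inj_on (image Suc) S" for S by (auto intro: inj_onI simp: inj_image_eq_iff)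
  have fin: "finite (?inv J)" if "finite J" for J
  proof (rule finite_subset)
    show "?inv J \<subseteq> J \<times> {..Max J}" using that by (auto intro: Max_ge less_imp_le le_trans)
    show "finite (J \<times> {..Max J})" using that by simp
  qed
  have Pow: "Pow {..<Suc ?n} = image Suc ` Pow {..<?n} \<union> (\<lambda>J. insert 0 (Suc ` J)) ` Pow {..<?n}"
  proof -
    have "Pow (Suc ` {..<?n}) = image Suc ` Pow {..<?n}" by (rule image_Pow_surj[OF refl, symmetric])
    then show ?thesis unfolding lessThan_Suc_eq_insert_0 Pow_insert by (simp add: image_image)
  qed
  have c1: "card (?inv (Suc ` J)) = card (?inv J) + card J" if "finite J" for J
  proof -
    have "?inv (Suc ` J) = map_prod Suc Suc ` ?inv J \<union> (\<lambda>i. (Suc i, 0)) ` J"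
    proof (intro equalityI subsetI)
      fix x assume "x \<in> ?inv (Suc ` J)"
      then obtain i j where x: "x = (Suc i, j)" "i \<in> J" "j \<notin> Suc ` J" "j < Suc i" by auto
      then show "x \<in> map_prod Suc Suc ` ?inv J \<union> (\<lambda>i. (Suc i, 0)) ` J" by (cases j) (auto intro: rev_image_eqI)
    qed auto
    moreover have "map_prod Suc Suc ` ?inv J \<inter> (\<lambda>i. (Suc i, 0)) ` J = {}" by auto
    ultimately show ?thesis
      using that fin[OF that]
      by (simp add: card_Un_disjoint card_image prod.inj_map inj_on_subset[OF prod.inj_map subset_UNIV] inj_on_def)
  qed
  have c2: "card (?inv (insert 0 (Suc ` J))) = card (?inv J)" for J
  proof -
    have "?inv (insert 0 (Suc ` J)) = map_prod Suc Suc ` ?inv J"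
    proof (intro equalityI subsetI)
      fix x assume "x \<in> ?inv (insert 0 (Suc ` J))"
      then obtain i j where x: "x = (Suc i, j)" "i \<in> J" "j \<notin> Suc ` J" "0 < j" "j < Suc i" by auto
      then show "x \<in> map_prod Suc Suc ` ?inv J" by (cases j) (auto intro: rev_image_eqI)
    qed auto
    then show ?thesis by (simp add: card_image inj_on_subset[OF prod.inj_map subset_UNIV])
  qed
  have n1: "nths (X # Xs) (Suc ` J) = nths Xs J" "nths (X # Xs) (- Suc ` J) = X # nths Xs (- J)"
    "nths (X # Xs) (insert 0 (Suc ` J)) = X # nths Xs J"
    "nths (X # Xs) (- insert 0 (Suc ` J)) = nths Xs (- J)" for J
  proof -
    have "{j. Suc j \<in> Suc ` J} = J" "{j. Suc j \<in> - Suc ` J} = - J"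
      "{j. Suc j \<in> insert 0 (Suc ` J)} = J" "{j. Suc j \<in> - insert 0 (Suc ` J)} = - J" by auto
    then show "nths (X # Xs) (Suc ` J) = nths Xs J" "nths (X # Xs) (- Suc ` J) = X # nths Xs (- J)"
      "nths (X # Xs) (insert 0 (Suc ` J)) = X # nths Xs J"
      "nths (X # Xs) (- insert 0 (Suc ` J)) = nths Xs (- J)" by (auto simp: nths_Cons)
  qed
  have len: "length (nths Xs J) = card J" if "J \<in> Pow {..<?n}" for J
  proof -
    have "{i. i < ?n \<and> i \<in> J} = J" using that by auto
    then show ?thesis by (simp add: length_nths)
  qed
  have "(\<sigma> \<and>\<^sub>\<Omega> \<rho>) (X # Xs) p = (\<Sum>I\<in>Pow {..<Suc ?n}. ?t \<sigma> \<rho> (X # Xs) I)"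
    by (simp add: wedge_def)
  also have "\<dots> = (\<Sum>I\<in>image Suc ` Pow {..<?n}. ?t \<sigma> \<rho> (X # Xs) I) +
      (\<Sum>I\<in>(\<lambda>J. insert 0 (Suc ` J)) ` Pow {..<?n}. ?t \<sigma> \<rho> (X # Xs) I)"
    unfolding Pow by (rule sum.union_disjoint) auto
  also have "(\<Sum>I\<in>image Suc ` Pow {..<?n}. ?t \<sigma> \<rho> (X # Xs) I) =
      (\<Sum>J\<in>Pow {..<?n}. ?t \<sigma> \<rho> (X # Xs) (Suc ` J))"
    by (simp add: sum.reindex[OF inj])
  also have "\<dots> = (\<Sum>J\<in>Pow {..<?n}. ?t (par \<sigma>) (ins X \<rho>) Xs J)"
  proof (rule sum.cong[OF refl])
    fix J assume J: "J \<in> Pow {..<?n}"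
    then have "finite J" using finite_subset by blast
    then show "?t \<sigma> \<rho> (X # Xs) (Suc ` J) = ?t (par \<sigma>) (ins X \<rho>) Xs J"
      by (simp add: c1 n1 len[OF J] par_def ins_def power_add)
  qed
  also have "(\<Sum>I\<in>(\<lambda>J. insert 0 (Suc ` J)) ` Pow {..<?n}. ?t \<sigma> \<rho> (X # Xs) I) =
      (\<Sum>J\<in>Pow {..<?n}. ?t \<sigma> \<rho> (X # Xs) (insert 0 (Suc ` J)))"
  proof (subst sum.reindex)
    show "inj_on (\<lambda>J. insert 0 (Suc ` J)) (Pow {..<?n})"
    proof (rule inj_onI)
      fix I J assume "insert 0 (Suc ` I) = insert 0 (Suc ` J)"
      then have "Suc ` I = Suc ` J" by (metis Diff_insert_absorb Zero_not_Suc imageE)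
      then show "I = J" by (simp add: inj_image_eq_iff)
    qed
  qed simp
  also have "\<dots> = (\<Sum>J\<in>Pow {..<?n}. ?t (ins X \<sigma>) \<rho> Xs J)"
    by (rule sum.cong[OF refl]) (simp only: c2 n1 ins_def)
  finally show "(\<sigma> \<and>\<^sub>\<Omega> \<rho>) (X # Xs) p = ((ins X \<sigma> \<and>\<^sub>\<Omega> \<rho>) Xs + (par \<sigma> \<and>\<^sub>\<Omega> ins X \<rho>) Xs) p"
    by (simp add: wedge_def)
qed

lemma ins_apply: "ins X \<omega> Xs = \<omega> (X # Xs)" by (simp add: ins_def)

lemma ins_linear [simp]:
  "ins X (\<sigma> + \<tau>) = ins X \<sigma> + ins X \<tau>" "ins X (\<sigma> - \<tau>) = ins X \<sigma> - ins X \<tau>"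
  "ins X (- \<sigma>) = - ins X \<sigma>" "ins X 0 = 0" "ins X (f \<cdot> \<sigma>) = f \<cdot> ins X \<sigma>" "ins X (sc c \<sigma>) = sc c (ins X \<sigma>)"
  by (auto simp: ins_def fun_eq_iff)

lemma par_linear [simp]:
  "par (\<sigma> + \<tau>) = par \<sigma> + par \<tau>" "par 0 = 0" "par (f \<cdot> \<sigma>) = f \<cdot> par \<sigma>" "par (sc c \<sigma>) = sc c (par \<sigma>)"
  "par (- \<sigma>) = - par \<sigma>" "par (par \<sigma>) = \<sigma>"
  by (auto simp: par_def fun_eq_iff distrib_left mult.left_commute)

lemma ins_par: "ins X (par \<sigma>) = - par (ins X \<sigma>)"
  by (auto simp: par_def ins_def fun_eq_iff)

lemma wedge_linear [simp]:
  "(\<sigma> + \<tau>) \<and>\<^sub>\<Omega> \<rho> = \<sigma> \<and>\<^sub>\<Omega> \<rho> + \<tau> \<and>\<^sub>\<Omega> \<rho>" "\<rho> \<and>\<^sub>\<Omega> (\<sigma> + \<tau>) = \<rho> \<and>\<^sub>\<Omega> \<sigma> + \<rho> \<and>\<^sub>\<Omega> \<tau>"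
  "(\<sigma> - \<tau>) \<and>\<^sub>\<Omega> \<rho> = \<sigma> \<and>\<^sub>\<Omega> \<rho> - \<tau> \<and>\<^sub>\<Omega> \<rho>" "\<rho> \<and>\<^sub>\<Omega> (\<sigma> - \<tau>) = \<rho> \<and>\<^sub>\<Omega> \<sigma> - \<rho> \<and>\<^sub>\<Omega> \<tau>"
  "0 \<and>\<^sub>\<Omega> \<rho> = 0" "\<rho> \<and>\<^sub>\<Omega> 0 = 0" "(- \<sigma>) \<and>\<^sub>\<Omega> \<rho> = - (\<sigma> \<and>\<^sub>\<Omega> \<rho>)" "\<rho> \<and>\<^sub>\<Omega> (- \<sigma>) = - (\<rho> \<and>\<^sub>\<Omega> \<sigma>)"
  "(f \<cdot> \<sigma>) \<and>\<^sub>\<Omega> \<rho> = f \<cdot> (\<sigma> \<and>\<^sub>\<Omega> \<rho>)" "\<rho> \<and>\<^sub>\<Omega> (f \<cdot> \<sigma>) = f \<cdot> (\<rho> \<and>\<^sub>\<Omega> \<sigma>)"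
  "(sc c \<sigma>) \<and>\<^sub>\<Omega> \<rho> = sc c (\<sigma> \<and>\<^sub>\<Omega> \<rho>)" "\<rho> \<and>\<^sub>\<Omega> (sc c \<sigma>) = sc c (\<rho> \<and>\<^sub>\<Omega> \<sigma>)"
  by (auto simp: wedge_def fun_eq_iff sum.distrib sum_subtractf sum_negf sum_distrib_left algebra_simps)

lemma ins_wedge: "ins X (\<sigma> \<and>\<^sub>\<Omega> \<rho>) = ins X \<sigma> \<and>\<^sub>\<Omega> \<rho> + par \<sigma> \<and>\<^sub>\<Omega> ins X \<rho>"
  by (simp add: fun_eq_iff ins_apply wedge_Cons)

lemma par_apply: "par \<omega> Xs p = (- 1) ^ length Xs * \<omega> Xs p" by (simp add: par_def)

lemma par_wedge: "par (\<sigma> \<and>\<^sub>\<Omega> \<rho>) = par \<sigma> \<and>\<^sub>\<Omega> par \<rho>"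
proof -
  have "par (\<sigma> \<and>\<^sub>\<Omega> \<rho>) Xs p = (par \<sigma> \<and>\<^sub>\<Omega> par \<rho>) Xs p" for Xs p
  proof (induction Xs arbitrary: \<sigma> \<rho>)
    case Nil
    then show ?case by (simp add: par_def wedge_Nil)
  next
    case (Cons X Xs)
    have "par (\<sigma> \<and>\<^sub>\<Omega> \<rho>) (X # Xs) p =
        - (par (ins X \<sigma> \<and>\<^sub>\<Omega> \<rho>) Xs p + par (par \<sigma> \<and>\<^sub>\<Omega> ins X \<rho>) Xs p)"
      by (simp add: par_apply wedge_Cons algebra_simps)
    also have "\<dots> = (par \<sigma> \<and>\<^sub>\<Omega> par \<rho>) (X # Xs) p"
      by (simp add: Cons.IH wedge_Cons ins_par)
    finally show ?case .
  qed
  then show ?thesis by (simp add: fun_eq_iff)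
qed

lemma wedge_assoc: "(\<sigma> \<and>\<^sub>\<Omega> \<rho>) \<and>\<^sub>\<Omega> \<tau> = \<sigma> \<and>\<^sub>\<Omega> \<rho> \<and>\<^sub>\<Omega> \<tau>"
proof
  fix Xs show "((\<sigma> \<and>\<^sub>\<Omega> \<rho>) \<and>\<^sub>\<Omega> \<tau>) Xs = (\<sigma> \<and>\<^sub>\<Omega> \<rho> \<and>\<^sub>\<Omega> \<tau>) Xs"
    by (induction Xs arbitrary: \<sigma> \<rho> \<tau>)
       (simp_all add: wedge_Nil wedge_Cons ins_wedge par_wedge mult.assoc add.assoc)
qed

lemma zero_form_Nil [simp]: "zero_form f [] = f" by (simp add: zero_form_def)

lemma ins_zero_form [simp]: "ins X (zero_form f) = 0"
  by (auto simp: ins_def zero_form_def fun_eq_iff)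

lemma zero_form_wedge [simp]: "zero_form f \<and>\<^sub>\<Omega> \<omega> = f \<cdot> \<omega>"
proof
  have p: "par (zero_form f) = zero_form f" by (auto simp: par_def zero_form_def fun_eq_iff)
  show "(zero_form f \<and>\<^sub>\<Omega> \<omega>) Xs = (f \<cdot> \<omega>) Xs" for Xs
    by (induction Xs arbitrary: \<omega>) (auto simp: wedge_Nil wedge_Cons p fmul_def ins_apply)
qed

lemma wedge_zero_form [simp]: "\<omega> \<and>\<^sub>\<Omega> zero_form f = f \<cdot> \<omega>"
proof
  show "(\<omega> \<and>\<^sub>\<Omega> zero_form f) Xs = (f \<cdot> \<omega>) Xs" for Xs
    by (induction Xs arbitrary: \<omega>) (auto simp: wedge_Nil wedge_Cons fmul_def ins_apply mult.commute)
qed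

definition homog :: "nat \<Rightarrow> 'm form \<Rightarrow> bool" where
  "homog k \<omega> \<longleftrightarrow> (\<forall>Xs. length Xs \<noteq> k \<longrightarrow> \<omega> Xs = 0)"

lemma homog_par: "homog k \<omega> \<Longrightarrow> par \<omega> = sc ((- 1) ^ k) \<omega>"
  by (force simp: homog_def par_def fun_eq_iff)

lemma homog_ins_Suc: "homog (Suc k) \<omega> \<Longrightarrow> homog k (ins X \<omega>)"
  by (auto simp: homog_def ins_def)

lemma homog_ins_0: "homog 0 \<omega> \<Longrightarrow> ins X \<omega> = 0"
  by (auto simp: homog_def ins_def fun_eq_iff)

lemma wedge_commute:
  assumes "homog k \<sigma>" "homog l \<rho>"
  shows "\<sigma> \<and>\<^sub>\<Omega> \<rho> = sc ((- 1) ^ (k * l)) (\<rho> \<and>\<^sub>\<Omega> \<sigma>)"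
proof (intro ext)
  fix Xs p show "(\<sigma> \<and>\<^sub>\<Omega> \<rho>) Xs p = sc ((- 1) ^ (k * l)) (\<rho> \<and>\<^sub>\<Omega> \<sigma>) Xs p"
    using assms
  proof (induction Xs arbitrary: k l \<sigma> \<rho>)
    case Nil
    then show ?case by (cases "k = 0"; cases "l = 0") (auto simp: wedge_Nil homog_def)
  next
    case (Cons X Xs)
    have 1: "(ins X \<sigma> \<and>\<^sub>\<Omega> \<rho>) Xs p = (- 1) ^ (k * l) * (- 1) ^ l * (\<rho> \<and>\<^sub>\<Omega> ins X \<sigma>) Xs p"
    proof (cases k)
      case 0
      then have "ins X \<sigma> = 0" using homog_ins_0 Cons.prems(1) by blast
      then show ?thesis by simp
    next
      case (Suc k')
      then show ?thesis using Cons.IH[OF homog_ins_Suc Cons.prems(2)] Cons.prems(1)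
        by (simp add: power_add power_mult_distrib[symmetric] mult.assoc[symmetric])
    qed
    have 2: "(\<sigma> \<and>\<^sub>\<Omega> ins X \<rho>) Xs p = (- 1) ^ (k * l) * (- 1) ^ k * (ins X \<rho> \<and>\<^sub>\<Omega> \<sigma>) Xs p"
    proof (cases l)
      case 0
      then have "ins X \<rho> = 0" using homog_ins_0 Cons.prems(2) by blast
      then show ?thesis by simp
    next
      case (Suc l')
      then show ?thesis using Cons.IH[OF Cons.prems(1) homog_ins_Suc] Cons.prems(2)
        by (simp add: power_add power_mult_distrib[symmetric] mult.assoc[symmetric])
    qed
    show ?case
      using 1 2 by (cases "even k"; cases "even l")
        (simp_all add: wedge_Cons homog_par[OF Cons.prems(1)] homog_par[OF Cons.prems(2)])
  qed
qed

section \<open>Vector fields and forms on a manifold\<close>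

locale manifold =
  fixes A :: "('m::{t2_space, second_countable_topology}, 'e::real_inner) chart set"
  assumes manifold: "smooth_manifold A"
begin

abbreviation "\<F> \<equiv> smooth_functions A"
abbreviation "\<X> \<equiv> vector_fields A"
abbreviation "\<Omega> \<equiv> forms A"
abbreviation "\<dd> \<equiv> ext_d A"
abbreviation "df \<equiv> differential A"

lemma F_const [simp, intro]: "(\<lambda>_. c) \<in> \<F>" by (rule smooth_functions_const[OF manifold])
lemma F_0 [simp, intro]: "0 \<in> \<F>" using F_const[of 0] by (simp add: zero_fun_def)
lemma F_1 [simp, intro]: "1 \<in> \<F>" using F_const[of 1] by (simp add: one_fun_def)
lemma F_add [simp, intro]: "f \<in> \<F> \<Longrightarrow> g \<in> \<F> \<Longrightarrow> f + g \<in> \<F>" by (rule smooth_functions_add[OF manifold])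
lemma F_mult [simp, intro]: "f \<in> \<F> \<Longrightarrow> g \<in> \<F> \<Longrightarrow> f * g \<in> \<F>" by (rule smooth_functions_mult[OF manifold])
lemma F_minus [simp, intro]: "f \<in> \<F> \<Longrightarrow> - f \<in> \<F>"
proof -
  assume "f \<in> \<F>"
  moreover have "- f = (\<lambda>_. - 1) * f" by (simp add: fun_eq_iff)
  ultimately show ?thesis by (metis F_const F_mult)
qed
lemma F_diff [simp, intro]: "f \<in> \<F> \<Longrightarrow> g \<in> \<F> \<Longrightarrow> f - g \<in> \<F>"
  using F_add[of f "- g"] F_minus[of g] by (metis diff_conv_add_uminus)
lemma X_F [simp, intro]: "X \<in> \<X> \<Longrightarrow> f \<in> \<F> \<Longrightarrow> X f \<in> \<F>" by (rule vector_fieldD)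
lemma X_add: "X \<in> \<X> \<Longrightarrow> f \<in> \<F> \<Longrightarrow> g \<in> \<F> \<Longrightarrow> X (f + g) = X f + X g" by (rule vector_fieldD)
lemma X_scale: "X \<in> \<X> \<Longrightarrow> f \<in> \<F> \<Longrightarrow> X ((\<lambda>_. c) * f) = (\<lambda>_. c) * X f" by (rule vector_fieldD)
lemma X_mult: "X \<in> \<X> \<Longrightarrow> f \<in> \<F> \<Longrightarrow> g \<in> \<F> \<Longrightarrow> X (f * g) = X f * g + f * X g" by (rule vector_fieldD)
lemma X_out: "X \<in> \<X> \<Longrightarrow> f \<notin> \<F> \<Longrightarrow> X f = 0" by (rule vector_fieldD)
lemma X_minus: "X \<in> \<X> \<Longrightarrow> f \<in> \<F> \<Longrightarrow> X (- f) = - X f"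
proof -
  assume a: "X \<in> \<X>" "f \<in> \<F>"
  have "- g = (\<lambda>_. - 1) * g" for g :: "'m \<Rightarrow> real" by (simp add: fun_eq_iff)
  then show ?thesis using X_scale[OF a, of "-1"] by metis
qed
lemma X_diff: "X \<in> \<X> \<Longrightarrow> f \<in> \<F> \<Longrightarrow> g \<in> \<F> \<Longrightarrow> X (f - g) = X f - X g"
  using X_add[of X f "- g"] X_minus[of X g] F_minus[of g] by (metis diff_conv_add_uminus)
lemma X_0 [simp]: "X \<in> \<X> \<Longrightarrow> X 0 = 0"
  using X_diff[of X 0 0] by simp
lemma X_const [simp]: "X \<in> \<X> \<Longrightarrow> X (\<lambda>_. c) = 0"
proof -
  assume a: "X \<in> \<X>"
  have "X (1 * 1) = X 1 * 1 + 1 * X 1" by (rule X_mult[OF a]) auto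
  then have "X 1 = 0" by (simp add: fun_eq_iff)
  then have "X ((\<lambda>_. c) * 1) = 0" using X_scale[OF a F_1, of c] by (simp add: fun_eq_iff)
  then show ?thesis by simp
qed
lemma vector_fieldI:
  assumes "\<And>f. f \<in> \<F> \<Longrightarrow> X f \<in> \<F>" "\<And>f g. f \<in> \<F> \<Longrightarrow> g \<in> \<F> \<Longrightarrow> X (f + g) = X f + X g"
    "\<And>c f. f \<in> \<F> \<Longrightarrow> X ((\<lambda>_. c) * f) = (\<lambda>_. c) * X f"
    "\<And>f g. f \<in> \<F> \<Longrightarrow> g \<in> \<F> \<Longrightarrow> X (f * g) = X f * g + f * X g"
    "\<And>f. f \<notin> \<F> \<Longrightarrow> X f = 0"
  shows "X \<in> \<X>"
  unfolding vector_fields_def mem_Collect_eq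
  by (intro conjI ballI allI impI; rule assms; assumption)

lemma vector_field_eqI:
  "X \<in> \<X> \<Longrightarrow> Y \<in> \<X> \<Longrightarrow> (\<And>f. f \<in> \<F> \<Longrightarrow> X f = Y f) \<Longrightarrow> X = Y"
  by (rule ext) (metis X_out)

lemma VF_add [simp, intro]: "X \<in> \<X> \<Longrightarrow> Y \<in> \<X> \<Longrightarrow> X + Y \<in> \<X>"
  by (rule vector_fieldI) (simp_all add: X_add X_scale X_mult X_out, simp_all add: fun_eq_iff algebra_simps)
lemma VF_fmul [simp, intro]: "f \<in> \<F> \<Longrightarrow> X \<in> \<X> \<Longrightarrow> f \<cdot> X \<in> \<X>"
  by (rule vector_fieldI) (simp_all add: fmul_def X_add X_scale X_mult X_out, simp_all add: fun_eq_iff algebra_simps)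
lemma VF_0 [simp, intro]: "0 \<in> \<X>"
  by (rule vector_fieldI) (auto simp: fun_eq_iff)
lemma VF_minus [simp, intro]: "X \<in> \<X> \<Longrightarrow> - X \<in> \<X>"
  by (rule vector_fieldI) (simp_all add: X_add X_scale X_mult X_out, simp_all add: fun_eq_iff algebra_simps)
lemma VF_diff [simp, intro]: "X \<in> \<X> \<Longrightarrow> Y \<in> \<X> \<Longrightarrow> X - Y \<in> \<X>"
  by (rule vector_fieldI) (simp_all add: X_add X_scale X_mult X_out, simp_all add: fun_eq_iff algebra_simps)
lemma lie_bracket_apply: "lie_bracket X Y f = X (Y f) - Y (X f)" by (simp add: lie_bracket_def)

lemma VF_lie [simp, intro]: "X \<in> \<X> \<Longrightarrow> Y \<in> \<X> \<Longrightarrow> lie_bracket X Y \<in> \<X>"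
proof -
  assume X: "X \<in> \<X>" and Y: "Y \<in> \<X>"
  show ?thesis
  proof (rule vector_fieldI)
    fix f assume f: "f \<in> \<F>"
    then show "lie_bracket X Y f \<in> \<F>" using X Y by (simp add: lie_bracket_def)
    show "lie_bracket X Y ((\<lambda>_. c) * f) = (\<lambda>_. c) * lie_bracket X Y f" for c
      using X Y f by (simp only: lie_bracket_apply X_scale[OF Y f] X_scale[OF X f] X_scale[OF X X_F[OF Y f]]
          X_scale[OF Y X_F[OF X f]] right_diff_distrib)
    fix g assume g: "g \<in> \<F>"
    show "lie_bracket X Y (f + g) = lie_bracket X Y f + lie_bracket X Y g"
      using X Y f g by (simp only: lie_bracket_apply X_add[OF Y f g] X_add[OF X f g] X_add[OF X X_F[OF Y f] X_F[OF Y g]]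
          X_add[OF Y X_F[OF X f] X_F[OF X g]]) (simp add: algebra_simps)
    show "lie_bracket X Y (f * g) = lie_bracket X Y f * g + f * lie_bracket X Y g"
      proof -
      have "U (V (f * g)) = U (V f) * g + V f * U g + (U f * V g + f * U (V g))"
        if "U \<in> \<X>" "V \<in> \<X>" for U V
        using that f g X_add[of U "V f * g" "f * V g"] X_mult[of U "V f" g] X_mult[of U f "V g"]
        by (metis F_mult X_F X_mult)
      from this[OF X Y] this[OF Y X] show ?thesis
        by (simp only: lie_bracket_apply) (simp add: algebra_simps)
    qed
  next
    fix f assume "f \<notin> \<F>"
    then show "lie_bracket X Y f = 0" using X Y X_out[OF X] X_out[OF Y] by (simp add: lie_bracket_def)
  qed
qed
lemma VF_sum [simp, intro]: "(\<And>i. i \<in> I \<Longrightarrow> X i \<in> \<X>) \<Longrightarrow> (\<Sum>i\<in>I. X i) \<in> \<X>"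
proof (induction I rule: infinite_finite_induct)
  case (insert x I)
  then show ?case unfolding sum.insert[OF insert.hyps] by (blast intro: VF_add)
qed (simp_all only: sum.infinite sum.empty VF_0 not_False_eq_True)

lemma lie_bracket_self [simp]: "lie_bracket X X = 0" by (simp add: lie_bracket_def fun_eq_iff)
lemma lie_bracket_swap: "lie_bracket X Y = - lie_bracket Y X" by (simp add: lie_bracket_def fun_eq_iff)
lemma lie_jacobi:
  "X \<in> \<X> \<Longrightarrow> Y \<in> \<X> \<Longrightarrow> Z \<in> \<X> \<Longrightarrow>
    lie_bracket (lie_bracket X Y) Z = lie_bracket X (lie_bracket Y Z) - lie_bracket Y (lie_bracket X Z)"
proof -
  assume X: "X \<in> \<X>" and Y: "Y \<in> \<X>" and Z: "Z \<in> \<X>"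
  show ?thesis
  proof (rule vector_field_eqI)
    fix f assume f: "f \<in> \<F>"
    show "lie_bracket (lie_bracket X Y) Z f = (lie_bracket X (lie_bracket Y Z) - lie_bracket Y (lie_bracket X Z)) f"
      using X Y Z f by (simp add: lie_bracket_apply X_diff fun_eq_iff)
  qed (use X Y Z in auto)
qed

lemma Om_smooth [simp, intro]: "\<omega> \<in> \<Omega> k \<Longrightarrow> \<omega> Xs \<in> \<F>"
  unfolding forms_def by (cases "length Xs \<noteq> k \<or> \<not> set Xs \<subseteq> \<X>") auto

lemma Om_out: "\<omega> \<in> \<Omega> k \<Longrightarrow> \<not> set Xs \<subseteq> \<X> \<Longrightarrow> \<omega> Xs = 0"
  unfolding forms_def by auto

lemma Om_length: "\<omega> \<in> \<Omega> k \<Longrightarrow> length Xs \<noteq> k \<Longrightarrow> \<omega> Xs = 0"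
  unfolding forms_def by auto

lemma Om_homog: "\<omega> \<in> \<Omega> k \<Longrightarrow> homog k \<omega>"
  unfolding homog_def using Om_length by blast

lemma Om_par: "\<omega> \<in> \<Omega> k \<Longrightarrow> par \<omega> = sc ((- 1) ^ k) \<omega>"
  by (rule homog_par[OF Om_homog])

lemma Om_slot_add:
  assumes "\<omega> \<in> \<Omega> k" "length Xs = k" "set Xs \<subseteq> \<X>" "i < k" "X \<in> \<X>" "Y \<in> \<X>"
  shows "\<omega> (Xs[i := X + Y]) = \<omega> (Xs[i := X]) + \<omega> (Xs[i := Y])"
  using assms unfolding forms_def by blast

lemma Om_slot_fmul:
  assumes "\<omega> \<in> \<Omega> k" "length Xs = k" "set Xs \<subseteq> \<X>" "i < k" "f \<in> \<F>" "X \<in> \<X>"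
  shows "\<omega> (Xs[i := f \<cdot> X]) = f * \<omega> (Xs[i := X])"
  using assms unfolding forms_def by blast

lemma Om_alternating:
  assumes "\<omega> \<in> \<Omega> k" "i < length Xs" "j < length Xs" "i \<noteq> j" "Xs ! i = Xs ! j"
  shows "\<omega> Xs = 0"
proof (cases "length Xs = k \<and> set Xs \<subseteq> \<X>")
  case True
  then have "\<forall>i<k. \<forall>j<k. i \<noteq> j \<and> Xs ! i = Xs ! j \<longrightarrow> \<omega> Xs = 0"
    using assms(1) unfolding forms_def mem_Collect_eq by presburger
  then show ?thesis using assms(2-5) True by metis
next
  case False
  then show ?thesis using Om_out[OF assms(1)] Om_length[OF assms(1)] by metis
qed

lemma OmI:
  assumes "\<And>Xs. length Xs \<noteq> k \<or> \<not> set Xs \<subseteq> \<X> \<Longrightarrow> \<omega> Xs = 0"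
    "\<And>Xs. length Xs = k \<Longrightarrow> set Xs \<subseteq> \<X> \<Longrightarrow> \<omega> Xs \<in> \<F>"
    "\<And>Xs i X Y. length Xs = k \<Longrightarrow> set Xs \<subseteq> \<X> \<Longrightarrow> i < k \<Longrightarrow> X \<in> \<X> \<Longrightarrow> Y \<in> \<X> \<Longrightarrow>
      \<omega> (Xs[i := X + Y]) = \<omega> (Xs[i := X]) + \<omega> (Xs[i := Y])"
    "\<And>Xs i f X. length Xs = k \<Longrightarrow> set Xs \<subseteq> \<X> \<Longrightarrow> i < k \<Longrightarrow> f \<in> \<F> \<Longrightarrow> X \<in> \<X> \<Longrightarrow>
      \<omega> (Xs[i := f \<cdot> X]) = f * \<omega> (Xs[i := X])"
    "\<And>Xs i j. length Xs = k \<Longrightarrow> set Xs \<subseteq> \<X> \<Longrightarrow> i < k \<Longrightarrow> j < k \<Longrightarrow> i \<noteq> j \<Longrightarrow> Xs ! i = Xs ! j \<Longrightarrow> \<omega> Xs = 0"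
  shows "\<omega> \<in> \<Omega> k"
  unfolding forms_def mem_Collect_eq
  by (intro conjI ballI allI impI; (elim conjE)?; rule assms; assumption)

lemma Om_add [simp, intro]:
  assumes s: "\<sigma> \<in> \<Omega> k" and t: "\<tau> \<in> \<Omega> k" shows "\<sigma> + \<tau> \<in> \<Omega> k"
proof (rule OmI)
  fix Xs assume "length Xs \<noteq> k \<or> \<not> set Xs \<subseteq> \<X>"
  then have "\<sigma> Xs = 0" "\<tau> Xs = 0" using Om_out[OF s] Om_out[OF t] Om_length[OF s] Om_length[OF t] by blast+
  then show "(\<sigma> + \<tau>) Xs = 0" by simp
next
  fix Xs show "(\<sigma> + \<tau>) Xs \<in> \<F>" using Om_smooth[OF s] Om_smooth[OF t] by simp
next
  fix Xs :: "'m vfield list" and i X Y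
  assume a: "length Xs = k" "set Xs \<subseteq> \<X>" "i < k" "X \<in> \<X>" "Y \<in> \<X>"
  show "(\<sigma> + \<tau>) (Xs[i := X + Y]) = (\<sigma> + \<tau>) (Xs[i := X]) + (\<sigma> + \<tau>) (Xs[i := Y])"
    by (simp add: Om_slot_add[OF s a] Om_slot_add[OF t a] algebra_simps)
next
  fix Xs :: "'m vfield list" and i f X
  assume a: "length Xs = k" "set Xs \<subseteq> \<X>" "i < k" "f \<in> \<F>" "X \<in> \<X>"
  show "(\<sigma> + \<tau>) (Xs[i := f \<cdot> X]) = f * (\<sigma> + \<tau>) (Xs[i := X])"
    by (simp add: Om_slot_fmul[OF s a] Om_slot_fmul[OF t a] algebra_simps)
next
  fix Xs :: "'m vfield list" and i j
  assume a: "length Xs = k" "i < k" "j < k" "i \<noteq> j" "Xs ! i = Xs ! j"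
  then have "\<sigma> Xs = 0" "\<tau> Xs = 0" using Om_alternating[OF s] Om_alternating[OF t] by blast+
  then show "(\<sigma> + \<tau>) Xs = 0" by simp
qed

lemma Om_fmul [simp, intro]:
  assumes f: "f \<in> \<F>" and s: "\<sigma> \<in> \<Omega> k" shows "f \<cdot> \<sigma> \<in> \<Omega> k"
proof (rule OmI)
  fix Xs assume "length Xs \<noteq> k \<or> \<not> set Xs \<subseteq> \<X>"
  then have "\<sigma> Xs = 0" using Om_out[OF s] Om_length[OF s] by blast
  then show "(f \<cdot> \<sigma>) Xs = 0" by (simp add: fun_eq_iff)
next
  fix Xs show "(f \<cdot> \<sigma>) Xs \<in> \<F>" using Om_smooth[OF s] f by (simp add: fmul_def)
next
  fix Xs :: "'m vfield list" and i X Y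
  assume a: "length Xs = k" "set Xs \<subseteq> \<X>" "i < k" "X \<in> \<X>" "Y \<in> \<X>"
  show "(f \<cdot> \<sigma>) (Xs[i := X + Y]) = (f \<cdot> \<sigma>) (Xs[i := X]) + (f \<cdot> \<sigma>) (Xs[i := Y])"
    by (simp add: Om_slot_add[OF s a] fmul_def algebra_simps)
next
  fix Xs :: "'m vfield list" and i g X
  assume a: "length Xs = k" "set Xs \<subseteq> \<X>" "i < k" "g \<in> \<F>" "X \<in> \<X>"
  show "(f \<cdot> \<sigma>) (Xs[i := g \<cdot> X]) = g * (f \<cdot> \<sigma>) (Xs[i := X])"
    unfolding fmul_def[of f] by (simp add: Om_slot_fmul[OF s a] algebra_simps)
next
  fix Xs :: "'m vfield list" and i j
  assume a: "length Xs = k" "i < k" "j < k" "i \<noteq> j" "Xs ! i = Xs ! j"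
  then have "\<sigma> Xs = 0" using Om_alternating[OF s] by blast
  then show "(f \<cdot> \<sigma>) Xs = 0" by (simp add: fun_eq_iff)
qed

lemma Om_0 [simp, intro]: "0 \<in> \<Omega> k"
  by (rule OmI) (auto simp: fun_eq_iff)

lemma Om_sc [simp, intro]: "\<sigma> \<in> \<Omega> k \<Longrightarrow> sc c \<sigma> \<in> \<Omega> k"
  by (simp add: sc_def)

lemma Om_minus [simp, intro]: "\<sigma> \<in> \<Omega> k \<Longrightarrow> - \<sigma> \<in> \<Omega> k"
proof -
  assume "\<sigma> \<in> \<Omega> k"
  moreover have "- \<sigma> = sc (-1) \<sigma>" by (simp add: fun_eq_iff)
  ultimately show ?thesis by simp
qed

lemma Om_diff [simp, intro]: "\<sigma> \<in> \<Omega> k \<Longrightarrow> \<tau> \<in> \<Omega> k \<Longrightarrow> \<sigma> - \<tau> \<in> \<Omega> k"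
  using Om_add[of \<sigma> k "- \<tau>"] Om_minus[of \<tau> k] by (metis diff_conv_add_uminus)

lemma Om_sum [simp, intro]: "(\<And>i. i \<in> I \<Longrightarrow> \<sigma> i \<in> \<Omega> k) \<Longrightarrow> (\<Sum>i\<in>I. \<sigma> i) \<in> \<Omega> k"
proof (induction I rule: infinite_finite_induct)
  case (insert x I)
  then show ?case unfolding sum.insert[OF insert.hyps] by (blast intro: Om_add)
qed (simp_all only: sum.infinite sum.empty Om_0 not_False_eq_True)

lemma zero_form_Om [simp, intro]: "f \<in> \<F> \<Longrightarrow> zero_form f \<in> \<Omega> 0"
  by (rule OmI) (auto simp: zero_form_def)

lemma Om_0_eq: "\<omega> \<in> \<Omega> 0 \<Longrightarrow> \<omega> = zero_form (\<omega> [])"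
  by (auto simp: zero_form_def fun_eq_iff Om_length)

lemma Om_0E: "\<omega> \<in> \<Omega> 0 \<Longrightarrow> (\<And>f. f \<in> \<F> \<Longrightarrow> \<omega> = zero_form f \<Longrightarrow> P) \<Longrightarrow> P"
  using Om_0_eq Om_smooth by blast

lemma ins_Om_0 [simp]: "\<omega> \<in> \<Omega> 0 \<Longrightarrow> ins X \<omega> = 0"
  by (rule homog_ins_0[OF Om_homog])

lemma ins_out: "\<omega> \<in> \<Omega> k \<Longrightarrow> X \<notin> \<X> \<Longrightarrow> ins X \<omega> = 0"
  by (auto simp: ins_def fun_eq_iff Om_out)

lemma ins_Om_Suc: assumes \<omega>: "\<omega> \<in> \<Omega> (Suc k)" and X: "X \<in> \<X>" shows "ins X \<omega> \<in> \<Omega> k"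
proof (rule OmI)
  fix Xs assume "length Xs \<noteq> k \<or> \<not> set Xs \<subseteq> \<X>"
  then have "\<not> set (X # Xs) \<subseteq> \<X> \<or> length (X # Xs) \<noteq> Suc k" by auto
  then show "ins X \<omega> Xs = 0" using Om_out[OF \<omega>] Om_length[OF \<omega>] unfolding ins_def by blast
next
  fix Xs show "ins X \<omega> Xs \<in> \<F>" using \<omega> by (auto simp: ins_def)
next
  fix Xs :: "'m vfield list" and i Y Z
  assume "length Xs = k" "set Xs \<subseteq> \<X>" "i < k" "Y \<in> \<X>" "Z \<in> \<X>"
  then show "ins X \<omega> (Xs[i := Y + Z]) = ins X \<omega> (Xs[i := Y]) + ins X \<omega> (Xs[i := Z])"
    using Om_slot_add[OF \<omega>, of "X # Xs" "Suc i" Y Z] X by (simp add: ins_def)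
next
  fix Xs :: "'m vfield list" and i f Y
  assume "length Xs = k" "set Xs \<subseteq> \<X>" "i < k" "f \<in> \<F>" "Y \<in> \<X>"
  then show "ins X \<omega> (Xs[i := f \<cdot> Y]) = f * ins X \<omega> (Xs[i := Y])"
    using Om_slot_fmul[OF \<omega>, of "X # Xs" "Suc i" f Y] X by (simp add: ins_def)
next
  fix Xs :: "'m vfield list" and i j
  assume "length Xs = k" "set Xs \<subseteq> \<X>" "i < k" "j < k" "i \<noteq> j" "Xs ! i = Xs ! j"
  then show "ins X \<omega> Xs = 0"
    using Om_alternating[OF \<omega>, of "Suc i" "X # Xs" "Suc j"] by (simp add: ins_def)
qed

lemma ins_Om [simp, intro]: "\<omega> \<in> \<Omega> k \<Longrightarrow> X \<in> \<X> \<Longrightarrow> ins X \<omega> \<in> \<Omega> (k - 1)"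
  by (cases k) (auto intro: ins_Om_Suc)

lemma ins_vf_add: assumes \<omega>: "\<omega> \<in> \<Omega> k" and "X \<in> \<X>" "Y \<in> \<X>" shows "ins (X + Y) \<omega> = ins X \<omega> + ins Y \<omega>"
proof
  fix Xs show "ins (X + Y) \<omega> Xs = (ins X \<omega> + ins Y \<omega>) Xs"
  proof (cases "set Xs \<subseteq> \<X> \<and> k = Suc (length Xs)")
    case True
    then show ?thesis using Om_slot_add[OF \<omega>, of "X # Xs" 0 X Y] assms by (simp add: ins_def)
  next
    case False
    then have "\<not> set (Z # Xs) \<subseteq> \<X> \<or> length (Z # Xs) \<noteq> k" for Z by auto
    then have "\<omega> (Z # Xs) = 0" for Z using Om_out[OF \<omega>] Om_length[OF \<omega>] by blast
    then show ?thesis by (simp add: ins_def)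
  qed
qed

lemma ins_vf_fmul: assumes \<omega>: "\<omega> \<in> \<Omega> k" and "f \<in> \<F>" "X \<in> \<X>" shows "ins (f \<cdot> X) \<omega> = f \<cdot> ins X \<omega>"
proof
  fix Xs show "ins (f \<cdot> X) \<omega> Xs = (f \<cdot> ins X \<omega>) Xs"
  proof (cases "set Xs \<subseteq> \<X> \<and> k = Suc (length Xs)")
    case True
    then show ?thesis using Om_slot_fmul[OF \<omega>, of "X # Xs" 0 f X] assms by (simp add: ins_def fmul_def)
  next
    case False
    then have "\<not> set (Z # Xs) \<subseteq> \<X> \<or> length (Z # Xs) \<noteq> k" for Z by auto
    then have "\<omega> (Z # Xs) = 0" for Z using Om_out[OF \<omega>] Om_length[OF \<omega>] by blast
    then show ?thesis by (simp add: ins_def fmul_def)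
  qed
qed

lemma ins_vf_minus: assumes "\<omega> \<in> \<Omega> k" "X \<in> \<X>" shows "ins (- X) \<omega> = - ins X \<omega>"
proof -
  have "- X = (\<lambda>_. -1) \<cdot> X" by (simp add: fun_eq_iff)
  then have "ins (- X) \<omega> = (\<lambda>_. -1) \<cdot> ins X \<omega>" using ins_vf_fmul[OF assms(1) F_const assms(2)] by metis
  then show ?thesis by (simp add: fun_eq_iff)
qed

lemma ins_vf_diff: "\<omega> \<in> \<Omega> k \<Longrightarrow> X \<in> \<X> \<Longrightarrow> Y \<in> \<X> \<Longrightarrow> ins (X - Y) \<omega> = ins X \<omega> - ins Y \<omega>"
  using ins_vf_add[of \<omega> k X "- Y"] ins_vf_minus[of \<omega> k Y] VF_minus[of Y] by (metis diff_conv_add_uminus)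

lemma ins_vf_0 [simp]: "\<omega> \<in> \<Omega> k \<Longrightarrow> ins 0 \<omega> = 0"
  using ins_vf_diff[of \<omega> k 0 0] by simp

lemma ins_vf_sum: assumes "\<omega> \<in> \<Omega> k" shows "(\<And>i. i \<in> I \<Longrightarrow> X i \<in> \<X>) \<Longrightarrow> ins (\<Sum>i\<in>I. X i) \<omega> = (\<Sum>i\<in>I. ins (X i) \<omega>)"
proof (induction I rule: infinite_finite_induct)
  case (insert x I)
  have "ins (X x + sum X I) \<omega> = ins (X x) \<omega> + ins (sum X I) \<omega>"
    using insert.prems by (intro ins_vf_add[OF assms] VF_sum) auto
  moreover have "ins (sum X I) \<omega> = (\<Sum>i\<in>I. ins (X i) \<omega>)" by (rule insert.IH) (use insert.prems in auto)
  ultimately show ?case by (simp only: sum.insert[OF insert.hyps])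
qed (simp_all only: sum.infinite sum.empty ins_vf_0[OF assms] not_False_eq_True)

lemma ins_ins_self: assumes "\<omega> \<in> \<Omega> k" shows "ins X (ins X \<omega>) = 0"
proof
  fix Xs show "ins X (ins X \<omega>) Xs = 0 Xs"
    using Om_alternating[OF assms, of 0 "X # X # Xs" 1] by (simp add: ins_def)
qed

lemma ins_ins: assumes \<omega>: "\<omega> \<in> \<Omega> k" and XY: "X \<in> \<X>" "Y \<in> \<X>" shows "ins X (ins Y \<omega>) = - ins Y (ins X \<omega>)"
proof -
  have "ins (X + Y) (ins (X + Y) \<omega>) = ins X (ins Y \<omega>) + ins Y (ins X \<omega>)"
    using XY \<omega> ins_vf_add[OF \<omega> XY] ins_vf_add[OF ins_Om[OF \<omega> XY(1)] XY] ins_vf_add[OF ins_Om[OF \<omega> XY(2)] XY]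
    by (simp add: ins_ins_self[OF \<omega>])
  then show ?thesis using ins_ins_self[OF \<omega>, of "X + Y"] by (simp add: eq_neg_iff_add_eq_0)
qed

text \<open>
  An alternating multilinear map is antisymmetric; forms are only required to vanish on
  repeated arguments.
\<close>

lemma Om_swap:
  assumes \<omega>: "\<omega> \<in> \<Omega> k" and Xs: "set Xs \<subseteq> \<X>" and ij: "i < length Xs" "j < length Xs" "i \<noteq> j"
  shows "\<omega> (Xs[i := Xs ! j, j := Xs ! i]) = - \<omega> Xs"
proof (cases "length Xs = k")
  case False
  then show ?thesis using Om_length[OF \<omega>] by (simp add: fun_eq_iff)
next
  case True
  let ?Z = "\<lambda>a b. \<omega> (Xs[i := a, j := b])"
  have sub: "set (Xs[l := a]) \<subseteq> \<X>" if "a \<in> \<X>" for a l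
    using Xs that set_update_subset_insert[of Xs l a] by blast
  have add1: "?Z (a + b) c = ?Z a c + ?Z b c" if "a \<in> \<X>" "b \<in> \<X>" "c \<in> \<X>" for a b c
    using Om_slot_add[OF \<omega>, of "Xs[j := c]" i a b] sub that True ij by (simp add: list_update_swap)
  have add2: "?Z a (b + c) = ?Z a b + ?Z a c" if "a \<in> \<X>" "b \<in> \<X>" "c \<in> \<X>" for a b c
    using Om_slot_add[OF \<omega>, of "Xs[i := a]" j b c] sub that True ij by simp
  have alt: "?Z a a = 0" for a
    using Om_alternating[OF \<omega>, of i "Xs[i := a, j := a]" j] ij by simp
  have mem: "Xs ! i \<in> \<X>" "Xs ! j \<in> \<X>" using Xs ij by (auto dest: nth_mem)
  let ?a = "Xs ! j" and ?b = "Xs ! i"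
  have "0 = ?Z (?a + ?b) (?a + ?b)" by (simp only: alt)
  also have "\<dots> = ?Z ?a (?a + ?b) + ?Z ?b (?a + ?b)" by (rule add1) (use mem in auto)
  also have "?Z ?a (?a + ?b) = ?Z ?a ?a + ?Z ?a ?b" by (rule add2) (use mem in auto)
  also have "?Z ?b (?a + ?b) = ?Z ?b ?a + ?Z ?b ?b" by (rule add2) (use mem in auto)
  finally have "?Z ?a ?b + ?Z ?b ?a = 0" by (simp only: alt add_0_left add_0_right)
  moreover have "Xs[i := Xs ! i, j := Xs ! j] = Xs" by simp
  ultimately have "?Z ?a ?b + \<omega> Xs = 0" by (simp only:)
  then show ?thesis by (simp only: eq_neg_iff_add_eq_0)
qed

text \<open>
  Linearity and alternation in the later arguments are those of the contractions \<open>ins X \<omega>\<close>.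
  A second occurrence of the first argument is moved to the second place by their
  antisymmetry.
\<close>

lemma Om_SucI:
  assumes "\<omega> [] = 0" "\<And>X. X \<notin> \<X> \<Longrightarrow> ins X \<omega> = 0" and Om: "\<And>X. X \<in> \<X> \<Longrightarrow> ins X \<omega> \<in> \<Omega> k"
    and self: "\<And>X. X \<in> \<X> \<Longrightarrow> ins X (ins X \<omega>) = 0"
    and add: "\<And>X Y. X \<in> \<X> \<Longrightarrow> Y \<in> \<X> \<Longrightarrow> ins (X + Y) \<omega> = ins X \<omega> + ins Y \<omega>"
    and fmul: "\<And>f X. f \<in> \<F> \<Longrightarrow> X \<in> \<X> \<Longrightarrow> ins (f \<cdot> X) \<omega> = f \<cdot> ins X \<omega>"
  shows "\<omega> \<in> \<Omega> (Suc k)"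
proof (rule OmI)
  fix Xs assume a: "length Xs \<noteq> Suc k \<or> \<not> set Xs \<subseteq> \<X>"
  show "\<omega> Xs = 0"
  proof (cases Xs)
    case Nil then show ?thesis using assms by simp
  next
    case (Cons X Ys)
    then have "\<omega> Xs = ins X \<omega> Ys" by (simp add: ins_def)
    also have "\<dots> = 0"
      using a Cons assms(2) Om_out[OF Om] Om_length[OF Om] by (cases "X \<in> \<X>") auto
    finally show ?thesis .
  qed
next
  fix Xs assume "length Xs = Suc k" "set Xs \<subseteq> \<X>"
  then show "\<omega> Xs \<in> \<F>" using Om_smooth[OF Om] by (cases Xs) (auto simp: ins_def)
next
  fix Xs :: "'m vfield list" and i Y Z
  assume a: "length Xs = Suc k" "set Xs \<subseteq> \<X>" "i < Suc k" "Y \<in> \<X>" "Z \<in> \<X>"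
  obtain X Ys where Xs: "Xs = X # Ys" using a by (cases Xs) auto
  show "\<omega> (Xs[i := Y + Z]) = \<omega> (Xs[i := Y]) + \<omega> (Xs[i := Z])"
  proof (cases i)
    case 0 then show ?thesis using fun_cong[OF add[OF a(4,5)], of Ys] Xs by (simp add: ins_def)
  next
    case (Suc i') then show ?thesis using Om_slot_add[OF Om, of X Ys i' Y Z] Xs a by (simp add: ins_def)
  qed
next
  fix Xs :: "'m vfield list" and i f Y
  assume a: "length Xs = Suc k" "set Xs \<subseteq> \<X>" "i < Suc k" "f \<in> \<F>" "Y \<in> \<X>"
  obtain X Ys where Xs: "Xs = X # Ys" using a by (cases Xs) auto
  show "\<omega> (Xs[i := f \<cdot> Y]) = f * \<omega> (Xs[i := Y])"
  proof (cases i)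
    case 0 then show ?thesis using fun_cong[OF fmul[OF a(4,5)], of Ys] Xs by (simp add: ins_def fmul_def)
  next
    case (Suc i') then show ?thesis using Om_slot_fmul[OF Om, of X Ys i' f Y] Xs a by (simp add: ins_def)
  qed
next
  fix Xs :: "'m vfield list" and i j
  assume a: "length Xs = Suc k" "set Xs \<subseteq> \<X>" "i < Suc k" "j < Suc k" "i \<noteq> j" "Xs ! i = Xs ! j"
  obtain X Ys where Xs: "Xs = X # Ys" using a by (cases Xs) auto
  have X: "X \<in> \<X>" using a Xs by simp
  have head: "\<omega> (X # Ys) = 0" if j: "j < length Ys" "Ys ! j = X" for j
  proof -
    obtain Y Zs where Ys: "Ys = Y # Zs" using j by (cases Ys) auto
    show ?thesis
    proof (cases "j = 0")
      case True
      then show ?thesis using fun_cong[OF self[OF X], of Zs] j Ys by (simp add: ins_def)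
    next
      case False
      have "ins X \<omega> (Ys[0 := Ys ! j, j := Ys ! 0]) = - ins X \<omega> Ys"
        using Om_swap[OF Om[OF X], of Ys 0 j] a Xs j False Ys by auto
      moreover have "Ys[0 := Ys ! j, j := Ys ! 0] = X # Zs[j - 1 := Y]"
        using Ys j False by (cases j) auto
      moreover have "ins X (ins X \<omega>) (Zs[j - 1 := Y]) = 0" using self[OF X] by simp
      ultimately show ?thesis by (simp add: ins_def)
    qed
  qed
  show "\<omega> Xs = 0"
  proof (cases "i = 0 \<or> j = 0")
    case True
    then show ?thesis using head[of "i + j - 1"] a Xs by (auto simp: nth_Cons')
  next
    case False
    then obtain i' j' where "i = Suc i'" "j = Suc j'" by (metis not0_implies_Suc)
    then show ?thesis using Om_alternating[OF Om[OF X], of i' Ys j'] a Xs by (simp add: ins_def)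
  qed
qed

lemma form_eqI:
  assumes "\<sigma> \<in> \<Omega> (Suc k)" "\<tau> \<in> \<Omega> (Suc k)" "\<And>X. X \<in> \<X> \<Longrightarrow> ins X \<sigma> = ins X \<tau>"
  shows "\<sigma> = \<tau>"
proof
  fix Xs show "\<sigma> Xs = \<tau> Xs"
  proof (cases Xs)
    case Nil then show ?thesis using assms Om_length by simp
  next
    case (Cons X Ys)
    have "ins X \<sigma> = ins X \<tau>" by (cases "X \<in> \<X>") (use assms ins_out in metis)+
    then show ?thesis using Cons by (metis ins_apply)
  qed
qed

lemma ins_wedge_Om: "\<sigma> \<in> \<Omega> k \<Longrightarrow> ins X (\<sigma> \<and>\<^sub>\<Omega> \<rho>) = ins X \<sigma> \<and>\<^sub>\<Omega> \<rho> + sc ((- 1) ^ k) (\<sigma> \<and>\<^sub>\<Omega> ins X \<rho>)"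
  by (simp add: ins_wedge Om_par)

lemma wedge_Om [simp, intro]:
  assumes "\<sigma> \<in> \<Omega> k" "\<rho> \<in> \<Omega> l" shows "\<sigma> \<and>\<^sub>\<Omega> \<rho> \<in> \<Omega> (k + l)"
proof -
  have "\<sigma> \<and>\<^sub>\<Omega> \<rho> \<in> \<Omega> n" if "k + l = n" for n
    using that assms
  proof (induction n arbitrary: k l \<sigma> \<rho>)
    case 0
    then obtain f where f: "f \<in> \<F>" "\<sigma> = zero_form f" by (auto elim: Om_0E)
    have "\<sigma> \<and>\<^sub>\<Omega> \<rho> = f \<cdot> \<rho>" using f by (simp only: zero_form_wedge)
    moreover have "f \<cdot> \<rho> \<in> \<Omega> l" by (rule Om_fmul[OF f(1) 0(3)])
    ultimately show ?case using 0(1) by (simp del: fmul_apply)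
  next
    case (Suc n)
    note \<sigma> = Suc.prems(2) and \<rho> = Suc.prems(3)
    have 1: "ins X \<sigma> \<and>\<^sub>\<Omega> \<rho> \<in> \<Omega> n" if "X \<in> \<X>" for X
    proof (cases k)
      case 0 then show ?thesis using \<sigma> by simp
    next
      case (Suc k') then show ?thesis using Suc.IH[of k' l] Suc.prems ins_Om_Suc that by auto
    qed
    have 2: "\<sigma> \<and>\<^sub>\<Omega> ins X \<rho> \<in> \<Omega> n" if "X \<in> \<X>" for X
    proof (cases l)
      case 0 then show ?thesis using \<rho> by simp
    next
      case (Suc l') then show ?thesis using Suc.IH[of k l'] Suc.prems ins_Om_Suc that by auto
    qed
    show ?case
    proof (rule Om_SucI)
      show "(\<sigma> \<and>\<^sub>\<Omega> \<rho>) [] = 0"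
        using Suc.prems Om_length[OF \<sigma>, of "[]"] Om_length[OF \<rho>, of "[]"] by (cases k) (auto simp: wedge_Nil)
      show "ins X (\<sigma> \<and>\<^sub>\<Omega> \<rho>) = 0" if "X \<notin> \<X>" for X
        using ins_out[OF \<sigma> that] ins_out[OF \<rho> that] by (simp add: ins_wedge)
      show "ins X (\<sigma> \<and>\<^sub>\<Omega> \<rho>) \<in> \<Omega> n" if "X \<in> \<X>" for X
        using 1 2 that by (simp add: ins_wedge_Om[OF \<sigma>])
      show "ins X (ins X (\<sigma> \<and>\<^sub>\<Omega> \<rho>)) = 0" if "X \<in> \<X>" for X
        using ins_ins_self[OF \<sigma>, of X] ins_ins_self[OF \<rho>, of X] by (simp add: ins_wedge ins_par)
      show "ins (X + Y) (\<sigma> \<and>\<^sub>\<Omega> \<rho>) = ins X (\<sigma> \<and>\<^sub>\<Omega> \<rho>) + ins Y (\<sigma> \<and>\<^sub>\<Omega> \<rho>)" if "X \<in> \<X>" "Y \<in> \<X>" for X Y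
        by (simp add: ins_wedge ins_vf_add[OF \<sigma> that] ins_vf_add[OF \<rho> that])
      show "ins (f \<cdot> X) (\<sigma> \<and>\<^sub>\<Omega> \<rho>) = f \<cdot> ins X (\<sigma> \<and>\<^sub>\<Omega> \<rho>)" if "f \<in> \<F>" "X \<in> \<X>" for f X
        by (simp add: ins_wedge ins_vf_fmul[OF \<sigma> that] ins_vf_fmul[OF \<rho> that] fun_eq_iff algebra_simps)
    qed
  qed
  then show ?thesis by simp
qed

end

section \<open>The exterior derivative\<close>

text \<open>
  Reduces an equation between forms to one between real numbers.
\<close>

lemmas pointwise = fmul_apply sc_apply plus_fun_apply minus_apply uminus_apply zero_fun_apply times_fun_apply

context manifold
begin

text \<open>
  A derivation of the module of vector fields along the vector field \<open>V\<close>, such as \<open>[V, \<cdot>]\<close>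
  or a covariant derivative. It induces a derivation on forms; Lie derivatives and
  contravariant connections are the two instances.
\<close>

definition field_derivation :: "'m vfield \<Rightarrow> ('m vfield \<Rightarrow> 'm vfield) \<Rightarrow> bool" where
  "field_derivation V N \<longleftrightarrow> V \<in> \<X> \<and> (\<forall>X\<in>\<X>. N X \<in> \<X>) \<and> (\<forall>X\<in>\<X>. \<forall>Y\<in>\<X>. N (X + Y) = N X + N Y) \<and>
     (\<forall>f\<in>\<F>. \<forall>X\<in>\<X>. N (f \<cdot> X) = f \<cdot> N X + V f \<cdot> X)"

definition induced :: "'m vfield \<Rightarrow> ('m vfield \<Rightarrow> 'm vfield) \<Rightarrow> 'm form \<Rightarrow> 'm form" where
  "induced V N \<omega> = (\<lambda>Xs. if set Xs \<subseteq> \<X>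
     then V (\<omega> Xs) - (\<Sum>i<length Xs. \<omega> (Xs[i := N (Xs ! i)])) else 0)"

lemma induced_Nil [simp]: "induced V N \<omega> [] = V (\<omega> [])"
  by (simp add: induced_def)

lemma induced_Om_0: "V \<in> \<X> \<Longrightarrow> f \<in> \<F> \<Longrightarrow> induced V N (zero_form f) = zero_form (V f)"
  by (auto simp: induced_def zero_form_def fun_eq_iff intro!: sum.neutral)

context
  fixes V N assumes VN: "field_derivation V N"
begin

lemma V_X [simp]: "V \<in> \<X>" using VN by (simp add: field_derivation_def)
lemma N_X [simp]: "X \<in> \<X> \<Longrightarrow> N X \<in> \<X>" using VN by (simp add: field_derivation_def)
lemma N_add: "X \<in> \<X> \<Longrightarrow> Y \<in> \<X> \<Longrightarrow> N (X + Y) = N X + N Y" using VN by (simp add: field_derivation_def)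
lemma N_fmul: "f \<in> \<F> \<Longrightarrow> X \<in> \<X> \<Longrightarrow> N (f \<cdot> X) = f \<cdot> N X + V f \<cdot> X" using VN by (simp add: field_derivation_def)

lemma ins_induced:
  assumes \<omega>: "\<omega> \<in> \<Omega> k" and Y: "Y \<in> \<X>"
  shows "ins Y (induced V N \<omega>) = induced V N (ins Y \<omega>) - ins (N Y) \<omega>"
proof
  fix Xs show "ins Y (induced V N \<omega>) Xs = (induced V N (ins Y \<omega>) - ins (N Y) \<omega>) Xs"
  proof (cases "set Xs \<subseteq> \<X>")
    case True
    have "(\<Sum>i<length (Y # Xs). \<omega> ((Y # Xs)[i := N ((Y # Xs) ! i)])) =
      \<omega> (N Y # Xs) + (\<Sum>i<length Xs. \<omega> (Y # Xs[i := N (Xs ! i)]))"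
      by (simp add: sum.lessThan_Suc_shift del: sum.lessThan_Suc)
    then show ?thesis using True Y by (simp add: induced_def ins_def)
  next
    case False
    then show ?thesis using Y Om_out[OF \<omega>, of "N Y # Xs"] by (simp add: induced_def ins_def)
  qed
qed

lemma induced_add:
  assumes "\<And>Xs. \<sigma> Xs \<in> \<F>" "\<And>Xs. \<tau> Xs \<in> \<F>"
  shows "induced V N (\<sigma> + \<tau>) = induced V N \<sigma> + induced V N \<tau>"
  by (intro ext) (simp add: induced_def X_add assms sum.distrib)

lemma induced_sc:
  assumes "\<And>Xs. \<sigma> Xs \<in> \<F>" shows "induced V N (sc c \<sigma>) = sc c (induced V N \<sigma>)"
  by (intro ext) (simp add: induced_def sc_def fmul_def X_scale assms sum_fun_apply sum_distrib_left algebra_simps)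

lemma induced_0 [simp]: "induced V N 0 = 0"
  by (intro ext) (simp add: induced_def)

lemma induced_diff:
  assumes "\<And>Xs. \<sigma> Xs \<in> \<F>" "\<And>Xs. \<tau> Xs \<in> \<F>"
  shows "induced V N (\<sigma> - \<tau>) = induced V N \<sigma> - induced V N \<tau>"
  by (intro ext) (simp add: induced_def X_diff assms sum_subtractf)

lemma induced_fmul':
  assumes "\<And>Xs. \<sigma> Xs \<in> \<F>" "f \<in> \<F>" "\<And>Xs. \<not> set Xs \<subseteq> \<X> \<Longrightarrow> \<sigma> Xs = 0"
  shows "induced V N (f \<cdot> \<sigma>) = f \<cdot> induced V N \<sigma> + V f \<cdot> \<sigma>"
  by (intro ext) (simp add: induced_def fmul_def X_mult assms sum_fun_apply sum_distrib_left algebra_simps)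

lemma induced_fmul:
  "\<sigma> \<in> \<Omega> k \<Longrightarrow> f \<in> \<F> \<Longrightarrow> induced V N (f \<cdot> \<sigma>) = f \<cdot> induced V N \<sigma> + V f \<cdot> \<sigma>"
  by (rule induced_fmul') (auto simp: Om_out)

lemma induced_Om [simp, intro]: "\<omega> \<in> \<Omega> k \<Longrightarrow> induced V N \<omega> \<in> \<Omega> k"
proof (induction k arbitrary: \<omega>)
  case 0
  then show ?case by (auto elim!: Om_0E simp: induced_Om_0)
next
  case (Suc k)
  note \<omega> = Suc.prems
  show ?case
  proof (rule Om_SucI)
    have "\<omega> [] = 0" by (rule Om_length[OF \<omega>]) simp
    then show "induced V N \<omega> [] = 0" by (simp only: induced_Nil X_0[OF V_X])
    show "ins X (induced V N \<omega>) = 0" if "X \<notin> \<X>" for X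
      using that by (auto simp: ins_def induced_def fun_eq_iff)
    show "ins X (induced V N \<omega>) \<in> \<Omega> k" if "X \<in> \<X>" for X
      using Suc.IH ins_Om_Suc[OF \<omega>] that by (simp add: ins_induced[OF \<omega>])
    show "ins X (ins X (induced V N \<omega>)) = 0" if X: "X \<in> \<X>" for X
    proof -
      have "ins X (ins X (induced V N \<omega>)) = - (ins (N X) (ins X \<omega>) + ins X (ins (N X) \<omega>))"
        by (simp add: ins_induced[OF \<omega> X] ins_induced[OF ins_Om_Suc[OF \<omega> X] X] ins_ins_self[OF \<omega>])
      also have "\<dots> = 0" using ins_ins[OF \<omega> X N_X[OF X]] by simp
      finally show ?thesis .
    qed
    show "ins (X + Y) (induced V N \<omega>) = ins X (induced V N \<omega>) + ins Y (induced V N \<omega>)"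
      if XY: "X \<in> \<X>" "Y \<in> \<X>" for X Y
      using XY by (simp add: ins_induced[OF \<omega>] N_add ins_vf_add[OF \<omega>] induced_add
          Om_smooth[OF ins_Om_Suc[OF \<omega>]])
    show "ins (f \<cdot> X) (induced V N \<omega>) = f \<cdot> ins X (induced V N \<omega>)" if fX: "f \<in> \<F>" "X \<in> \<X>" for f X
    proof -
      have "ins (N (f \<cdot> X)) \<omega> = f \<cdot> ins (N X) \<omega> + V f \<cdot> ins X \<omega>"
        using fX by (simp add: N_fmul ins_vf_add[OF \<omega>] ins_vf_fmul[OF \<omega>])
      then show ?thesis
        using fX by (simp add: ins_induced[OF \<omega>] ins_vf_fmul[OF \<omega>] induced_fmul[OF ins_Om_Suc[OF \<omega>]]
            fun_eq_iff algebra_simps)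
    qed
  qed
qed

text \<open>
  By induction on the arguments, because contraction satisfies \<open>[i\<^sub>Y, T] = i(N Y)\<close> up to sign
  (\<open>ins_induced\<close>).
\<close>

lemma induced_wedge:
  assumes "\<sigma> \<in> \<Omega> k" "\<rho> \<in> \<Omega> l"
  shows "induced V N (\<sigma> \<and>\<^sub>\<Omega> \<rho>) = induced V N \<sigma> \<and>\<^sub>\<Omega> \<rho> + \<sigma> \<and>\<^sub>\<Omega> induced V N \<rho>"
proof -
  have "induced V N (\<sigma> \<and>\<^sub>\<Omega> \<rho>) Xs = (induced V N \<sigma> \<and>\<^sub>\<Omega> \<rho> + \<sigma> \<and>\<^sub>\<Omega> induced V N \<rho>) Xs" for Xs
    using assms
  proof (induction Xs arbitrary: k l \<sigma> \<rho>)
    case Nil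
    then show ?case by (simp add: wedge_Nil X_mult algebra_simps Om_smooth)
  next
    case (Cons Y Ys)
    note \<sigma> = Cons.prems(1) and \<rho> = Cons.prems(2)
    show ?case
    proof (cases "Y \<in> \<X>")
      case False
      have "induced V N \<omega> (Y # Ys) = 0" for \<omega> using False by (simp add: induced_def)
      moreover have "(\<sigma> \<and>\<^sub>\<Omega> induced V N \<rho>) (Y # Ys) = 0" "(induced V N \<sigma> \<and>\<^sub>\<Omega> \<rho>) (Y # Ys) = 0"
        using \<sigma> \<rho> False by (auto intro!: Om_out[of _ "k + l"])
      ultimately show ?thesis by simp
    next
      case Y: True
      let ?s = "(- 1) ^ k :: real"
      have sm: "(ins Y \<sigma> \<and>\<^sub>\<Omega> \<rho>) Xs \<in> \<F>" "sc ?s (\<sigma> \<and>\<^sub>\<Omega> ins Y \<rho>) Xs \<in> \<F>" "(\<sigma> \<and>\<^sub>\<Omega> ins Y \<rho>) Xs \<in> \<F>" for Xs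
        using Om_smooth[OF wedge_Om[OF ins_Om[OF \<sigma> Y] \<rho>]]
          Om_smooth[OF Om_sc[OF wedge_Om[OF \<sigma> ins_Om[OF \<rho> Y]]]]
          Om_smooth[OF wedge_Om[OF \<sigma> ins_Om[OF \<rho> Y]]] by auto
      have "induced V N (\<sigma> \<and>\<^sub>\<Omega> \<rho>) (Y # Ys) =
        (induced V N (ins Y \<sigma> \<and>\<^sub>\<Omega> \<rho> + sc ?s (\<sigma> \<and>\<^sub>\<Omega> ins Y \<rho>)) - ins (N Y) (\<sigma> \<and>\<^sub>\<Omega> \<rho>)) Ys"
        by (simp only: ins_apply[symmetric] ins_induced[OF wedge_Om[OF \<sigma> \<rho>] Y] ins_wedge_Om[OF \<sigma>])
      also have "\<dots> = (induced V N (ins Y \<sigma> \<and>\<^sub>\<Omega> \<rho>) + sc ?s (induced V N (\<sigma> \<and>\<^sub>\<Omega> ins Y \<rho>))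
          - ins (N Y) (\<sigma> \<and>\<^sub>\<Omega> \<rho>)) Ys"
        using sm by (simp add: induced_add induced_sc)
      also have "\<dots> = (induced V N (ins Y \<sigma>) \<and>\<^sub>\<Omega> \<rho> + ins Y \<sigma> \<and>\<^sub>\<Omega> induced V N \<rho>
          + sc ?s (induced V N \<sigma> \<and>\<^sub>\<Omega> ins Y \<rho> + \<sigma> \<and>\<^sub>\<Omega> induced V N (ins Y \<rho>))
          - ins (N Y) (\<sigma> \<and>\<^sub>\<Omega> \<rho>)) Ys"
        using Cons.IH[OF ins_Om[OF \<sigma> Y] \<rho>] Cons.IH[OF \<sigma> ins_Om[OF \<rho> Y]] by (simp add: fun_eq_iff)
      also have "\<dots> = (ins Y (induced V N \<sigma> \<and>\<^sub>\<Omega> \<rho>) + ins Y (\<sigma> \<and>\<^sub>\<Omega> induced V N \<rho>)) Ys"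
        by (simp add: ins_wedge_Om[OF \<sigma>] ins_wedge_Om[OF induced_Om[OF \<sigma>]] ins_induced[OF \<sigma> Y]
            ins_induced[OF \<rho> Y] fun_eq_iff algebra_simps)
      finally show ?thesis by (simp add: ins_apply)
    qed
  qed
  then show ?thesis by blast
qed

end

abbreviation Lie :: "'m vfield \<Rightarrow> 'm form \<Rightarrow> 'm form" where
  "Lie X \<equiv> induced X (lie_bracket X)"

lemma lie_field_derivation [simp]: "X \<in> \<X> \<Longrightarrow> field_derivation X (lie_bracket X)"
  unfolding field_derivation_def
proof (intro conjI ballI)
  assume X: "X \<in> \<X>"
  then show "X \<in> \<X>" .
  fix Y assume Y: "Y \<in> \<X>"
  then show "lie_bracket X Y \<in> \<X>" using X by simp
  show "lie_bracket X (Y + Z) = lie_bracket X Y + lie_bracket X Z" if Z: "Z \<in> \<X>" for Z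
  proof (rule vector_field_eqI)
    fix f assume f: "f \<in> \<F>"
    show "lie_bracket X (Y + Z) f = (lie_bracket X Y + lie_bracket X Z) f"
      using X Y Z f X_add[OF X X_F[OF Y f] X_F[OF Z f]] by (simp add: lie_bracket_apply)
  qed (use X Y Z in auto)
next
  fix f Y assume X: "X \<in> \<X>" and f: "f \<in> \<F>" and Y: "Y \<in> \<X>"
  show "lie_bracket X (f \<cdot> Y) = f \<cdot> lie_bracket X Y + X f \<cdot> Y"
  proof (rule vector_field_eqI)
    fix g assume g: "g \<in> \<F>"
    have e: "(h \<cdot> Z) k = h * Z k" for h k and Z :: "'m vfield" by (simp add: fmul_def)
    show "lie_bracket X (f \<cdot> Y) g = (f \<cdot> lie_bracket X Y + X f \<cdot> Y) g"
      using X_mult[OF X f X_F[OF Y g]] by (simp add: lie_bracket_apply e algebra_simps)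
  qed (use X Y f in auto)
qed

lemma ins_Lie:
  "\<omega> \<in> \<Omega> k \<Longrightarrow> X \<in> \<X> \<Longrightarrow> Y \<in> \<X> \<Longrightarrow> ins Y (Lie X \<omega>) = Lie X (ins Y \<omega>) - ins (lie_bracket X Y) \<omega>"
  by (rule ins_induced[OF lie_field_derivation])

lemma Lie_Om [simp, intro]: "\<omega> \<in> \<Omega> k \<Longrightarrow> X \<in> \<X> \<Longrightarrow> Lie X \<omega> \<in> \<Omega> k"
  by (rule induced_Om[OF lie_field_derivation])

lemma Lie_add: "X \<in> \<X> \<Longrightarrow> \<sigma> \<in> \<Omega> k \<Longrightarrow> \<tau> \<in> \<Omega> l \<Longrightarrow> Lie X (\<sigma> + \<tau>) = Lie X \<sigma> + Lie X \<tau>"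
  by (rule induced_add[OF lie_field_derivation]) auto

lemma Lie_diff: "X \<in> \<X> \<Longrightarrow> \<sigma> \<in> \<Omega> k \<Longrightarrow> \<tau> \<in> \<Omega> l \<Longrightarrow> Lie X (\<sigma> - \<tau>) = Lie X \<sigma> - Lie X \<tau>"
  by (rule induced_diff[OF lie_field_derivation]) auto

text \<open>
  The formula for the exterior derivative puts the bracket of two vector fields first,
  whereas the Lie derivative leaves it in the place of the second one.
\<close>

lemma Om_move_head:
  assumes "\<omega> \<in> \<Omega> k" "set Xs \<subseteq> \<X>" "Z \<in> \<X>" "j < length Xs"
  shows "\<omega> (Z # nths Xs (- {j})) p = (- 1) ^ j * \<omega> (Xs[j := Z]) p"
  using assms
proof (induction j arbitrary: Xs \<omega> k)
  case 0
  then obtain Y Ys where Xs: "Xs = Y # Ys" by (cases Xs) auto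
  have "{i. Suc i \<in> - {0}} = UNIV" by auto
  then show ?case using Xs by (simp add: nths_Cons nths_all)
next
  case (Suc j)
  then obtain Y Ys where Xs: "Xs = Y # Ys" by (cases Xs) auto
  have "{i. Suc i \<in> - {Suc j}} = - {j}" by auto
  then have n: "nths Xs (- {Suc j}) = Y # nths Ys (- {j})" using Xs by (simp add: nths_Cons)
  have "\<omega> (Z # Y # nths Ys (- {j})) p = ins Y (ins Z \<omega>) (nths Ys (- {j})) p" by (simp add: ins_def)
  also have "\<dots> = - ins Y \<omega> (Z # nths Ys (- {j})) p"
  proof -
    have "ins Y (ins Z \<omega>) = - ins Z (ins Y \<omega>)" by (rule ins_ins[OF Suc.prems(1)]) (use Suc.prems Xs in auto)
    then show ?thesis by (simp add: ins_def)
  qed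
  also have "ins Y \<omega> (Z # nths Ys (- {j})) p = (- 1) ^ j * ins Y \<omega> (Ys[j := Z]) p"
    using Suc.prems Xs by (intro Suc.IH) auto
  finally show ?case using n Xs by (simp add: ins_def)
qed

lemma ext_d_Nil [simp]: "\<dd> \<omega> [] = 0"
  by (simp add: ext_d_def fun_eq_iff)

text \<open>
  Separating the terms that contain the first vector field turns the formula for the
  exterior derivative into a recursion.
\<close>

lemma ext_d_Cons:
  assumes \<omega>: "\<omega> \<in> \<Omega> k" and X: "X \<in> \<X>" and Xs: "set Xs \<subseteq> \<X>"
  shows "\<dd> \<omega> (X # Xs) p = Lie X \<omega> Xs p - \<dd> (ins X \<omega>) Xs p"
proof -
  let ?n = "length Xs"
  let ?b = "lie_bracket"
  note shift = sum.lessThan_Suc_shift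
  have n0: "nths (X # Xs) (- {0}) = Xs"
  proof -
    have "{i. Suc i \<in> - {0}} = UNIV" by auto
    then show ?thesis by (simp add: nths_Cons nths_all)
  qed
  have n1: "nths (X # Xs) (- {Suc i}) = X # nths Xs (- {i})" for i
  proof -
    have "{l. Suc l \<in> - {Suc i}} = - {i}" by auto
    then show ?thesis by (simp add: nths_Cons)
  qed
  have n2: "nths (X # Xs) (- {0, Suc j}) = nths Xs (- {j})" for j
  proof -
    have "{l. Suc l \<in> - {0, Suc j}} = - {j}" by auto
    then show ?thesis by (simp add: nths_Cons)
  qed
  have n3: "nths (X # Xs) (- {Suc i, Suc j}) = X # nths Xs (- {i, j})" for i j
  proof -
    have "{l. Suc l \<in> - {Suc i, Suc j}} = - {i, j}" by auto
    then show ?thesis by (simp add: nths_Cons)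
  qed
  have mem: "Xs ! i \<in> \<X>" if "i < ?n" for i using Xs that by (auto dest: nth_mem)
  have s1: "(\<Sum>i<Suc ?n. (- 1) ^ i * ((X # Xs) ! i) (\<omega> (nths (X # Xs) (- {i}))) p) =
      X (\<omega> Xs) p - (\<Sum>i<?n. (- 1) ^ i * (Xs ! i) (ins X \<omega> (nths Xs (- {i}))) p)"
    by (simp add: shift n0 n1 ins_def sum_negf del: sum.lessThan_Suc)
  have inner: "(\<Sum>i<Suc j. (- 1) ^ (i + Suc j) *
        \<omega> (?b ((X # Xs) ! i) ((X # Xs) ! Suc j) # nths (X # Xs) (- {i, Suc j})) p) =
      - \<omega> (Xs[j := ?b X (Xs ! j)]) p -
      (\<Sum>i<j. (- 1) ^ (i + j) * ins X \<omega> (?b (Xs ! i) (Xs ! j) # nths Xs (- {i, j})) p)"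
    if j: "j < ?n" for j
  proof -
    have "(- 1) ^ Suc j * \<omega> (?b X (Xs ! j) # nths Xs (- {j})) p = - \<omega> (Xs[j := ?b X (Xs ! j)]) p"
      using Om_move_head[OF \<omega> Xs _ j, of "?b X (Xs ! j)" p] X mem[OF j]
      by (cases "even j") simp_all
    moreover have "\<omega> (?b (Xs ! i) (Xs ! j) # X # nths Xs (- {i, j})) p =
        - ins X \<omega> (?b (Xs ! i) (Xs ! j) # nths Xs (- {i, j})) p" if "i < j" for i
    proof -
      have "?b (Xs ! i) (Xs ! j) \<in> \<X>" using mem[of i] mem[OF j] that j by simp
      then have "ins X (ins (?b (Xs ! i) (Xs ! j)) \<omega>) = - ins (?b (Xs ! i) (Xs ! j)) (ins X \<omega>)"
        by (rule ins_ins[OF \<omega> X])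
      from fun_cong[OF fun_cong[OF this], of "nths Xs (- {i, j})" p] show ?thesis
        by (simp add: ins_apply)
    qed
    ultimately show ?thesis
      by (simp add: shift n2 n3 sum_negf del: sum.lessThan_Suc)
  qed
  have s2: "(\<Sum>j<Suc ?n. \<Sum>i<j. (- 1) ^ (i + j) *
        \<omega> (?b ((X # Xs) ! i) ((X # Xs) ! j) # nths (X # Xs) (- {i, j})) p) =
      (\<Sum>j<?n. - \<omega> (Xs[j := ?b X (Xs ! j)]) p -
        (\<Sum>i<j. (- 1) ^ (i + j) * ins X \<omega> (?b (Xs ! i) (Xs ! j) # nths Xs (- {i, j})) p))"
  proof -
    have "(\<Sum>j<Suc ?n. \<Sum>i<j. (- 1) ^ (i + j) *
        \<omega> (?b ((X # Xs) ! i) ((X # Xs) ! j) # nths (X # Xs) (- {i, j})) p) =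
      (\<Sum>j<?n. \<Sum>i<Suc j. (- 1) ^ (i + Suc j) *
        \<omega> (?b ((X # Xs) ! i) ((X # Xs) ! Suc j) # nths (X # Xs) (- {i, Suc j})) p)"
      by (subst shift) simp
    also have "\<dots> = (\<Sum>j<?n. - \<omega> (Xs[j := ?b X (Xs ! j)]) p -
        (\<Sum>i<j. (- 1) ^ (i + j) * ins X \<omega> (?b (Xs ! i) (Xs ! j) # nths Xs (- {i, j})) p))"
      by (rule sum.cong[OF refl], rule inner) simp
    finally show ?thesis .
  qed
  have "\<dd> \<omega> (X # Xs) p = (\<Sum>i<Suc ?n. (- 1) ^ i * ((X # Xs) ! i) (\<omega> (nths (X # Xs) (- {i}))) p) +
      (\<Sum>j<Suc ?n. \<Sum>i<j. (- 1) ^ (i + j) *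
        \<omega> (?b ((X # Xs) ! i) ((X # Xs) ! j) # nths (X # Xs) (- {i, j})) p)"
    using X Xs by (simp add: ext_d_def)
  also have "\<dots> = Lie X \<omega> Xs p - \<dd> (ins X \<omega>) Xs p"
    unfolding s1 s2 using Xs
    by (simp add: induced_def ext_d_def sum_fun_apply sum_subtractf sum_negf)
  finally show ?thesis .
qed

lemma ext_d_out: "\<not> set Xs \<subseteq> \<X> \<Longrightarrow> \<dd> \<omega> Xs = 0"
  by (simp add: ext_d_def)

text \<open>
  Cartan's formula is a recursion for the exterior derivative, from which its properties
  follow by induction on the degree or on the arguments.
\<close>

lemma cartan: assumes "\<omega> \<in> \<Omega> k" "X \<in> \<X>" shows "ins X (\<dd> \<omega>) = Lie X \<omega> - \<dd> (ins X \<omega>)"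
proof (intro ext)
  fix Xs p show "ins X (\<dd> \<omega>) Xs p = (Lie X \<omega> - \<dd> (ins X \<omega>)) Xs p"
    using ext_d_Cons[OF assms, of Xs p] ext_d_out[of Xs] ext_d_out[of "X # Xs"]
    by (cases "set Xs \<subseteq> \<X>") (auto simp: ins_def induced_def)
qed

lemma nth_X: "set Xs \<subseteq> \<X> \<Longrightarrow> i < length Xs \<Longrightarrow> Xs ! i \<in> \<X>" by (auto dest: nth_mem)

lemma ext_d_add':
  assumes "\<And>Xs. \<sigma> Xs \<in> \<F>" "\<And>Xs. \<tau> Xs \<in> \<F>" shows "\<dd> (\<sigma> + \<tau>) = \<dd> \<sigma> + \<dd> \<tau>"
proof (intro ext)
  fix Xs p
  show "\<dd> (\<sigma> + \<tau>) Xs p = (\<dd> \<sigma> + \<dd> \<tau>) Xs p"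
    using nth_X[of Xs] by (simp add: ext_d_def X_add assms sum.distrib algebra_simps)
qed

lemma ext_d_sc':
  assumes "\<And>Xs. \<sigma> Xs \<in> \<F>" shows "\<dd> (sc c \<sigma>) = sc c (\<dd> \<sigma>)"
proof (intro ext)
  fix Xs p
  have "sc c \<sigma> Ys = (\<lambda>_. c) * \<sigma> Ys" for Ys by (simp add: sc_def fmul_def)
  then show "\<dd> (sc c \<sigma>) Xs p = sc c (\<dd> \<sigma>) Xs p"
    using nth_X[of Xs] by (simp add: ext_d_def X_scale assms sum_distrib_left algebra_simps)
qed

lemma ext_d_add: "\<sigma> \<in> \<Omega> k \<Longrightarrow> \<tau> \<in> \<Omega> l \<Longrightarrow> \<dd> (\<sigma> + \<tau>) = \<dd> \<sigma> + \<dd> \<tau>"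
  by (rule ext_d_add') auto
lemma ext_d_sc [simp]: "\<sigma> \<in> \<Omega> k \<Longrightarrow> \<dd> (sc c \<sigma>) = sc c (\<dd> \<sigma>)"
  by (rule ext_d_sc') auto
lemma ext_d_minus: "\<sigma> \<in> \<Omega> k \<Longrightarrow> \<dd> (- \<sigma>) = - \<dd> \<sigma>"
proof -
  assume a: "\<sigma> \<in> \<Omega> k"
  have m: "- \<tau> = sc (-1) \<tau>" for \<tau> :: "'m form" by (simp add: fun_eq_iff)
  show ?thesis unfolding m using a by simp
qed
lemma ext_d_diff: "\<sigma> \<in> \<Omega> k \<Longrightarrow> \<tau> \<in> \<Omega> l \<Longrightarrow> \<dd> (\<sigma> - \<tau>) = \<dd> \<sigma> - \<dd> \<tau>"
  using ext_d_add[of \<sigma> k "- \<tau>" l] ext_d_minus[of \<tau> l] Om_minus[of \<tau> l] by (metis diff_conv_add_uminus)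
lemma ext_d_0 [simp]: "\<dd> 0 = 0"
  using ext_d_diff[of 0 0 0 0] by simp

lemma df_apply: "f \<in> \<F> \<Longrightarrow> X \<in> \<X> \<Longrightarrow> ins X (df f) = zero_form (X f)"
  using cartan[of "zero_form f" 0 X] by (simp add: induced_Om_0)

lemma df_eval: "f \<in> \<F> \<Longrightarrow> X \<in> \<X> \<Longrightarrow> df f [X] = X f"
  using df_apply[of f X] by (metis ins_apply zero_form_Nil)

lemma zero_form_add: "zero_form (f + g) = zero_form f + zero_form g"
  by (simp add: zero_form_def fun_eq_iff)

lemma zero_form_diff: "zero_form (f - g) = zero_form f - zero_form g"
  by (simp add: zero_form_def fun_eq_iff)

lemma zero_form_mult: "zero_form (f * g) = f \<cdot> zero_form g"
  by (simp add: zero_form_def fun_eq_iff)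

lemma df_Om [simp, intro]: assumes f: "f \<in> \<F>" shows "df f \<in> \<Omega> (Suc 0)"
proof (rule Om_SucI)
  show "df f [] = 0" by simp
  show "ins X (df f) = 0" if "X \<notin> \<X>" for X
    using that by (auto simp: ins_def ext_d_def fun_eq_iff)
  show "ins X (df f) \<in> \<Omega> 0" if "X \<in> \<X>" for X
    using f that by (simp add: df_apply)
  show "ins X (ins X (df f)) = 0" if "X \<in> \<X>" for X
    using f that by (simp add: df_apply)
  show "ins (X + Y) (df f) = ins X (df f) + ins Y (df f)" if "X \<in> \<X>" "Y \<in> \<X>" for X Y
    using f that by (simp add: df_apply zero_form_add)
  show "ins (g \<cdot> X) (df f) = g \<cdot> ins X (df f)" if "g \<in> \<F>" "X \<in> \<X>" for g X
  proof -
    have "(g \<cdot> X) f = g * X f" by (simp add: fmul_def)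
    then show ?thesis using f that by (simp add: df_apply zero_form_mult del: fmul_apply)
  qed
qed

lemma Lie_fmul_vf:
  assumes f: "f \<in> \<F>" and X: "X \<in> \<X>"
  shows "\<omega> \<in> \<Omega> k \<Longrightarrow> Lie (f \<cdot> X) \<omega> = f \<cdot> Lie X \<omega> + df f \<and>\<^sub>\<Omega> ins X \<omega>"
proof (induction k arbitrary: \<omega>)
  case 0
  then obtain g where g: "g \<in> \<F>" "\<omega> = zero_form g" by (rule Om_0E)
  have "(f \<cdot> X) g = f * X g" by (simp add: fmul_def)
  then have "Lie (f \<cdot> X) (zero_form g) = f \<cdot> Lie X (zero_form g) + df f \<and>\<^sub>\<Omega> ins X (zero_form g)"
    using f X g(1) by (simp add: induced_Om_0 zero_form_mult del: fmul_apply)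
  then show ?case unfolding g(2) .
next
  case (Suc k)
  note \<omega> = Suc.prems
  have fX: "f \<cdot> X \<in> \<X>" using f X by (rule VF_fmul)
  have IH: "Lie (f \<cdot> X) \<tau> = f \<cdot> Lie X \<tau> + df f \<and>\<^sub>\<Omega> ins X \<tau>" if "\<tau> \<in> \<Omega> k" for \<tau>
    by (rule Suc.IH[OF that])
  show ?case
  proof (rule form_eqI)
    show "Lie (f \<cdot> X) \<omega> \<in> \<Omega> (Suc k)" using \<omega> fX by (rule Lie_Om)
    have "df f \<and>\<^sub>\<Omega> ins X \<omega> \<in> \<Omega> (Suc k)"
      using wedge_Om[OF df_Om[OF f] ins_Om_Suc[OF \<omega> X]] by (simp only: add_Suc add_0)
    then show "f \<cdot> Lie X \<omega> + df f \<and>\<^sub>\<Omega> ins X \<omega> \<in> \<Omega> (Suc k)"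
      by (intro Om_add Om_fmul f Lie_Om \<omega> X)
    fix Y assume Y: "Y \<in> \<X>"
    have br: "lie_bracket (f \<cdot> X) Y = f \<cdot> lie_bracket X Y - Y f \<cdot> X"
    proof (rule vector_field_eqI)
      fix g assume g: "g \<in> \<F>"
      have e: "(h \<cdot> Z) k = h * Z k" for h k and Z :: "'m vfield" by (simp add: fmul_def)
      show "lie_bracket (f \<cdot> X) Y g = (f \<cdot> lie_bracket X Y - Y f \<cdot> X) g"
        using X_mult[OF Y f X_F[OF X g]] by (simp add: lie_bracket_apply e algebra_simps)
    qed (use f X Y in auto)
    have "ins Y (Lie (f \<cdot> X) \<omega>) = f \<cdot> Lie X (ins Y \<omega>) + df f \<and>\<^sub>\<Omega> ins X (ins Y \<omega>)
        - (f \<cdot> ins (lie_bracket X Y) \<omega> - Y f \<cdot> ins X \<omega>)"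
      using f X Y by (simp add: ins_Lie[OF \<omega> fX Y] IH[OF ins_Om_Suc[OF \<omega> Y]] br ins_vf_diff[OF \<omega>] ins_vf_fmul[OF \<omega>] del: pointwise)
    also have "\<dots> = ins Y (f \<cdot> Lie X \<omega> + df f \<and>\<^sub>\<Omega> ins X \<omega>)"
      using f X Y by (simp add: ins_Lie[OF \<omega>] ins_wedge_Om[OF df_Om] df_apply ins_ins[OF \<omega> Y X] fun_eq_iff algebra_simps)
    finally show "ins Y (Lie (f \<cdot> X) \<omega>) = ins Y (f \<cdot> Lie X \<omega> + df f \<and>\<^sub>\<Omega> ins X \<omega>)" .
  qed
qed

lemma Lie_add_vf:
  assumes X: "X \<in> \<X>" and Y: "Y \<in> \<X>" shows "\<omega> \<in> \<Omega> k \<Longrightarrow> Lie (X + Y) \<omega> = Lie X \<omega> + Lie Y \<omega>"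
proof (induction k arbitrary: \<omega>)
  case 0
  then obtain g where g: "g \<in> \<F>" "\<omega> = zero_form g" by (rule Om_0E)
  then have "Lie (X + Y) (zero_form g) = Lie X (zero_form g) + Lie Y (zero_form g)"
    using X Y by (simp add: induced_Om_0 zero_form_add)
  then show ?case unfolding g(2) .
next
  case (Suc k)
  note \<omega> = Suc.prems
  have IH: "Lie (X + Y) \<tau> = Lie X \<tau> + Lie Y \<tau>" if "\<tau> \<in> \<Omega> k" for \<tau>
    by (rule Suc.IH[OF that])
  show ?case
  proof (rule form_eqI)
    show "Lie (X + Y) \<omega> \<in> \<Omega> (Suc k)" "Lie X \<omega> + Lie Y \<omega> \<in> \<Omega> (Suc k)" using \<omega> X Y by auto
    fix Z assume Z: "Z \<in> \<X>"
    have "lie_bracket (X + Y) Z = lie_bracket X Z + lie_bracket Y Z"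
    proof (rule vector_field_eqI)
      fix g assume g: "g \<in> \<F>"
      show "lie_bracket (X + Y) Z g = (lie_bracket X Z + lie_bracket Y Z) g"
        using X_add[OF Z X_F[OF X g] X_F[OF Y g]] by (simp add: lie_bracket_apply)
    qed (use X Y Z in auto)
    then show "ins Z (Lie (X + Y) \<omega>) = ins Z (Lie X \<omega> + Lie Y \<omega>)"
      using X Y Z by (simp add: ins_Lie[OF \<omega>] IH[OF ins_Om_Suc[OF \<omega> Z]] ins_vf_add[OF \<omega>] del: pointwise)
  qed
qed

lemma ext_d_fmul:
  assumes f: "f \<in> \<F>" and \<omega>: "\<omega> \<in> \<Omega> k" shows "\<dd> (f \<cdot> \<omega>) = df f \<and>\<^sub>\<Omega> \<omega> + f \<cdot> \<dd> \<omega>"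
proof -
  have "\<dd> (f \<cdot> \<omega>) Xs p = (df f \<and>\<^sub>\<Omega> \<omega> + f \<cdot> \<dd> \<omega>) Xs p" for Xs p
    using \<omega>
  proof (induction Xs arbitrary: \<omega> k)
    case Nil
    then show ?case by (simp add: wedge_Nil)
  next
    case (Cons X Xs)
    show ?case
    proof (cases "X \<in> \<X>")
      case False
      then have "\<dd> \<tau> (X # Xs) = 0" for \<tau> by (simp add: ext_d_out)
      moreover have "ins X (df f) = 0" using ins_out[OF df_Om[OF f] False] .
      moreover have "ins X \<omega> = 0" using ins_out[OF Cons.prems False] .
      ultimately show ?thesis by (simp add: wedge_Cons)
    next
      case X: True
      note o = ins_Om[OF Cons.prems X]
      have "\<dd> (f \<cdot> \<omega>) (X # Xs) p = (Lie X (f \<cdot> \<omega>) - \<dd> (f \<cdot> ins X \<omega>)) Xs p"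
        using cartan[OF Om_fmul[OF f Cons.prems] X] by (metis ins_apply ins_linear(5))
      also have "\<dots> = (f \<cdot> Lie X \<omega> + X f \<cdot> \<omega>) Xs p - (df f \<and>\<^sub>\<Omega> ins X \<omega> + f \<cdot> \<dd> (ins X \<omega>)) Xs p"
      proof -
        have "\<dd> (f \<cdot> ins X \<omega>) Xs p = (df f \<and>\<^sub>\<Omega> ins X \<omega> + f \<cdot> \<dd> (ins X \<omega>)) Xs p"
          by (rule Cons.IH[OF o])
        moreover have "Lie X (f \<cdot> \<omega>) = f \<cdot> Lie X \<omega> + X f \<cdot> \<omega>"
          by (rule induced_fmul[OF lie_field_derivation[OF X] Cons.prems f])
        ultimately show ?thesis by simp
      qed
      also have "\<dots> = (ins X (df f \<and>\<^sub>\<Omega> \<omega>) + ins X (f \<cdot> \<dd> \<omega>)) Xs p"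
        by (simp add: ins_wedge_Om[OF df_Om[OF f]] df_apply[OF f X] cartan[OF Cons.prems X] algebra_simps)
      finally show "\<dd> (f \<cdot> \<omega>) (X # Xs) p = (df f \<and>\<^sub>\<Omega> \<omega> + f \<cdot> \<dd> \<omega>) (X # Xs) p"
        by (simp only: ins_apply pointwise)
    qed
  qed
  then show ?thesis by (intro ext)
qed

text \<open>
  With the formulas for \<open>L\<^sub>f\<^sub>X\<close> and \<open>d(f\<omega>)\<close>, Cartan's formula shows that \<open>d\<omega>\<close> is linear over
  the functions in its first argument.
\<close>

lemma ext_d_Om [simp, intro]: "\<omega> \<in> \<Omega> k \<Longrightarrow> \<dd> \<omega> \<in> \<Omega> (Suc k)"
proof (induction k arbitrary: \<omega> rule: less_induct)
  case (less k)
  note \<omega> = less.prems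
  have IH: "\<dd> (ins X \<omega>) \<in> \<Omega> k" if X: "X \<in> \<X>" for X
  proof (cases k)
    case 0
    then have "ins X \<omega> = 0" using \<omega> by simp
    then show ?thesis by simp
  next
    case (Suc l)
    then show ?thesis using less.IH[of l] ins_Om_Suc[of \<omega> l] \<omega> X by simp
  qed
  show ?case
  proof (rule Om_SucI)
    show "\<dd> \<omega> [] = 0" by simp
    show "ins X (\<dd> \<omega>) = 0" if "X \<notin> \<X>" for X
      using that by (auto simp: ins_def ext_d_def fun_eq_iff)
    show "ins X (\<dd> \<omega>) \<in> \<Omega> k" if X: "X \<in> \<X>" for X
      using IH[OF X] Lie_Om[OF \<omega> X] cartan[OF \<omega> X] by (metis Om_diff)
    show "ins X (ins X (\<dd> \<omega>)) = 0" if X: "X \<in> \<X>" for X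
    proof -
      have "ins X (ins X \<omega>) = 0" by (rule ins_ins_self[OF \<omega>])
      moreover have "ins 0 \<omega> = 0" by (rule ins_vf_0[OF \<omega>])
      ultimately show ?thesis
        using X by (simp add: cartan[OF \<omega> X] cartan[OF ins_Om[OF \<omega> X] X] ins_Lie[OF \<omega>])
    qed
    show "ins (X + Y) (\<dd> \<omega>) = ins X (\<dd> \<omega>) + ins Y (\<dd> \<omega>)" if XY: "X \<in> \<X>" "Y \<in> \<X>" for X Y
      using XY by (simp add: cartan[OF \<omega>] Lie_add_vf[OF _ _ \<omega>] ins_vf_add[OF \<omega>]
          ext_d_add[OF ins_Om[OF \<omega> XY(1)] ins_Om[OF \<omega> XY(2)]])
    show "ins (f \<cdot> X) (\<dd> \<omega>) = f \<cdot> ins X (\<dd> \<omega>)" if fX: "f \<in> \<F>" "X \<in> \<X>" for f X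
      using fX by (simp add: cartan[OF \<omega>] Lie_fmul_vf[OF _ _ \<omega>] ins_vf_fmul[OF \<omega>]
          ext_d_fmul[OF fX(1) ins_Om[OF \<omega> fX(2)]] fun_eq_iff algebra_simps)
  qed
qed

lemma Lie_Lie:
  assumes X: "X \<in> \<X>" and Y: "Y \<in> \<X>"
  shows "\<omega> \<in> \<Omega> k \<Longrightarrow> Lie (lie_bracket X Y) \<omega> = Lie X (Lie Y \<omega>) - Lie Y (Lie X \<omega>)"
proof (induction k arbitrary: \<omega>)
  case 0
  then obtain g where g: "g \<in> \<F>" "\<omega> = zero_form g" by (rule Om_0E)
  then have "Lie (lie_bracket X Y) (zero_form g) = Lie X (Lie Y (zero_form g)) - Lie Y (Lie X (zero_form g))"
    using X Y by (simp add: induced_Om_0 zero_form_diff lie_bracket_apply)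
  then show ?case unfolding g(2) .
next
  case (Suc k)
  note \<omega> = Suc.prems
  show ?case
  proof (rule form_eqI)
    have IH: "Lie (lie_bracket X Y) \<tau> = Lie X (Lie Y \<tau>) - Lie Y (Lie X \<tau>)" if "\<tau> \<in> \<Omega> k" for \<tau>
      by (rule Suc.IH[OF that])
    show "Lie (lie_bracket X Y) \<omega> \<in> \<Omega> (Suc k)" "Lie X (Lie Y \<omega>) - Lie Y (Lie X \<omega>) \<in> \<Omega> (Suc k)"
      using \<omega> X Y by auto
    fix Z assume Z: "Z \<in> \<X>"
    note o = ins_Om_Suc[OF \<omega>]
    show "ins Z (Lie (lie_bracket X Y) \<omega>) = ins Z (Lie X (Lie Y \<omega>) - Lie Y (Lie X \<omega>))"
      using X Y Z by (simp add: ins_Lie[OF \<omega>] ins_Lie[OF Lie_Om[OF \<omega>]] IH[OF o] lie_jacobi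
          ins_vf_diff[OF \<omega>] Lie_diff[OF _ Lie_Om[OF o] o] del: pointwise)
  qed
qed

lemma ext_d_Lie:
  assumes X: "X \<in> \<X>" shows "\<omega> \<in> \<Omega> k \<Longrightarrow> \<dd> (Lie X \<omega>) = Lie X (\<dd> \<omega>)"
proof (induction k arbitrary: \<omega>)
  case 0
  show ?case
  proof (rule form_eqI)
    show "\<dd> (Lie X \<omega>) \<in> \<Omega> (Suc 0)" "Lie X (\<dd> \<omega>) \<in> \<Omega> (Suc 0)" using 0 X by auto
    fix Y assume Y: "Y \<in> \<X>"
    show "ins Y (\<dd> (Lie X \<omega>)) = ins Y (Lie X (\<dd> \<omega>))"
      using X Y 0 by (simp add: cartan[OF Lie_Om] ins_Lie[OF ext_d_Om] cartan Lie_Lie)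
  qed
next
  case (Suc k)
  note \<omega> = Suc.prems
  show ?case
  proof (rule form_eqI)
    show "\<dd> (Lie X \<omega>) \<in> \<Omega> (Suc (Suc k))" "Lie X (\<dd> \<omega>) \<in> \<Omega> (Suc (Suc k))" using \<omega> X by auto
    fix Y assume Y: "Y \<in> \<X>"
    note o = ins_Om_Suc[OF \<omega>]
    have "\<dd> (ins Y (Lie X \<omega>)) = Lie X (\<dd> (ins Y \<omega>)) - \<dd> (ins (lie_bracket X Y) \<omega>)"
      using X Y by (simp add: ins_Lie[OF \<omega>] ext_d_diff[OF Lie_Om[OF o] o] Suc.IH[OF o])
    then show "ins Y (\<dd> (Lie X \<omega>)) = ins Y (Lie X (\<dd> \<omega>))"
      using X Y \<omega> by (simp add: cartan[OF Lie_Om[OF \<omega>]] ins_Lie[OF ext_d_Om[OF \<omega>]] cartan[OF \<omega>]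
          Lie_Lie[OF _ _ \<omega>] Lie_diff[OF _ Lie_Om[OF \<omega>] ext_d_Om[OF o]])
  qed
qed

text \<open>
  By induction on the degree, since \<open>d\<^sup>2\<close> commutes with contractions by Cartan's formula.
\<close>

lemma ext_d_ext_d [simp]: "\<omega> \<in> \<Omega> k \<Longrightarrow> \<dd> (\<dd> \<omega>) = 0"
proof (induction k arbitrary: \<omega>)
  case 0
  show "\<dd> (\<dd> \<omega>) = 0"
  proof (rule form_eqI)
    show "\<dd> (\<dd> \<omega>) \<in> \<Omega> (Suc (Suc 0))" using 0 by auto
    show "0 \<in> \<Omega> (Suc (Suc 0))" by (rule Om_0)
    fix X assume X: "X \<in> \<X>"
    show "ins X (\<dd> (\<dd> \<omega>)) = ins X 0"
      using 0 X by (simp add: cartan[OF ext_d_Om] cartan ext_d_Lie)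
  qed
next
  case (Suc k)
  note \<omega> = Suc.prems
  show "\<dd> (\<dd> \<omega>) = 0"
  proof (rule form_eqI)
    show "\<dd> (\<dd> \<omega>) \<in> \<Omega> (Suc (Suc (Suc k)))" using \<omega> by auto
    show "0 \<in> \<Omega> (Suc (Suc (Suc k)))" by (rule Om_0)
    fix X assume X: "X \<in> \<X>"
    note o = ins_Om_Suc[OF \<omega> X]
    have IH: "\<dd> (\<dd> (ins X \<omega>)) = 0" by (rule Suc.IH[OF o])
    show "ins X (\<dd> (\<dd> \<omega>)) = ins X 0"
      using \<omega> X by (simp add: cartan[OF ext_d_Om[OF \<omega>]] cartan[OF \<omega>] ext_d_Lie[OF X \<omega>]
         ext_d_diff[OF Lie_Om[OF \<omega>] ext_d_Om[OF o]] IH)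
  qed
qed

lemma ext_d_wedge:
  assumes "\<sigma> \<in> \<Omega> k" "\<rho> \<in> \<Omega> l"
  shows "\<dd> (\<sigma> \<and>\<^sub>\<Omega> \<rho>) = \<dd> \<sigma> \<and>\<^sub>\<Omega> \<rho> + sc ((- 1) ^ k) (\<sigma> \<and>\<^sub>\<Omega> \<dd> \<rho>)"
proof -
  have "\<dd> (\<sigma> \<and>\<^sub>\<Omega> \<rho>) Xs p = (\<dd> \<sigma> \<and>\<^sub>\<Omega> \<rho> + sc ((- 1) ^ k) (\<sigma> \<and>\<^sub>\<Omega> \<dd> \<rho>)) Xs p" for Xs p
    using assms
  proof (induction Xs arbitrary: k l \<sigma> \<rho>)
    case Nil
    then show ?case by (simp add: wedge_Nil)
  next
    case (Cons X Xs)
    note \<sigma> = Cons.prems(1) and \<rho> = Cons.prems(2)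
    show ?case
    proof (cases "X \<in> \<X>")
      case False
      have "\<dd> (\<sigma> \<and>\<^sub>\<Omega> \<rho>) (X # Xs) = 0" "(\<dd> \<sigma> \<and>\<^sub>\<Omega> \<rho>) (X # Xs) = 0" "(\<sigma> \<and>\<^sub>\<Omega> \<dd> \<rho>) (X # Xs) = 0"
        using False Om_out[OF ext_d_Om[OF wedge_Om[OF \<sigma> \<rho>]], of "X # Xs"]
          Om_out[OF wedge_Om[OF ext_d_Om[OF \<sigma>] \<rho>], of "X # Xs"]
          Om_out[OF wedge_Om[OF \<sigma> ext_d_Om[OF \<rho>]], of "X # Xs"] by auto
      then show ?thesis by simp
    next
      case X: True
      let ?s = "(- 1) ^ k :: real"

      note iw = wedge_Om[OF ins_Om[OF \<sigma> X] \<rho>] wedge_Om[OF \<sigma> ins_Om[OF \<rho> X]]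
      have "\<dd> (\<sigma> \<and>\<^sub>\<Omega> \<rho>) (X # Xs) p = (Lie X (\<sigma> \<and>\<^sub>\<Omega> \<rho>) - \<dd> (ins X \<sigma> \<and>\<^sub>\<Omega> \<rho> + sc ?s (\<sigma> \<and>\<^sub>\<Omega> ins X \<rho>))) Xs p"
        by (simp only: ins_apply[symmetric] cartan[OF wedge_Om[OF \<sigma> \<rho>] X] ins_wedge_Om[OF \<sigma>])
      also have "\<dd> (ins X \<sigma> \<and>\<^sub>\<Omega> \<rho> + sc ?s (\<sigma> \<and>\<^sub>\<Omega> ins X \<rho>)) =
          \<dd> (ins X \<sigma> \<and>\<^sub>\<Omega> \<rho>) + sc ?s (\<dd> (\<sigma> \<and>\<^sub>\<Omega> ins X \<rho>))"
        by (simp add: ext_d_add[OF iw(1) Om_sc[OF iw(2)]] ext_d_sc[OF iw(2)])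
      also have "Lie X (\<sigma> \<and>\<^sub>\<Omega> \<rho>) = Lie X \<sigma> \<and>\<^sub>\<Omega> \<rho> + \<sigma> \<and>\<^sub>\<Omega> Lie X \<rho>"
        by (rule induced_wedge[OF lie_field_derivation[OF X] \<sigma> \<rho>])
      finally have "\<dd> (\<sigma> \<and>\<^sub>\<Omega> \<rho>) (X # Xs) p = (Lie X \<sigma> \<and>\<^sub>\<Omega> \<rho>) Xs p + (\<sigma> \<and>\<^sub>\<Omega> Lie X \<rho>) Xs p
         - ((\<dd> (ins X \<sigma>) \<and>\<^sub>\<Omega> \<rho>) Xs p + (-1) ^ (k - 1) * (ins X \<sigma> \<and>\<^sub>\<Omega> \<dd> \<rho>) Xs p)
         - ?s * ((\<dd> \<sigma> \<and>\<^sub>\<Omega> ins X \<rho>) Xs p + ?s * (\<sigma> \<and>\<^sub>\<Omega> \<dd> (ins X \<rho>)) Xs p)"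
        using Cons.IH[OF ins_Om[OF \<sigma> X] \<rho>] Cons.IH[OF \<sigma> ins_Om[OF \<rho> X]] by simp
      moreover have "(-1) ^ (k - 1) * (ins X \<sigma> \<and>\<^sub>\<Omega> \<dd> \<rho>) Xs p = - ?s * (ins X \<sigma> \<and>\<^sub>\<Omega> \<dd> \<rho>) Xs p"
        using \<sigma> by (cases k) auto
      ultimately show ?thesis
        by (cases "even k") (simp_all add: wedge_Cons cartan[OF \<sigma> X] cartan[OF \<rho> X] Om_par[OF \<sigma>]
            Om_par[OF ext_d_Om[OF \<sigma>]])
    qed
  qed
  then show ?thesis by (intro ext)
qed

section \<open>Graded derivations\<close>

lemma ins_sum: "ins X (\<Sum>i\<in>I. \<sigma> i) = (\<Sum>i\<in>I. ins X (\<sigma> i))"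
  by (simp add: fun_eq_iff ins_apply sum_fun_apply)

definition local_frame :: "('m \<Rightarrow> real) \<Rightarrow> 'e set \<Rightarrow> ('e \<Rightarrow> 'm \<Rightarrow> real) \<Rightarrow> ('e \<Rightarrow> 'm vfield) \<Rightarrow> bool" where
  "local_frame w J g Y \<longleftrightarrow> w \<in> \<F> \<and> finite J \<and> (\<forall>e\<in>J. g e \<in> \<F> \<and> Y e \<in> \<X>) \<and>
     (\<forall>X\<in>\<X>. w \<cdot> X = (\<Sum>e\<in>J. X (g e) \<cdot> Y e))"

lemma local_frame_at: obtains w J g Y where "local_frame w J g Y" "w p \<noteq> 0"
  using local_frame_exists[OF manifold, of p] unfolding local_frame_def by blast

text \<open>
  In a frame, \<open>\<Sum>\<^sub>e dg\<^sub>e \<and> i(Y\<^sub>e)\<close> is \<open>w\<close> times the degree operator. This shows that forms are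
  locally generated by differentials, with no reference to coordinates.
\<close>

lemma frame_expansion:
  assumes "local_frame w J g Y"
  shows "\<omega> \<in> \<Omega> k \<Longrightarrow> (\<Sum>e\<in>J. df (g e) \<and>\<^sub>\<Omega> ins (Y e) \<omega>) = sc (real k) (w \<cdot> \<omega>)"
proof (induction k arbitrary: \<omega>)
  case 0
  then have "ins (Y e) \<omega> = 0" for e by simp
  moreover have "sc (real 0) (w \<cdot> \<omega>) = 0" by (simp add: fun_eq_iff)
  ultimately show "(\<Sum>e\<in>J. df (g e) \<and>\<^sub>\<Omega> ins (Y e) \<omega>) = sc (real 0) (w \<cdot> \<omega>)"
    by simp
next
  case (Suc k)
  note \<omega> = Suc.prems
  have w: "w \<in> \<F>" and g: "\<And>e. e \<in> J \<Longrightarrow> g e \<in> \<F>" and Y: "\<And>e. e \<in> J \<Longrightarrow> Y e \<in> \<X>"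
    and fr: "\<And>X. X \<in> \<X> \<Longrightarrow> w \<cdot> X = (\<Sum>e\<in>J. X (g e) \<cdot> Y e)"
    using assms unfolding local_frame_def by blast+
  have IH: "(\<Sum>e\<in>J. df (g e) \<and>\<^sub>\<Omega> ins (Y e) \<tau>) = sc (real k) (w \<cdot> \<tau>)" if "\<tau> \<in> \<Omega> k" for \<tau>
    by (rule Suc.IH[OF that])
  show "(\<Sum>e\<in>J. df (g e) \<and>\<^sub>\<Omega> ins (Y e) \<omega>) = sc (real (Suc k)) (w \<cdot> \<omega>)"
  proof (rule form_eqI)
    have "df (g e) \<and>\<^sub>\<Omega> ins (Y e) \<omega> \<in> \<Omega> (Suc k)" if "e \<in> J" for e
      using wedge_Om[OF df_Om[OF g[OF that]] ins_Om_Suc[OF \<omega> Y[OF that]]] by (simp only: add_Suc add_0)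
    then show "(\<Sum>e\<in>J. df (g e) \<and>\<^sub>\<Omega> ins (Y e) \<omega>) \<in> \<Omega> (Suc k)" by (rule Om_sum)
    show "sc (real (Suc k)) (w \<cdot> \<omega>) \<in> \<Omega> (Suc k)" by (intro Om_sc Om_fmul w \<omega>)
    fix X assume X: "X \<in> \<X>"
    have 1: "ins X (df (g e) \<and>\<^sub>\<Omega> ins (Y e) \<omega>) = ins (X (g e) \<cdot> Y e) \<omega> + df (g e) \<and>\<^sub>\<Omega> ins (Y e) (ins X \<omega>)"
      if e: "e \<in> J" for e
    proof -
      have "ins X (ins (Y e) \<omega>) = - ins (Y e) (ins X \<omega>)" by (rule ins_ins[OF \<omega> X Y[OF e]])
      then show ?thesis
        using X g[OF e] Y[OF e]
        by (simp add: ins_wedge Om_par[OF df_Om[OF g[OF e]]] df_apply ins_vf_fmul[OF \<omega>] del: pointwise)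
           (simp add: fun_eq_iff)
    qed
    have "ins X (\<Sum>e\<in>J. df (g e) \<and>\<^sub>\<Omega> ins (Y e) \<omega>) =
        (\<Sum>e\<in>J. ins (X (g e) \<cdot> Y e) \<omega>) + (\<Sum>e\<in>J. df (g e) \<and>\<^sub>\<Omega> ins (Y e) (ins X \<omega>))"
      unfolding ins_sum sum.distrib[symmetric] by (rule sum.cong[OF refl 1])
    also have "(\<Sum>e\<in>J. ins (X (g e) \<cdot> Y e) \<omega>) = ins (\<Sum>e\<in>J. X (g e) \<cdot> Y e) \<omega>"
      by (rule ins_vf_sum[OF \<omega>, symmetric]) (use X g Y in blast)
    also have "\<dots> = w \<cdot> ins X \<omega>" by (simp only: fr[OF X, symmetric] ins_vf_fmul[OF \<omega> w X])
    also have "(\<Sum>e\<in>J. df (g e) \<and>\<^sub>\<Omega> ins (Y e) (ins X \<omega>)) = sc (real k) (w \<cdot> ins X \<omega>)"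
      by (rule IH[OF ins_Om_Suc[OF \<omega> X]])
    finally show "ins X (\<Sum>e\<in>J. df (g e) \<and>\<^sub>\<Omega> ins (Y e) \<omega>) = ins X (sc (real (Suc k)) (w \<cdot> \<omega>))"
      by (simp add: fun_eq_iff algebra_simps)
  qed
qed

lemma sc_fmul: "sc c \<omega> = (\<lambda>_. c) \<cdot> \<omega>" by (simp add: sc_def)

lemma additive_sum:
  fixes F :: "'m form \<Rightarrow> 'b \<Rightarrow> 'm \<Rightarrow> real"
  assumes add: "\<And>\<sigma> \<tau>. \<sigma> \<in> \<Omega> k \<Longrightarrow> \<tau> \<in> \<Omega> k \<Longrightarrow> F (\<sigma> + \<tau>) = F \<sigma> + F \<tau>"
    and "\<And>i. i \<in> I \<Longrightarrow> \<sigma> i \<in> \<Omega> k"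
  shows "F (\<Sum>i\<in>I. \<sigma> i) = (\<Sum>i\<in>I. F (\<sigma> i))"
proof -
  have "F (0 + 0) = F 0 + F 0" by (rule add) (rule Om_0)+
  then have F0: "F 0 = 0" by simp
  show ?thesis
    using assms(2)
  proof (induction I rule: infinite_finite_induct)
    case (insert x I)
    have "F (\<sigma> x + sum \<sigma> I) = F (\<sigma> x) + F (sum \<sigma> I)"
      by (intro add Om_sum) (use insert.prems in auto)
    moreover have "F (sum \<sigma> I) = (\<Sum>i\<in>I. F (\<sigma> i))" by (rule insert.IH) (use insert.prems in auto)
    ultimately show ?case by (simp only: sum.insert[OF insert.hyps])
  qed (simp_all only: sum.infinite sum.empty F0 not_False_eq_True)
qed

text \<open>
  At a point where \<open>w\<close> does not vanish, \<open>frame_expansion\<close> writes a multiple of \<open>\<omega>\<close> as a sum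
  of forms \<open>dg \<and> \<tau>\<close> with \<open>\<tau>\<close> of lower degree.
\<close>

lemma vanishing_principle:
  fixes F :: "nat \<Rightarrow> 'm form \<Rightarrow> 'b \<Rightarrow> 'm \<Rightarrow> real"
  assumes add: "\<And>k \<sigma> \<tau>. \<sigma> \<in> \<Omega> k \<Longrightarrow> \<tau> \<in> \<Omega> k \<Longrightarrow> F k (\<sigma> + \<tau>) = F k \<sigma> + F k \<tau>"
    and fmul: "\<And>k f \<sigma>. f \<in> \<F> \<Longrightarrow> \<sigma> \<in> \<Omega> k \<Longrightarrow> F k (f \<cdot> \<sigma>) = f \<cdot> F k \<sigma>"
    and zero: "\<And>f. f \<in> \<F> \<Longrightarrow> F 0 (zero_form f) = 0"
    and step: "\<And>k g \<omega>. (\<And>\<tau>. \<tau> \<in> \<Omega> k \<Longrightarrow> F k \<tau> = 0) \<Longrightarrow> g \<in> \<F> \<Longrightarrow> \<omega> \<in> \<Omega> k \<Longrightarrow> F (Suc k) (df g \<and>\<^sub>\<Omega> \<omega>) = 0"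
  shows "\<omega> \<in> \<Omega> k \<Longrightarrow> F k \<omega> = 0"
proof (induction k arbitrary: \<omega>)
  case 0
  then show ?case using zero Om_0E by metis
next
  case (Suc k)
  note \<omega> = Suc.prems
  show "F (Suc k) \<omega> = 0"
  proof (intro ext)
    fix x p
    obtain w J g Y where fr: "local_frame w J g Y" and wp: "w p \<noteq> 0" by (rule local_frame_at)
    have w: "w \<in> \<F>" and g: "\<And>e. e \<in> J \<Longrightarrow> g e \<in> \<F>" and Y: "\<And>e. e \<in> J \<Longrightarrow> Y e \<in> \<X>"
      using fr unfolding local_frame_def by blast+
    have mem: "df (g e) \<and>\<^sub>\<Omega> ins (Y e) \<omega> \<in> \<Omega> (Suc k)" if "e \<in> J" for e
      using wedge_Om[OF df_Om[OF g[OF that]] ins_Om_Suc[OF \<omega> Y[OF that]]] by (simp only: add_Suc add_0)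
    have "(\<lambda>_. real (Suc k)) \<cdot> (w \<cdot> F (Suc k) \<omega>) = F (Suc k) (sc (real (Suc k)) (w \<cdot> \<omega>))"
      unfolding sc_fmul by (simp only: fmul[OF F_const Om_fmul[OF w \<omega>]] fmul[OF w \<omega>])
    also have "\<dots> = F (Suc k) (\<Sum>e\<in>J. df (g e) \<and>\<^sub>\<Omega> ins (Y e) \<omega>)"
      by (simp only: frame_expansion[OF fr \<omega>])
    also have "\<dots> = (\<Sum>e\<in>J. F (Suc k) (df (g e) \<and>\<^sub>\<Omega> ins (Y e) \<omega>))"
      by (rule additive_sum[where k = "Suc k", OF add]) (assumption | rule mem)+
    also have "\<dots> = (\<Sum>e\<in>J. 0)"
      by (rule sum.cong[OF refl], rule step[OF Suc.IH g ins_Om_Suc[OF \<omega> Y]])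
    finally have "real (Suc k) * (w p * F (Suc k) \<omega> x p) = 0"
      by (simp add: fun_eq_iff)
    then show "F (Suc k) \<omega> x p = 0 x p" using wp by simp
  qed
qed

lemma one_form_vanishing:
  fixes F :: "'m form \<Rightarrow> 'b \<Rightarrow> 'm \<Rightarrow> real"
  assumes add: "\<And>\<sigma> \<tau>. \<sigma> \<in> \<Omega> 1 \<Longrightarrow> \<tau> \<in> \<Omega> 1 \<Longrightarrow> F (\<sigma> + \<tau>) = F \<sigma> + F \<tau>"
    and fmul: "\<And>f \<sigma>. f \<in> \<F> \<Longrightarrow> \<sigma> \<in> \<Omega> 1 \<Longrightarrow> F (f \<cdot> \<sigma>) = f \<cdot> F \<sigma>"
    and zero: "\<And>f. f \<in> \<F> \<Longrightarrow> F (df f) = 0"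
    and \<alpha>: "\<alpha> \<in> \<Omega> 1"
  shows "F \<alpha> = 0"
proof (intro ext)
  fix x p
  obtain w J g Y where fr: "local_frame w J g Y" and wp: "w p \<noteq> 0" by (rule local_frame_at)
  have w: "w \<in> \<F>" and g: "\<And>e. e \<in> J \<Longrightarrow> g e \<in> \<F>" and Y: "\<And>e. e \<in> J \<Longrightarrow> Y e \<in> \<X>"
    using fr unfolding local_frame_def by blast+
  have \<alpha>F: "\<alpha> [Y e] \<in> \<F>" for e using \<alpha> by blast
  have d: "df (g e) \<in> \<Omega> 1" if "e \<in> J" for e using df_Om[OF g[OF that]] by simp
  have "df (g e) \<and>\<^sub>\<Omega> ins (Y e) \<alpha> = \<alpha> [Y e] \<cdot> df (g e)" if "e \<in> J" for e
  proof -
    have "ins (Y e) \<alpha> \<in> \<Omega> 0" using ins_Om[OF \<alpha> Y[OF that]] by simp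
    then have "ins (Y e) \<alpha> = zero_form (\<alpha> [Y e])" using Om_0_eq by (metis ins_apply)
    then show ?thesis by simp
  qed
  then have "w \<cdot> \<alpha> = (\<Sum>e\<in>J. \<alpha> [Y e] \<cdot> df (g e))"
    using frame_expansion[OF fr \<alpha>] by (simp add: fun_eq_iff sum_fun_apply)
  then have "w \<cdot> F \<alpha> = F (\<Sum>e\<in>J. \<alpha> [Y e] \<cdot> df (g e))" using fmul[OF w \<alpha>] by metis
  also have "\<dots> = (\<Sum>e\<in>J. F (\<alpha> [Y e] \<cdot> df (g e)))"
    by (rule additive_sum[where k = 1, OF add]) (use \<alpha>F d in auto)
  also have "\<dots> = (\<Sum>e\<in>J. 0)"
    by (rule sum.cong[OF refl]) (use fmul[OF \<alpha>F d] zero[OF g] in \<open>auto simp: fun_eq_iff\<close>)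
  finally have "w \<cdot> F \<alpha> = (\<Sum>e\<in>J. 0)" .
  from fun_cong[OF fun_cong[OF this, of x], of p] have "w p * F \<alpha> x p = 0" by simp
  then show "F \<alpha> x p = 0 x p" using wp by simp
qed

lemma one_form_eqI:
  fixes F G :: "'m form \<Rightarrow> 'b \<Rightarrow> 'm \<Rightarrow> real"
  assumes "\<And>\<sigma> \<tau>. \<sigma> \<in> \<Omega> 1 \<Longrightarrow> \<tau> \<in> \<Omega> 1 \<Longrightarrow> F (\<sigma> + \<tau>) = F \<sigma> + F \<tau>"
    "\<And>f \<sigma>. f \<in> \<F> \<Longrightarrow> \<sigma> \<in> \<Omega> 1 \<Longrightarrow> F (f \<cdot> \<sigma>) = f \<cdot> F \<sigma>"
    "\<And>\<sigma> \<tau>. \<sigma> \<in> \<Omega> 1 \<Longrightarrow> \<tau> \<in> \<Omega> 1 \<Longrightarrow> G (\<sigma> + \<tau>) = G \<sigma> + G \<tau>"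
    "\<And>f \<sigma>. f \<in> \<F> \<Longrightarrow> \<sigma> \<in> \<Omega> 1 \<Longrightarrow> G (f \<cdot> \<sigma>) = f \<cdot> G \<sigma>"
    "\<And>f. f \<in> \<F> \<Longrightarrow> F (df f) = G (df f)" "\<alpha> \<in> \<Omega> 1"
  shows "F \<alpha> = G \<alpha>"
proof -
  have "F \<alpha> - G \<alpha> = 0"
  proof (rule one_form_vanishing[where F = "\<lambda>\<alpha>. F \<alpha> - G \<alpha>"])
    show "F (\<sigma> + \<tau>) - G (\<sigma> + \<tau>) = F \<sigma> - G \<sigma> + (F \<tau> - G \<tau>)" if "\<sigma> \<in> \<Omega> 1" "\<tau> \<in> \<Omega> 1" for \<sigma> \<tau>
      by (simp add: assms(1,3)[OF that])
    show "F (f \<cdot> \<sigma>) - G (f \<cdot> \<sigma>) = f \<cdot> (F \<sigma> - G \<sigma>)" if "f \<in> \<F>" "\<sigma> \<in> \<Omega> 1" for f \<sigma>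
      unfolding assms(2,4)[OF that] by (simp add: fun_eq_iff algebra_simps)
    show "F (df f) - G (df f) = 0" if "f \<in> \<F>" for f using assms(5)[OF that] by simp
  qed (rule assms(6))
  then show ?thesis by simp
qed

text \<open>
  The operator may depend on the degree of its argument. This is needed for operators \<open>\<rho> \<mapsto>
  (-1)\<^sup>k\<^sup>l {\<rho>, \<sigma>}\<close> with signs that depend on the degree \<open>l\<close> of \<open>\<rho>\<close>.
\<close>

definition graded_derivation :: "nat \<Rightarrow> (nat \<Rightarrow> 'm form \<Rightarrow> 'm form) \<Rightarrow> bool" where
  "graded_derivation m F \<longleftrightarrow> (\<forall>k. \<forall>\<sigma>\<in>\<Omega> k. F k \<sigma> \<in> \<Omega> (k + m)) \<and>
     (\<forall>k. \<forall>\<sigma>\<in>\<Omega> k. \<forall>\<tau>\<in>\<Omega> k. F k (\<sigma> + \<tau>) = F k \<sigma> + F k \<tau>) \<and>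
     (\<forall>k l. \<forall>\<sigma>\<in>\<Omega> k. \<forall>\<tau>\<in>\<Omega> l.
        F (k + l) (\<sigma> \<and>\<^sub>\<Omega> \<tau>) = F k \<sigma> \<and>\<^sub>\<Omega> \<tau> + sc ((- 1) ^ (m * k)) (\<sigma> \<and>\<^sub>\<Omega> F l \<tau>))"

lemma graded_derivationI:
  assumes "\<And>k \<sigma>. \<sigma> \<in> \<Omega> k \<Longrightarrow> F k \<sigma> \<in> \<Omega> (k + m)"
    "\<And>k \<sigma> \<tau>. \<sigma> \<in> \<Omega> k \<Longrightarrow> \<tau> \<in> \<Omega> k \<Longrightarrow> F k (\<sigma> + \<tau>) = F k \<sigma> + F k \<tau>"
    "\<And>k l \<sigma> \<tau>. \<sigma> \<in> \<Omega> k \<Longrightarrow> \<tau> \<in> \<Omega> l \<Longrightarrow>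
        F (k + l) (\<sigma> \<and>\<^sub>\<Omega> \<tau>) = F k \<sigma> \<and>\<^sub>\<Omega> \<tau> + sc ((- 1) ^ (m * k)) (\<sigma> \<and>\<^sub>\<Omega> F l \<tau>)"
  shows "graded_derivation m F"
  unfolding graded_derivation_def by (intro conjI allI ballI; rule assms; assumption)

lemma gd_Om: "graded_derivation m F \<Longrightarrow> \<sigma> \<in> \<Omega> k \<Longrightarrow> F k \<sigma> \<in> \<Omega> (k + m)"
  unfolding graded_derivation_def by blast
lemma gd_add: "graded_derivation m F \<Longrightarrow> \<sigma> \<in> \<Omega> k \<Longrightarrow> \<tau> \<in> \<Omega> k \<Longrightarrow> F k (\<sigma> + \<tau>) = F k \<sigma> + F k \<tau>"
  unfolding graded_derivation_def by blast
lemma gd_wedge: "graded_derivation m F \<Longrightarrow> \<sigma> \<in> \<Omega> k \<Longrightarrow> \<tau> \<in> \<Omega> l \<Longrightarrow>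
    F (k + l) (\<sigma> \<and>\<^sub>\<Omega> \<tau>) = F k \<sigma> \<and>\<^sub>\<Omega> \<tau> + sc ((- 1) ^ (m * k)) (\<sigma> \<and>\<^sub>\<Omega> F l \<tau>)"
  unfolding graded_derivation_def by blast

lemma gd_0: assumes "graded_derivation m F" shows "F k 0 = 0"
proof -
  have "F k (0 + 0) = F k 0 + F k 0" by (rule gd_add[OF assms]) (rule Om_0)+
  then show ?thesis by simp
qed

lemma gd_minus: assumes "graded_derivation m F" "\<sigma> \<in> \<Omega> k" shows "F k (- \<sigma>) = - F k \<sigma>"
proof -
  have "F k (\<sigma> + - \<sigma>) = F k \<sigma> + F k (- \<sigma>)"
    by (rule gd_add[OF assms Om_minus[OF assms(2)]])
  then show ?thesis using gd_0[OF assms(1), of k] by (simp add: eq_neg_iff_add_eq_0 add.commute)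
qed

lemma sc_sign: "sc ((- 1) ^ n) \<sigma> = (if even n then \<sigma> else - \<sigma>)"
  by (simp add: fun_eq_iff)

lemma gd_sign: "graded_derivation m F \<Longrightarrow> \<sigma> \<in> \<Omega> k \<Longrightarrow> F k (sc ((- 1) ^ n) \<sigma>) = sc ((- 1) ^ n) (F k \<sigma>)"
  unfolding sc_sign by (simp add: gd_minus del: pointwise)

lemma gd_fmul: assumes "graded_derivation m F" "f \<in> \<F>" "\<sigma> \<in> \<Omega> k"
  shows "F k (f \<cdot> \<sigma>) = F 0 (zero_form f) \<and>\<^sub>\<Omega> \<sigma> + f \<cdot> F k \<sigma>"
  using gd_wedge[OF assms(1) zero_form_Om[OF assms(2)] assms(3)] by (simp add: fun_eq_iff)

text \<open>
  The difference of the two derivations is linear over the functions because it vanishes on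
  them, so \<open>vanishing_principle\<close> applies.
\<close>

lemma gd_eqI:
  assumes F: "graded_derivation m F" and G: "graded_derivation m G"
    and 0: "\<And>f. f \<in> \<F> \<Longrightarrow> F 0 (zero_form f) = G 0 (zero_form f)"
    and 1: "\<And>f. f \<in> \<F> \<Longrightarrow> F 1 (df f) = G 1 (df f)"
    and \<omega>: "\<omega> \<in> \<Omega> k"
  shows "F k \<omega> = G k \<omega>"
proof -
  have "F k \<omega> - G k \<omega> = 0"
  proof (rule vanishing_principle[where F = "\<lambda>k \<omega>. F k \<omega> - G k \<omega>", OF _ _ _ _ \<omega>])
    show "F k (\<sigma> + \<tau>) - G k (\<sigma> + \<tau>) = F k \<sigma> - G k \<sigma> + (F k \<tau> - G k \<tau>)"
      if "\<sigma> \<in> \<Omega> k" "\<tau> \<in> \<Omega> k" for k \<sigma> \<tau>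
      by (simp add: gd_add[OF F that] gd_add[OF G that])
    show "F k (f \<cdot> \<sigma>) - G k (f \<cdot> \<sigma>) = f \<cdot> (F k \<sigma> - G k \<sigma>)" if "f \<in> \<F>" "\<sigma> \<in> \<Omega> k" for k f \<sigma>
      unfolding gd_fmul[OF F that] gd_fmul[OF G that] 0[OF that(1)] by (simp add: fun_eq_iff algebra_simps)
    show "F 0 (zero_form f) - G 0 (zero_form f) = 0" if "f \<in> \<F>" for f
      using 0[OF that] by simp
    show "F (Suc k) (df g \<and>\<^sub>\<Omega> \<omega>) - G (Suc k) (df g \<and>\<^sub>\<Omega> \<omega>) = 0"
      if IH: "\<And>\<tau>. \<tau> \<in> \<Omega> k \<Longrightarrow> F k \<tau> - G k \<tau> = 0" and g: "g \<in> \<F>" and \<omega>: "\<omega> \<in> \<Omega> k" for k g \<omega>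
    proof -
      have "F k \<omega> = G k \<omega>" using IH[OF \<omega>] by simp
      moreover have d: "df g \<in> \<Omega> 1" using df_Om[OF g] by simp
      ultimately show ?thesis using gd_wedge[OF F d \<omega>] gd_wedge[OF G d \<omega>] 1[OF g] by simp
    qed
  qed
  then show ?thesis by simp
qed

lemma gd_plus: assumes F: "graded_derivation m F" and G: "graded_derivation m G"
  shows "graded_derivation m (\<lambda>k \<omega>. F k \<omega> + G k \<omega>)"
proof (rule graded_derivationI)
  fix k \<sigma> assume s: "\<sigma> \<in> \<Omega> k"
  show "F k \<sigma> + G k \<sigma> \<in> \<Omega> (k + m)" by (rule Om_add[OF gd_Om[OF F s] gd_Om[OF G s]])
  show "F k (\<sigma> + \<tau>) + G k (\<sigma> + \<tau>) = F k \<sigma> + G k \<sigma> + (F k \<tau> + G k \<tau>)" if t: "\<tau> \<in> \<Omega> k" for \<tau>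
    unfolding gd_add[OF F s t] gd_add[OF G s t] by (simp add: ac_simps)
  show "F (k + l) (\<sigma> \<and>\<^sub>\<Omega> \<tau>) + G (k + l) (\<sigma> \<and>\<^sub>\<Omega> \<tau>) =
      (F k \<sigma> + G k \<sigma>) \<and>\<^sub>\<Omega> \<tau> + sc ((- 1) ^ (m * k)) (\<sigma> \<and>\<^sub>\<Omega> (F l \<tau> + G l \<tau>))" if t: "\<tau> \<in> \<Omega> l" for l \<tau>
    unfolding gd_wedge[OF F s t] gd_wedge[OF G s t] by (simp add: fun_eq_iff algebra_simps)
qed

lemma gd_scale: assumes F: "graded_derivation m F"
  shows "graded_derivation m (\<lambda>k \<omega>. sc c (F k \<omega>))"
proof (rule graded_derivationI)
  fix k \<sigma> assume s: "\<sigma> \<in> \<Omega> k"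
  show "sc c (F k \<sigma>) \<in> \<Omega> (k + m)" by (rule Om_sc[OF gd_Om[OF F s]])
  show "sc c (F k (\<sigma> + \<tau>)) = sc c (F k \<sigma>) + sc c (F k \<tau>)" if t: "\<tau> \<in> \<Omega> k" for \<tau>
    unfolding gd_add[OF F s t] by (simp add: fun_eq_iff algebra_simps)
  show "sc c (F (k + l) (\<sigma> \<and>\<^sub>\<Omega> \<tau>)) = sc c (F k \<sigma>) \<and>\<^sub>\<Omega> \<tau> + sc ((- 1) ^ (m * k)) (\<sigma> \<and>\<^sub>\<Omega> sc c (F l \<tau>))"
    if t: "\<tau> \<in> \<Omega> l" for l \<tau>
    unfolding gd_wedge[OF F s t] by (simp add: fun_eq_iff algebra_simps)
qed

lemma Om_wedge_commute: "\<sigma> \<in> \<Omega> k \<Longrightarrow> \<tau> \<in> \<Omega> l \<Longrightarrow> \<sigma> \<and>\<^sub>\<Omega> \<tau> = sc ((- 1) ^ (k * l)) (\<tau> \<and>\<^sub>\<Omega> \<sigma>)"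
  by (rule wedge_commute[OF Om_homog Om_homog])

lemma gd_wedge_left: assumes F: "graded_derivation m F" and \<rho>: "\<rho> \<in> \<Omega> n"
  shows "graded_derivation (n + m) (\<lambda>k \<omega>. \<rho> \<and>\<^sub>\<Omega> F k \<omega>)"
proof (rule graded_derivationI)
  fix k \<sigma> assume s: "\<sigma> \<in> \<Omega> k"
  show "\<rho> \<and>\<^sub>\<Omega> F k \<sigma> \<in> \<Omega> (k + (n + m))"
    using wedge_Om[OF \<rho> gd_Om[OF F s]] by (simp only: add.left_commute)
  show "\<rho> \<and>\<^sub>\<Omega> F k (\<sigma> + \<tau>) = \<rho> \<and>\<^sub>\<Omega> F k \<sigma> + \<rho> \<and>\<^sub>\<Omega> F k \<tau>" if t: "\<tau> \<in> \<Omega> k" for \<tau>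
    unfolding gd_add[OF F s t] by simp
  show "\<rho> \<and>\<^sub>\<Omega> F (k + l) (\<sigma> \<and>\<^sub>\<Omega> \<tau>) =
      (\<rho> \<and>\<^sub>\<Omega> F k \<sigma>) \<and>\<^sub>\<Omega> \<tau> + sc ((- 1) ^ ((n + m) * k)) (\<sigma> \<and>\<^sub>\<Omega> (\<rho> \<and>\<^sub>\<Omega> F l \<tau>))"
    if t: "\<tau> \<in> \<Omega> l" for l \<tau>
  proof -
    have "\<sigma> \<and>\<^sub>\<Omega> (\<rho> \<and>\<^sub>\<Omega> F l \<tau>) = (\<sigma> \<and>\<^sub>\<Omega> \<rho>) \<and>\<^sub>\<Omega> F l \<tau>" by (simp only: wedge_assoc)
    also have "\<dots> = sc ((- 1) ^ (k * n)) (\<rho> \<and>\<^sub>\<Omega> (\<sigma> \<and>\<^sub>\<Omega> F l \<tau>))"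
      by (simp only: Om_wedge_commute[OF s \<rho>] wedge_linear wedge_assoc)
    finally show ?thesis
      unfolding gd_wedge[OF F s t] by (simp add: wedge_assoc fun_eq_iff minus_one_power_iff)
  qed
qed

lemma gd_commutator: assumes F: "graded_derivation m F" and G: "graded_derivation n G"
  shows "graded_derivation (m + n) (\<lambda>k \<omega>. F (k + n) (G k \<omega>) - sc ((- 1) ^ (m * n)) (G (k + m) (F k \<omega>)))"
proof (rule graded_derivationI)
  fix k \<sigma> assume s: "\<sigma> \<in> \<Omega> k"
  have FG: "F (k + n) (G k \<sigma>) \<in> \<Omega> (k + (m + n))" if "\<sigma> \<in> \<Omega> k" for k \<sigma>
    using gd_Om[OF F gd_Om[OF G that]] by (simp only: ac_simps)
  have GF: "G (k + m) (F k \<sigma>) \<in> \<Omega> (k + (m + n))" if "\<sigma> \<in> \<Omega> k" for k \<sigma>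
    using gd_Om[OF G gd_Om[OF F that]] by (simp only: ac_simps)
  show "F (k + n) (G k \<sigma>) - sc ((- 1) ^ (m * n)) (G (k + m) (F k \<sigma>)) \<in> \<Omega> (k + (m + n))"
    by (intro Om_diff Om_sc FG GF s)
  show "F (k + n) (G k (\<sigma> + \<tau>)) - sc ((- 1) ^ (m * n)) (G (k + m) (F k (\<sigma> + \<tau>))) =
      F (k + n) (G k \<sigma>) - sc ((- 1) ^ (m * n)) (G (k + m) (F k \<sigma>)) +
      (F (k + n) (G k \<tau>) - sc ((- 1) ^ (m * n)) (G (k + m) (F k \<tau>)))" if t: "\<tau> \<in> \<Omega> k" for \<tau>
    unfolding gd_add[OF F s t] gd_add[OF G s t] gd_add[OF F gd_Om[OF G s] gd_Om[OF G t]]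
      gd_add[OF G gd_Om[OF F s] gd_Om[OF F t]] by (simp add: fun_eq_iff algebra_simps)
  fix l \<tau> assume t: "\<tau> \<in> \<Omega> l"
  have expand: "H (k + l + n') (K (k + l) (\<sigma> \<and>\<^sub>\<Omega> \<tau>)) = H (k + n') (K k \<sigma>) \<and>\<^sub>\<Omega> \<tau>
      + sc ((- 1) ^ (m' * (k + n'))) (K k \<sigma> \<and>\<^sub>\<Omega> H l \<tau>)
      + sc ((- 1) ^ (n' * k)) (H k \<sigma> \<and>\<^sub>\<Omega> K l \<tau>)
      + sc ((- 1) ^ (n' * k)) (sc ((- 1) ^ (m' * k)) (\<sigma> \<and>\<^sub>\<Omega> H (l + n') (K l \<tau>)))"
    if H: "graded_derivation m' H" and K: "graded_derivation n' K" for H K m' n'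
  proof -
    have a: "K k \<sigma> \<and>\<^sub>\<Omega> \<tau> \<in> \<Omega> (k + l + n')" using wedge_Om[OF gd_Om[OF K s] t] by (simp only: ac_simps)
    have b: "\<sigma> \<and>\<^sub>\<Omega> K l \<tau> \<in> \<Omega> (k + l + n')" using wedge_Om[OF s gd_Om[OF K t]] by (simp only: ac_simps)
    have "H (k + l + n') (K (k + l) (\<sigma> \<and>\<^sub>\<Omega> \<tau>)) =
        H (k + l + n') (K k \<sigma> \<and>\<^sub>\<Omega> \<tau>) + sc ((- 1) ^ (n' * k)) (H (k + l + n') (\<sigma> \<and>\<^sub>\<Omega> K l \<tau>))"
      unfolding gd_wedge[OF K s t] gd_add[OF H a Om_sc[OF b]] gd_sign[OF H b] by (rule refl)
    also have "H (k + l + n') (K k \<sigma> \<and>\<^sub>\<Omega> \<tau>) = H (k + n') (K k \<sigma>) \<and>\<^sub>\<Omega> \<tau>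
        + sc ((- 1) ^ (m' * (k + n'))) (K k \<sigma> \<and>\<^sub>\<Omega> H l \<tau>)"
      using gd_wedge[OF H gd_Om[OF K s] t] by (simp only: ac_simps)
    also have "H (k + l + n') (\<sigma> \<and>\<^sub>\<Omega> K l \<tau>) = H k \<sigma> \<and>\<^sub>\<Omega> K l \<tau>
        + sc ((- 1) ^ (m' * k)) (\<sigma> \<and>\<^sub>\<Omega> H (l + n') (K l \<tau>))"
      using gd_wedge[OF H s gd_Om[OF K t]] by (simp only: ac_simps)
    finally show ?thesis by (simp add: fun_eq_iff algebra_simps)
  qed
  show "F (k + l + n) (G (k + l) (\<sigma> \<and>\<^sub>\<Omega> \<tau>)) - sc ((- 1) ^ (m * n)) (G (k + l + m) (F (k + l) (\<sigma> \<and>\<^sub>\<Omega> \<tau>))) =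
      (F (k + n) (G k \<sigma>) - sc ((- 1) ^ (m * n)) (G (k + m) (F k \<sigma>))) \<and>\<^sub>\<Omega> \<tau> +
      sc ((- 1) ^ ((m + n) * k)) (\<sigma> \<and>\<^sub>\<Omega> (F (l + n) (G l \<tau>) - sc ((- 1) ^ (m * n)) (G (l + m) (F l \<tau>))))"
    unfolding expand[OF F G] expand[OF G F]
    by (cases "even m"; cases "even n"; cases "even k") (simp_all add: fun_eq_iff minus_one_power_iff)
qed

lemma gd_induced: "field_derivation V N \<Longrightarrow> graded_derivation 0 (\<lambda>_. induced V N)"
proof (rule graded_derivationI)
  assume VN: "field_derivation V N"
  fix k \<sigma> assume s: "\<sigma> \<in> \<Omega> k"
  show "induced V N \<sigma> \<in> \<Omega> (k + 0)" using induced_Om[OF VN s] by simp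
  show "induced V N (\<sigma> + \<tau>) = induced V N \<sigma> + induced V N \<tau>" if "\<tau> \<in> \<Omega> k" for \<tau>
    by (rule induced_add[OF VN]) (use s that in auto)
  show "induced V N (\<sigma> \<and>\<^sub>\<Omega> \<tau>) = induced V N \<sigma> \<and>\<^sub>\<Omega> \<tau> + sc ((- 1) ^ (0 * k)) (\<sigma> \<and>\<^sub>\<Omega> induced V N \<tau>)"
    if "\<tau> \<in> \<Omega> l" for l \<tau>
    using induced_wedge[OF VN s that] by (simp add: fun_eq_iff)
qed

section \<open>Poisson structures and the Koszul bracket\<close>

lemma df_add: "f \<in> \<F> \<Longrightarrow> g \<in> \<F> \<Longrightarrow> df (f + g) = df f + df g"
  by (simp only: zero_form_add ext_d_add[OF zero_form_Om zero_form_Om])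

lemma df_mult: assumes "f \<in> \<F>" "g \<in> \<F>" shows "df (f * g) = f \<cdot> df g + g \<cdot> df f"
  unfolding zero_form_mult ext_d_fmul[OF assms(1) zero_form_Om[OF assms(2)]] wedge_zero_form
  by (rule add.commute)

lemma df_const: "df (\<lambda>_. c) = 0"
proof (rule form_eqI)
  show "df (\<lambda>_. c) \<in> \<Omega> (Suc 0)" by (rule df_Om) simp
  show "0 \<in> \<Omega> (Suc 0)" by (rule Om_0)
  show "ins X (df (\<lambda>_. c)) = ins X 0" if "X \<in> \<X>" for X
  proof -
    have "ins X (df (\<lambda>_. c)) = zero_form 0" unfolding df_apply[OF F_const that] X_const[OF that] ..
    also have "zero_form 0 = ins X 0" by (simp add: zero_form_def fun_eq_iff)
    finally show ?thesis .
  qed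
qed

lemma df_scale: assumes "f \<in> \<F>" shows "df ((\<lambda>_. c) * f) = (\<lambda>_. c) \<cdot> df f"
  unfolding df_mult[OF F_const assms] df_const by (simp add: fun_eq_iff)

lemma df_Om1: "f \<in> \<F> \<Longrightarrow> df f \<in> \<Omega> 1"
  using df_Om by simp

lemma one_form_ins: "\<beta> \<in> \<Omega> 1 \<Longrightarrow> X \<in> \<X> \<Longrightarrow> ins X \<beta> = zero_form (\<beta> [X])"
  using Om_0_eq[of "ins X \<beta>"] ins_Om[of \<beta> 1 X] by (simp add: ins_apply)

text \<open>
  Two applications of \<open>one_form_vanishing\<close>. Curvature, torsion and similar tensors are shown
  to vanish in this way.
\<close>

lemma bilinear_vanishing:
  fixes F :: "'m form \<Rightarrow> 'm form \<Rightarrow> 'b \<Rightarrow> 'm \<Rightarrow> real"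
  assumes "\<And>\<sigma> \<tau> \<beta>. \<sigma> \<in> \<Omega> 1 \<Longrightarrow> \<tau> \<in> \<Omega> 1 \<Longrightarrow> \<beta> \<in> \<Omega> 1 \<Longrightarrow> F (\<sigma> + \<tau>) \<beta> = F \<sigma> \<beta> + F \<tau> \<beta>"
    "\<And>f \<sigma> \<beta>. f \<in> \<F> \<Longrightarrow> \<sigma> \<in> \<Omega> 1 \<Longrightarrow> \<beta> \<in> \<Omega> 1 \<Longrightarrow> F (f \<cdot> \<sigma>) \<beta> = f \<cdot> F \<sigma> \<beta>"
    "\<And>\<sigma> \<tau> \<alpha>. \<sigma> \<in> \<Omega> 1 \<Longrightarrow> \<tau> \<in> \<Omega> 1 \<Longrightarrow> \<alpha> \<in> \<Omega> 1 \<Longrightarrow> F \<alpha> (\<sigma> + \<tau>) = F \<alpha> \<sigma> + F \<alpha> \<tau>"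
    "\<And>f \<sigma> \<alpha>. f \<in> \<F> \<Longrightarrow> \<sigma> \<in> \<Omega> 1 \<Longrightarrow> \<alpha> \<in> \<Omega> 1 \<Longrightarrow> F \<alpha> (f \<cdot> \<sigma>) = f \<cdot> F \<alpha> \<sigma>"
    "\<And>f g. f \<in> \<F> \<Longrightarrow> g \<in> \<F> \<Longrightarrow> F (df f) (df g) = 0"
    and ab: "\<alpha> \<in> \<Omega> 1" "\<beta> \<in> \<Omega> 1"
  shows "F \<alpha> \<beta> = 0"
proof -
  have "F \<alpha> (df g) = 0" if g: "g \<in> \<F>" for g
    by (rule one_form_vanishing[where F = "\<lambda>\<alpha>. F \<alpha> (df g)", OF _ _ _ ab(1)])
       (rule assms(1,2,5); (assumption | rule df_Om1 g)+)+
  note zero = this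
  show ?thesis
    by (rule one_form_vanishing[where F = "F \<alpha>", OF _ _ _ ab(2)])
       (rule assms(3,4) zero; (assumption | rule ab)+)+
qed

lemma skew_bilinear_vanishing:
  fixes F :: "'m form \<Rightarrow> 'm form \<Rightarrow> 'b \<Rightarrow> 'm \<Rightarrow> real"
  assumes swap: "\<And>\<alpha> \<beta>. \<alpha> \<in> \<Omega> 1 \<Longrightarrow> \<beta> \<in> \<Omega> 1 \<Longrightarrow> F \<alpha> \<beta> = - F \<beta> \<alpha>"
    and add: "\<And>\<sigma> \<tau> \<alpha>. \<sigma> \<in> \<Omega> 1 \<Longrightarrow> \<tau> \<in> \<Omega> 1 \<Longrightarrow> \<alpha> \<in> \<Omega> 1 \<Longrightarrow> F \<alpha> (\<sigma> + \<tau>) = F \<alpha> \<sigma> + F \<alpha> \<tau>"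
    and fmul: "\<And>f \<sigma> \<alpha>. f \<in> \<F> \<Longrightarrow> \<sigma> \<in> \<Omega> 1 \<Longrightarrow> \<alpha> \<in> \<Omega> 1 \<Longrightarrow> F \<alpha> (f \<cdot> \<sigma>) = f \<cdot> F \<alpha> \<sigma>"
    and exact: "\<And>f g. f \<in> \<F> \<Longrightarrow> g \<in> \<F> \<Longrightarrow> F (df f) (df g) = 0"
    and ab: "\<alpha> \<in> \<Omega> 1" "\<beta> \<in> \<Omega> 1"
  shows "F \<alpha> \<beta> = 0"
proof (rule bilinear_vanishing[where F = F, OF _ _ add fmul exact ab])
  show "F (\<sigma> + \<tau>) \<beta> = F \<sigma> \<beta> + F \<tau> \<beta>" if "\<sigma> \<in> \<Omega> 1" "\<tau> \<in> \<Omega> 1" "\<beta> \<in> \<Omega> 1" for \<sigma> \<tau> \<beta>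
  proof -
    have "F (\<sigma> + \<tau>) \<beta> = - F \<beta> (\<sigma> + \<tau>)" by (rule swap[OF Om_add[OF that(1,2)] that(3)])
    also have "\<dots> = - F \<beta> \<sigma> + - F \<beta> \<tau>" by (simp only: add[OF that] minus_add_distrib)
    finally show ?thesis by (simp only: swap[OF that(1,3)] swap[OF that(2,3)])
  qed
  show "F (f \<cdot> \<sigma>) \<beta> = f \<cdot> F \<sigma> \<beta>" if "f \<in> \<F>" "\<sigma> \<in> \<Omega> 1" "\<beta> \<in> \<Omega> 1" for f \<sigma> \<beta>
  proof -
    have "F (f \<cdot> \<sigma>) \<beta> = - F \<beta> (f \<cdot> \<sigma>)" by (rule swap[OF Om_fmul[OF that(1,2)] that(3)])
    also have "\<dots> = - (f \<cdot> F \<beta> \<sigma>)" by (simp only: fmul[OF that])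
    also have "\<dots> = f \<cdot> - F \<beta> \<sigma>" by (simp add: fun_eq_iff right_diff_distrib)
    finally show ?thesis by (simp only: swap[OF that(2,3)])
  qed
qed

end

locale bivector_manifold = manifold A for A :: "('m::{t2_space, second_countable_topology}, 'e::real_inner) chart set" +
  fixes \<pi> assumes bivector: "bivector A \<pi>"
begin

lemma pi_F [simp, intro]: "\<pi> \<alpha> \<beta> \<in> \<F>"
proof (cases "\<alpha> \<in> \<Omega> 1 \<and> \<beta> \<in> \<Omega> 1")
  case True then show ?thesis using bivector unfolding bivector_def by blast
next
  case False
  then have "\<pi> \<alpha> \<beta> = 0" using bivector unfolding bivector_def by blast
  then show ?thesis using F_0 by metis
qed

lemma pi_swap: "\<alpha> \<in> \<Omega> 1 \<Longrightarrow> \<beta> \<in> \<Omega> 1 \<Longrightarrow> \<pi> \<alpha> \<beta> = - \<pi> \<beta> \<alpha>"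
  using bivector unfolding bivector_def by blast

lemma pi_add1: "\<alpha> \<in> \<Omega> 1 \<Longrightarrow> \<beta> \<in> \<Omega> 1 \<Longrightarrow> \<gamma> \<in> \<Omega> 1 \<Longrightarrow> \<pi> (\<alpha> + \<beta>) \<gamma> = \<pi> \<alpha> \<gamma> + \<pi> \<beta> \<gamma>"
  using bivector unfolding bivector_def by blast

lemma pi_fmul1: "f \<in> \<F> \<Longrightarrow> \<alpha> \<in> \<Omega> 1 \<Longrightarrow> \<beta> \<in> \<Omega> 1 \<Longrightarrow> \<pi> (f \<cdot> \<alpha>) \<beta> = f * \<pi> \<alpha> \<beta>"
  using bivector unfolding bivector_def by blast

lemma pi_add2: assumes "\<alpha> \<in> \<Omega> 1" "\<beta> \<in> \<Omega> 1" "\<gamma> \<in> \<Omega> 1" shows "\<pi> \<gamma> (\<alpha> + \<beta>) = \<pi> \<gamma> \<alpha> + \<pi> \<gamma> \<beta>"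
  using pi_swap[OF assms(3) Om_add[OF assms(1,2)]] pi_add1[OF assms] pi_swap[OF assms(3,1)] pi_swap[OF assms(3,2)]
  by simp

lemma pi_fmul2: assumes "f \<in> \<F>" "\<alpha> \<in> \<Omega> 1" "\<beta> \<in> \<Omega> 1" shows "\<pi> \<beta> (f \<cdot> \<alpha>) = f * \<pi> \<beta> \<alpha>"
  using pi_swap[OF assms(3) Om_fmul[OF assms(1,2)]] pi_fmul1[OF assms] pi_swap[OF assms(3,2)] by simp

abbreviation "an \<equiv> anchor A \<pi>"
abbreviation "br \<equiv> function_bracket A \<pi>"

lemma anchor_apply: "f \<in> \<F> \<Longrightarrow> an \<alpha> f = \<pi> \<alpha> (df f)" by (simp add: anchor_def)

lemma anchor_X [simp, intro]: assumes a: "\<alpha> \<in> \<Omega> 1" shows "an \<alpha> \<in> \<X>"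
proof (rule vector_fieldI)
  fix f assume f: "f \<in> \<F>"
  show "an \<alpha> f \<in> \<F>" unfolding anchor_apply[OF f] by (rule pi_F)
  show "an \<alpha> ((\<lambda>_. c) * f) = (\<lambda>_. c) * an \<alpha> f" for c
    unfolding anchor_apply[OF F_mult[OF F_const f]] anchor_apply[OF f] df_scale[OF f]
    by (rule pi_fmul2[OF F_const df_Om1[OF f] a])
  fix g assume g: "g \<in> \<F>"
  show "an \<alpha> (f + g) = an \<alpha> f + an \<alpha> g"
    unfolding anchor_apply[OF F_add[OF f g]] anchor_apply[OF f] anchor_apply[OF g] df_add[OF f g]
    by (rule pi_add2[OF df_Om1[OF f] df_Om1[OF g] a])
  have "\<pi> \<alpha> (f \<cdot> df g + g \<cdot> df f) = f * \<pi> \<alpha> (df g) + g * \<pi> \<alpha> (df f)"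
    using pi_add2[OF Om_fmul[OF f df_Om1[OF g]] Om_fmul[OF g df_Om1[OF f]] a]
      pi_fmul2[OF f df_Om1[OF g] a] pi_fmul2[OF g df_Om1[OF f] a] by metis
  then show "an \<alpha> (f * g) = an \<alpha> f * g + f * an \<alpha> g"
    unfolding anchor_apply[OF F_mult[OF f g]] anchor_apply[OF f] anchor_apply[OF g] df_mult[OF f g]
    by (simp only: mult.commute add.commute)
qed (simp add: anchor_def)

lemma anchor_add: assumes "\<alpha> \<in> \<Omega> 1" "\<beta> \<in> \<Omega> 1" shows "an (\<alpha> + \<beta>) = an \<alpha> + an \<beta>"
proof (rule vector_field_eqI)
  fix f assume f: "f \<in> \<F>"
  show "an (\<alpha> + \<beta>) f = (an \<alpha> + an \<beta>) f"
    using pi_add1[OF assms df_Om1[OF f]] by (simp only: anchor_apply[OF f] plus_fun_apply)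
qed (use assms in auto)

lemma anchor_fmul: assumes "h \<in> \<F>" "\<alpha> \<in> \<Omega> 1" shows "an (h \<cdot> \<alpha>) = h \<cdot> an \<alpha>"
proof (rule vector_field_eqI)
  fix f assume f: "f \<in> \<F>"
  show "an (h \<cdot> \<alpha>) f = (h \<cdot> an \<alpha>) f"
    using pi_fmul1[OF assms df_Om1[OF f]] by (simp only: anchor_apply[OF f] fmul_def)
qed (use assms in auto)

lemma anchor_minus: assumes "\<alpha> \<in> \<Omega> 1" shows "an (- \<alpha>) = - an \<alpha>"
proof -
  have "- \<sigma> = (\<lambda>_. - 1) \<cdot> \<sigma>" for \<sigma> :: "'x \<Rightarrow> 'm \<Rightarrow> real" by (simp add: fun_eq_iff)
  then show ?thesis using anchor_fmul[OF F_const assms, of "-1"] by metis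
qed

lemma eval_anchor: assumes a: "\<alpha> \<in> \<Omega> 1" and b: "\<beta> \<in> \<Omega> 1" shows "\<beta> [an \<alpha>] = \<pi> \<alpha> \<beta>"
proof -
  have "(\<lambda>_::unit. \<beta> [an \<alpha>]) = (\<lambda>_. \<pi> \<alpha> \<beta>)"
  proof (rule one_form_eqI[where F = "\<lambda>\<beta> _. \<beta> [an \<alpha>]" and G = "\<lambda>\<beta> _. \<pi> \<alpha> \<beta>", OF _ _ _ _ _ b])
    show "(\<lambda>_. \<pi> \<alpha> (\<sigma> + \<tau>)) = (\<lambda>_. \<pi> \<alpha> \<sigma>) + (\<lambda>_. \<pi> \<alpha> \<tau>)" if "\<sigma> \<in> \<Omega> 1" "\<tau> \<in> \<Omega> 1" for \<sigma> \<tau>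
      using pi_add2[OF that a] by (simp add: fun_eq_iff)
    show "(\<lambda>_. \<pi> \<alpha> (f \<cdot> \<sigma>)) = f \<cdot> (\<lambda>_. \<pi> \<alpha> \<sigma>)" if "f \<in> \<F>" "\<sigma> \<in> \<Omega> 1" for f \<sigma>
      using pi_fmul2[OF that a] by (simp add: fun_eq_iff)
    show "(\<lambda>_. df f [an \<alpha>]) = (\<lambda>_. \<pi> \<alpha> (df f))" if "f \<in> \<F>" for f
      using df_eval[OF that anchor_X[OF a]] anchor_apply[OF that] by metis
  qed (simp_all add: fun_eq_iff)
  then show ?thesis by metis
qed

lemma fb_F [simp, intro]: "br f g \<in> \<F>" by (simp add: function_bracket_def)
lemma fb_anchor: "g \<in> \<F> \<Longrightarrow> br f g = an (df f) g"
  by (simp only: function_bracket_def anchor_apply)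
lemma fb_swap: "f \<in> \<F> \<Longrightarrow> g \<in> \<F> \<Longrightarrow> br f g = - br g f"
  unfolding function_bracket_def by (rule pi_swap[OF df_Om1 df_Om1])

end

context manifold
begin

lemma Lie_scale_form: "X \<in> \<X> \<Longrightarrow> f \<in> \<F> \<Longrightarrow> \<beta> \<in> \<Omega> k \<Longrightarrow> Lie X (f \<cdot> \<beta>) = f \<cdot> Lie X \<beta> + X f \<cdot> \<beta>"
  by (rule induced_fmul[OF lie_field_derivation])

lemma Lie_df: assumes X: "X \<in> \<X>" and f: "f \<in> \<F>" shows "Lie X (df f) = df (X f)"
  using ext_d_Lie[OF X zero_form_Om[OF f]] induced_Om_0[OF X f, of "lie_bracket X"] by simp

lemma bilinear_onI:
  assumes "\<And>x y z. x \<in> S \<Longrightarrow> y \<in> S \<Longrightarrow> z \<in> S \<Longrightarrow> b (x + y) z = b x z + b y z"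
    "\<And>x y z. x \<in> S \<Longrightarrow> y \<in> S \<Longrightarrow> z \<in> S \<Longrightarrow> b z (x + y) = b z x + b z y"
    "\<And>c x z. x \<in> S \<Longrightarrow> z \<in> S \<Longrightarrow> b (sc c x) z = sc c (b x z)"
    "\<And>c x z. x \<in> S \<Longrightarrow> z \<in> S \<Longrightarrow> b z (sc c x) = sc c (b z x)"
  shows "bilinear_on sc S b"
  using assms unfolding bilinear_on_def linear_on_def by simp

text \<open>
  The classical formula for the Koszul bracket. That it exists and is unique makes the
  description operator in the definition of the bracket denote it (\<open>koszul_bracket_eq\<close>).
\<close>

definition koszul :: "('m form \<Rightarrow> 'm form \<Rightarrow> 'm \<Rightarrow> real) \<Rightarrow> 'm form \<Rightarrow> 'm form \<Rightarrow> 'm form" where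
  "koszul \<pi> \<alpha> \<beta> = (if \<alpha> \<in> \<Omega> 1 \<and> \<beta> \<in> \<Omega> 1
     then Lie (anchor A \<pi> \<alpha>) \<beta> - Lie (anchor A \<pi> \<beta>) \<alpha> - df (\<pi> \<alpha> \<beta>) else 0)"

end

locale poisson_manifold = bivector_manifold A \<pi> for A :: "('m::{t2_space, second_countable_topology}, 'e::real_inner) chart set" and \<pi> +
  assumes poisson: "poisson_structure A \<pi>"
begin

abbreviation "K \<equiv> koszul \<pi>"

text \<open>
  This is the Jacobi identity, read as an equation between derivations.
\<close>

lemma anchor_df_bracket: assumes f: "f \<in> \<F>" and g: "g \<in> \<F>"
  shows "an (df (br f g)) = lie_bracket (an (df f)) (an (df g))"
proof (rule vector_field_eqI)
  note b = fb_F
  show "an (df (br f g)) \<in> \<X>" by (rule anchor_X[OF df_Om1[OF b]])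
  show "lie_bracket (an (df f)) (an (df g)) \<in> \<X>"
    by (intro VF_lie anchor_X df_Om1 f g)
  fix h assume h: "h \<in> \<F>"
  have "br f (br g h) + br g (br h f) + br h (br f g) = 0"
    using poisson f g h unfolding poisson_structure_def by blast
  moreover have "br h (br f g) = - br (br f g) h" by (rule fb_swap[OF h b])
  moreover have "br g (br h f) = - br g (br f h)"
  proof -
    have "br h f = - br f h" by (rule fb_swap[OF h f])
    then show ?thesis using X_minus[OF anchor_X[OF df_Om1[OF g]] b] fb_anchor b F_minus[OF b] by metis
  qed
  ultimately have "br (br f g) h = br f (br g h) - br g (br f h)"
    by (simp add: eq_neg_iff_add_eq_0 algebra_simps)
  then show "an (df (br f g)) h = lie_bracket (an (df f)) (an (df g)) h"
    by (simp only: lie_bracket_apply fb_anchor[OF h] fb_anchor[OF X_F[OF anchor_X[OF df_Om1[OF g]] h]]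
        fb_anchor[OF X_F[OF anchor_X[OF df_Om1[OF f]] h]])
qed

lemma K_Om [simp, intro]: "K \<alpha> \<beta> \<in> \<Omega> 1"
proof (cases "\<alpha> \<in> \<Omega> 1 \<and> \<beta> \<in> \<Omega> 1")
  case True
  then show ?thesis unfolding koszul_def if_P[OF True]
    by (intro Om_diff Lie_Om anchor_X df_Om1 pi_F; simp)
next
  case False
  then have "K \<alpha> \<beta> = 0" by (auto simp: koszul_def)
  then show ?thesis using Om_0 by metis
qed

lemma K_eq: "\<alpha> \<in> \<Omega> 1 \<Longrightarrow> \<beta> \<in> \<Omega> 1 \<Longrightarrow> K \<alpha> \<beta> = Lie (an \<alpha>) \<beta> - Lie (an \<beta>) \<alpha> - df (\<pi> \<alpha> \<beta>)"
  by (simp only: koszul_def if_True simp_thms)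

lemma df_minus: "f \<in> \<F> \<Longrightarrow> df (- f) = - df f"
proof -
  assume f: "f \<in> \<F>"
  have e: "- h = (\<lambda>_. - 1) * h" for h :: "'m \<Rightarrow> real" by (simp add: fun_eq_iff)
  have "df (- f) = (\<lambda>_. - 1) \<cdot> df f" by (subst e, rule df_scale[OF f])
  then show ?thesis by (simp add: fun_eq_iff)
qed

lemma K_swap: "K \<alpha> \<beta> = - K \<beta> \<alpha>"
proof (cases "\<alpha> \<in> \<Omega> 1 \<and> \<beta> \<in> \<Omega> 1")
  case True
  then have a: "\<alpha> \<in> \<Omega> 1" and b: "\<beta> \<in> \<Omega> 1" by auto
  have "df (\<pi> \<alpha> \<beta>) = - df (\<pi> \<beta> \<alpha>)"
    using pi_swap[OF a b] df_minus[OF pi_F] by metis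
  then show ?thesis unfolding K_eq[OF a b] K_eq[OF b a] by simp
qed (auto simp: koszul_def)

lemma K_add2: assumes a: "\<alpha> \<in> \<Omega> 1" and b: "\<beta> \<in> \<Omega> 1" and c: "\<gamma> \<in> \<Omega> 1"
  shows "K \<alpha> (\<beta> + \<gamma>) = K \<alpha> \<beta> + K \<alpha> \<gamma>"
proof -
  note X = anchor_X
  have "Lie (an \<alpha>) (\<beta> + \<gamma>) = Lie (an \<alpha>) \<beta> + Lie (an \<alpha>) \<gamma>" by (rule Lie_add[OF X[OF a] b c])
  moreover have "Lie (an (\<beta> + \<gamma>)) \<alpha> = Lie (an \<beta>) \<alpha> + Lie (an \<gamma>) \<alpha>"
    unfolding anchor_add[OF b c] by (rule Lie_add_vf[OF X[OF b] X[OF c] a])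
  moreover have "df (\<pi> \<alpha> (\<beta> + \<gamma>)) = df (\<pi> \<alpha> \<beta>) + df (\<pi> \<alpha> \<gamma>)"
    unfolding pi_add2[OF b c a] by (rule df_add[OF pi_F pi_F])
  ultimately show ?thesis unfolding K_eq[OF a b] K_eq[OF a c] K_eq[OF a Om_add[OF b c]] by simp
qed

lemma K_fmul2: assumes f: "f \<in> \<F>" and a: "\<alpha> \<in> \<Omega> 1" and b: "\<beta> \<in> \<Omega> 1"
  shows "K \<alpha> (f \<cdot> \<beta>) = f \<cdot> K \<alpha> \<beta> + an \<alpha> f \<cdot> \<beta>"
proof -
  note X = anchor_X
  have 1: "Lie (an \<alpha>) (f \<cdot> \<beta>) = f \<cdot> Lie (an \<alpha>) \<beta> + an \<alpha> f \<cdot> \<beta>" by (rule Lie_scale_form[OF X[OF a] f b])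
  have "ins (an \<beta>) \<alpha> = zero_form (\<pi> \<beta> \<alpha>)"
    using one_form_ins[OF a X[OF b]] eval_anchor[OF b a] by metis
  then have 2: "Lie (an (f \<cdot> \<beta>)) \<alpha> = f \<cdot> Lie (an \<beta>) \<alpha> + \<pi> \<beta> \<alpha> \<cdot> df f"
    unfolding anchor_fmul[OF f b] Lie_fmul_vf[OF f X[OF b] a] by simp
  have 3: "df (\<pi> \<alpha> (f \<cdot> \<beta>)) = f \<cdot> df (\<pi> \<alpha> \<beta>) + \<pi> \<alpha> \<beta> \<cdot> df f"
    unfolding pi_fmul2[OF f b a] by (rule df_mult[OF f pi_F])
  have 4: "\<pi> \<beta> \<alpha> = - \<pi> \<alpha> \<beta>" by (rule pi_swap[OF b a])
  show ?thesis
    unfolding K_eq[OF a b] K_eq[OF a Om_fmul[OF f b]] 1 2 3 4 by (simp add: fun_eq_iff algebra_simps)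
qed

lemma K_add1: assumes a: "\<alpha> \<in> \<Omega> 1" and b: "\<beta> \<in> \<Omega> 1" and c: "\<gamma> \<in> \<Omega> 1"
  shows "K (\<beta> + \<gamma>) \<alpha> = K \<beta> \<alpha> + K \<gamma> \<alpha>"
  unfolding K_swap[of "\<beta> + \<gamma>" \<alpha>] K_swap[of \<beta> \<alpha>] K_swap[of \<gamma> \<alpha>] K_add2[OF assms] by simp

lemma K_exact: assumes f: "f \<in> \<F>" and g: "g \<in> \<F>" shows "K (df f) (df g) = df (br f g)"
proof -
  note X = anchor_X[OF df_Om1]
  have "Lie (an (df f)) (df g) = df (br f g)" using Lie_df[OF X[OF f] g] fb_anchor[OF g] by metis
  moreover have "Lie (an (df g)) (df f) = - df (br f g)"
    using Lie_df[OF X[OF g] f] fb_anchor[OF f] fb_swap[OF g f] df_minus[OF fb_F] by metis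
  ultimately show ?thesis unfolding K_eq[OF df_Om1[OF f] df_Om1[OF g]] by (simp add: function_bracket_def)
qed

text \<open>
  The difference is a tensor, and on exact forms it vanishes by \<open>anchor_df_bracket\<close>.
\<close>

lemma anchor_K: assumes "\<alpha> \<in> \<Omega> 1" "\<beta> \<in> \<Omega> 1" shows "an (K \<alpha> \<beta>) = lie_bracket (an \<alpha>) (an \<beta>)"
proof -
  note X = anchor_X
  let ?F = "\<lambda>\<alpha> \<beta>. an (K \<alpha> \<beta>) - lie_bracket (an \<alpha>) (an \<beta>)"
  have swap: "?F \<alpha> \<beta> = - ?F \<beta> \<alpha>" for \<alpha> \<beta>
  proof -
    have "an (K \<alpha> \<beta>) = - an (K \<beta> \<alpha>)" using anchor_minus[OF K_Om] K_swap by metis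
    then show ?thesis using lie_bracket_swap[of "an \<alpha>" "an \<beta>"] by (simp only: minus_diff_eq diff_minus_eq_add) simp
  qed
  have add2: "?F \<alpha> (\<sigma> + \<tau>) = ?F \<alpha> \<sigma> + ?F \<alpha> \<tau>" if s: "\<sigma> \<in> \<Omega> 1" and t: "\<tau> \<in> \<Omega> 1" and a: "\<alpha> \<in> \<Omega> 1" for \<alpha> \<sigma> \<tau>
    unfolding K_add2[OF a s t] anchor_add[OF s t] anchor_add[OF K_Om K_Om]
      N_add[OF lie_field_derivation[OF X[OF a]] X[OF s] X[OF t]] by simp
  have fmul2: "?F \<alpha> (f \<cdot> \<sigma>) = f \<cdot> ?F \<alpha> \<sigma>" if f: "f \<in> \<F>" and s: "\<sigma> \<in> \<Omega> 1" and a: "\<alpha> \<in> \<Omega> 1" for \<alpha> f \<sigma>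
    unfolding K_fmul2[OF f a s] anchor_fmul[OF f s]
      anchor_add[OF Om_fmul[OF f K_Om] Om_fmul[OF X_F[OF X[OF a] f] s]] anchor_fmul[OF f K_Om]
      anchor_fmul[OF X_F[OF X[OF a] f] s] N_fmul[OF lie_field_derivation[OF X[OF a]] f X[OF s]]
    by (simp add: fun_eq_iff algebra_simps)
  have "?F \<alpha> \<beta> = 0"
  proof (rule skew_bilinear_vanishing[where F = ?F, OF _ _ _ _ assms])
    show "?F (df f) (df g) = 0" if f: "f \<in> \<F>" and g: "g \<in> \<F>" for f g
      unfolding K_exact[OF f g] anchor_df_bracket[OF f g] by simp
  qed (rule swap add2 fmul2; assumption?)+
  then show ?thesis by simp
qed

text \<open>
  The left-hand side is a tensor in each argument because \<open>#\<close> is a homomorphism, and on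
  exact forms it is \<open>d\<close> of the Jacobi identity for functions.
\<close>

lemma K_jacobi:
  assumes "\<alpha> \<in> \<Omega> 1" "\<beta> \<in> \<Omega> 1" "\<gamma> \<in> \<Omega> 1"
  shows "K \<alpha> (K \<beta> \<gamma>) + K \<beta> (K \<gamma> \<alpha>) + K \<gamma> (K \<alpha> \<beta>) = 0"
proof -
  note X = anchor_X
  let ?J = "\<lambda>\<alpha> \<beta> \<gamma>. K \<alpha> (K \<beta> \<gamma>) + K \<beta> (K \<gamma> \<alpha>) + K \<gamma> (K \<alpha> \<beta>)"
  have cyc: "?J \<alpha> \<beta> \<gamma> = ?J \<beta> \<gamma> \<alpha>" for \<alpha> \<beta> \<gamma> by (simp only: ac_simps)
  have add: "?J \<alpha> \<beta> (\<sigma> + \<tau>) = ?J \<alpha> \<beta> \<sigma> + ?J \<alpha> \<beta> \<tau>"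
    if a: "\<alpha> \<in> \<Omega> 1" and b: "\<beta> \<in> \<Omega> 1" and s: "\<sigma> \<in> \<Omega> 1" and t: "\<tau> \<in> \<Omega> 1" for \<alpha> \<beta> \<sigma> \<tau>
    unfolding K_add2[OF b s t] K_add1[OF a s t] K_add2[OF a K_Om K_Om] K_add2[OF b K_Om K_Om] K_add1[OF K_Om s t]
    by (simp only: ac_simps)
  have fmul: "?J \<alpha> \<beta> (f \<cdot> \<gamma>) = f \<cdot> ?J \<alpha> \<beta> \<gamma>"
    if f: "f \<in> \<F>" and a: "\<alpha> \<in> \<Omega> 1" and b: "\<beta> \<in> \<Omega> 1" and c: "\<gamma> \<in> \<Omega> 1" for \<alpha> \<beta> \<gamma> f
  proof -
    have A: "K \<alpha> (K \<beta> (f \<cdot> \<gamma>)) = (f \<cdot> K \<alpha> (K \<beta> \<gamma>) + an \<alpha> f \<cdot> K \<beta> \<gamma>) + (an \<beta> f \<cdot> K \<alpha> \<gamma> + an \<alpha> (an \<beta> f) \<cdot> \<gamma>)"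
      if a: "\<alpha> \<in> \<Omega> 1" and b: "\<beta> \<in> \<Omega> 1" for \<alpha> \<beta>
      unfolding K_fmul2[OF f b c] K_add2[OF a Om_fmul[OF f K_Om] Om_fmul[OF X_F[OF X[OF b] f] c]]
        K_fmul2[OF f a K_Om] K_fmul2[OF X_F[OF X[OF b] f] a c] by (rule refl)
    have B: "K (f \<cdot> \<gamma>) (K \<alpha> \<beta>) = - (f \<cdot> K (K \<alpha> \<beta>) \<gamma> + an (K \<alpha> \<beta>) f \<cdot> \<gamma>)"
      using K_swap[of "f \<cdot> \<gamma>"] K_fmul2[OF f K_Om c] by metis
    have C: "K \<beta> (K (f \<cdot> \<gamma>) \<alpha>) = - K \<beta> (K \<alpha> (f \<cdot> \<gamma>))" "K \<beta> (K \<gamma> \<alpha>) = - K \<beta> (K \<alpha> \<gamma>)"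
      "K \<gamma> (K \<alpha> \<beta>) = - K (K \<alpha> \<beta>) \<gamma>"
    proof -
      have m: "K \<beta> (- \<sigma>) = - K \<beta> \<sigma>" if s: "\<sigma> \<in> \<Omega> 1" for \<sigma>
      proof -
        have "K \<beta> (0 + 0) = K \<beta> 0 + K \<beta> 0" by (rule K_add2[OF b Om_0 Om_0])
        then have "K \<beta> 0 = 0" by simp
        moreover have "K \<beta> (\<sigma> + - \<sigma>) = K \<beta> \<sigma> + K \<beta> (- \<sigma>)" by (rule K_add2[OF b s Om_minus[OF s]])
        ultimately show ?thesis by (simp add: eq_neg_iff_add_eq_0 add.commute)
      qed
      show "K \<beta> (K (f \<cdot> \<gamma>) \<alpha>) = - K \<beta> (K \<alpha> (f \<cdot> \<gamma>))" "K \<beta> (K \<gamma> \<alpha>) = - K \<beta> (K \<alpha> \<gamma>)"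
        using m K_Om K_swap by metis+
      show "K \<gamma> (K \<alpha> \<beta>) = - K (K \<alpha> \<beta>) \<gamma>" by (rule K_swap)
    qed
    have L: "an (K \<alpha> \<beta>) f = an \<alpha> (an \<beta> f) - an \<beta> (an \<alpha> f)"
      unfolding anchor_K[OF a b] by (rule lie_bracket_apply)
    show ?thesis
      unfolding C A[OF a b] A[OF b a] B L by (simp add: fun_eq_iff algebra_simps)
  qed
  have e3: "?J (df f) (df g) (df h) = 0" if "f \<in> \<F>" "g \<in> \<F>" "h \<in> \<F>" for f g h
  proof -
    have "?J (df f) (df g) (df h) = df (br f (br g h) + br g (br h f) + br h (br f g))"
      using that by (simp only: K_exact fb_F df_add F_add)
    also have "br f (br g h) + br g (br h f) + br h (br f g) = 0"
      using poisson that unfolding poisson_structure_def by blast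
    also have "df 0 = 0" using df_const[of 0] by (simp add: zero_fun_def)
    finally show ?thesis .
  qed
  have e2: "?J (df f) (df g) \<gamma> = 0" if f: "f \<in> \<F>" and g: "g \<in> \<F>" and c: "\<gamma> \<in> \<Omega> 1" for f g \<gamma>
    by (rule one_form_vanishing[where F = "?J (df f) (df g)", OF _ _ _ c])
       ((rule add fmul e3; (assumption | rule df_Om1 f g)+)+)
  have e1: "?J (df g) \<gamma> \<beta> = 0" if g: "g \<in> \<F>" and c: "\<gamma> \<in> \<Omega> 1" and b: "\<beta> \<in> \<Omega> 1" for g \<gamma> \<beta>
  proof (rule one_form_vanishing[where F = "?J (df g) \<gamma>", OF _ _ _ b])
    show "?J (df g) \<gamma> (df f) = 0" if f: "f \<in> \<F>" for f using e2[OF f g c] cyc[of "df f" "df g" \<gamma>] by metis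
  qed ((rule add fmul; (assumption | rule df_Om1 g c)+)+)
  show ?thesis
  proof (rule one_form_vanishing[where F = "?J \<alpha> \<beta>", OF _ _ _ assms(3)])
    show "?J \<alpha> \<beta> (df f) = 0" if f: "f \<in> \<F>" for f using e1[OF f assms(1,2)] cyc[of "df f" \<alpha> \<beta>] by metis
  qed ((rule add fmul; (assumption | rule assms(1,2))+)+)
qed

lemma koszul_is_koszul_bracket: "is_koszul_bracket A \<pi> K"
  unfolding is_koszul_bracket_def
proof (intro conjI ballI allI impI)
  have s2: "K z (sc c x) = sc c (K z x)" if "x \<in> \<Omega> 1" "z \<in> \<Omega> 1" for c x z
    unfolding sc_fmul K_fmul2[OF F_const that(2,1)] X_const[OF anchor_X[OF that(2)]] by (simp add: fun_eq_iff)
  have m: "sc c (- \<omega>) = - sc c \<omega>" for c and \<omega> :: "'m form" by (simp add: fun_eq_iff)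
  show "bilinear_on sc (\<Omega> 1) K"
  proof (rule bilinear_onI)
    show "K (sc c x) z = sc c (K x z)" if "x \<in> \<Omega> 1" "z \<in> \<Omega> 1" for c x z
      using s2[OF that] K_swap m by metis
  qed (rule K_add1 K_add2 s2; assumption)+
  show "K \<alpha> \<beta> = - K \<beta> \<alpha>" for \<alpha> \<beta> by (rule K_swap)
  show "K \<alpha> \<beta> = 0" if "\<alpha> \<notin> \<Omega> 1 \<or> \<beta> \<notin> \<Omega> 1" for \<alpha> \<beta> using that by (auto simp: koszul_def)
qed (rule K_Om K_jacobi K_fmul2 K_exact; assumption?)+

lemma koszul_unique: assumes "is_koszul_bracket A \<pi> L" shows "L = K"
proof (rule ext, rule ext)
  fix \<alpha> \<beta>
  have L: "bilinear_on sc (\<Omega> 1) L" "\<And>\<alpha> \<beta>. \<alpha> \<in> \<Omega> 1 \<Longrightarrow> \<beta> \<in> \<Omega> 1 \<Longrightarrow> L \<alpha> \<beta> = - L \<beta> \<alpha>"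
    "\<And>f \<alpha> \<beta>. f \<in> \<F> \<Longrightarrow> \<alpha> \<in> \<Omega> 1 \<Longrightarrow> \<beta> \<in> \<Omega> 1 \<Longrightarrow> L \<alpha> (f \<cdot> \<beta>) = f \<cdot> L \<alpha> \<beta> + an \<alpha> f \<cdot> \<beta>"
    "\<And>f g. f \<in> \<F> \<Longrightarrow> g \<in> \<F> \<Longrightarrow> L (df f) (df g) = df (br f g)"
    "\<And>\<alpha> \<beta>. \<alpha> \<notin> \<Omega> 1 \<or> \<beta> \<notin> \<Omega> 1 \<Longrightarrow> L \<alpha> \<beta> = 0"
    using assms unfolding is_koszul_bracket_def by blast+
  have La: "L z (x + y) = L z x + L z y" "L (x + y) z = L x z + L y z" if "x \<in> \<Omega> 1" "y \<in> \<Omega> 1" "z \<in> \<Omega> 1" for x y z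
    using L(1) that unfolding bilinear_on_def linear_on_def by blast+
  let ?F = "\<lambda>\<alpha> \<beta>. L \<alpha> \<beta> - K \<alpha> \<beta>"
  have swap: "?F \<alpha> \<beta> = - ?F \<beta> \<alpha>" if "\<alpha> \<in> \<Omega> 1" "\<beta> \<in> \<Omega> 1" for \<alpha> \<beta>
    using L(2)[OF that] K_swap[of \<alpha> \<beta>] by simp
  have fmul2: "?F \<alpha> (f \<cdot> \<sigma>) = f \<cdot> ?F \<alpha> \<sigma>" if "f \<in> \<F>" "\<sigma> \<in> \<Omega> 1" "\<alpha> \<in> \<Omega> 1" for \<alpha> f \<sigma>
    unfolding L(3)[OF that(1,3,2)] K_fmul2[OF that(1,3,2)] by (simp add: fun_eq_iff algebra_simps)
  have "?F \<alpha> \<beta> = 0" if ab: "\<alpha> \<in> \<Omega> 1" "\<beta> \<in> \<Omega> 1"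
  proof (rule skew_bilinear_vanishing[where F = ?F, OF _ _ _ _ ab])
    show "?F \<beta> (\<sigma> + \<tau>) = ?F \<beta> \<sigma> + ?F \<beta> \<tau>" if "\<sigma> \<in> \<Omega> 1" "\<tau> \<in> \<Omega> 1" "\<beta> \<in> \<Omega> 1" for \<sigma> \<tau> \<beta>
      unfolding La(1)[OF that] K_add2[OF that(3,1,2)] by simp
    show "?F (df f) (df g) = 0" if "f \<in> \<F>" "g \<in> \<F>" for f g
      unfolding L(4)[OF that] K_exact[OF that] by simp
  qed (rule swap fmul2; assumption)+
  then show "L \<alpha> \<beta> = K \<alpha> \<beta>"
    using L(5)[of \<alpha> \<beta>] by (cases "\<alpha> \<in> \<Omega> 1 \<and> \<beta> \<in> \<Omega> 1") (auto simp: koszul_def)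
qed

lemma koszul_bracket_eq: "koszul_bracket A \<pi> = K"
  unfolding koszul_bracket_def
  by (rule the_equality[where P = "is_koszul_bracket A \<pi>", OF koszul_is_koszul_bracket koszul_unique])

end

context manifold
begin

section \<open>Contravariant connections\<close>

lemma one_form_eval_add: "\<beta> \<in> \<Omega> 1 \<Longrightarrow> X \<in> \<X> \<Longrightarrow> Y \<in> \<X> \<Longrightarrow> \<beta> [X + Y] = \<beta> [X] + \<beta> [Y]"
  using Om_slot_add[of \<beta> 1 "[X]" 0 X Y] by simp

lemma one_form_eval_fmul: "\<beta> \<in> \<Omega> 1 \<Longrightarrow> f \<in> \<F> \<Longrightarrow> X \<in> \<X> \<Longrightarrow> \<beta> [f \<cdot> X] = f * \<beta> [X]"
  using Om_slot_fmul[of \<beta> 1 "[X]" 0 f X] by simp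

lemma one_form_eqI': "\<alpha> \<in> \<Omega> 1 \<Longrightarrow> \<beta> \<in> \<Omega> 1 \<Longrightarrow> (\<And>X. X \<in> \<X> \<Longrightarrow> \<alpha> [X] = \<beta> [X]) \<Longrightarrow> \<alpha> = \<beta>"
  using form_eqI[of \<alpha> 0 \<beta>] one_form_ins by simp

lemma induced_fmul_field:
  assumes f: "f \<in> \<F>" and VN: "field_derivation V N" and \<omega>: "\<omega> \<in> \<Omega> k"
  shows "induced (f \<cdot> V) (\<lambda>X. f \<cdot> N X) \<omega> = f \<cdot> induced V N \<omega>"
proof (rule ext)
  fix Xs
  show "induced (f \<cdot> V) (\<lambda>X. f \<cdot> N X) \<omega> Xs = (f \<cdot> induced V N \<omega>) Xs"
  proof (cases "set Xs \<subseteq> \<X> \<and> length Xs = k")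
    case True
    have "\<omega> (Xs[i := f \<cdot> N (Xs ! i)]) = f * \<omega> (Xs[i := N (Xs ! i)])" if "i < length Xs" for i
      using Om_slot_fmul[OF \<omega>, of Xs i f "N (Xs ! i)"] True that f N_X[OF VN] nth_X by simp
    then show ?thesis using True by (simp add: induced_def fmul_def sum_distrib_left right_diff_distrib)
  next
    case False
    moreover have "\<omega> Ys = 0" if "length Ys \<noteq> k" for Ys by (rule Om_length[OF \<omega> that])
    moreover have "V 0 = 0" by (rule X_0[OF V_X[OF VN]])
    ultimately show ?thesis by (auto simp: induced_def fmul_def)
  qed
qed

lemma induced_add_field:
  assumes VN: "field_derivation V N" and UM: "field_derivation U M" and \<omega>: "\<omega> \<in> \<Omega> k"
  shows "induced (V + U) (\<lambda>X. N X + M X) \<omega> = induced V N \<omega> + induced U M \<omega>"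
proof (rule ext)
  fix Xs
  show "induced (V + U) (\<lambda>X. N X + M X) \<omega> Xs = (induced V N \<omega> + induced U M \<omega>) Xs"
  proof (cases "set Xs \<subseteq> \<X> \<and> length Xs = k")
    case True
    have "\<omega> (Xs[i := N (Xs ! i) + M (Xs ! i)]) = \<omega> (Xs[i := N (Xs ! i)]) + \<omega> (Xs[i := M (Xs ! i)])"
      if "i < length Xs" for i
      using Om_slot_add[OF \<omega>, of Xs i "N (Xs ! i)" "M (Xs ! i)"] True that N_X[OF VN] N_X[OF UM] nth_X by simp
    then show ?thesis using True by (simp add: induced_def sum.distrib)
  next
    case False
    moreover have "\<omega> Ys = 0" if "length Ys \<noteq> k" for Ys by (rule Om_length[OF \<omega> that])
    moreover have "V 0 = 0" "U 0 = 0" by (rule X_0[OF V_X[OF VN]] X_0[OF V_X[OF UM]])+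
    ultimately show ?thesis by (auto simp: induced_def)
  qed
qed

end

locale contravariant_manifold = poisson_manifold A \<pi> for A :: "('m::{t2_space, second_countable_topology}, 'e::real_inner) chart set" and \<pi> +
  fixes D assumes conn: "contravariant_connection A \<pi> D"
begin

abbreviation "nab \<equiv> connection_on_vfield A \<pi> D"
abbreviation "T \<equiv> connection_on_form A \<pi> D"
abbreviation "H \<equiv> function_form_bracket A \<pi> D"

lemma D_Om: "\<alpha> \<in> \<Omega> 1 \<Longrightarrow> \<beta> \<in> \<Omega> 1 \<Longrightarrow> D \<alpha> \<beta> \<in> \<Omega> 1"
  using conn unfolding contravariant_connection_def by blast

lemma D_add1: "\<alpha> \<in> \<Omega> 1 \<Longrightarrow> \<beta> \<in> \<Omega> 1 \<Longrightarrow> \<gamma> \<in> \<Omega> 1 \<Longrightarrow> D (\<alpha> + \<beta>) \<gamma> = D \<alpha> \<gamma> + D \<beta> \<gamma>"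
  using conn unfolding contravariant_connection_def bilinear_on_def linear_on_def by blast

lemma D_add2: "\<alpha> \<in> \<Omega> 1 \<Longrightarrow> \<beta> \<in> \<Omega> 1 \<Longrightarrow> \<gamma> \<in> \<Omega> 1 \<Longrightarrow> D \<gamma> (\<alpha> + \<beta>) = D \<gamma> \<alpha> + D \<gamma> \<beta>"
  using conn unfolding contravariant_connection_def bilinear_on_def linear_on_def by blast

lemma D_fmul1: "f \<in> \<F> \<Longrightarrow> \<alpha> \<in> \<Omega> 1 \<Longrightarrow> \<beta> \<in> \<Omega> 1 \<Longrightarrow> D (f \<cdot> \<alpha>) \<beta> = f \<cdot> D \<alpha> \<beta>"
  using conn unfolding contravariant_connection_def by blast

lemma D_fmul2: "f \<in> \<F> \<Longrightarrow> \<alpha> \<in> \<Omega> 1 \<Longrightarrow> \<beta> \<in> \<Omega> 1 \<Longrightarrow> D \<alpha> (f \<cdot> \<beta>) = f \<cdot> D \<alpha> \<beta> + an \<alpha> f \<cdot> \<beta>"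
  using conn unfolding contravariant_connection_def by blast

lemma D_outside: "\<alpha> \<notin> \<Omega> 1 \<or> \<beta> \<notin> \<Omega> 1 \<Longrightarrow> D \<alpha> \<beta> = 0"
  using conn unfolding contravariant_connection_def by blast

lemma nab_apply: "g \<in> \<F> \<Longrightarrow> nab \<alpha> X g = an \<alpha> (X g) - D \<alpha> (df g) [X]"
  by (simp add: connection_on_vfield_def)

text \<open>
  That \<open>D\<^sub>\<alpha> X\<close> is a derivation on functions uses the Leibniz rule of \<open>D\<close> for \<open>d(fg) = f dg +
  g df\<close>.
\<close>

lemma nab_X: assumes a: "\<alpha> \<in> \<Omega> 1" and X: "X \<in> \<X>" shows "nab \<alpha> X \<in> \<X>"
proof (rule vector_fieldI)
  note an = anchor_X[OF a]
  note Dm = D_Om[OF a df_Om1]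
  fix f assume f: "f \<in> \<F>"
  show "nab \<alpha> X f \<in> \<F>" unfolding nab_apply[OF f]
    by (intro F_diff X_F[OF an] X_F[OF X] f Om_smooth[OF Dm])
  show "nab \<alpha> X ((\<lambda>_. c) * f) = (\<lambda>_. c) * nab \<alpha> X f" for c
    unfolding nab_apply[OF F_mult[OF F_const f]] nab_apply[OF f] df_scale[OF f] D_fmul2[OF F_const a df_Om1[OF f]]
      X_scale[OF X f] X_scale[OF an X_F[OF X f]] X_const[OF an] by (simp add: fun_eq_iff algebra_simps)
  fix g assume g: "g \<in> \<F>"
  have "D \<alpha> (df f + df g) = D \<alpha> (df f) + D \<alpha> (df g)" by (rule D_add2[OF df_Om1[OF f] df_Om1[OF g] a])
  then show "nab \<alpha> X (f + g) = nab \<alpha> X f + nab \<alpha> X g"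
    unfolding nab_apply[OF F_add[OF f g]] nab_apply[OF f] nab_apply[OF g] df_add[OF f g]
      X_add[OF X f g] X_add[OF an X_F[OF X f] X_F[OF X g]] by (simp add: fun_eq_iff)
  have "D \<alpha> (f \<cdot> df g + g \<cdot> df f) = (f \<cdot> D \<alpha> (df g) + an \<alpha> f \<cdot> df g) + (g \<cdot> D \<alpha> (df f) + an \<alpha> g \<cdot> df f)"
    unfolding D_add2[OF Om_fmul[OF f df_Om1[OF g]] Om_fmul[OF g df_Om1[OF f]] a]
      D_fmul2[OF f a df_Om1[OF g]] D_fmul2[OF g a df_Om1[OF f]] by (rule refl)
  then have "D \<alpha> (df (f * g)) [X] = f * D \<alpha> (df g) [X] + an \<alpha> f * X g + (g * D \<alpha> (df f) [X] + an \<alpha> g * X f)"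
    unfolding df_mult[OF f g] using df_eval[OF f X] df_eval[OF g X] by (simp add: fun_eq_iff)
  moreover have "an \<alpha> (X (f * g)) = an \<alpha> (X f) * g + X f * an \<alpha> g + (an \<alpha> f * X g + f * an \<alpha> (X g))"
    unfolding X_mult[OF X f g] X_add[OF an F_mult[OF X_F[OF X f] g] F_mult[OF f X_F[OF X g]]]
      X_mult[OF an X_F[OF X f] g] X_mult[OF an f X_F[OF X g]] by (rule refl)
  ultimately show "nab \<alpha> X (f * g) = nab \<alpha> X f * g + f * nab \<alpha> X g"
    unfolding nab_apply[OF F_mult[OF f g]] nab_apply[OF f] nab_apply[OF g]
    by (simp add: fun_eq_iff algebra_simps)
qed (simp add: connection_on_vfield_def)

text \<open>
  Hence the extension of \<open>D\<^sub>\<alpha>\<close> to forms is one of the operators \<open>induced\<close>, and its Leibniz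
  rule for the wedge product is \<open>induced_wedge\<close>.
\<close>

lemma nab_field_derivation: assumes a: "\<alpha> \<in> \<Omega> 1" shows "field_derivation (an \<alpha>) (nab \<alpha>)"
  unfolding field_derivation_def
proof (intro conjI ballI)
  note an = anchor_X[OF a]
  note Dm = D_Om[OF a df_Om1]
  show "an \<alpha> \<in> \<X>" by (rule an)
  show "nab \<alpha> X \<in> \<X>" if "X \<in> \<X>" for X by (rule nab_X[OF a that])
  show "nab \<alpha> (X + Y) = nab \<alpha> X + nab \<alpha> Y" if X: "X \<in> \<X>" and Y: "Y \<in> \<X>" for X Y
  proof (rule vector_field_eqI)
    fix g assume g: "g \<in> \<F>"
    have "an \<alpha> ((X + Y) g) = an \<alpha> (X g) + an \<alpha> (Y g)"
      unfolding plus_fun_apply[of X Y g] by (rule X_add[OF an X_F[OF X g] X_F[OF Y g]])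
    then show "nab \<alpha> (X + Y) g = (nab \<alpha> X + nab \<alpha> Y) g"
      unfolding plus_fun_apply[of "nab \<alpha> X"] nab_apply[OF g] one_form_eval_add[OF Dm[OF g] X Y] by simp
  qed (intro nab_X[OF a] VF_add X Y)+
  show "nab \<alpha> (f \<cdot> X) = f \<cdot> nab \<alpha> X + an \<alpha> f \<cdot> X" if f: "f \<in> \<F>" and X: "X \<in> \<X>" for f X
  proof (rule vector_field_eqI)
    fix g assume g: "g \<in> \<F>"
    have e: "(h \<cdot> Z) k = h * Z k" for h k and Z :: "'m vfield" by (simp add: fmul_def)
    show "nab \<alpha> (f \<cdot> X) g = (f \<cdot> nab \<alpha> X + an \<alpha> f \<cdot> X) g"
      unfolding plus_fun_apply[of "f \<cdot> nab \<alpha> X"] e nab_apply[OF g] X_mult[OF an f X_F[OF X g]]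
        one_form_eval_fmul[OF Dm[OF g] f X] by (simp add: algebra_simps)
  next
    show "f \<cdot> nab \<alpha> X + an \<alpha> f \<cdot> X \<in> \<X>"
      by (intro VF_add VF_fmul nab_X[OF a] X_F[OF an] f X)
  qed (intro nab_X[OF a] VF_fmul f X)
qed

lemma T_eq: "T \<alpha> = induced (an \<alpha>) (nab \<alpha>)"
  unfolding connection_on_form_def induced_def by (rule refl)

lemma T_Om: "\<alpha> \<in> \<Omega> 1 \<Longrightarrow> \<omega> \<in> \<Omega> k \<Longrightarrow> T \<alpha> \<omega> \<in> \<Omega> k"
  unfolding T_eq by (rule induced_Om[OF nab_field_derivation])

lemma T_zero_form: "\<alpha> \<in> \<Omega> 1 \<Longrightarrow> g \<in> \<F> \<Longrightarrow> T \<alpha> (zero_form g) = zero_form (an \<alpha> g)"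
  unfolding T_eq by (rule induced_Om_0[OF anchor_X])

text \<open>
  The dual of the dual of \<open>D\<^sub>\<alpha>\<close> is \<open>D\<^sub>\<alpha>\<close>. Both sides have the same Leibniz rule, so their
  difference is a tensor, and on \<open>dg\<close> they agree by the definition of the dual.
\<close>

lemma T_one_form: assumes a: "\<alpha> \<in> \<Omega> 1" and b: "\<beta> \<in> \<Omega> 1" shows "T \<alpha> \<beta> = D \<alpha> \<beta>"
proof -
  note VN = nab_field_derivation[OF a]
  have "T \<alpha> \<beta> - D \<alpha> \<beta> = 0"
  proof (rule one_form_vanishing[where F = "\<lambda>\<beta>. T \<alpha> \<beta> - D \<alpha> \<beta>", OF _ _ _ b])
    fix \<sigma> assume s: "\<sigma> \<in> \<Omega> 1"
    show "T \<alpha> (\<sigma> + \<tau>) - D \<alpha> (\<sigma> + \<tau>) = T \<alpha> \<sigma> - D \<alpha> \<sigma> + (T \<alpha> \<tau> - D \<alpha> \<tau>)" if t: "\<tau> \<in> \<Omega> 1" for \<tau>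
      unfolding D_add2[OF s t a] T_eq induced_add[OF VN Om_smooth[OF s] Om_smooth[OF t]] by simp
    show "T \<alpha> (f \<cdot> \<sigma>) - D \<alpha> (f \<cdot> \<sigma>) = f \<cdot> (T \<alpha> \<sigma> - D \<alpha> \<sigma>)" if f: "f \<in> \<F>" for f
      unfolding D_fmul2[OF f a s] T_eq induced_fmul[OF VN s f] by (simp add: fun_eq_iff algebra_simps)
  next
    fix g assume g: "g \<in> \<F>"
    have "T \<alpha> (df g) = D \<alpha> (df g)"
    proof (rule form_eqI)
      show "T \<alpha> (df g) \<in> \<Omega> (Suc 0)" by (rule T_Om[OF a df_Om[OF g]])
      show "D \<alpha> (df g) \<in> \<Omega> (Suc 0)" using D_Om[OF a df_Om1[OF g]] by simp
      fix X assume X: "X \<in> \<X>"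
      have "ins X (T \<alpha> (df g)) = zero_form (an \<alpha> (X g)) - zero_form (nab \<alpha> X g)"
        unfolding T_eq ins_induced[OF VN df_Om[OF g] X] df_apply[OF g X] df_apply[OF g nab_X[OF a X]]
          induced_Om_0[OF anchor_X[OF a] X_F[OF X g]] by (rule refl)
      also have "\<dots> = zero_form (D \<alpha> (df g) [X])" unfolding zero_form_diff[symmetric] nab_apply[OF g] by simp
      also have "\<dots> = ins X (D \<alpha> (df g))" by (rule one_form_ins[OF D_Om[OF a df_Om1[OF g]] X, symmetric])
      finally show "ins X (T \<alpha> (df g)) = ins X (D \<alpha> (df g))" .
    qed
    then show "T \<alpha> (df g) - D \<alpha> (df g) = 0" by simp
  qed
  then show ?thesis by simp
qed

lemma nab_fmul: assumes f: "f \<in> \<F>" and a: "\<alpha> \<in> \<Omega> 1" shows "nab (f \<cdot> \<alpha>) = (\<lambda>X. f \<cdot> nab \<alpha> X)"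
proof (rule ext, rule ext)
  fix X g
  show "nab (f \<cdot> \<alpha>) X g = (f \<cdot> nab \<alpha> X) g"
  proof (cases "g \<in> \<F>")
    case g: True
    have e: "(h \<cdot> Z) k = h * Z k" for h k and Z :: "'x \<Rightarrow> 'm \<Rightarrow> real" by (simp add: fmul_def)
    show ?thesis unfolding e nab_apply[OF g] anchor_fmul[OF f a] D_fmul1[OF f a df_Om1[OF g]]
      by (simp add: algebra_simps)
  qed (simp add: connection_on_vfield_def fun_eq_iff)
qed

lemma nab_add: assumes a: "\<alpha> \<in> \<Omega> 1" and b: "\<beta> \<in> \<Omega> 1" shows "nab (\<alpha> + \<beta>) = (\<lambda>X. nab \<alpha> X + nab \<beta> X)"
proof (rule ext, rule ext)
  fix X g
  show "nab (\<alpha> + \<beta>) X g = (nab \<alpha> X + nab \<beta> X) g"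
  proof (cases "g \<in> \<F>")
    case g: True
    show ?thesis unfolding plus_fun_apply[of "nab \<alpha> X"] nab_apply[OF g] anchor_add[OF a b] D_add1[OF a b df_Om1[OF g]]
      by simp
  qed (simp add: connection_on_vfield_def)
qed

lemma T_fmul_field: assumes f: "f \<in> \<F>" and a: "\<alpha> \<in> \<Omega> 1" and \<omega>: "\<omega> \<in> \<Omega> k" shows "T (f \<cdot> \<alpha>) \<omega> = f \<cdot> T \<alpha> \<omega>"
  unfolding T_eq anchor_fmul[OF f a] nab_fmul[OF f a]
  by (rule induced_fmul_field[OF f nab_field_derivation[OF a] \<omega>])

lemma T_add_field: assumes a: "\<alpha> \<in> \<Omega> 1" and b: "\<beta> \<in> \<Omega> 1" and \<omega>: "\<omega> \<in> \<Omega> k"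
  shows "T (\<alpha> + \<beta>) \<omega> = T \<alpha> \<omega> + T \<beta> \<omega>"
  unfolding T_eq anchor_add[OF a b] nab_add[OF a b]
  by (rule induced_add_field[OF nab_field_derivation[OF a] nab_field_derivation[OF b] \<omega>])

lemma H_eq: "H f = T (df f)" by (rule ext) (simp add: function_form_bracket_def)

lemma H_Om: "f \<in> \<F> \<Longrightarrow> \<omega> \<in> \<Omega> k \<Longrightarrow> H f \<omega> \<in> \<Omega> k"
  unfolding H_eq by (rule T_Om[OF df_Om1])

lemma H_zero_form: "f \<in> \<F> \<Longrightarrow> g \<in> \<F> \<Longrightarrow> H f (zero_form g) = zero_form (br f g)"
  unfolding H_eq fb_anchor by (rule T_zero_form[OF df_Om1])

lemma H_one_form: "f \<in> \<F> \<Longrightarrow> \<beta> \<in> \<Omega> 1 \<Longrightarrow> H f \<beta> = D (df f) \<beta>"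
  unfolding H_eq by (rule T_one_form[OF df_Om1])

lemma H_gd: "f \<in> \<F> \<Longrightarrow> graded_derivation 0 (\<lambda>_. H f)"
  unfolding H_eq T_eq by (rule gd_induced[OF nab_field_derivation[OF df_Om1]])

lemma H_add: "f \<in> \<F> \<Longrightarrow> \<sigma> \<in> \<Omega> k \<Longrightarrow> \<tau> \<in> \<Omega> k \<Longrightarrow> H f (\<sigma> + \<tau>) = H f \<sigma> + H f \<tau>"
  by (rule gd_add[OF H_gd])

lemma H_fmul: "f \<in> \<F> \<Longrightarrow> g \<in> \<F> \<Longrightarrow> \<omega> \<in> \<Omega> k \<Longrightarrow> H f (g \<cdot> \<omega>) = g \<cdot> H f \<omega> + br f g \<cdot> \<omega>"
  using gd_fmul[OF H_gd, of f g \<omega> k] H_zero_form[of f g] by (simp add: add.commute)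

lemma H_sc: "f \<in> \<F> \<Longrightarrow> \<omega> \<in> \<Omega> k \<Longrightarrow> H f (sc c \<omega>) = sc c (H f \<omega>)"
proof -
  assume f: "f \<in> \<F>" and \<omega>: "\<omega> \<in> \<Omega> k"
  have "br f (\<lambda>_. c) = 0" unfolding fb_anchor[OF F_const] by (rule X_const[OF anchor_X[OF df_Om1[OF f]]])
  then show ?thesis unfolding sc_fmul H_fmul[OF f F_const \<omega>] by (simp add: fun_eq_iff)
qed

lemma H_wedge: "f \<in> \<F> \<Longrightarrow> \<sigma> \<in> \<Omega> k \<Longrightarrow> \<tau> \<in> \<Omega> l \<Longrightarrow> H f (\<sigma> \<and>\<^sub>\<Omega> \<tau>) = H f \<sigma> \<and>\<^sub>\<Omega> \<tau> + \<sigma> \<and>\<^sub>\<Omega> H f \<tau>"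
  using gd_wedge[OF H_gd, of f \<sigma> k \<tau> l] by (simp add: fun_eq_iff)

lemma H_add_fun: "f \<in> \<F> \<Longrightarrow> g \<in> \<F> \<Longrightarrow> \<omega> \<in> \<Omega> k \<Longrightarrow> H (f + g) \<omega> = H f \<omega> + H g \<omega>"
  unfolding H_eq df_add by (rule T_add_field[OF df_Om1 df_Om1])

lemma H_scale_fun: "f \<in> \<F> \<Longrightarrow> \<omega> \<in> \<Omega> k \<Longrightarrow> H ((\<lambda>_. c) * f) \<omega> = (\<lambda>_. c) \<cdot> H f \<omega>"
  unfolding H_eq df_scale by (rule T_fmul_field[OF F_const df_Om1])

lemma H_mult_fun: "f \<in> \<F> \<Longrightarrow> g \<in> \<F> \<Longrightarrow> \<omega> \<in> \<Omega> k \<Longrightarrow> H (f * g) \<omega> = f \<cdot> H g \<omega> + g \<cdot> H f \<omega>"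
  unfolding H_eq df_mult
  by (simp only: T_add_field[OF Om_fmul[OF _ df_Om1] Om_fmul[OF _ df_Om1]] T_fmul_field[OF _ df_Om1])

text \<open>
  By the Leibniz rule two such brackets differ by a tensor, and the compatibility with \<open>d\<close>
  prescribes the bracket with an exact form.
\<close>

lemma one_form_bracket_unique:
  assumes "is_one_form_bracket A \<pi> D B" shows "one_form_bracket A \<pi> D = B"
  unfolding one_form_bracket_def
proof (rule the_equality[where P = "is_one_form_bracket A \<pi> D"])
  show "is_one_form_bracket A \<pi> D B" by fact
  fix B' assume B': "is_one_form_bracket A \<pi> D B'"
  have exact: "C (df f) \<beta> = \<dd> (H f \<beta>) - H f (\<dd> \<beta>)"
    if "is_one_form_bracket A \<pi> D C" "f \<in> \<F>" "\<beta> \<in> \<Omega> 1" for C f \<beta>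
  proof -
    have "\<dd> (H f \<beta>) = C (df f) \<beta> + H f (\<dd> \<beta>)"
      using that unfolding is_one_form_bracket_def by blast
    then show ?thesis by simp
  qed
  have fmul: "C (f \<cdot> \<alpha>) \<beta> = f \<cdot> C \<alpha> \<beta> + \<alpha> \<and>\<^sub>\<Omega> H f \<beta>"
    if "is_one_form_bracket A \<pi> D C" "f \<in> \<F>" "\<alpha> \<in> \<Omega> 1" "\<beta> \<in> \<Omega> 1" for C f \<alpha> \<beta>
    using that unfolding is_one_form_bracket_def by blast
  have add: "C (\<alpha> + \<alpha>') \<beta> = C \<alpha> \<beta> + C \<alpha>' \<beta>"
    if "is_one_form_bracket A \<pi> D C" "\<alpha> \<in> \<Omega> 1" "\<alpha>' \<in> \<Omega> 1" "\<beta> \<in> \<Omega> 1" for C \<alpha> \<alpha>' \<beta>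
    using that unfolding is_one_form_bracket_def bilinear_on_def linear_on_def by blast
  have out: "C \<alpha> \<beta> = 0" if "is_one_form_bracket A \<pi> D C" "\<alpha> \<notin> \<Omega> 1 \<or> \<beta> \<notin> \<Omega> 1" for C \<alpha> \<beta>
    using that unfolding is_one_form_bracket_def by blast
  have "B' \<alpha> \<beta> - B \<alpha> \<beta> = 0" if a: "\<alpha> \<in> \<Omega> 1" and b: "\<beta> \<in> \<Omega> 1" for \<alpha> \<beta>
  proof (rule one_form_vanishing[where F = "\<lambda>\<alpha>. B' \<alpha> \<beta> - B \<alpha> \<beta>", OF _ _ _ a])
    fix \<sigma> assume s: "\<sigma> \<in> \<Omega> 1"
    show "B' (\<sigma> + \<tau>) \<beta> - B (\<sigma> + \<tau>) \<beta> = B' \<sigma> \<beta> - B \<sigma> \<beta> + (B' \<tau> \<beta> - B \<tau> \<beta>)" if t: "\<tau> \<in> \<Omega> 1" for \<tau>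
      unfolding add[OF B' s t b] add[OF assms s t b] by simp
    show "B' (f \<cdot> \<sigma>) \<beta> - B (f \<cdot> \<sigma>) \<beta> = f \<cdot> (B' \<sigma> \<beta> - B \<sigma> \<beta>)" if f: "f \<in> \<F>" for f
      unfolding fmul[OF B' f s b] fmul[OF assms f s b] by (simp add: fun_eq_iff algebra_simps)
  next
    fix f assume f: "f \<in> \<F>"
    show "B' (df f) \<beta> - B (df f) \<beta> = 0"
      unfolding exact[OF B' f b] exact[OF assms f b] by simp
  qed
  then have "B' \<alpha> \<beta> = B \<alpha> \<beta>" for \<alpha> \<beta>
    using out[OF B', of \<alpha> \<beta>] out[OF assms, of \<alpha> \<beta>] by (metis eq_iff_diff_eq_0)
  then show "B' = B" by (intro ext) metis
qed

lemma metacurvature_unique: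
  assumes "is_metacurvature A \<pi> D M" shows "metacurvature A \<pi> D = M"
  unfolding metacurvature_def
proof (rule the_equality[where P = "is_metacurvature A \<pi> D"])
  show "is_metacurvature A \<pi> D M" by fact
  fix M' assume M': "is_metacurvature A \<pi> D M'"
  have out: "N \<alpha> \<beta> \<gamma> = 0" if "is_metacurvature A \<pi> D N" "\<alpha> \<notin> \<Omega> 1 \<or> \<beta> \<notin> \<Omega> 1 \<or> \<gamma> \<notin> \<Omega> 1" for N \<alpha> \<beta> \<gamma>
    using that unfolding is_metacurvature_def by blast
  have lin: "function_linear A (\<lambda>\<alpha>. N \<alpha> \<beta> \<gamma>)" if "is_metacurvature A \<pi> D N" "\<beta> \<in> \<Omega> 1" "\<gamma> \<in> \<Omega> 1" for N \<beta> \<gamma>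
    using that unfolding is_metacurvature_def by blast
  have val: "N (df f) \<beta> \<gamma> = H f (one_form_bracket A \<pi> D \<beta> \<gamma>) - one_form_bracket A \<pi> D (H f \<beta>) \<gamma>
      - one_form_bracket A \<pi> D (H f \<gamma>) \<beta>"
    if "is_metacurvature A \<pi> D N" "f \<in> \<F>" "\<beta> \<in> \<Omega> 1" "\<gamma> \<in> \<Omega> 1" for N f \<beta> \<gamma>
    using that unfolding is_metacurvature_def by blast
  have exact: "M' (df f) \<beta> \<gamma> = M (df f) \<beta> \<gamma>" if "f \<in> \<F>" "\<beta> \<in> \<Omega> 1" "\<gamma> \<in> \<Omega> 1" for f \<beta> \<gamma>
    unfolding val[OF M' that] val[OF assms that] by (rule refl)
  have "M' \<alpha> \<beta> \<gamma> = M \<alpha> \<beta> \<gamma>" if "\<alpha> \<in> \<Omega> 1" "\<beta> \<in> \<Omega> 1" "\<gamma> \<in> \<Omega> 1" for \<alpha> \<beta> \<gamma>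
  proof (rule one_form_eqI[where F = "\<lambda>\<alpha>. M' \<alpha> \<beta> \<gamma>" and G = "\<lambda>\<alpha>. M \<alpha> \<beta> \<gamma>", OF _ _ _ _ _ that(1)])
    note l = lin[OF M' that(2,3), unfolded function_linear_def] lin[OF assms that(2,3), unfolded function_linear_def]
    fix \<sigma> assume s: "\<sigma> \<in> \<Omega> 1"
    show "M' (\<sigma> + \<tau>) \<beta> \<gamma> = M' \<sigma> \<beta> \<gamma> + M' \<tau> \<beta> \<gamma>" "M (\<sigma> + \<tau>) \<beta> \<gamma> = M \<sigma> \<beta> \<gamma> + M \<tau> \<beta> \<gamma>"
      if "\<tau> \<in> \<Omega> 1" for \<tau> using l s that by metis+
    show "M' (f \<cdot> \<sigma>) \<beta> \<gamma> = f \<cdot> M' \<sigma> \<beta> \<gamma>" "M (f \<cdot> \<sigma>) \<beta> \<gamma> = f \<cdot> M \<sigma> \<beta> \<gamma>"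
      if "f \<in> \<F>" for f using l s that by metis+
  qed (rule exact[OF _ that(2,3)])
  then have "M' \<alpha> \<beta> \<gamma> = M \<alpha> \<beta> \<gamma>" for \<alpha> \<beta> \<gamma>
    using out[OF M', of \<alpha> \<beta> \<gamma>] out[OF assms, of \<alpha> \<beta> \<gamma>] by metis
  then show "M' = M" by (intro ext) metis
qed

end

context manifold
begin

section \<open>Inhomogeneous forms\<close>

lemma Om_total: assumes "\<omega> \<in> \<Omega> k" shows "\<omega> \<in> total \<Omega>"
proof -
  let ?y = "\<lambda>j. if j = k then \<omega> else 0"
  have "(\<Sum>j<Suc k. ?y j) = (if k \<in> {..<Suc k} then \<omega> else 0)"
    by (rule sum.delta) (rule finite_lessThan)
  then have "\<omega> = (\<Sum>j<Suc k. ?y j)" by (simp only: lessThan_iff lessI if_True)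
  moreover have "?y j \<in> \<Omega> j" for j
    by (cases "j = k") (simp_all only: if_True if_False assms Om_0 refl)
  ultimately show ?thesis unfolding total_def mem_Collect_eq by (intro exI[of _ "Suc k"] exI[of _ ?y] conjI allI impI)
qed

definition component :: "nat \<Rightarrow> 'm form \<Rightarrow> 'm form" where
  "component k \<omega> = (\<lambda>Xs. if length Xs = k then \<omega> Xs else 0)"

lemma component_add: "component k (\<sigma> + \<tau>) = component k \<sigma> + component k \<tau>"
  by (rule ext, rule ext) (simp add: component_def)

lemma component_sc: "component k (sc c \<sigma>) = sc c (component k \<sigma>)"
  by (rule ext, rule ext) (simp add: component_def)

lemma component_sum: "component k (\<Sum>i\<in>I. \<sigma> i) = (\<Sum>i\<in>I. component k (\<sigma> i))"
  by (rule ext, rule ext) (simp add: component_def sum_fun_apply)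

lemma component_same: "\<omega> \<in> \<Omega> k \<Longrightarrow> component k \<omega> = \<omega>"
  by (rule ext, rule ext) (simp add: component_def Om_length)

lemma component_other: "\<omega> \<in> \<Omega> k \<Longrightarrow> j \<noteq> k \<Longrightarrow> component j \<omega> = 0"
  by (rule ext, rule ext) (simp add: component_def Om_length)

text \<open>
  A form is a finite sum of homogeneous ones iff its components are forms and almost all of
  them vanish; unlike the definition this is obviously closed under sums.
\<close>

lemma total_iff: "\<omega> \<in> total \<Omega> \<longleftrightarrow> (\<forall>k. component k \<omega> \<in> \<Omega> k) \<and> (\<exists>n. \<forall>Xs. n \<le> length Xs \<longrightarrow> \<omega> Xs = 0)"
proof
  assume "\<omega> \<in> total \<Omega>"
  then obtain n y where y: "\<And>k. k < n \<Longrightarrow> y k \<in> \<Omega> k" and \<omega>: "\<omega> = (\<Sum>k<n. y k)"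
    unfolding total_def by blast
  have "component j (y k) \<in> \<Omega> j" if "k < n" for j k
    using component_same[OF y[OF that]] component_other[OF y[OF that], of j] y[OF that] Om_0[of j] by (cases "j = k") metis+
  then have 1: "component j \<omega> \<in> \<Omega> j" for j unfolding \<omega> component_sum by (intro Om_sum) simp
  have "\<omega> Xs = 0" if "n \<le> length Xs" for Xs
  proof -
    have "y k Xs = 0" if "k < n" for k using Om_length[OF y[OF that], of Xs] \<open>n \<le> length Xs\<close> that by simp
    then show ?thesis unfolding \<omega> by (simp add: sum_fun_apply fun_eq_iff)
  qed
  then show "(\<forall>k. component k \<omega> \<in> \<Omega> k) \<and> (\<exists>n. \<forall>Xs. n \<le> length Xs \<longrightarrow> \<omega> Xs = 0)" using 1 by blast
next
  assume a: "(\<forall>k. component k \<omega> \<in> \<Omega> k) \<and> (\<exists>n. \<forall>Xs. n \<le> length Xs \<longrightarrow> \<omega> Xs = 0)"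
  then obtain n where n: "\<And>Xs. n \<le> length Xs \<Longrightarrow> \<omega> Xs = 0" by blast
  have "\<omega> = (\<Sum>k<n. component k \<omega>)"
  proof (rule ext, rule ext)
    fix Xs p
    have "(\<Sum>k<n. component k \<omega>) Xs p = (\<Sum>k<n. if length Xs = k then \<omega> Xs p else 0)"
      unfolding sum_fun_apply by (rule sum.cong[OF refl]) (simp add: component_def)
    also have "\<dots> = \<omega> Xs p" using n[of Xs] by (simp add: sum.delta' not_less)
    finally show "\<omega> Xs p = (\<Sum>k<n. component k \<omega>) Xs p" by simp
  qed
  moreover have "\<forall>k<n. component k \<omega> \<in> \<Omega> k" using a by blast
  ultimately show "\<omega> \<in> total \<Omega>"
    unfolding total_def mem_Collect_eq by (intro exI[of _ n] exI[of _ "\<lambda>k. component k \<omega>"] conjI)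
qed

lemma component_Om: "\<omega> \<in> total \<Omega> \<Longrightarrow> component k \<omega> \<in> \<Omega> k" by (simp add: total_iff)

lemma total_add: assumes s: "\<sigma> \<in> total \<Omega>" and t: "\<tau> \<in> total \<Omega>" shows "\<sigma> + \<tau> \<in> total \<Omega>"
proof -
  obtain m where m: "\<And>Xs. m \<le> length Xs \<Longrightarrow> \<sigma> Xs = 0" using s unfolding total_iff by blast
  obtain n where n: "\<And>Xs. n \<le> length Xs \<Longrightarrow> \<tau> Xs = 0" using t unfolding total_iff by blast
  have "\<forall>Xs. max m n \<le> length Xs \<longrightarrow> (\<sigma> + \<tau>) Xs = 0" using m n by simp
  then show ?thesis unfolding total_iff component_add using component_Om[OF s] component_Om[OF t] Om_add by blast
qed

lemma total_sc: assumes s: "\<sigma> \<in> total \<Omega>" shows "sc c \<sigma> \<in> total \<Omega>"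
proof -
  obtain m where m: "\<And>Xs. m \<le> length Xs \<Longrightarrow> \<sigma> Xs = 0" using s unfolding total_iff by blast
  have "\<forall>Xs. m \<le> length Xs \<longrightarrow> sc c \<sigma> Xs = 0" using m by (simp add: fun_eq_iff)
  then show ?thesis unfolding total_iff component_sc using component_Om[OF s] Om_sc by blast
qed

lemma total_smooth: assumes "\<sigma> \<in> total \<Omega>" shows "\<sigma> Xs \<in> \<F>"
  using Om_smooth[OF component_Om[OF assms, of "length Xs"], of Xs] by (simp add: component_def)

lemma total_induct [consumes 1, case_names homogeneous add]:
  assumes "\<omega> \<in> total \<Omega>" and hom: "\<And>k \<omega>. \<omega> \<in> \<Omega> k \<Longrightarrow> P \<omega>"
    and add: "\<And>\<sigma> \<tau>. \<sigma> \<in> total \<Omega> \<Longrightarrow> \<tau> \<in> total \<Omega> \<Longrightarrow> P \<sigma> \<Longrightarrow> P \<tau> \<Longrightarrow> P (\<sigma> + \<tau>)"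
  shows "P \<omega>"
proof -
  obtain n y where y: "\<forall>k<n. y k \<in> \<Omega> k" and \<omega>: "\<omega> = (\<Sum>k<n. y k)"
    using assms(1) unfolding total_def by blast
  have "(\<Sum>k<m. y k) \<in> total \<Omega> \<and> P (\<Sum>k<m. y k)" if "m \<le> n" for m
    using that
  proof (induction m)
    case 0
    have "0 \<in> total \<Omega>" "P 0" using Om_total[OF Om_0] hom[OF Om_0] by blast+
    then show ?case unfolding lessThan_0 sum.empty by (rule conjI)
  next
    case (Suc m)
    then have "y m \<in> \<Omega> m" using y by simp
    then have "y m \<in> total \<Omega>" "P (y m)" using Om_total hom by blast+
    moreover have "(\<Sum>k<m. y k) \<in> total \<Omega>" "P (\<Sum>k<m. y k)" using Suc by simp_all
    ultimately show ?case unfolding sum.lessThan_Suc using total_add add by blast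
  qed
  then show ?thesis unfolding \<omega> by blast
qed

lemma ext_d_add_total: "\<sigma> \<in> total \<Omega> \<Longrightarrow> \<tau> \<in> total \<Omega> \<Longrightarrow> \<dd> (\<sigma> + \<tau>) = \<dd> \<sigma> + \<dd> \<tau>"
  by (rule ext_d_add') (rule total_smooth, assumption)+

lemma ext_d_total: "\<sigma> \<in> total \<Omega> \<Longrightarrow> \<dd> \<sigma> \<in> total \<Omega>"
proof (induction rule: total_induct)
  case (homogeneous k \<omega>)
  show "\<dd> \<omega> \<in> total \<Omega>" by (rule Om_total[OF ext_d_Om[OF homogeneous]])
next
  case (add \<sigma> \<tau>)
  show "\<dd> (\<sigma> + \<tau>) \<in> total \<Omega>" unfolding ext_d_add_total[OF add(1,2)] by (rule total_add[OF add(3,4)])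
qed

lemma forms_graded_vector_space: "graded_vector_space sc \<Omega>"
  unfolding graded_vector_space_def
proof (intro conjI allI impI)
  show vs: "vector_space (sc :: real \<Rightarrow> 'm form \<Rightarrow> 'm form)"
    by unfold_locales (simp_all add: fun_eq_iff algebra_simps)
  interpret vector_space "sc :: real \<Rightarrow> 'm form \<Rightarrow> 'm form" by (rule vs)
  show "subspace (\<Omega> k)" for k unfolding subspace_def using Om_0 Om_add Om_sc by blast
  fix n y k assume y: "(\<forall>k<n. y k \<in> \<Omega> k) \<and> (\<Sum>k<n. y k) = 0" and k: "k < n"
  have yk: "y k \<in> \<Omega> k" using y k by blast
  have "component k (y j) = (if j = k then y k else 0)" if "j < n" for j
    using component_same[OF yk] component_other[of "y j" j k] y that by auto
  then have "(\<Sum>j<n. component k (y j)) = (\<Sum>j<n. if j = k then y k else 0)" by (intro sum.cong) auto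
  also have "\<dots> = y k" using k by (subst sum.delta) auto
  finally have "component k (\<Sum>j<n. y j) = y k" unfolding component_sum .
  moreover have "component k 0 = 0" by (rule component_other[where k = "Suc k", OF Om_0]) simp
  ultimately show "y k = 0" using y by simp
qed

section \<open>From a bracket to a connection\<close>

definition one_form_of :: "('m vfield \<Rightarrow> 'm \<Rightarrow> real) \<Rightarrow> 'm form" where
  "one_form_of L = (\<lambda>Xs. case Xs of [X] \<Rightarrow> if X \<in> \<X> then L X else 0 | _ \<Rightarrow> 0)"

lemma one_form_of_eval: "X \<in> \<X> \<Longrightarrow> one_form_of L [X] = L X"
  by (simp add: one_form_of_def)

lemma one_form_of_Om:
  assumes F: "\<And>X. X \<in> \<X> \<Longrightarrow> L X \<in> \<F>"
    and add: "\<And>X Y. X \<in> \<X> \<Longrightarrow> Y \<in> \<X> \<Longrightarrow> L (X + Y) = L X + L Y"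
    and fmul: "\<And>f X. f \<in> \<F> \<Longrightarrow> X \<in> \<X> \<Longrightarrow> L (f \<cdot> X) = f * L X"
  shows "one_form_of L \<in> \<Omega> 1"
proof -
  have i: "ins X (one_form_of L) = zero_form (L X)" if "X \<in> \<X>" for X
    using that by (auto simp: ins_def one_form_of_def zero_form_def split: list.split)
  have "one_form_of L \<in> \<Omega> (Suc 0)"
  proof (rule Om_SucI)
    show "one_form_of L [] = 0" by (simp add: one_form_of_def)
    show "ins X (one_form_of L) = 0" if "X \<notin> \<X>" for X
      using that by (auto simp: ins_def one_form_of_def fun_eq_iff split: list.split)
    show "ins X (one_form_of L) \<in> \<Omega> 0" if "X \<in> \<X>" for X
      unfolding i[OF that] by (rule zero_form_Om[OF F[OF that]])
    show "ins X (ins X (one_form_of L)) = 0" if "X \<in> \<X>" for X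
      unfolding i[OF that] by simp
    show "ins (X + Y) (one_form_of L) = ins X (one_form_of L) + ins Y (one_form_of L)"
      if "X \<in> \<X>" "Y \<in> \<X>" for X Y
      unfolding i[OF that(1)] i[OF that(2)] i[OF VF_add[OF that]] add[OF that] by (rule zero_form_add)
    show "ins (f \<cdot> X) (one_form_of L) = f \<cdot> ins X (one_form_of L)" if "f \<in> \<F>" "X \<in> \<X>" for f X
      unfolding i[OF that(2)] i[OF VF_fmul[OF that]] fmul[OF that] by (rule zero_form_mult)
  qed
  then show ?thesis by simp
qed

lemma zero_form_inject: "zero_form f = zero_form g \<longleftrightarrow> f = g"
  by (metis zero_form_Nil)

definition hamiltonian :: "('m form \<Rightarrow> 'm form \<Rightarrow> 'm form) \<Rightarrow> ('m \<Rightarrow> real) \<Rightarrow> 'm vfield" where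
  "hamiltonian b f = (\<lambda>g. if g \<in> \<F> then b (zero_form f) (zero_form g) [] else 0)"

text \<open>
  For \<open>\<alpha> = dg\<close> antisymmetry gives \<open>(#dg)(f) = {g, f} = - X\<^sub>f(g) = - dg(X\<^sub>f)\<close>, where \<open>X\<^sub>f\<close> is
  the Hamiltonian vector field. The last expression makes sense for all 1-forms.
\<close>

definition bracket_anchor :: "('m form \<Rightarrow> 'm form \<Rightarrow> 'm form) \<Rightarrow> 'm form \<Rightarrow> 'm vfield" where
  "bracket_anchor b \<alpha> = (\<lambda>f. if f \<in> \<F> then - \<alpha> [hamiltonian b f] else 0)"

definition bracket_bivector :: "('m form \<Rightarrow> 'm form \<Rightarrow> 'm form) \<Rightarrow> 'm form \<Rightarrow> 'm form \<Rightarrow> 'm \<Rightarrow> real" where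
  "bracket_bivector b \<alpha> \<beta> = (if \<alpha> \<in> \<Omega> 1 \<and> \<beta> \<in> \<Omega> 1 then \<beta> [bracket_anchor b \<alpha>] else 0)"

text \<open>
  The derivation \<open>g \<mapsto> {g, \<beta>}(X)\<close> of the functions. Pairing it with \<open>\<alpha>\<close> is the extension of
  \<open>{f, \<beta>}\<close>, which depends on \<open>f\<close> through \<open>df\<close> only, to a function-linear operation in \<open>\<alpha>\<close>.
\<close>

definition bracket_field :: "('m form \<Rightarrow> 'm form \<Rightarrow> 'm form) \<Rightarrow> 'm form \<Rightarrow> 'm vfield \<Rightarrow> 'm vfield" where
  "bracket_field b \<beta> X = (\<lambda>g. if g \<in> \<F> then b (zero_form g) \<beta> [X] else 0)"

definition bracket_connection :: "('m form \<Rightarrow> 'm form \<Rightarrow> 'm form) \<Rightarrow> 'm form \<Rightarrow> 'm form \<Rightarrow> 'm form" where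
  "bracket_connection b \<alpha> \<beta> = (if \<alpha> \<in> \<Omega> 1 \<and> \<beta> \<in> \<Omega> 1
     then one_form_of (\<lambda>X. \<alpha> [bracket_field b \<beta> X]) else 0)"

lemma sc_one [simp]: "sc 1 \<omega> = \<omega>" by (simp add: fun_eq_iff)

end

locale dgp_bracket = manifold A for A :: "('m::{t2_space, second_countable_topology}, 'e::real_inner) chart set" +
  fixes b assumes b: "b \<in> dgp_brackets A"
begin

lemma dgp: "dg_poisson_algebra sc \<Omega> \<dd> (\<and>\<^sub>\<Omega>) b"
  using b by (simp add: dgp_brackets_def)

lemma b_outside: "\<sigma> \<notin> total \<Omega> \<or> \<rho> \<notin> total \<Omega> \<Longrightarrow> b \<sigma> \<rho> = 0"
  using b by (simp add: dgp_brackets_def)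

lemma b_bilinear: "bilinear_on sc (total \<Omega>) b"
  using dgp unfolding dg_poisson_algebra_def by (elim conjE)

lemma b_Om: assumes "\<sigma> \<in> \<Omega> k" "\<tau> \<in> \<Omega> l" shows "b \<sigma> \<tau> \<in> \<Omega> (k + l)"
proof -
  have "\<forall>k l. \<forall>x\<in>\<Omega> k. \<forall>y\<in>\<Omega> l. b x y \<in> \<Omega> (k + l)"
    using dgp unfolding dg_poisson_algebra_def by (elim conjE)
  then show ?thesis using assms by blast
qed

lemma b_add2: "\<sigma> \<in> total \<Omega> \<Longrightarrow> \<tau> \<in> total \<Omega> \<Longrightarrow> \<rho> \<in> total \<Omega> \<Longrightarrow> b \<rho> (\<sigma> + \<tau>) = b \<rho> \<sigma> + b \<rho> \<tau>"
  using b_bilinear unfolding bilinear_on_def linear_on_def by blast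
lemma b_add1: "\<sigma> \<in> total \<Omega> \<Longrightarrow> \<tau> \<in> total \<Omega> \<Longrightarrow> \<rho> \<in> total \<Omega> \<Longrightarrow> b (\<sigma> + \<tau>) \<rho> = b \<sigma> \<rho> + b \<tau> \<rho>"
  using b_bilinear unfolding bilinear_on_def linear_on_def by blast
lemma b_sc2: "\<sigma> \<in> total \<Omega> \<Longrightarrow> \<rho> \<in> total \<Omega> \<Longrightarrow> b \<rho> (sc c \<sigma>) = sc c (b \<rho> \<sigma>)"
  using b_bilinear unfolding bilinear_on_def linear_on_def by blast
lemma b_sc1: "\<sigma> \<in> total \<Omega> \<Longrightarrow> \<rho> \<in> total \<Omega> \<Longrightarrow> b (sc c \<sigma>) \<rho> = sc c (b \<sigma> \<rho>)"
  using b_bilinear unfolding bilinear_on_def linear_on_def by blast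

lemma b_swap: assumes "\<sigma> \<in> \<Omega> k" "\<tau> \<in> \<Omega> l" shows "b \<sigma> \<tau> = - sc ((- 1) ^ (k * l)) (b \<tau> \<sigma>)"
proof -
  have "\<forall>k l. \<forall>x\<in>\<Omega> k. \<forall>y\<in>\<Omega> l. b x y = - sc ((- 1) ^ (k * l)) (b y x)"
    using dgp unfolding dg_poisson_algebra_def by (elim conjE)
  then show ?thesis using assms by blast
qed

lemma b_jacobi: assumes "\<sigma> \<in> \<Omega> k" "\<tau> \<in> \<Omega> l" "\<rho> \<in> \<Omega> n"
  shows "b (b \<sigma> \<tau>) \<rho> = b \<sigma> (b \<tau> \<rho>) - sc ((- 1) ^ (k * l)) (b \<tau> (b \<sigma> \<rho>))"
proof -
  have "\<forall>k l. \<forall>x\<in>\<Omega> k. \<forall>y\<in>\<Omega> l. \<forall>z\<in>total \<Omega>.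
        b (b x y) z = b x (b y z) - sc ((- 1) ^ (k * l)) (b y (b x z))"
    using dgp unfolding dg_poisson_algebra_def by (elim conjE)
  then show ?thesis using assms Om_total by blast
qed

lemma b_ext_d: assumes "\<sigma> \<in> \<Omega> k" "\<tau> \<in> \<Omega> l"
  shows "\<dd> (b \<sigma> \<tau>) = b (\<dd> \<sigma>) \<tau> + sc ((- 1) ^ k) (b \<sigma> (\<dd> \<tau>))"
proof -
  have "\<forall>k. \<forall>x\<in>\<Omega> k. \<forall>y\<in>total \<Omega>. \<dd> (b x y) = b (\<dd> x) y + sc ((- 1) ^ k) (b x (\<dd> y))"
    using dgp unfolding dg_poisson_algebra_def by (elim conjE)
  then show ?thesis using assms Om_total by blast
qed

lemma b_wedge: assumes "\<sigma> \<in> \<Omega> k" "\<tau> \<in> \<Omega> l" "\<rho> \<in> \<Omega> n"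
  shows "b \<sigma> (\<tau> \<and>\<^sub>\<Omega> \<rho>) = b \<sigma> \<tau> \<and>\<^sub>\<Omega> \<rho> + sc ((- 1) ^ (k * l)) (\<tau> \<and>\<^sub>\<Omega> b \<sigma> \<rho>)"
proof -
  have "\<forall>k l. \<forall>x\<in>\<Omega> k. \<forall>y\<in>\<Omega> l. \<forall>z\<in>total \<Omega>.
        b x (y \<and>\<^sub>\<Omega> z) = b x y \<and>\<^sub>\<Omega> z + sc ((- 1) ^ (k * l)) (y \<and>\<^sub>\<Omega> b x z)"
    using dgp unfolding dg_poisson_algebra_def by (elim conjE)
  then show ?thesis using assms Om_total by blast
qed

lemma b_gd: assumes s: "\<sigma> \<in> \<Omega> k" shows "graded_derivation k (\<lambda>_. b \<sigma>)"
proof (rule graded_derivationI)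
  fix l \<tau> assume t: "\<tau> \<in> \<Omega> l"
  show "b \<sigma> \<tau> \<in> \<Omega> (l + k)" using b_Om[OF s t] by (simp only: add.commute)
  show "b \<sigma> (\<tau> + \<rho>) = b \<sigma> \<tau> + b \<sigma> \<rho>" if "\<rho> \<in> \<Omega> l" for \<rho>
    by (rule b_add2[OF Om_total[OF t] Om_total[OF that] Om_total[OF s]])
  show "b \<sigma> (\<tau> \<and>\<^sub>\<Omega> \<rho>) = b \<sigma> \<tau> \<and>\<^sub>\<Omega> \<rho> + sc ((- 1) ^ (k * l)) (\<tau> \<and>\<^sub>\<Omega> b \<sigma> \<rho>)" if "\<rho> \<in> \<Omega> n" for \<rho> n
    by (rule b_wedge[OF s t that])
qed

abbreviation "zf \<equiv> zero_form"

lemma b_zf_swap: "f \<in> \<F> \<Longrightarrow> \<sigma> \<in> \<Omega> k \<Longrightarrow> b (zf f) \<sigma> = - b \<sigma> (zf f)"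
  using b_swap[OF zero_form_Om, of f \<sigma> k] by simp

lemma b_fmul: "f \<in> \<F> \<Longrightarrow> \<sigma> \<in> \<Omega> k \<Longrightarrow> \<tau> \<in> \<Omega> l \<Longrightarrow> b \<sigma> (f \<cdot> \<tau>) = b \<sigma> (zf f) \<and>\<^sub>\<Omega> \<tau> + f \<cdot> b \<sigma> \<tau>"
  by (rule gd_fmul[OF b_gd])

lemma b_zf_mult: assumes f: "f \<in> \<F>" and g: "g \<in> \<F>" and s: "\<sigma> \<in> \<Omega> k"
  shows "b (zf (f * g)) \<sigma> = f \<cdot> b (zf g) \<sigma> + g \<cdot> b (zf f) \<sigma>"
proof -
  have "b \<sigma> (zf (f * g)) = g \<cdot> b \<sigma> (zf f) + f \<cdot> b \<sigma> (zf g)"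
    unfolding zero_form_mult b_fmul[OF f s zero_form_Om[OF g]] wedge_zero_form by (rule refl)
  then show ?thesis
    unfolding b_zf_swap[OF F_mult[OF f g] s] b_zf_swap[OF f s] b_zf_swap[OF g s] by (simp add: fun_eq_iff)
qed

lemma b_zf_add: assumes f: "f \<in> \<F>" and g: "g \<in> \<F>" and s: "\<sigma> \<in> \<Omega> k"
  shows "b (zf (f + g)) \<sigma> = b (zf f) \<sigma> + b (zf g) \<sigma>"
  unfolding zero_form_add by (intro b_add1 Om_total[OF zero_form_Om] Om_total[OF s] f g)

lemma b_zf_scale: assumes f: "f \<in> \<F>" and s: "\<sigma> \<in> \<Omega> k"
  shows "b (zf ((\<lambda>_. c) * f)) \<sigma> = (\<lambda>_. c) \<cdot> b (zf f) \<sigma>"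
  unfolding zero_form_mult sc_fmul[symmetric] by (intro b_sc1 Om_total[OF zero_form_Om] Om_total[OF s] f)

lemma b_zf_zf: assumes "f \<in> \<F>" "g \<in> \<F>" shows "b (zf f) (zf g) = zf (hamiltonian b f g)"
  using Om_0_eq[of "b (zf f) (zf g)"] b_Om[OF zero_form_Om[OF assms(1)] zero_form_Om[OF assms(2)]] assms(2)
  by (simp add: hamiltonian_def)

lemma hamiltonian_swap: assumes "f \<in> \<F>" "g \<in> \<F>" shows "hamiltonian b f g = - hamiltonian b g f"
  using b_zf_swap[OF assms(1) zero_form_Om[OF assms(2)]] b_zf_zf[OF assms] b_zf_zf[OF assms(2,1)]
  by (metis uminus_apply zero_form_Nil)

lemma hamiltonian_X: assumes f: "f \<in> \<F>" shows "hamiltonian b f \<in> \<X>"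
proof (rule vector_fieldI)
  have h: "hamiltonian b f g = b (zf f) (zf g) []" if "g \<in> \<F>" for g using that by (simp add: hamiltonian_def)
  note z = zero_form_Om[OF f]
  fix g assume g: "g \<in> \<F>"
  show "hamiltonian b f g \<in> \<F>" unfolding h[OF g] by (rule Om_smooth[OF b_Om[OF z zero_form_Om[OF g]]])
  show "hamiltonian b f ((\<lambda>_. c) * g) = (\<lambda>_. c) * hamiltonian b f g" for c
    unfolding h[OF F_mult[OF F_const g]] h[OF g] zero_form_mult sc_fmul[symmetric]
      b_sc2[OF Om_total[OF zero_form_Om[OF g]] Om_total[OF z]] by (simp add: fun_eq_iff)
  fix k assume k: "k \<in> \<F>"
  show "hamiltonian b f (g + k) = hamiltonian b f g + hamiltonian b f k"
    unfolding h[OF F_add[OF g k]] h[OF g] h[OF k] zero_form_add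
      b_add2[OF Om_total[OF zero_form_Om[OF g]] Om_total[OF zero_form_Om[OF k]] Om_total[OF z]] by simp
  show "hamiltonian b f (g * k) = hamiltonian b f g * k + g * hamiltonian b f k"
    unfolding h[OF F_mult[OF g k]] h[OF g] h[OF k] zero_form_mult b_fmul[OF g z zero_form_Om[OF k]]
    by (simp add: fun_eq_iff)
qed (simp add: hamiltonian_def)

lemma hamiltonian_add: assumes f: "f \<in> \<F>" and g: "g \<in> \<F>"
  shows "hamiltonian b (f + g) = hamiltonian b f + hamiltonian b g"
  by (rule ext) (simp add: hamiltonian_def b_zf_add[OF f g zero_form_Om])

lemma hamiltonian_scale: assumes f: "f \<in> \<F>"
  shows "hamiltonian b ((\<lambda>_. c) * f) = (\<lambda>_. c) \<cdot> hamiltonian b f"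
  by (simp add: hamiltonian_def b_zf_scale[OF f zero_form_Om] fun_eq_iff)

lemma hamiltonian_mult: assumes f: "f \<in> \<F>" and g: "g \<in> \<F>"
  shows "hamiltonian b (f * g) = f \<cdot> hamiltonian b g + g \<cdot> hamiltonian b f"
  by (simp add: hamiltonian_def b_zf_mult[OF f g zero_form_Om] fun_eq_iff)

lemma bracket_anchor_apply: "f \<in> \<F> \<Longrightarrow> bracket_anchor b \<alpha> f = - \<alpha> [hamiltonian b f]"
  by (simp add: bracket_anchor_def)

lemma bracket_anchor_X: assumes a: "\<alpha> \<in> \<Omega> 1" shows "bracket_anchor b \<alpha> \<in> \<X>"
proof (rule vector_fieldI)
  fix f assume f: "f \<in> \<F>"
  note h = hamiltonian_X
  show "bracket_anchor b \<alpha> f \<in> \<F>" unfolding bracket_anchor_apply[OF f] by (rule F_minus[OF Om_smooth[OF a]])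
  show "bracket_anchor b \<alpha> ((\<lambda>_. c) * f) = (\<lambda>_. c) * bracket_anchor b \<alpha> f" for c
    unfolding bracket_anchor_apply[OF F_mult[OF F_const f]] bracket_anchor_apply[OF f] hamiltonian_scale[OF f]
      one_form_eval_fmul[OF a F_const h[OF f]] by simp
  fix g assume g: "g \<in> \<F>"
  show "bracket_anchor b \<alpha> (f + g) = bracket_anchor b \<alpha> f + bracket_anchor b \<alpha> g"
    unfolding bracket_anchor_apply[OF F_add[OF f g]] bracket_anchor_apply[OF f] bracket_anchor_apply[OF g]
      hamiltonian_add[OF f g] one_form_eval_add[OF a h[OF f] h[OF g]] by simp
  show "bracket_anchor b \<alpha> (f * g) = bracket_anchor b \<alpha> f * g + f * bracket_anchor b \<alpha> g"
    unfolding bracket_anchor_apply[OF F_mult[OF f g]] bracket_anchor_apply[OF f] bracket_anchor_apply[OF g]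
      hamiltonian_mult[OF f g] one_form_eval_add[OF a VF_fmul[OF f h[OF g]] VF_fmul[OF g h[OF f]]]
      one_form_eval_fmul[OF a f h[OF g]] one_form_eval_fmul[OF a g h[OF f]] by (simp add: fun_eq_iff)
qed (simp add: bracket_anchor_def)

lemma bracket_anchor_add: "bracket_anchor b (\<alpha> + \<beta>) = bracket_anchor b \<alpha> + bracket_anchor b \<beta>"
  by (simp add: bracket_anchor_def fun_eq_iff)

lemma bracket_anchor_fmul: "bracket_anchor b (f \<cdot> \<alpha>) = f \<cdot> bracket_anchor b \<alpha>"
  by (simp add: bracket_anchor_def fun_eq_iff)

lemma bracket_anchor_df: assumes f: "f \<in> \<F>" shows "bracket_anchor b (df f) = hamiltonian b f"
proof (rule vector_field_eqI[OF bracket_anchor_X[OF df_Om1[OF f]] hamiltonian_X[OF f]])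
  fix g assume g: "g \<in> \<F>"
  show "bracket_anchor b (df f) g = hamiltonian b f g"
    unfolding bracket_anchor_apply[OF g] df_eval[OF f hamiltonian_X[OF g]] by (rule hamiltonian_swap[OF f g, symmetric])
qed

abbreviation "bpi \<equiv> bracket_bivector b"
abbreviation "bD \<equiv> bracket_connection b"

lemma bpi_eq: "\<alpha> \<in> \<Omega> 1 \<Longrightarrow> \<beta> \<in> \<Omega> 1 \<Longrightarrow> bpi \<alpha> \<beta> = \<beta> [bracket_anchor b \<alpha>]"
  by (simp add: bracket_bivector_def)

text \<open>
  The difference of both sides is a tensor, and on exact forms its vanishing is the
  antisymmetry of the bracket of functions.
\<close>

lemma bpi_swap: assumes a: "\<alpha> \<in> \<Omega> 1" and c: "\<beta> \<in> \<Omega> 1" shows "bpi \<alpha> \<beta> = - bpi \<beta> \<alpha>"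
proof -
  let ?F = "\<lambda>\<alpha> \<beta> (_::unit). \<beta> [bracket_anchor b \<alpha>] + \<alpha> [bracket_anchor b \<beta>]"
  note X = bracket_anchor_X
  have "?F \<alpha> \<beta> = 0"
  proof (rule bilinear_vanishing[where F = ?F, OF _ _ _ _ _ a c])
    fix \<sigma> \<tau> \<gamma> assume s: "\<sigma> \<in> \<Omega> 1" and t: "\<tau> \<in> \<Omega> 1" and g: "\<gamma> \<in> \<Omega> 1"
    show "?F (\<sigma> + \<tau>) \<gamma> = ?F \<sigma> \<gamma> + ?F \<tau> \<gamma>" "?F \<gamma> (\<sigma> + \<tau>) = ?F \<gamma> \<sigma> + ?F \<gamma> \<tau>"
      unfolding bracket_anchor_add one_form_eval_add[OF g X[OF s] X[OF t]] by (simp_all add: fun_eq_iff)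
  next
    fix f \<sigma> \<gamma> assume f: "f \<in> \<F>" and s: "\<sigma> \<in> \<Omega> 1" and g: "\<gamma> \<in> \<Omega> 1"
    show "?F (f \<cdot> \<sigma>) \<gamma> = f \<cdot> ?F \<sigma> \<gamma>" "?F \<gamma> (f \<cdot> \<sigma>) = f \<cdot> ?F \<gamma> \<sigma>"
      unfolding bracket_anchor_fmul one_form_eval_fmul[OF g f X[OF s]] by (simp_all add: fun_eq_iff algebra_simps)
  next
    fix f g assume f: "f \<in> \<F>" and g: "g \<in> \<F>"
    show "?F (df f) (df g) = 0"
      unfolding bracket_anchor_df[OF f] bracket_anchor_df[OF g] df_eval[OF f hamiltonian_X[OF g]]
        df_eval[OF g hamiltonian_X[OF f]] hamiltonian_swap[OF f g] by (simp add: fun_eq_iff)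
  qed
  from fun_cong[OF this, of "()"] show ?thesis
    unfolding bpi_eq[OF a c] bpi_eq[OF c a] by (simp add: eq_neg_iff_add_eq_0 fun_eq_iff)
qed

lemma bpi_bivector: "bivector A bpi"
  unfolding bivector_def
proof (intro conjI ballI allI impI)
  note X = bracket_anchor_X
  fix \<alpha> \<beta> assume a: "\<alpha> \<in> \<Omega> 1" and c: "\<beta> \<in> \<Omega> 1"
  show "bpi \<alpha> \<beta> \<in> \<F>" unfolding bpi_eq[OF a c] by (rule Om_smooth[OF c])
  show "bpi \<alpha> \<beta> = - bpi \<beta> \<alpha>" by (rule bpi_swap[OF a c])
  show "bpi (\<alpha> + \<beta>) \<gamma> = bpi \<alpha> \<gamma> + bpi \<beta> \<gamma>" if g: "\<gamma> \<in> \<Omega> 1" for \<gamma>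
    unfolding bpi_eq[OF Om_add[OF a c] g] bpi_eq[OF a g] bpi_eq[OF c g] bracket_anchor_add
    by (rule one_form_eval_add[OF g X[OF a] X[OF c]])
next
  fix f \<alpha> \<beta> assume f: "f \<in> \<F>" and a: "\<alpha> \<in> \<Omega> 1" and c: "\<beta> \<in> \<Omega> 1"
  show "bpi (f \<cdot> \<alpha>) \<beta> = f * bpi \<alpha> \<beta>"
    unfolding bpi_eq[OF Om_fmul[OF f a] c] bpi_eq[OF a c] bracket_anchor_fmul
    by (rule one_form_eval_fmul[OF c f bracket_anchor_X[OF a]])
next
  fix \<alpha> \<beta> assume "\<alpha> \<notin> \<Omega> 1 \<or> \<beta> \<notin> \<Omega> 1"
  then show "bpi \<alpha> \<beta> = 0" by (auto simp: bracket_bivector_def)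
qed

sublocale pc: bivector_manifold A bpi
  by unfold_locales (rule bpi_bivector)

lemma bpi_anchor: assumes a: "\<alpha> \<in> \<Omega> 1" shows "anchor A bpi \<alpha> = bracket_anchor b \<alpha>"
proof (rule vector_field_eqI[OF pc.anchor_X[OF a] bracket_anchor_X[OF a]])
  fix f assume f: "f \<in> \<F>"
  show "anchor A bpi \<alpha> f = bracket_anchor b \<alpha> f"
    unfolding pc.anchor_apply[OF f] bpi_eq[OF a df_Om1[OF f]] by (rule df_eval[OF f bracket_anchor_X[OF a]])
qed

lemma bpi_function_bracket: assumes f: "f \<in> \<F>" and g: "g \<in> \<F>"
  shows "function_bracket A bpi f g = hamiltonian b f g"
  unfolding pc.fb_anchor[OF g] bpi_anchor[OF df_Om1[OF f]] bracket_anchor_df[OF f] by (rule refl)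

lemma b_function_bracket: assumes f: "f \<in> \<F>" and g: "g \<in> \<F>"
  shows "b (zf f) (zf g) = zf (function_bracket A bpi f g)"
  unfolding bpi_function_bracket[OF f g] by (rule b_zf_zf[OF f g])

lemma bpi_poisson: "poisson_structure A bpi"
  unfolding poisson_structure_def
proof (intro conjI ballI)
  show "bivector A bpi" by (rule bpi_bivector)
  fix f g h assume f: "f \<in> \<F>" and g: "g \<in> \<F>" and h: "h \<in> \<F>"
  let ?br = "function_bracket A bpi"
  note z = zero_form_Om
  note bf = pc.fb_F
  note e = b_function_bracket
  have "b (b (zf f) (zf g)) (zf h) = b (zf f) (b (zf g) (zf h)) - b (zf g) (b (zf f) (zf h))"
    using b_jacobi[OF z[OF f] z[OF g] z[OF h]] by simp
  then have 1: "?br (?br f g) h = ?br f (?br g h) - ?br g (?br f h)"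
    unfolding e[OF f g] e[OF g h] e[OF f h] e[OF bf h] e[OF f bf] e[OF g bf] zero_form_diff[symmetric]
      zero_form_inject .
  have 2: "?br h (?br f g) = - ?br (?br f g) h" by (rule pc.fb_swap[OF h bf])
  have "?br h f = - ?br f h" by (rule pc.fb_swap[OF h f])
  then have 3: "?br g (?br h f) = - ?br g (?br f h)"
    using X_minus[OF pc.anchor_X[OF df_Om1[OF g]] bf] pc.fb_anchor bf F_minus by metis
  show "?br f (?br g h) + ?br g (?br h f) + ?br h (?br f g) = 0"
    unfolding 2 3 1 by simp
qed

lemma bracket_field_apply: "g \<in> \<F> \<Longrightarrow> bracket_field b \<beta> X g = b (zf g) \<beta> [X]"
  by (simp add: bracket_field_def)

lemma bracket_field_X: assumes c: "\<beta> \<in> \<Omega> 1" shows "bracket_field b \<beta> X \<in> \<X>"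
proof (rule vector_fieldI)
  fix f assume f: "f \<in> \<F>"
  show "bracket_field b \<beta> X f \<in> \<F>" unfolding bracket_field_apply[OF f]
    by (rule Om_smooth[OF b_Om[OF zero_form_Om[OF f] c]])
  show "bracket_field b \<beta> X ((\<lambda>_. k) * f) = (\<lambda>_. k) * bracket_field b \<beta> X f" for k
    unfolding bracket_field_apply[OF F_mult[OF F_const f]] bracket_field_apply[OF f] b_zf_scale[OF f c]
    by (simp add: fun_eq_iff)
  fix g assume g: "g \<in> \<F>"
  show "bracket_field b \<beta> X (f + g) = bracket_field b \<beta> X f + bracket_field b \<beta> X g"
    unfolding bracket_field_apply[OF F_add[OF f g]] bracket_field_apply[OF f] bracket_field_apply[OF g]
      b_zf_add[OF f g c] by (simp add: fun_eq_iff)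
  show "bracket_field b \<beta> X (f * g) = bracket_field b \<beta> X f * g + f * bracket_field b \<beta> X g"
    unfolding bracket_field_apply[OF F_mult[OF f g]] bracket_field_apply[OF f] bracket_field_apply[OF g]
      b_zf_mult[OF f g c] by (simp add: fun_eq_iff algebra_simps)
qed (simp add: bracket_field_def)

lemma b_zf_Om1: "g \<in> \<F> \<Longrightarrow> \<beta> \<in> \<Omega> 1 \<Longrightarrow> b (zf g) \<beta> \<in> \<Omega> 1"
  using b_Om[OF zero_form_Om, of g \<beta> 1] by simp

lemma bracket_field_add: assumes c: "\<beta> \<in> \<Omega> 1" and X: "X \<in> \<X>" and Y: "Y \<in> \<X>"
  shows "bracket_field b \<beta> (X + Y) = bracket_field b \<beta> X + bracket_field b \<beta> Y"
  by (rule ext) (simp add: bracket_field_def one_form_eval_add[OF b_zf_Om1[OF _ c] X Y])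

lemma bracket_field_fmul: assumes c: "\<beta> \<in> \<Omega> 1" and f: "f \<in> \<F>" and X: "X \<in> \<X>"
  shows "bracket_field b \<beta> (f \<cdot> X) = f \<cdot> bracket_field b \<beta> X"
  by (simp add: fun_eq_iff bracket_field_def one_form_eval_fmul[OF b_zf_Om1[OF _ c] f X])

lemma bD_eval: "\<alpha> \<in> \<Omega> 1 \<Longrightarrow> \<beta> \<in> \<Omega> 1 \<Longrightarrow> X \<in> \<X> \<Longrightarrow> bD \<alpha> \<beta> [X] = \<alpha> [bracket_field b \<beta> X]"
  by (simp add: bracket_connection_def one_form_of_eval)

lemma bD_Om: assumes a: "\<alpha> \<in> \<Omega> 1" and c: "\<beta> \<in> \<Omega> 1" shows "bD \<alpha> \<beta> \<in> \<Omega> 1"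
proof -
  have "one_form_of (\<lambda>X. \<alpha> [bracket_field b \<beta> X]) \<in> \<Omega> 1"
  proof (rule one_form_of_Om)
    fix X assume X: "X \<in> \<X>"
    show "\<alpha> [bracket_field b \<beta> X] \<in> \<F>" by (rule Om_smooth[OF a])
    show "\<alpha> [bracket_field b \<beta> (X + Y)] = \<alpha> [bracket_field b \<beta> X] + \<alpha> [bracket_field b \<beta> Y]" if Y: "Y \<in> \<X>" for Y
      unfolding bracket_field_add[OF c X Y] by (rule one_form_eval_add[OF a bracket_field_X[OF c] bracket_field_X[OF c]])
    show "\<alpha> [bracket_field b \<beta> (f \<cdot> X)] = f * \<alpha> [bracket_field b \<beta> X]" if f: "f \<in> \<F>" for f
      unfolding bracket_field_fmul[OF c f X] by (rule one_form_eval_fmul[OF a f bracket_field_X[OF c]])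
  qed
  then show ?thesis using a c by (simp add: bracket_connection_def)
qed

lemma bD_df: assumes f: "f \<in> \<F>" and c: "\<beta> \<in> \<Omega> 1" shows "bD (df f) \<beta> = b (zf f) \<beta>"
proof (rule one_form_eqI'[OF bD_Om[OF df_Om1[OF f] c] b_zf_Om1[OF f c]])
  fix X assume X: "X \<in> \<X>"
  show "bD (df f) \<beta> [X] = b (zf f) \<beta> [X]"
    unfolding bD_eval[OF df_Om1[OF f] c X] df_eval[OF f bracket_field_X[OF c]] by (rule bracket_field_apply[OF f])
qed

lemma bD_add1: assumes a: "\<alpha> \<in> \<Omega> 1" "\<alpha>' \<in> \<Omega> 1" and c: "\<beta> \<in> \<Omega> 1"
  shows "bD (\<alpha> + \<alpha>') \<beta> = bD \<alpha> \<beta> + bD \<alpha>' \<beta>"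
  by (rule one_form_eqI'[OF bD_Om[OF Om_add[OF a] c] Om_add[OF bD_Om[OF a(1) c] bD_Om[OF a(2) c]]])
     (simp add: bD_eval[OF Om_add[OF a] c] bD_eval[OF a(1) c] bD_eval[OF a(2) c])

lemma bD_fmul1: assumes f: "f \<in> \<F>" and a: "\<alpha> \<in> \<Omega> 1" and c: "\<beta> \<in> \<Omega> 1"
  shows "bD (f \<cdot> \<alpha>) \<beta> = f \<cdot> bD \<alpha> \<beta>"
  by (rule one_form_eqI'[OF bD_Om[OF Om_fmul[OF f a] c] Om_fmul[OF f bD_Om[OF a c]]])
     (simp add: bD_eval[OF Om_fmul[OF f a] c] bD_eval[OF a c] fun_eq_iff)

lemma bD_add2: assumes a: "\<alpha> \<in> \<Omega> 1" and c: "\<beta> \<in> \<Omega> 1" "\<beta>' \<in> \<Omega> 1"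
  shows "bD \<alpha> (\<beta> + \<beta>') = bD \<alpha> \<beta> + bD \<alpha> \<beta>'"
proof (rule one_form_eqI'[OF bD_Om[OF a Om_add[OF c]] Om_add[OF bD_Om[OF a c(1)] bD_Om[OF a c(2)]]])
  fix X assume X: "X \<in> \<X>"
  have "bracket_field b (\<beta> + \<beta>') X = bracket_field b \<beta> X + bracket_field b \<beta>' X"
    by (rule ext) (simp add: bracket_field_def b_add2[OF Om_total[OF c(1)] Om_total[OF c(2)] Om_total[OF zero_form_Om]])
  then show "bD \<alpha> (\<beta> + \<beta>') [X] = (bD \<alpha> \<beta> + bD \<alpha> \<beta>') [X]"
    unfolding plus_fun_apply[of "bD \<alpha> \<beta>"] bD_eval[OF a Om_add[OF c] X] bD_eval[OF a c(1) X] bD_eval[OF a c(2) X]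
    using one_form_eval_add[OF a bracket_field_X[OF c(1)] bracket_field_X[OF c(2)]] by metis
qed

lemma bD_fmul2: assumes f: "f \<in> \<F>" and a: "\<alpha> \<in> \<Omega> 1" and c: "\<beta> \<in> \<Omega> 1"
  shows "bD \<alpha> (f \<cdot> \<beta>) = f \<cdot> bD \<alpha> \<beta> + anchor A bpi \<alpha> f \<cdot> \<beta>"
proof (rule one_form_eqI'[OF bD_Om[OF a Om_fmul[OF f c]]])
  have an: "anchor A bpi \<alpha> f \<in> \<F>" by (rule X_F[OF pc.anchor_X[OF a] f])
  show "f \<cdot> bD \<alpha> \<beta> + anchor A bpi \<alpha> f \<cdot> \<beta> \<in> \<Omega> 1"
    by (intro Om_add Om_fmul f bD_Om a c an)
  fix X assume X: "X \<in> \<X>"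
  have eX: "bracket_field b (f \<cdot> \<beta>) X = f \<cdot> bracket_field b \<beta> X + \<beta> [X] \<cdot> (- hamiltonian b f)"
  proof (rule vector_field_eqI)
    show "bracket_field b (f \<cdot> \<beta>) X \<in> \<X>" by (rule bracket_field_X[OF Om_fmul[OF f c]])
    show "f \<cdot> bracket_field b \<beta> X + \<beta> [X] \<cdot> (- hamiltonian b f) \<in> \<X>"
      by (intro VF_add VF_fmul f bracket_field_X[OF c] Om_smooth[OF c] VF_minus hamiltonian_X[OF f])
    fix g assume g: "g \<in> \<F>"
    show "bracket_field b (f \<cdot> \<beta>) X g = (f \<cdot> bracket_field b \<beta> X + \<beta> [X] \<cdot> (- hamiltonian b f)) g"
      unfolding bracket_field_apply[OF g] b_fmul[OF f zero_form_Om[OF g] c] b_zf_zf[OF g f] zero_form_wedge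
        hamiltonian_swap[OF g f] by (simp add: fun_eq_iff bracket_field_apply[OF g])
  qed
  have "\<alpha> [bracket_field b (f \<cdot> \<beta>) X] = f * \<alpha> [bracket_field b \<beta> X] + \<beta> [X] * \<alpha> [- hamiltonian b f]"
    unfolding eX using one_form_eval_add[OF a VF_fmul[OF f bracket_field_X[OF c]]
        VF_fmul[OF Om_smooth[OF c] VF_minus[OF hamiltonian_X[OF f]]]]
      one_form_eval_fmul[OF a f bracket_field_X[OF c]]
      one_form_eval_fmul[OF a Om_smooth[OF c] VF_minus[OF hamiltonian_X[OF f]]] by metis
  moreover have "\<alpha> [- hamiltonian b f] = - \<alpha> [hamiltonian b f]"
    using ins_vf_minus[OF a hamiltonian_X[OF f]] by (metis ins_apply uminus_apply)
  ultimately show "bD \<alpha> (f \<cdot> \<beta>) [X] = (f \<cdot> bD \<alpha> \<beta> + anchor A bpi \<alpha> f \<cdot> \<beta>) [X]"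
    unfolding bD_eval[OF a Om_fmul[OF f c] X] bpi_anchor[OF a] bracket_anchor_apply[OF f]
    by (simp add: fun_eq_iff bD_eval[OF a c X])
qed

lemma bD_connection: "contravariant_connection A bpi bD"
  unfolding contravariant_connection_def
proof (intro conjI ballI allI impI)
  have s1: "bD (sc k \<alpha>) \<beta> = sc k (bD \<alpha> \<beta>)" if "\<alpha> \<in> \<Omega> 1" "\<beta> \<in> \<Omega> 1" for k \<alpha> \<beta>
    unfolding sc_fmul by (rule bD_fmul1[OF F_const that])
  have s2: "bD \<alpha> (sc k \<beta>) = sc k (bD \<alpha> \<beta>)" if "\<beta> \<in> \<Omega> 1" "\<alpha> \<in> \<Omega> 1" for k \<alpha> \<beta>
    unfolding sc_fmul bD_fmul2[OF F_const that(2,1)] X_const[OF pc.anchor_X[OF that(2)]]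
    by (simp add: fun_eq_iff)
  show "bilinear_on sc (\<Omega> 1) bD"
    by (rule bilinear_onI) (rule bD_add1 bD_add2 s1 s2; assumption)+
  fix \<alpha> \<beta> assume "\<alpha> \<notin> \<Omega> 1 \<or> \<beta> \<notin> \<Omega> 1"
  then show "bD \<alpha> \<beta> = 0" by (auto simp: bracket_connection_def)
qed (rule bD_Om bD_fmul1 bD_fmul2; assumption)+

sublocale pc: contravariant_manifold A bpi bD
  by unfold_locales (rule bpi_poisson bD_connection)+

abbreviation "Kb \<equiv> koszul bpi"

lemma Kb_exact: "f \<in> \<F> \<Longrightarrow> g \<in> \<F> \<Longrightarrow> Kb (df f) (df g) = df (function_bracket A bpi f g)"
  by (rule pc.K_exact)

text \<open>
  The curvature is an antisymmetric tensor, and on \<open>df, dh\<close> it is the Jacobi identity for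
  \<open>f, h, \<gamma>\<close>.
\<close>

lemma bD_flat: "flat A bpi bD"
  unfolding flat_def pc.koszul_bracket_eq
proof (intro ballI)
  note Dm = bD_Om and Km = pc.K_Om
  fix \<alpha> \<beta> \<gamma> assume a: "\<alpha> \<in> \<Omega> 1" and c: "\<beta> \<in> \<Omega> 1" and g: "\<gamma> \<in> \<Omega> 1"
  let ?R = "\<lambda>\<alpha> \<beta>. bD \<alpha> (bD \<beta> \<gamma>) - bD \<beta> (bD \<alpha> \<gamma>) - bD (Kb \<alpha> \<beta>) \<gamma>"
  have D_minus1: "bD (- \<sigma>) \<gamma> = - bD \<sigma> \<gamma>" if s: "\<sigma> \<in> \<Omega> 1" for \<sigma>
  proof -
    have e: "- \<tau> = (\<lambda>_. - 1) \<cdot> \<tau>" for \<tau> :: "'m form" by (simp add: fun_eq_iff)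
    show ?thesis unfolding e[of \<sigma>] bD_fmul1[OF F_const s g] by (simp add: fun_eq_iff)
  qed
  have swap: "?R \<alpha> \<beta> = - ?R \<beta> \<alpha>" for \<alpha> \<beta>
  proof -
    have "bD (Kb \<alpha> \<beta>) \<gamma> = - bD (Kb \<beta> \<alpha>) \<gamma>" using D_minus1[OF Km] pc.K_swap by metis
    then show ?thesis by (simp add: fun_eq_iff)
  qed
  have add2: "?R \<alpha> (\<sigma> + \<tau>) = ?R \<alpha> \<sigma> + ?R \<alpha> \<tau>"
    if s: "\<sigma> \<in> \<Omega> 1" and t: "\<tau> \<in> \<Omega> 1" and a: "\<alpha> \<in> \<Omega> 1" for \<alpha> \<sigma> \<tau>
    unfolding bD_add1[OF s t g] bD_add2[OF a Dm[OF s g] Dm[OF t g]] bD_add1[OF s t Dm[OF a g]]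
      pc.K_add2[OF a s t] bD_add1[OF Km Km g] by (simp add: fun_eq_iff)
  have fmul2: "?R \<alpha> (f \<cdot> \<sigma>) = f \<cdot> ?R \<alpha> \<sigma>"
    if f: "f \<in> \<F>" and s: "\<sigma> \<in> \<Omega> 1" and a: "\<alpha> \<in> \<Omega> 1" for \<alpha> f \<sigma>
  proof -
    have an: "anchor A bpi \<alpha> f \<in> \<F>" by (rule X_F[OF pc.anchor_X[OF a] f])
    show ?thesis
      unfolding bD_fmul1[OF f s g] bD_fmul2[OF f a Dm[OF s g]] bD_fmul1[OF f s Dm[OF a g]]
        pc.K_fmul2[OF f a s] bD_add1[OF Om_fmul[OF f Km] Om_fmul[OF an s] g]
        bD_fmul1[OF f Km g] bD_fmul1[OF an s g] by (simp add: fun_eq_iff algebra_simps)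
  qed
  show "?R \<alpha> \<beta> = 0"
  proof (rule skew_bilinear_vanishing[where F = ?R, OF _ _ _ _ a c])
    show "?R (df f) (df h) = 0" if f: "f \<in> \<F>" and h: "h \<in> \<F>" for f h
    proof -
      note z = zero_form_Om and m = b_zf_Om1[OF _ g]
      have "b (b (zero_form f) (zero_form h)) \<gamma> =
          b (zero_form f) (b (zero_form h) \<gamma>) - b (zero_form h) (b (zero_form f) \<gamma>)"
        using b_jacobi[OF z[OF f] z[OF h] g] by (simp add: fun_eq_iff)
      then show ?thesis
        unfolding Kb_exact[OF f h] bD_df[OF f g] bD_df[OF h g] bD_df[OF f m[OF h]] bD_df[OF h m[OF f]]
          bD_df[OF pc.fb_F g] b_function_bracket[OF f h] by simp
    qed
  qed (rule swap add2 fmul2; assumption?)+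
qed

text \<open>
  The torsion is an antisymmetric tensor, and on \<open>df, dh\<close> it vanishes because \<open>d\<close> is a
  derivation of the bracket \<open>{f, h}\<close>.
\<close>

lemma bD_torsion_free: "torsion_free A bpi bD"
  unfolding torsion_free_def pc.koszul_bracket_eq
proof (intro ballI)
  fix \<alpha> \<beta> assume a: "\<alpha> \<in> \<Omega> 1" and c: "\<beta> \<in> \<Omega> 1"
  let ?R = "\<lambda>\<alpha> \<beta>. bD \<alpha> \<beta> - bD \<beta> \<alpha> - Kb \<alpha> \<beta>"
  have swap: "?R \<alpha> \<beta> = - ?R \<beta> \<alpha>" for \<alpha> \<beta>
    unfolding pc.K_swap[of \<alpha> \<beta>] by (simp add: fun_eq_iff)
  have add2: "?R \<alpha> (\<sigma> + \<tau>) = ?R \<alpha> \<sigma> + ?R \<alpha> \<tau>"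
    if s: "\<sigma> \<in> \<Omega> 1" and t: "\<tau> \<in> \<Omega> 1" and a: "\<alpha> \<in> \<Omega> 1" for \<alpha> \<sigma> \<tau>
    unfolding bD_add1[OF s t a] bD_add2[OF a s t] pc.K_add2[OF a s t] by (simp add: fun_eq_iff)
  have fmul2: "?R \<alpha> (f \<cdot> \<sigma>) = f \<cdot> ?R \<alpha> \<sigma>"
    if f: "f \<in> \<F>" and s: "\<sigma> \<in> \<Omega> 1" and a: "\<alpha> \<in> \<Omega> 1" for \<alpha> f \<sigma>
    unfolding bD_fmul1[OF f s a] bD_fmul2[OF f a s] pc.K_fmul2[OF f a s]
    by (simp add: fun_eq_iff algebra_simps)
  have "?R \<alpha> \<beta> = 0"
  proof (rule skew_bilinear_vanishing[where F = ?R, OF _ _ _ _ a c])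
    show "?R (df f) (df h) = 0" if f: "f \<in> \<F>" and h: "h \<in> \<F>" for f h
    proof -
      note z = zero_form_Om
      have "\<dd> (b (zero_form f) (zero_form h)) = b (df f) (zero_form h) + b (zero_form f) (df h)"
        using b_ext_d[OF z[OF f] z[OF h]] by (simp add: fun_eq_iff)
      moreover have "b (zero_form h) (df f) = - b (df f) (zero_form h)" by (rule b_zf_swap[OF h df_Om1[OF f]])
      ultimately show ?thesis
        unfolding Kb_exact[OF f h] bD_df[OF f df_Om1[OF h]] bD_df[OF h df_Om1[OF f]] b_function_bracket[OF f h]
        by (simp add: fun_eq_iff)
    qed
  qed (rule swap add2 fmul2; assumption?)+
  then show "bD \<alpha> \<beta> - bD \<beta> \<alpha> = Kb \<alpha> \<beta>" by simp
qed

text \<open>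
  Both sides are derivations of degree 0 that agree on functions and differentials. So the
  bracket of a function with a form of any degree is given by the connection.
\<close>

lemma H_bracket: assumes f: "f \<in> \<F>" and \<omega>: "\<omega> \<in> \<Omega> k"
  shows "function_form_bracket A bpi bD f \<omega> = b (zero_form f) \<omega>"
proof -
  show ?thesis
  proof (rule gd_eqI[OF pc.H_gd[OF f] b_gd[OF zero_form_Om[OF f]] _ _ \<omega>])
    fix g assume g: "g \<in> \<F>"
    show "function_form_bracket A bpi bD f (zero_form g) = b (zero_form f) (zero_form g)"
      unfolding pc.H_zero_form[OF f g] by (rule b_function_bracket[OF f g, symmetric])
    show "function_form_bracket A bpi bD f (df g) = b (zero_form f) (df g)"
      unfolding pc.H_one_form[OF f df_Om1[OF g]] by (rule bD_df[OF f df_Om1[OF g]])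
  qed
qed

definition one_form_restriction :: "'m form \<Rightarrow> 'm form \<Rightarrow> 'm form" where
  "one_form_restriction \<alpha> \<beta> = (if \<alpha> \<in> \<Omega> 1 \<and> \<beta> \<in> \<Omega> 1 then b \<alpha> \<beta> else 0)"

lemma one_form_restriction_eq: "\<alpha> \<in> \<Omega> 1 \<Longrightarrow> \<beta> \<in> \<Omega> 1 \<Longrightarrow> one_form_restriction \<alpha> \<beta> = b \<alpha> \<beta>"
  by (simp add: one_form_restriction_def)

lemma b_one_forms_swap: assumes "\<alpha> \<in> \<Omega> 1" "\<beta> \<in> \<Omega> 1" shows "b \<alpha> \<beta> = b \<beta> \<alpha>"
  using b_swap[OF assms] by (simp add: fun_eq_iff)

lemma restriction_is_one_form_bracket: "is_one_form_bracket A bpi bD one_form_restriction"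
  unfolding is_one_form_bracket_def
proof (intro conjI ballI allI impI)
  note e = one_form_restriction_eq and t = Om_total
  show "bilinear_on sc (\<Omega> 1) one_form_restriction"
  proof (rule bilinear_onI)
    fix x y z assume x: "x \<in> \<Omega> 1" and y: "y \<in> \<Omega> 1" and z: "z \<in> \<Omega> 1"
    show "one_form_restriction (x + y) z = one_form_restriction x z + one_form_restriction y z"
      unfolding e[OF x z] e[OF y z] e[OF Om_add[OF x y] z] by (rule b_add1[OF t[OF x] t[OF y] t[OF z]])
    show "one_form_restriction z (x + y) = one_form_restriction z x + one_form_restriction z y"
      unfolding e[OF z x] e[OF z y] e[OF z Om_add[OF x y]] by (rule b_add2[OF t[OF x] t[OF y] t[OF z]])
  next
    fix c x z assume x: "x \<in> \<Omega> 1" and z: "z \<in> \<Omega> 1"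
    show "one_form_restriction (sc c x) z = sc c (one_form_restriction x z)"
      unfolding e[OF x z] e[OF Om_sc[OF x] z] by (rule b_sc1[OF t[OF x] t[OF z]])
    show "one_form_restriction z (sc c x) = sc c (one_form_restriction z x)"
      unfolding e[OF z x] e[OF z Om_sc[OF x]] by (rule b_sc2[OF t[OF x] t[OF z]])
  qed
  fix \<alpha> \<beta> assume a: "\<alpha> \<in> \<Omega> 1" and c: "\<beta> \<in> \<Omega> 1"
  show "one_form_restriction \<alpha> \<beta> \<in> \<Omega> 2" unfolding e[OF a c] using b_Om[OF a c] by (simp add: numeral_2_eq_2)
  show "one_form_restriction \<alpha> \<beta> = one_form_restriction \<beta> \<alpha>"
    unfolding e[OF a c] e[OF c a] by (rule b_one_forms_swap[OF a c])
next
  note e = one_form_restriction_eq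
  fix f \<alpha> \<beta> assume f: "f \<in> \<F>" and a: "\<alpha> \<in> \<Omega> 1" and c: "\<beta> \<in> \<Omega> 1"
  have m: "b \<beta> (zero_form f) \<in> \<Omega> 1" using b_Om[OF c zero_form_Om[OF f]] by simp
  have "b (f \<cdot> \<alpha>) \<beta> = b \<beta> (zero_form f) \<and>\<^sub>\<Omega> \<alpha> + f \<cdot> b \<beta> \<alpha>"
    unfolding b_one_forms_swap[OF Om_fmul[OF f a] c] by (rule b_fmul[OF f c a])
  also have "b \<beta> (zero_form f) \<and>\<^sub>\<Omega> \<alpha> = \<alpha> \<and>\<^sub>\<Omega> b (zero_form f) \<beta>"
    unfolding b_zf_swap[OF f c] Om_wedge_commute[OF m a] by (simp add: fun_eq_iff)
  finally show "one_form_restriction (f \<cdot> \<alpha>) \<beta> = f \<cdot> one_form_restriction \<alpha> \<beta> + \<alpha> \<and>\<^sub>\<Omega> function_form_bracket A bpi bD f \<beta>"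
    unfolding e[OF a c] e[OF Om_fmul[OF f a] c] H_bracket[OF f c] b_one_forms_swap[OF a c] by (simp only: add.commute)
next
  note e = one_form_restriction_eq
  fix f \<beta> assume f: "f \<in> \<F>" and c: "\<beta> \<in> \<Omega> 1"
  show "\<dd> (function_form_bracket A bpi bD f \<beta>) = one_form_restriction (df f) \<beta> + function_form_bracket A bpi bD f (\<dd> \<beta>)"
    unfolding e[OF df_Om1[OF f] c] H_bracket[OF f c] H_bracket[OF f ext_d_Om[OF c]]
    using b_ext_d[OF zero_form_Om[OF f] c] by (simp add: fun_eq_iff)
next
  fix \<alpha> \<beta> assume "\<alpha> \<notin> \<Omega> 1 \<or> \<beta> \<notin> \<Omega> 1"
  then show "one_form_restriction \<alpha> \<beta> = 0" by (auto simp: one_form_restriction_def)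
qed

text \<open>
  By uniqueness the bracket of 1-forms in the definition of the metacurvature is the given
  one. The Jacobi identity for \<open>f, \<beta>, \<gamma>\<close> then says that 0 satisfies the definition of the
  metacurvature.
\<close>

lemma bracket_metacurvature: "metacurvature A bpi bD = (\<lambda>\<alpha> \<beta> \<gamma>. 0)"
proof (rule pc.metacurvature_unique)
  note ob = pc.one_form_bracket_unique[OF restriction_is_one_form_bracket]
  note e = one_form_restriction_eq
  have fl: "function_linear A (\<lambda>_. 0)" by (simp add: function_linear_def fun_eq_iff)
  show "is_metacurvature A bpi bD (\<lambda>\<alpha> \<beta> \<gamma>. 0)"
    unfolding is_metacurvature_def
  proof (intro conjI ballI allI impI)
    fix f \<beta> \<gamma> assume f: "f \<in> \<F>" and c: "\<beta> \<in> \<Omega> 1" and g: "\<gamma> \<in> \<Omega> 1"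
    note m = b_zf_Om1[OF f]
    have cg: "b \<beta> \<gamma> \<in> \<Omega> 2" using b_Om[OF c g] by (simp add: numeral_2_eq_2)
    have "b (b (zero_form f) \<beta>) \<gamma> = b (zero_form f) (b \<beta> \<gamma>) - b \<beta> (b (zero_form f) \<gamma>)"
      using b_jacobi[OF zero_form_Om[OF f] c g] by (simp add: fun_eq_iff)
    then show "0 = function_form_bracket A bpi bD f (one_form_bracket A bpi bD \<beta> \<gamma>)
          - one_form_bracket A bpi bD (function_form_bracket A bpi bD f \<beta>) \<gamma>
          - one_form_bracket A bpi bD (function_form_bracket A bpi bD f \<gamma>) \<beta>"
      unfolding ob H_bracket[OF f c] H_bracket[OF f g] e[OF c g] e[OF m[OF c] g] e[OF m[OF g] c]
        H_bracket[OF f cg] b_one_forms_swap[OF m[OF g] c] by simp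
  qed (rule fl Om_0 refl)+
qed

lemma bracket_poisson_connection: "(bpi, bD) \<in> poisson_connections A"
  unfolding poisson_connections_def
  using bpi_poisson bD_connection bD_flat bD_torsion_free bracket_metacurvature by simp

lemma bracket_corresponds: "corresponds A b (bpi, bD)"
  unfolding corresponds_def using b_function_bracket bD_df by simp

lemma poisson_connection_unique:
  assumes S: "(\<pi>, D) \<in> poisson_connections A" and c: "corresponds A b (\<pi>, D)"
  shows "\<pi> = bpi" "D = bD"
proof -
  interpret S: contravariant_manifold A \<pi> D
    by unfold_locales (use S in \<open>auto simp: poisson_connections_def poisson_structure_def\<close>)
  have fbe: "b (zero_form f) (zero_form g) = zero_form (function_bracket A \<pi> f g)" if "f \<in> \<F>" "g \<in> \<F>" for f g
    using c that unfolding corresponds_def by blast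
  have De: "D (df f) \<beta> = b (zero_form f) \<beta>" if "f \<in> \<F>" "\<beta> \<in> \<Omega> 1" for f \<beta>
    using c that unfolding corresponds_def by blast
  have out: "\<pi> \<alpha> \<beta> = 0" if "\<alpha> \<notin> \<Omega> 1 \<or> \<beta> \<notin> \<Omega> 1" for \<alpha> \<beta>
    using S.bivector that unfolding bivector_def by blast
  have "\<pi> \<alpha> \<beta> = bpi \<alpha> \<beta>" if a: "\<alpha> \<in> \<Omega> 1" and d: "\<beta> \<in> \<Omega> 1" for \<alpha> \<beta>
  proof -
    let ?F = "\<lambda>\<alpha> \<beta> (_::unit). \<pi> \<alpha> \<beta> - bpi \<alpha> \<beta>"
    have "?F \<alpha> \<beta> = 0"
    proof (rule bilinear_vanishing[where F = ?F, OF _ _ _ _ _ a d])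
      fix \<sigma> \<tau> \<gamma> assume s: "\<sigma> \<in> \<Omega> 1" and t: "\<tau> \<in> \<Omega> 1" and g: "\<gamma> \<in> \<Omega> 1"
      show "?F (\<sigma> + \<tau>) \<gamma> = ?F \<sigma> \<gamma> + ?F \<tau> \<gamma>" "?F \<gamma> (\<sigma> + \<tau>) = ?F \<gamma> \<sigma> + ?F \<gamma> \<tau>"
        unfolding S.pi_add1[OF s t g] pc.pi_add1[OF s t g] S.pi_add2[OF s t g] pc.pi_add2[OF s t g]
        by (simp_all add: fun_eq_iff)
    next
      fix f \<sigma> \<gamma> assume f: "f \<in> \<F>" and s: "\<sigma> \<in> \<Omega> 1" and g: "\<gamma> \<in> \<Omega> 1"
      show "?F (f \<cdot> \<sigma>) \<gamma> = f \<cdot> ?F \<sigma> \<gamma>" "?F \<gamma> (f \<cdot> \<sigma>) = f \<cdot> ?F \<gamma> \<sigma>"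
        unfolding S.pi_fmul1[OF f s g] pc.pi_fmul1[OF f s g] S.pi_fmul2[OF f s g] pc.pi_fmul2[OF f s g]
        by (simp_all add: fun_eq_iff algebra_simps)
    next
      fix f g assume f: "f \<in> \<F>" and g: "g \<in> \<F>"
      have "function_bracket A \<pi> f g = function_bracket A bpi f g"
        using fbe[OF f g] b_function_bracket[OF f g] by (metis zero_form_inject)
      then show "?F (df f) (df g) = 0" by (simp add: function_bracket_def fun_eq_iff)
    qed
    from fun_cong[OF this, of "()"] show ?thesis by (simp add: fun_eq_iff)
  qed
  then have "\<pi> \<alpha> \<beta> = bpi \<alpha> \<beta>" for \<alpha> \<beta>
    using out[of \<alpha> \<beta>] by (cases "\<alpha> \<in> \<Omega> 1 \<and> \<beta> \<in> \<Omega> 1") (auto simp: bracket_bivector_def)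
  then show pi: "\<pi> = bpi" by (intro ext) metis
  have "D \<alpha> \<beta> = bD \<alpha> \<beta>" if a: "\<alpha> \<in> \<Omega> 1" and d: "\<beta> \<in> \<Omega> 1" for \<alpha> \<beta>
  proof (rule one_form_eqI[where F = "\<lambda>\<alpha>. D \<alpha> \<beta>" and G = "\<lambda>\<alpha>. bD \<alpha> \<beta>", OF _ _ _ _ _ a])
    show "D (df f) \<beta> = bD (df f) \<beta>" if f: "f \<in> \<F>" for f
      unfolding De[OF f d] bD_df[OF f d] by (rule refl)
  qed (rule S.D_add1 S.D_fmul1 pc.D_add1 pc.D_fmul1; (assumption | rule d))+
  then have "D \<alpha> \<beta> = bD \<alpha> \<beta>" for \<alpha> \<beta>
    using S.D_outside[of \<alpha> \<beta>] pc.D_outside[of \<alpha> \<beta>] by metis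
  then show "D = bD" by (intro ext) metis
qed

text \<open>
  Brackets \<open>{f, \<cdot>}\<close> are derivations with given values on functions and differentials. By
  antisymmetry \<open>{\<sigma>, f}\<close> is known as well, and \<open>{\<sigma>, df}\<close> then follows from \<open>d{\<sigma>, f} = {d\<sigma>, f}
  \<plusminus> {\<sigma>, df}\<close>.
\<close>

lemma dgp_bracket_unique_homogeneous:
  assumes b': "b' \<in> dgp_brackets A"
    and zz: "\<And>f g. f \<in> \<F> \<Longrightarrow> g \<in> \<F> \<Longrightarrow> b' (zero_form f) (zero_form g) = b (zero_form f) (zero_form g)"
    and z1: "\<And>f \<alpha>. f \<in> \<F> \<Longrightarrow> \<alpha> \<in> \<Omega> 1 \<Longrightarrow> b' (zero_form f) \<alpha> = b (zero_form f) \<alpha>"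
    and s: "\<sigma> \<in> \<Omega> k" and t: "\<tau> \<in> \<Omega> l"
  shows "b' \<sigma> \<tau> = b \<sigma> \<tau>"
proof -
  interpret b': dgp_bracket A b' by unfold_locales (rule b')
  have z: "b' (zero_form f) \<tau> = b (zero_form f) \<tau>" if f: "f \<in> \<F>" and t: "\<tau> \<in> \<Omega> l" for f \<tau> l
    by (rule gd_eqI[OF b'.b_gd[OF zero_form_Om[OF f]] b_gd[OF zero_form_Om[OF f]] _ _ t])
       (rule zz[OF f] z1[OF f df_Om1]; assumption)+
  have z': "b' \<sigma> (zero_form f) = b \<sigma> (zero_form f)" if f: "f \<in> \<F>" and s: "\<sigma> \<in> \<Omega> k" for f \<sigma> k
    using z[OF f s] b'.b_zf_swap[OF f s] b_zf_swap[OF f s] by simp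
  show ?thesis
  proof (rule gd_eqI[OF b'.b_gd[OF s] b_gd[OF s] _ _ t])
    fix f assume f: "f \<in> \<F>"
    show "b' \<sigma> (zero_form f) = b \<sigma> (zero_form f)" by (rule z'[OF f s])
    have "sc ((- 1) ^ k) (b' \<sigma> (df f)) = sc ((- 1) ^ k) (b \<sigma> (df f))"
      using b'.b_ext_d[OF s zero_form_Om[OF f]] b_ext_d[OF s zero_form_Om[OF f]]
        z'[OF f s] z'[OF f ext_d_Om[OF s]] by simp
    then show "b' \<sigma> (df f) = b \<sigma> (df f)" by (simp add: fun_eq_iff)
  qed
qed

lemma corresponding_bracket_unique:
  assumes b': "b' \<in> dgp_brackets A"
    and c: "corresponds A b S" and c': "corresponds A b' S"
  shows "b' = b"
proof (rule ext, rule ext)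
  interpret b': dgp_bracket A b' by unfold_locales (rule b')
  fix \<sigma> \<rho>
  obtain \<pi> D where S: "S = (\<pi>, D)" by (cases S)
  have zz: "b' (zero_form f) (zero_form g) = b (zero_form f) (zero_form g)" if "f \<in> \<F>" "g \<in> \<F>" for f g
    using c c' that unfolding S corresponds_def by simp
  have z1: "b' (zero_form f) \<alpha> = b (zero_form f) \<alpha>" if "f \<in> \<F>" "\<alpha> \<in> \<Omega> 1" for f \<alpha>
    using c c' that unfolding S corresponds_def by simp
  note hom = dgp_bracket_unique_homogeneous[OF b' zz z1]
  show "b' \<sigma> \<rho> = b \<sigma> \<rho>"
  proof (cases "\<sigma> \<in> total \<Omega> \<and> \<rho> \<in> total \<Omega>")
    case True
    have one: "b' \<omega> \<rho> = b \<omega> \<rho>" if s: "\<omega> \<in> \<Omega> k" for \<omega> k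
      using conjunct2[OF True]
    proof (induction rule: total_induct)
      case (homogeneous l \<tau>)
      show "b' \<omega> \<tau> = b \<omega> \<tau>" by (rule hom[OF _ _ _ _ s homogeneous])
    next
      case (add \<tau> \<tau>')
      show "b' \<omega> (\<tau> + \<tau>') = b \<omega> (\<tau> + \<tau>')"
        unfolding b'.b_add2[OF add(1,2) Om_total[OF s]] b_add2[OF add(1,2) Om_total[OF s]] add(3,4) by (rule refl)
    qed
    show ?thesis
      using conjunct1[OF True]
    proof (induction rule: total_induct)
      case (homogeneous k \<omega>)
      show "b' \<omega> \<rho> = b \<omega> \<rho>" by (rule one[OF homogeneous])
    next
      case (add \<tau> \<tau>')
      note r = conjunct2[OF True]
      show "b' (\<tau> + \<tau>') \<rho> = b (\<tau> + \<tau>') \<rho>"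
        unfolding b'.b_add1[OF add(1,2) r] b_add1[OF add(1,2) r] add(3,4) by (rule refl)
    qed
  next
    case False
    then show ?thesis using b_outside b'.b_outside by metis
  qed
qed

end

context manifold
begin

section \<open>Contraction with a vector-valued form\<close>

text \<open>
  For \<open>\<kappa> = \<eta> \<otimes> Z\<close> with a \<open>k\<close>-form \<open>\<eta>\<close> and a vector field \<open>Z\<close>, the contraction is \<open>\<eta> \<and> i\<^sub>Z \<rho>\<close>.
  The recursion is what \<open>i\<^sub>X(\<eta> \<and> i\<^sub>Z \<rho>) = i\<^sub>X \<eta> \<and> i\<^sub>Z \<rho> - (-1)\<^sup>k \<eta> \<and> i\<^sub>Z(i\<^sub>X \<rho>)\<close> becomes for
  general \<open>\<kappa>\<close>; it ends with the evaluation of \<open>\<rho>\<close> on the vector field \<open>\<kappa> []\<close>.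
\<close>

primrec contr_at :: "'m vfield list \<Rightarrow> nat \<Rightarrow> ('m vfield list \<Rightarrow> 'm vfield) \<Rightarrow> 'm form \<Rightarrow> 'm \<Rightarrow> real" where
  "contr_at [] k \<kappa> \<rho> = \<rho> [\<kappa> []]"
| "contr_at (X # Xs) k \<kappa> \<rho> = contr_at Xs (k - 1) (\<lambda>Ys. \<kappa> (X # Ys)) \<rho> - (\<lambda>_. (- 1) ^ k) * contr_at Xs k \<kappa> (ins X \<rho>)"

definition contr :: "nat \<Rightarrow> ('m vfield list \<Rightarrow> 'm vfield) \<Rightarrow> 'm form \<Rightarrow> 'm form" where
  "contr k \<kappa> \<rho> = (\<lambda>Xs. contr_at Xs k \<kappa> \<rho>)"

definition vins :: "'m vfield \<Rightarrow> ('m vfield list \<Rightarrow> 'm vfield) \<Rightarrow> 'm vfield list \<Rightarrow> 'm vfield" where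
  "vins X \<kappa> = (\<lambda>Xs. \<kappa> (X # Xs))"

lemma contr_Nil: "contr k \<kappa> \<rho> [] = \<rho> [\<kappa> []]"
  by (simp add: contr_def)

lemma contr_Cons: "contr k \<kappa> \<rho> (X # Xs) p = contr (k - 1) (vins X \<kappa>) \<rho> Xs p - (- 1) ^ k * contr k \<kappa> (ins X \<rho>) Xs p"
  by (simp add: contr_def vins_def)

lemma ins_contr: "ins X (contr k \<kappa> \<rho>) = contr (k - 1) (vins X \<kappa>) \<rho> - sc ((- 1) ^ k) (contr k \<kappa> (ins X \<rho>))"
  by (rule ext, rule ext) (simp add: ins_apply contr_Cons)

text \<open>
  Vector-valued \<open>k\<close>-forms. Since vector fields are derivations, linearity and alternation
  can be required of the scalar forms that result from applying all values to one function.
\<close>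

definition vform :: "nat \<Rightarrow> ('m vfield list \<Rightarrow> 'm vfield) \<Rightarrow> bool" where
  "vform k \<kappa> \<longleftrightarrow> (\<forall>Xs. \<kappa> Xs \<in> \<X>) \<and> (\<forall>g\<in>\<F>. (\<lambda>Xs. \<kappa> Xs g) \<in> \<Omega> k)"

lemma vform_X: "vform k \<kappa> \<Longrightarrow> \<kappa> Xs \<in> \<X>" by (simp add: vform_def)
lemma vform_Om: "vform k \<kappa> \<Longrightarrow> g \<in> \<F> \<Longrightarrow> (\<lambda>Xs. \<kappa> Xs g) \<in> \<Omega> k" by (simp add: vform_def)

text \<open>
  Equality may be tested on functions, which reduces the properties of vector-valued forms
  to those of ordinary ones.
\<close>

lemma vform_eqI:
  assumes \<kappa>: "vform k \<kappa>" and "\<And>Xs. L Xs \<in> \<X>" and e: "\<And>g. g \<in> \<F> \<Longrightarrow> (\<lambda>Xs. \<kappa> Xs g) = (\<lambda>Xs. L Xs g)" shows "\<kappa> = L"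
proof
  fix Xs show "\<kappa> Xs = L Xs"
    by (rule vector_field_eqI[OF vform_X[OF \<kappa>] assms(2)]) (rule fun_cong[OF e])
qed

lemma ins_slot: "ins X (\<lambda>Xs. \<kappa> Xs g) = (\<lambda>Xs. vins X \<kappa> Xs g)"
  by (simp add: ins_def vins_def)

lemma vform_vins: assumes \<kappa>: "vform k \<kappa>" and X: "X \<in> \<X>" shows "vform (k - 1) (vins X \<kappa>)"
  unfolding vform_def
proof (intro conjI allI ballI)
  show "vins X \<kappa> Xs \<in> \<X>" for Xs unfolding vins_def by (rule vform_X[OF \<kappa>])
  show "(\<lambda>Xs. vins X \<kappa> Xs g) \<in> \<Omega> (k - 1)" if "g \<in> \<F>" for g
    unfolding ins_slot[symmetric] by (rule ins_Om[OF vform_Om[OF \<kappa> that] X])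
qed

lemma vins_eq_0: assumes \<kappa>: "vform k \<kappa>" and z: "\<And>g. g \<in> \<F> \<Longrightarrow> ins X (\<lambda>Xs. \<kappa> Xs g) = 0" shows "vins X \<kappa> = (\<lambda>_. 0)"
proof
  fix Xs show "vins X \<kappa> Xs = 0"
  proof (rule vector_field_eqI[OF _ VF_0])
    show "vins X \<kappa> Xs \<in> \<X>" unfolding vins_def by (rule vform_X[OF \<kappa>])
    show "vins X \<kappa> Xs g = 0 g" if "g \<in> \<F>" for g
      using fun_cong[OF z[OF that], of Xs] unfolding ins_slot by simp
  qed
qed

lemma vins_degree_0: "vform 0 \<kappa> \<Longrightarrow> vins X \<kappa> = (\<lambda>_. 0)"
  by (rule vins_eq_0[where k = 0]) (assumption | rule ins_Om_0 vform_Om)+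

lemma vins_out: assumes \<kappa>: "vform k \<kappa>" and X: "X \<notin> \<X>" shows "vins X \<kappa> = (\<lambda>_. 0)"
  by (rule vins_eq_0[OF \<kappa>]) (rule ins_out[OF vform_Om[OF \<kappa>] X])

lemma vins_self: assumes \<kappa>: "vform k \<kappa>" and X: "X \<in> \<X>" shows "vins X (vins X \<kappa>) = (\<lambda>_. 0)"
proof (rule vins_eq_0[OF vform_vins[OF \<kappa> X]])
  fix g assume g: "g \<in> \<F>"
  show "ins X (\<lambda>Xs. vins X \<kappa> Xs g) = 0"
    unfolding ins_slot[symmetric] by (rule ins_ins_self[OF vform_Om[OF \<kappa> g]])
qed

lemma vins_add: assumes \<kappa>: "vform k \<kappa>" and X: "X \<in> \<X>" and Y: "Y \<in> \<X>"
  shows "vins (X + Y) \<kappa> = (\<lambda>Xs. vins X \<kappa> Xs + vins Y \<kappa> Xs)"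
proof (rule vform_eqI[OF vform_vins[OF \<kappa> VF_add[OF X Y]]])
  show "vins X \<kappa> Xs + vins Y \<kappa> Xs \<in> \<X>" for Xs
    unfolding vins_def by (intro VF_add vform_X[OF \<kappa>])
  fix g assume g: "g \<in> \<F>"
  show "(\<lambda>Xs. vins (X + Y) \<kappa> Xs g) = (\<lambda>Xs. (vins X \<kappa> Xs + vins Y \<kappa> Xs) g)"
    unfolding ins_slot[symmetric] ins_vf_add[OF vform_Om[OF \<kappa> g] X Y]
    by (rule ext) (simp add: ins_def vins_def)
qed

lemma vins_fmul: assumes \<kappa>: "vform k \<kappa>" and f: "f \<in> \<F>" and X: "X \<in> \<X>"
  shows "vins (f \<cdot> X) \<kappa> = (\<lambda>Xs. f \<cdot> vins X \<kappa> Xs)"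
proof (rule vform_eqI[OF vform_vins[OF \<kappa> VF_fmul[OF f X]]])
  show "f \<cdot> vins X \<kappa> Xs \<in> \<X>" for Xs
    unfolding vins_def by (intro VF_fmul f vform_X[OF \<kappa>])
  fix g assume g: "g \<in> \<F>"
  show "(\<lambda>Xs. vins (f \<cdot> X) \<kappa> Xs g) = (\<lambda>Xs. (f \<cdot> vins X \<kappa> Xs) g)"
    unfolding ins_slot[symmetric] ins_vf_fmul[OF vform_Om[OF \<kappa> g] f X]
    by (rule ext, rule ext) (simp add: ins_def vins_def)
qed

lemma ins_Om_any: "\<omega> \<in> \<Omega> k \<Longrightarrow> ins X \<omega> \<in> \<Omega> (k - 1)"
  by (cases "X \<in> \<X>") (rule ins_Om, assumption, assumption, simp add: ins_out del: pointwise)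

lemma contr_Om_0: "\<rho> \<in> \<Omega> 0 \<Longrightarrow> contr k \<kappa> \<rho> = 0"
proof (rule ext, rule ext)
  fix Xs p assume "\<rho> \<in> \<Omega> 0"
  then show "contr k \<kappa> \<rho> Xs p = 0 Xs p"
  proof (induction Xs arbitrary: k \<kappa> \<rho>)
    case Nil
    then show ?case by (simp add: contr_Nil Om_length)
  next
    case (Cons X Xs)
    have "contr k \<kappa> (ins X \<rho>) Xs p = 0 Xs p"
      by (rule Cons.IH) (simp add: Cons.prems del: pointwise)
    then show ?case using Cons.IH[OF Cons.prems] by (simp add: contr_Cons)
  qed
qed

lemma contr_0 [simp]: "contr k \<kappa> 0 = 0"
  by (rule contr_Om_0[OF Om_0])

lemma contr_add: "contr k \<kappa> (\<rho> + \<tau>) = contr k \<kappa> \<rho> + contr k \<kappa> \<tau>"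
proof (rule ext, rule ext)
  fix Xs p show "contr k \<kappa> (\<rho> + \<tau>) Xs p = (contr k \<kappa> \<rho> + contr k \<kappa> \<tau>) Xs p"
    by (induction Xs arbitrary: k \<kappa> \<rho> \<tau>) (simp_all add: contr_Nil contr_Cons algebra_simps)
qed

lemma contr_fmul: "contr k \<kappa> (f \<cdot> \<rho>) = f \<cdot> contr k \<kappa> \<rho>"
proof (rule ext, rule ext)
  fix Xs p show "contr k \<kappa> (f \<cdot> \<rho>) Xs p = (f \<cdot> contr k \<kappa> \<rho>) Xs p"
    by (induction Xs arbitrary: k \<kappa> \<rho>) (simp_all add: contr_Nil contr_Cons algebra_simps)
qed

lemma contr_sc: "contr k \<kappa> (sc c \<rho>) = sc c (contr k \<kappa> \<rho>)"
  unfolding sc_fmul by (rule contr_fmul)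

lemma contr_vadd:
  assumes "\<And>Xs. \<kappa> Xs \<in> \<X>" "\<And>Xs. L Xs \<in> \<X>" "\<rho> \<in> \<Omega> l"
  shows "contr k (\<lambda>Xs. \<kappa> Xs + L Xs) \<rho> = contr k \<kappa> \<rho> + contr k L \<rho>"
proof (rule ext, rule ext)
  fix Xs p show "contr k (\<lambda>Xs. \<kappa> Xs + L Xs) \<rho> Xs p = (contr k \<kappa> \<rho> + contr k L \<rho>) Xs p"
    using assms
  proof (induction Xs arbitrary: k \<kappa> L \<rho> l)
    case Nil
    show ?case
      using fun_cong[OF fun_cong[OF ins_vf_add[OF Nil(3) Nil(1,2)], of "[]" "[]" "[]"], of p]
      unfolding plus_fun_apply contr_Nil ins_apply .
  next
    case (Cons X Xs)
    have v: "vins X \<kappa> Ys \<in> \<X>" "vins X L Ys \<in> \<X>" for Ys using Cons.prems by (simp_all add: vins_def)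
    have e: "vins X (\<lambda>Xs. \<kappa> Xs + L Xs) = (\<lambda>Xs. vins X \<kappa> Xs + vins X L Xs)" unfolding vins_def by (rule refl)
    have 1: "contr (k - 1) (\<lambda>Xs. vins X \<kappa> Xs + vins X L Xs) \<rho> Xs p =
        (contr (k - 1) (vins X \<kappa>) \<rho> + contr (k - 1) (vins X L) \<rho>) Xs p"
      by (rule Cons.IH[OF _ _ Cons.prems(3)]) (rule v)+
    have 2: "contr k (\<lambda>Xs. \<kappa> Xs + L Xs) (ins X \<rho>) Xs p =
        (contr k \<kappa> (ins X \<rho>) + contr k L (ins X \<rho>)) Xs p"
      by (rule Cons.IH[OF _ _ ins_Om_any[OF Cons.prems(3)]]) (rule Cons.prems)+
    show ?case
      unfolding contr_Cons e 1 2 by (simp add: contr_Cons algebra_simps)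
  qed
qed

lemma contr_vfmul:
  assumes "\<And>Xs. \<kappa> Xs \<in> \<X>" "f \<in> \<F>" "\<rho> \<in> \<Omega> l"
  shows "contr k (\<lambda>Xs. f \<cdot> \<kappa> Xs) \<rho> = f \<cdot> contr k \<kappa> \<rho>"
proof (rule ext, rule ext)
  fix Xs p show "contr k (\<lambda>Xs. f \<cdot> \<kappa> Xs) \<rho> Xs p = (f \<cdot> contr k \<kappa> \<rho>) Xs p"
    using assms
  proof (induction Xs arbitrary: k \<kappa> \<rho> l)
    case Nil
    show ?case
      using fun_cong[OF fun_cong[OF ins_vf_fmul[OF Nil(3) Nil(2,1)], of "[]" "[]"], of p]
      unfolding fmul_apply contr_Nil ins_apply .
  next
    case (Cons X Xs)
    have v: "vins X \<kappa> Ys \<in> \<X>" for Ys using Cons.prems by (simp add: vins_def)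
    have e: "vins X (\<lambda>Xs. f \<cdot> \<kappa> Xs) = (\<lambda>Xs. f \<cdot> vins X \<kappa> Xs)" unfolding vins_def by (rule refl)
    have 1: "contr (k - 1) (\<lambda>Xs. f \<cdot> vins X \<kappa> Xs) \<rho> Xs p = (f \<cdot> contr (k - 1) (vins X \<kappa>) \<rho>) Xs p"
      by (rule Cons.IH[OF _ Cons.prems(2,3)]) (rule v)
    have 2: "contr k (\<lambda>Xs. f \<cdot> \<kappa> Xs) (ins X \<rho>) Xs p = (f \<cdot> contr k \<kappa> (ins X \<rho>)) Xs p"
      by (rule Cons.IH[OF _ Cons.prems(2) ins_Om_any[OF Cons.prems(3)]]) (rule Cons.prems)
    show ?case
      unfolding contr_Cons e 1 2 by (simp add: contr_Cons algebra_simps)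
  qed
qed

lemma contr_v0: assumes "\<rho> \<in> \<Omega> l" shows "contr k (\<lambda>_. 0) \<rho> = 0"
proof -
  have "contr k (\<lambda>_. 0 + 0) \<rho> = contr k (\<lambda>_. 0) \<rho> + contr k (\<lambda>_. 0) \<rho>"
    by (rule contr_vadd[of "\<lambda>_. 0" "\<lambda>_. 0", OF VF_0 VF_0 assms])
  then show ?thesis by simp
qed

lemma contr_df: assumes "g \<in> \<F>" "\<And>Xs. \<kappa> Xs \<in> \<X>" shows "contr k \<kappa> (df g) = (\<lambda>Xs. \<kappa> Xs g)"
proof (rule ext, rule ext)
  fix Xs p show "contr k \<kappa> (df g) Xs p = \<kappa> Xs g p"
    using assms(2)
  proof (induction Xs arbitrary: k \<kappa>)
    case Nil
    show ?case using df_eval[OF assms(1) Nil] by (simp add: contr_Nil)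
  next
    case (Cons X Xs)
    have v: "vins X \<kappa> Ys \<in> \<X>" for Ys using Cons.prems by (simp add: vins_def)
    have "ins X (df g) \<in> \<Omega> 0" using ins_Om_any[OF df_Om[OF assms(1)], of X] by simp
    then have "contr k \<kappa> (ins X (df g)) = 0" by (rule contr_Om_0)
    then show ?case using Cons.IH[of "vins X \<kappa>" "k - 1", OF v] by (simp add: contr_Cons vins_def)
  qed
qed

text \<open>
  By induction on the degree, with \<open>Om_SucI\<close>. When \<open>ins X\<close> is applied twice, the two mixed
  terms have opposite signs and cancel.
\<close>

lemma contr_Om: "vform k \<kappa> \<Longrightarrow> \<rho> \<in> \<Omega> (Suc l) \<Longrightarrow> contr k \<kappa> \<rho> \<in> \<Omega> (k + l)"
proof -
  have "contr k \<kappa> \<rho> \<in> \<Omega> n" if "k + l = n" "vform k \<kappa>" "\<rho> \<in> \<Omega> (Suc l)" for n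
    using that
  proof (induction n arbitrary: k l \<kappa> \<rho>)
    case 0
    then have kl: "k = 0" "l = 0" and \<kappa>: "vform 0 \<kappa>" and r: "\<rho> \<in> \<Omega> (Suc 0)" by auto
    have "contr k \<kappa> \<rho> = zero_form (\<rho> [\<kappa> []])"
    proof (rule ext)
      fix Xs show "contr k \<kappa> \<rho> Xs = zero_form (\<rho> [\<kappa> []]) Xs"
      proof (cases Xs)
        case Nil then show ?thesis by (simp add: contr_Nil)
      next
        case (Cons X Ys)
        have "ins X \<rho> \<in> \<Omega> 0" using ins_Om_any[OF r, of X] by simp
        then have "ins X (contr k \<kappa> \<rho>) = 0"
          unfolding ins_contr kl vins_degree_0[OF \<kappa>] by (simp add: contr_v0[OF r] contr_Om_0 fun_eq_iff)
        from fun_cong[OF this, of Ys] show ?thesis using Cons by (simp add: ins_apply zero_form_def)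
      qed
    qed
    then show ?case using zero_form_Om[OF Om_smooth[OF r]] by (simp del: pointwise)
  next
    case (Suc n)
    note \<kappa> = Suc.prems(2) and r = Suc.prems(3)
    have 1: "contr (k - 1) (vins X \<kappa>) \<rho> \<in> \<Omega> n" if X: "X \<in> \<X>" for X
    proof (cases k)
      case 0
      then have "vins X \<kappa> = (\<lambda>_. 0)" using vins_degree_0 \<kappa> by blast
      then show ?thesis using contr_v0[OF r] Om_0 by metis
    next
      case (Suc k')
      show ?thesis by (rule Suc.IH[OF _ vform_vins[OF \<kappa> X] r]) (use Suc Suc.prems(1) in simp)
    qed
    have 2: "contr k \<kappa> (ins X \<rho>) \<in> \<Omega> n" if X: "X \<in> \<X>" for X
    proof (cases l)
      case 0
      then have "contr k \<kappa> (ins X \<rho>) = 0" using contr_Om_0 ins_Om_Suc[OF r X] by metis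
      then show ?thesis using Om_0 by metis
    next
      case (Suc l')
      show ?thesis by (rule Suc.IH[OF _ \<kappa>, of l']) (use Suc Suc.prems(1) ins_Om_Suc[OF r X] in auto)
    qed
    show ?case
    proof (rule Om_SucI)
      show "contr k \<kappa> \<rho> [] = 0"
      proof (cases "l = 0")
        case True
        then obtain k' where k: "k = Suc k'" using Suc.prems(1) by (cases k) auto
        have "\<kappa> [] = 0"
          by (rule vector_field_eqI[OF vform_X[OF \<kappa>] VF_0])
             (use Om_length[OF vform_Om[OF \<kappa>], of _ "[]"] k in \<open>simp add: fun_eq_iff\<close>)
        moreover have "\<rho> [0] = 0" using fun_cong[OF ins_vf_0[OF r], of "[]"] by (simp add: ins_apply)
        ultimately show ?thesis by (simp only: contr_Nil)
      next
        case False
        have "\<rho> [\<kappa> []] = 0" by (rule Om_length[OF r]) (use False in simp)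
        then show ?thesis by (simp only: contr_Nil)
      qed
      show "ins X (contr k \<kappa> \<rho>) = 0" if "X \<notin> \<X>" for X
        unfolding ins_contr vins_out[OF \<kappa> that] ins_out[OF r that] by (simp add: contr_v0[OF r] fun_eq_iff)
      show "ins X (contr k \<kappa> \<rho>) \<in> \<Omega> n" if "X \<in> \<X>" for X
        unfolding ins_contr by (intro Om_diff Om_sc 1 2 that)
      show "ins X (ins X (contr k \<kappa> \<rho>)) = 0" if X: "X \<in> \<X>" for X
      proof -
        note z = contr_v0[OF r] contr_v0[OF ins_Om[OF r X]]
        show ?thesis
        proof (cases k)
          case 0
          then have v: "vins X \<kappa> = (\<lambda>_. 0)" using vins_degree_0 \<kappa> by blast
          have v': "vins X (\<lambda>_. 0) = (\<lambda>_. 0)" unfolding vins_def by (rule refl)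
          show ?thesis
            unfolding ins_contr ins_linear v v' z ins_ins_self[OF r] contr_0 by (simp add: fun_eq_iff)
        next
          case (Suc k')
          show ?thesis
            unfolding ins_contr ins_linear vins_self[OF \<kappa> X] z ins_ins_self[OF r] contr_0 Suc
            by (simp add: fun_eq_iff)
        qed
      qed
      show "ins (X + Y) (contr k \<kappa> \<rho>) = ins X (contr k \<kappa> \<rho>) + ins Y (contr k \<kappa> \<rho>)" if X: "X \<in> \<X>" and Y: "Y \<in> \<X>" for X Y
      proof -
        have v: "vins X \<kappa> Xs \<in> \<X>" "vins Y \<kappa> Xs \<in> \<X>" for Xs unfolding vins_def by (rule vform_X[OF \<kappa>])+
        show ?thesis
          unfolding ins_contr vins_add[OF \<kappa> X Y] ins_vf_add[OF r X Y] contr_vadd[of "vins X \<kappa>" "vins Y \<kappa>", OF v r] contr_add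
          by (simp add: fun_eq_iff algebra_simps)
      qed
      show "ins (f \<cdot> X) (contr k \<kappa> \<rho>) = f \<cdot> ins X (contr k \<kappa> \<rho>)" if f: "f \<in> \<F>" and X: "X \<in> \<X>" for f X
      proof -
        have v: "vins X \<kappa> Xs \<in> \<X>" for Xs unfolding vins_def by (rule vform_X[OF \<kappa>])
        show ?thesis
          unfolding ins_contr vins_fmul[OF \<kappa> f X] ins_vf_fmul[OF r f X] contr_vfmul[of "vins X \<kappa>", OF v f r] contr_fmul
          by (simp add: fun_eq_iff algebra_simps)
      qed
    qed
  qed
  then show "vform k \<kappa> \<Longrightarrow> \<rho> \<in> \<Omega> (Suc l) \<Longrightarrow> contr k \<kappa> \<rho> \<in> \<Omega> (k + l)" by blast
qed

text \<open>
  The sign \<open>(-1)\<^sup>k\<^sup>+\<^sup>l\<^sup>-\<^sup>1\<close>, written so that it also holds for \<open>l = 0\<close>, where the contraction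
  vanishes.
\<close>

lemma par_contr: assumes "vform k \<kappa>" "\<rho> \<in> \<Omega> l" shows "par (contr k \<kappa> \<rho>) = - sc ((- 1) ^ (k + l)) (contr k \<kappa> \<rho>)"
proof (cases l)
  case 0
  then show ?thesis using contr_Om_0[of \<rho> k \<kappa>] assms(2) by (simp add: fun_eq_iff par_apply)
next
  case (Suc m)
  then have "par (contr k \<kappa> \<rho>) = sc ((- 1) ^ (k + m)) (contr k \<kappa> \<rho>)"
    using Om_par[OF contr_Om[OF assms(1)]] assms(2) by blast
  then show ?thesis using Suc by (simp add: fun_eq_iff)
qed

text \<open>
  Contraction with a \<open>k\<close>-form is a derivation of degree \<open>k - 1\<close>. For \<open>k = 0\<close> this is
  negative, which is why the sign is stated with \<open>k + 1\<close>.
\<close>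

lemma contr_wedge:
  assumes "vform k \<kappa>" "\<sigma> \<in> \<Omega> l" "\<tau> \<in> \<Omega> m"
  shows "contr k \<kappa> (\<sigma> \<and>\<^sub>\<Omega> \<tau>) = contr k \<kappa> \<sigma> \<and>\<^sub>\<Omega> \<tau> + sc ((- 1) ^ (Suc k * l)) (\<sigma> \<and>\<^sub>\<Omega> contr k \<kappa> \<tau>)"
proof (rule ext, rule ext)
  fix Xs p
  show "contr k \<kappa> (\<sigma> \<and>\<^sub>\<Omega> \<tau>) Xs p = (contr k \<kappa> \<sigma> \<and>\<^sub>\<Omega> \<tau> + sc ((- 1) ^ (Suc k * l)) (\<sigma> \<and>\<^sub>\<Omega> contr k \<kappa> \<tau>)) Xs p"
    using assms
  proof (induction Xs arbitrary: k \<kappa> \<sigma> l \<tau> m)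
    case Nil
    note \<kappa> = Nil(1) and s = Nil(2) and t = Nil(3)
    have z: "ins X \<omega> [] = \<omega> [X]" for X and \<omega> :: "'m form" by (simp add: ins_apply)
    have e: "(\<sigma> \<and>\<^sub>\<Omega> \<tau>) [X] p = \<sigma> [X] p * \<tau> [] p + (- 1) ^ l * (\<sigma> [] p * \<tau> [X] p)" for X
      unfolding z[symmetric] ins_wedge_Om[OF s] by (simp add: wedge_Nil)
    have "\<sigma> [] = 0" if "l \<noteq> 0" using Om_length[OF s, of "[]"] that by simp
    moreover have "\<sigma> [X] = 0" if "l = 0" for X using Om_length[OF s, of "[X]"] that by simp
    ultimately show ?case by (cases "l = 0") (simp_all add: contr_Nil wedge_Nil e)
  next
    case (Cons X Xs)
    note \<kappa> = Cons.prems(1) and s = Cons.prems(2) and t = Cons.prems(3)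
    have 1: "contr (k - 1) (vins X \<kappa>) (\<sigma> \<and>\<^sub>\<Omega> \<tau>) Xs p =
       (contr (k - 1) (vins X \<kappa>) \<sigma> \<and>\<^sub>\<Omega> \<tau>) Xs p + (- 1) ^ (k * l) * (\<sigma> \<and>\<^sub>\<Omega> contr (k - 1) (vins X \<kappa>) \<tau>) Xs p"
    proof (cases "k = 0 \<or> X \<notin> \<X>")
      case True
      then have "vins X \<kappa> = (\<lambda>_. 0)" using vins_degree_0 vins_out \<kappa> by metis
      then show ?thesis by (simp add: contr_v0[OF s] contr_v0[OF t] contr_v0[OF wedge_Om[OF s t]])
    next
      case False
      then have "Suc (k - 1) = k" and X: "X \<in> \<X>" by auto
      then show ?thesis using Cons.IH[OF vform_vins[OF \<kappa> X] s t] by simp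
    qed
    have 2: "contr k \<kappa> (ins X \<sigma> \<and>\<^sub>\<Omega> \<tau>) Xs p =
       (contr k \<kappa> (ins X \<sigma>) \<and>\<^sub>\<Omega> \<tau>) Xs p + (- 1) ^ (Suc k * (l - 1)) * (ins X \<sigma> \<and>\<^sub>\<Omega> contr k \<kappa> \<tau>) Xs p"
      using Cons.IH[OF \<kappa> ins_Om_any[OF s] t] by simp
    have 3: "contr k \<kappa> (\<sigma> \<and>\<^sub>\<Omega> ins X \<tau>) Xs p =
       (contr k \<kappa> \<sigma> \<and>\<^sub>\<Omega> ins X \<tau>) Xs p + (- 1) ^ (Suc k * l) * (\<sigma> \<and>\<^sub>\<Omega> contr k \<kappa> (ins X \<tau>)) Xs p"
      using Cons.IH[OF \<kappa> s ins_Om_any[OF t]] by simp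
    have 4: "(- 1) ^ k * ((- 1) ^ (Suc k * (l - 1)) * (ins X \<sigma> \<and>\<^sub>\<Omega> contr k \<kappa> \<tau>) Xs p)
        = - ((- 1) ^ (Suc k * l) * (ins X \<sigma> \<and>\<^sub>\<Omega> contr k \<kappa> \<tau>) Xs p)"
    proof (cases l)
      case 0
      then show ?thesis using s by simp
    next
      case (Suc l')
      then show ?thesis by (simp add: minus_one_power_iff)
    qed
    have "contr k \<kappa> (\<sigma> \<and>\<^sub>\<Omega> \<tau>) (X # Xs) p = contr (k - 1) (vins X \<kappa>) (\<sigma> \<and>\<^sub>\<Omega> \<tau>) Xs p
        - (- 1) ^ k * (contr k \<kappa> (ins X \<sigma> \<and>\<^sub>\<Omega> \<tau>) Xs p + (- 1) ^ l * contr k \<kappa> (\<sigma> \<and>\<^sub>\<Omega> ins X \<tau>) Xs p)"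
      unfolding contr_Cons ins_wedge_Om[OF s] contr_add contr_sc by simp
    also have "\<dots> = (contr k \<kappa> \<sigma> \<and>\<^sub>\<Omega> \<tau> + sc ((- 1) ^ (Suc k * l)) (\<sigma> \<and>\<^sub>\<Omega> contr k \<kappa> \<tau>)) (X # Xs) p"
      unfolding 1 2 3 using 4
      by (simp add: wedge_Cons ins_contr par_contr[OF \<kappa> s] Om_par[OF s] algebra_simps)
         (simp add: minus_one_power_iff)
    finally show "contr k \<kappa> (\<sigma> \<and>\<^sub>\<Omega> \<tau>) (X # Xs) p =
      (contr k \<kappa> \<sigma> \<and>\<^sub>\<Omega> \<tau> + sc ((- 1) ^ (Suc k * l)) (\<sigma> \<and>\<^sub>\<Omega> contr k \<kappa> \<tau>)) (X # Xs) p" .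
  qed
qed

section \<open>From a connection to a bracket\<close>

text \<open>
  The Lie derivative of Froelicher and Nijenhuis, the graded commutator of contraction and
  \<open>d\<close>.
\<close>

definition lie_along :: "nat \<Rightarrow> ('m vfield list \<Rightarrow> 'm vfield) \<Rightarrow> 'm form \<Rightarrow> 'm form" where
  "lie_along k \<kappa> \<rho> = contr k \<kappa> (\<dd> \<rho>) + sc ((- 1) ^ k) (\<dd> (contr k \<kappa> \<rho>))"

lemma gd_contr: assumes \<kappa>: "vform (Suc k) \<kappa>" shows "graded_derivation k (\<lambda>_. contr (Suc k) \<kappa>)"
proof (rule graded_derivationI)
  fix l \<sigma> assume s: "\<sigma> \<in> \<Omega> l"
  show "contr (Suc k) \<kappa> \<sigma> \<in> \<Omega> (l + k)"
  proof (cases l)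
    case 0
    then have "contr (Suc k) \<kappa> \<sigma> = 0" using contr_Om_0 s by blast
    then show ?thesis using Om_0 by metis
  next
    case (Suc j)
    then have "contr (Suc k) \<kappa> \<sigma> \<in> \<Omega> (Suc k + j)" using contr_Om[OF \<kappa>] s by blast
    moreover have "Suc k + j = l + k" using Suc by simp
    ultimately show ?thesis by metis
  qed
  show "contr (Suc k) \<kappa> (\<sigma> + \<tau>) = contr (Suc k) \<kappa> \<sigma> + contr (Suc k) \<kappa> \<tau>" for \<tau> by (rule contr_add)
  show "contr (Suc k) \<kappa> (\<sigma> \<and>\<^sub>\<Omega> \<tau>) = contr (Suc k) \<kappa> \<sigma> \<and>\<^sub>\<Omega> \<tau> + sc ((- 1) ^ (k * l)) (\<sigma> \<and>\<^sub>\<Omega> contr (Suc k) \<kappa> \<tau>)"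
    if t: "\<tau> \<in> \<Omega> m" for m \<tau>
    unfolding contr_wedge[OF \<kappa> s t] by (simp add: minus_one_power_iff)
qed

lemma contr_Om_pred: assumes \<kappa>: "vform k \<kappa>" and r: "\<rho> \<in> \<Omega> l" shows "contr k \<kappa> \<rho> \<in> \<Omega> (k + l - 1)"
proof (cases l)
  case 0
  then have "contr k \<kappa> \<rho> = 0" using contr_Om_0 r by blast
  then show ?thesis using Om_0 by metis
next
  case (Suc j)
  then have "contr k \<kappa> \<rho> \<in> \<Omega> (k + j)" using contr_Om[OF \<kappa>] r by blast
  then show ?thesis using Suc by simp
qed

lemma ext_d_contr_Om: assumes \<kappa>: "vform k \<kappa>" and r: "\<rho> \<in> \<Omega> l" shows "\<dd> (contr k \<kappa> \<rho>) \<in> \<Omega> (l + k)"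
proof (cases l)
  case 0
  then have "contr k \<kappa> \<rho> = 0" using contr_Om_0 r by blast
  moreover have "\<dd> 0 \<in> \<Omega> (l + k)" unfolding ext_d_0 by (rule Om_0)
  ultimately show ?thesis by metis
next
  case (Suc j)
  have e: "l + k = Suc (k + j)" using Suc by simp
  show ?thesis unfolding e by (rule ext_d_Om[OF contr_Om[OF \<kappa>]]) (use r Suc in blast)
qed

lemma ext_d_contr_wedge: assumes \<kappa>: "vform k \<kappa>" and s: "\<sigma> \<in> \<Omega> l" and t: "\<tau> \<in> \<Omega> m"
  shows "\<dd> (contr k \<kappa> \<sigma> \<and>\<^sub>\<Omega> \<tau>) = \<dd> (contr k \<kappa> \<sigma>) \<and>\<^sub>\<Omega> \<tau> - sc ((- 1) ^ (k + l)) (contr k \<kappa> \<sigma> \<and>\<^sub>\<Omega> \<dd> \<tau>)"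
proof (cases l)
  case 0
  then have "contr k \<kappa> \<sigma> = 0" using contr_Om_0 s by blast
  then show ?thesis by (simp only: wedge_linear ext_d_0) (simp add: fun_eq_iff)
next
  case (Suc j)
  then show ?thesis unfolding ext_d_wedge[OF contr_Om_pred[OF \<kappa> s] t] by (simp add: fun_eq_iff)
qed

text \<open>
  The commutator of two derivations; since contraction may have degree \<open>-1\<close>, it is computed
  directly.
\<close>

lemma gd_lie_along: assumes \<kappa>: "vform k \<kappa>" shows "graded_derivation k (\<lambda>_. lie_along k \<kappa>)"
proof (rule graded_derivationI)
  have contr_d: "contr k \<kappa> (\<dd> \<sigma>) \<in> \<Omega> (l + k)" if "\<sigma> \<in> \<Omega> l" for \<sigma> l
    using contr_Om[OF \<kappa> ext_d_Om[OF that]] by (simp only: add.commute)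
  note mem = contr_Om_pred[OF \<kappa>]
  fix l \<sigma> assume s: "\<sigma> \<in> \<Omega> l"
  show "lie_along k \<kappa> \<sigma> \<in> \<Omega> (l + k)" unfolding lie_along_def
    by (intro Om_add Om_sc contr_d ext_d_contr_Om \<kappa> s)
  show "lie_along k \<kappa> (\<sigma> + \<tau>) = lie_along k \<kappa> \<sigma> + lie_along k \<kappa> \<tau>" if t: "\<tau> \<in> \<Omega> l" for \<tau>
    unfolding lie_along_def ext_d_add[OF s t] contr_add ext_d_add[OF mem[OF s] mem[OF t]]
    by (simp add: fun_eq_iff algebra_simps)
  fix m \<tau> assume t: "\<tau> \<in> \<Omega> m"
  note ds = ext_d_Om[OF s] and dt = ext_d_Om[OF t]
  have 1: "contr k \<kappa> (\<dd> (\<sigma> \<and>\<^sub>\<Omega> \<tau>)) =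
      contr k \<kappa> (\<dd> \<sigma>) \<and>\<^sub>\<Omega> \<tau> + sc ((- 1) ^ (Suc k * Suc l)) (\<dd> \<sigma> \<and>\<^sub>\<Omega> contr k \<kappa> \<tau>)
      + sc ((- 1) ^ l) (contr k \<kappa> \<sigma> \<and>\<^sub>\<Omega> \<dd> \<tau> + sc ((- 1) ^ (Suc k * l)) (\<sigma> \<and>\<^sub>\<Omega> contr k \<kappa> (\<dd> \<tau>)))"
    unfolding ext_d_wedge[OF s t] contr_add contr_sc contr_wedge[OF \<kappa> ds t] contr_wedge[OF \<kappa> s dt] by (rule refl)
  have 2: "\<dd> (contr k \<kappa> (\<sigma> \<and>\<^sub>\<Omega> \<tau>)) =
      \<dd> (contr k \<kappa> \<sigma>) \<and>\<^sub>\<Omega> \<tau> - sc ((- 1) ^ (k + l)) (contr k \<kappa> \<sigma> \<and>\<^sub>\<Omega> \<dd> \<tau>)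
      + sc ((- 1) ^ (Suc k * l)) (\<dd> \<sigma> \<and>\<^sub>\<Omega> contr k \<kappa> \<tau> + sc ((- 1) ^ l) (\<sigma> \<and>\<^sub>\<Omega> \<dd> (contr k \<kappa> \<tau>)))"
    unfolding contr_wedge[OF \<kappa> s t] ext_d_add[OF wedge_Om[OF mem[OF s] t] Om_sc[OF wedge_Om[OF s mem[OF t]]]]
      ext_d_sc[OF wedge_Om[OF s mem[OF t]]] ext_d_contr_wedge[OF \<kappa> s t] ext_d_wedge[OF s mem[OF t]] by (rule refl)
  show "lie_along k \<kappa> (\<sigma> \<and>\<^sub>\<Omega> \<tau>) = lie_along k \<kappa> \<sigma> \<and>\<^sub>\<Omega> \<tau> + sc ((- 1) ^ (k * l)) (\<sigma> \<and>\<^sub>\<Omega> lie_along k \<kappa> \<tau>)"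
    unfolding lie_along_def 1 2
    by (cases "even k"; cases "even l") (simp_all add: fun_eq_iff minus_one_power_iff)
qed

end

context contravariant_manifold
begin

text \<open>
  The derivation \<open>g \<mapsto> D\<^sub>d\<^sub>g \<sigma>\<close> as a vector-valued form, written \<open>H\<^sub>\<sigma>\<close> in the comments.
\<close>

definition hform :: "'m form \<Rightarrow> 'm vfield list \<Rightarrow> 'm vfield" where
  "hform \<sigma> = (\<lambda>Xs g. if g \<in> \<F> then H g \<sigma> Xs else 0)"

lemma hform_slot: "g \<in> \<F> \<Longrightarrow> (\<lambda>Xs. hform \<sigma> Xs g) = H g \<sigma>"
  by (simp add: hform_def)

lemma hform_X: assumes s: "\<sigma> \<in> \<Omega> k" shows "hform \<sigma> Xs \<in> \<X>"
proof (rule vector_fieldI)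
  have e: "hform \<sigma> Xs g = H g \<sigma> Xs" if "g \<in> \<F>" for g using that by (simp add: hform_def)
  fix f assume f: "f \<in> \<F>"
  show "hform \<sigma> Xs f \<in> \<F>" unfolding e[OF f] by (rule Om_smooth[OF H_Om[OF f s]])
  show "hform \<sigma> Xs ((\<lambda>_. c) * f) = (\<lambda>_. c) * hform \<sigma> Xs f" for c
    unfolding e[OF f] e[OF F_mult[OF F_const f]] H_scale_fun[OF f s] by (simp add: fun_eq_iff)
  show "hform \<sigma> Xs (f + g) = hform \<sigma> Xs f + hform \<sigma> Xs g" if g: "g \<in> \<F>" for g
    unfolding e[OF f] e[OF g] e[OF F_add[OF f g]] H_add_fun[OF f g s] by simp
  show "hform \<sigma> Xs (f * g) = hform \<sigma> Xs f * g + f * hform \<sigma> Xs g" if g: "g \<in> \<F>" for g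
    unfolding e[OF f] e[OF g] e[OF F_mult[OF f g]] H_mult_fun[OF f g s]
    by (simp add: fun_eq_iff algebra_simps)
qed (simp add: hform_def)

lemma hform_vform: "\<sigma> \<in> \<Omega> k \<Longrightarrow> vform k (hform \<sigma>)"
  unfolding vform_def by (intro conjI allI ballI) (rule hform_X, assumption, simp only: hform_slot H_Om)

lemma H_0: "f \<in> \<F> \<Longrightarrow> H f 0 = 0"
  using gd_0[OF H_gd] by simp

lemma hform_0: "hform 0 = (\<lambda>_. 0)"
  by (rule ext, rule ext) (simp add: hform_def H_0)

text \<open>
  The bracket of a \<open>k\<close>-form with a form. The two terms are the derivations of degree \<open>k\<close>
  whose values on functions and differentials add up to those required by antisymmetry and
  compatibility with \<open>d\<close> (\<open>brk_zf\<close>, \<open>brk_df\<close>).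
\<close>

definition brk :: "nat \<Rightarrow> 'm form \<Rightarrow> 'm form \<Rightarrow> 'm form" where
  "brk k \<sigma> \<rho> = sc ((- 1) ^ k) (contr (Suc k) (hform (\<dd> \<sigma>)) \<rho>) + sc (- 1) (lie_along k (hform \<sigma>) \<rho>)"

lemma brk_gd: assumes s: "\<sigma> \<in> \<Omega> k" shows "graded_derivation k (\<lambda>_. brk k \<sigma>)"
  unfolding brk_def
  by (intro gd_plus gd_scale gd_contr gd_lie_along hform_vform s ext_d_Om)

lemma brk_Om: "\<sigma> \<in> \<Omega> k \<Longrightarrow> \<rho> \<in> \<Omega> l \<Longrightarrow> brk k \<sigma> \<rho> \<in> \<Omega> (k + l)"
  using gd_Om[OF brk_gd] by (simp only: add.commute)

lemma brk_zf: assumes s: "\<sigma> \<in> \<Omega> k" and g: "g \<in> \<F>" shows "brk k \<sigma> (zero_form g) = - H g \<sigma>"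
proof -
  have c: "contr n \<kappa> (zero_form g) = 0" for n \<kappa> by (rule contr_Om_0[OF zero_form_Om[OF g]])
  have "contr k (hform \<sigma>) (df g) = H g \<sigma>"
    unfolding contr_df[of g "hform \<sigma>", OF g hform_X[OF s]] by (rule hform_slot[OF g])
  then show ?thesis unfolding brk_def lie_along_def c ext_d_0 by (simp add: fun_eq_iff)
qed

lemma brk_df: assumes s: "\<sigma> \<in> \<Omega> k" and g: "g \<in> \<F>"
  shows "brk k \<sigma> (df g) = sc ((- 1) ^ k) (H g (\<dd> \<sigma>) - \<dd> (H g \<sigma>))"
proof -
  have 1: "contr k (hform \<sigma>) (df g) = H g \<sigma>"
    unfolding contr_df[of g "hform \<sigma>", OF g hform_X[OF s]] by (rule hform_slot[OF g])
  have 2: "contr (Suc k) (hform (\<dd> \<sigma>)) (df g) = H g (\<dd> \<sigma>)"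
    unfolding contr_df[of g "hform (\<dd> \<sigma>)", OF g hform_X[OF ext_d_Om[OF s]]] by (rule hform_slot[OF g])
  show ?thesis unfolding brk_def lie_along_def 1 2 ext_d_ext_d[OF zero_form_Om[OF g]] contr_0
    by (simp add: fun_eq_iff algebra_simps)
qed

text \<open>
  Since \<open>d\<^sup>2 = 0\<close>, the terms \<open>\<plusminus> d i(H\<^sub>d\<^sub>\<sigma>) \<rho>\<close> and \<open>- d i(H\<^sub>\<sigma>) d\<rho>\<close> remain on both sides.
\<close>

lemma brk_ext_d: assumes s: "\<sigma> \<in> \<Omega> k" and r: "\<rho> \<in> \<Omega> l"
  shows "\<dd> (brk k \<sigma> \<rho>) = brk (Suc k) (\<dd> \<sigma>) \<rho> + sc ((- 1) ^ k) (brk k \<sigma> (\<dd> \<rho>))"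
proof -
  let ?a = "contr k (hform \<sigma>)" and ?c = "contr (Suc k) (hform (\<dd> \<sigma>))"
  note v = hform_vform[OF s] and v' = hform_vform[OF ext_d_Om[OF s]]
  have m1: "?c \<rho> \<in> \<Omega> (l + k)" by (rule gd_Om[OF gd_contr[OF v'] r])
  have m2: "?a (\<dd> \<rho>) \<in> \<Omega> (l + k)" using contr_Om[OF v ext_d_Om[OF r]] by (simp only: add.commute)
  have m3: "\<dd> (?a \<rho>) \<in> \<Omega> (l + k)" by (rule ext_d_contr_Om[OF v r])
  have dd3: "\<dd> (\<dd> (?a \<rho>)) = 0"
  proof (cases l)
    case 0
    then have "?a \<rho> = 0" using contr_Om_0 r by blast
    then show ?thesis by (simp only: ext_d_0)
  next
    case (Suc j)
    then have "?a \<rho> \<in> \<Omega> (k + j)" using contr_Om[OF v] r by blast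
    then show ?thesis by (rule ext_d_ext_d)
  qed
  have "\<dd> (brk k \<sigma> \<rho>) = sc ((- 1) ^ k) (\<dd> (?c \<rho>)) + sc (- 1) (\<dd> (?a (\<dd> \<rho>)) + sc ((- 1) ^ k) 0)"
    unfolding brk_def lie_along_def
      ext_d_add[OF Om_sc[OF m1] Om_sc[OF Om_add[OF m2 Om_sc[OF m3]]]] ext_d_sc[OF m1]
      ext_d_sc[OF Om_add[OF m2 Om_sc[OF m3]]] ext_d_add[OF m2 Om_sc[OF m3]] ext_d_sc[OF m3] dd3 by (rule refl)
  moreover have "brk (Suc k) (\<dd> \<sigma>) \<rho> = sc (- 1) (?c (\<dd> \<rho>) + sc ((- 1) ^ Suc k) (\<dd> (?c \<rho>)))"
    unfolding brk_def lie_along_def ext_d_ext_d[OF s] hform_0 contr_v0[OF r] by (simp add: fun_eq_iff)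
  moreover have "brk k \<sigma> (\<dd> \<rho>) = sc ((- 1) ^ k) (?c (\<dd> \<rho>)) + sc (- 1) (sc ((- 1) ^ k) (\<dd> (?a (\<dd> \<rho>))))"
    unfolding brk_def lie_along_def ext_d_ext_d[OF r] contr_0 by (simp add: fun_eq_iff)
  ultimately show ?thesis by (simp add: fun_eq_iff minus_one_power_iff)
qed

lemma brk_add1: assumes s: "\<sigma> \<in> \<Omega> k" and t: "\<tau> \<in> \<Omega> k" and r: "\<rho> \<in> \<Omega> l"
  shows "brk k (\<sigma> + \<tau>) \<rho> = brk k \<sigma> \<rho> + brk k \<tau> \<rho>"
proof (rule gd_eqI[OF brk_gd[OF Om_add[OF s t]] gd_plus[OF brk_gd[OF s] brk_gd[OF t]] _ _ r])
  fix g assume g: "g \<in> \<F>"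
  show "brk k (\<sigma> + \<tau>) (zero_form g) = brk k \<sigma> (zero_form g) + brk k \<tau> (zero_form g)"
    unfolding brk_zf[OF s g] brk_zf[OF t g] brk_zf[OF Om_add[OF s t] g] H_add[OF g s t] by simp
  show "brk k (\<sigma> + \<tau>) (df g) = brk k \<sigma> (df g) + brk k \<tau> (df g)"
    unfolding brk_df[OF s g] brk_df[OF t g] brk_df[OF Om_add[OF s t] g] H_add[OF g s t]
      ext_d_add[OF s t] H_add[OF g ext_d_Om[OF s] ext_d_Om[OF t]]
      ext_d_add[OF H_Om[OF g s] H_Om[OF g t]] by (simp add: fun_eq_iff algebra_simps)
qed

lemma brk_sc1: assumes s: "\<sigma> \<in> \<Omega> k" and r: "\<rho> \<in> \<Omega> l" shows "brk k (sc c \<sigma>) \<rho> = sc c (brk k \<sigma> \<rho>)"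
proof (rule gd_eqI[OF brk_gd[OF Om_sc[OF s]] gd_scale[OF brk_gd[OF s]] _ _ r])
  fix g assume g: "g \<in> \<F>"
  show "brk k (sc c \<sigma>) (zero_form g) = sc c (brk k \<sigma> (zero_form g))"
    unfolding brk_zf[OF s g] brk_zf[OF Om_sc[OF s] g] H_sc[OF g s] by (simp add: fun_eq_iff)
  show "brk k (sc c \<sigma>) (df g) = sc c (brk k \<sigma> (df g))"
    unfolding brk_df[OF s g] brk_df[OF Om_sc[OF s] g] H_sc[OF g s] ext_d_sc[OF s]
      H_sc[OF g ext_d_Om[OF s]] ext_d_sc[OF H_Om[OF g s]] by (simp add: fun_eq_iff algebra_simps)
qed

lemma brk_add2: "\<sigma> \<in> \<Omega> k \<Longrightarrow> \<rho> \<in> \<Omega> l \<Longrightarrow> \<tau> \<in> \<Omega> l \<Longrightarrow> brk k \<sigma> (\<rho> + \<tau>) = brk k \<sigma> \<rho> + brk k \<sigma> \<tau>"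
  by (rule gd_add[OF brk_gd])

lemma brk_wedge2: "\<sigma> \<in> \<Omega> k \<Longrightarrow> \<rho> \<in> \<Omega> l \<Longrightarrow> \<tau> \<in> \<Omega> m \<Longrightarrow>
    brk k \<sigma> (\<rho> \<and>\<^sub>\<Omega> \<tau>) = brk k \<sigma> \<rho> \<and>\<^sub>\<Omega> \<tau> + sc ((- 1) ^ (k * l)) (\<rho> \<and>\<^sub>\<Omega> brk k \<sigma> \<tau>)"
  by (rule gd_wedge[OF brk_gd])

text \<open>
  For fixed \<open>\<sigma>, \<tau>\<close> both sides are derivations in \<open>\<rho>\<close>, and on \<open>g\<close> and \<open>dg\<close> they are the
  Leibniz rules of \<open>D\<^sub>d\<^sub>g\<close> and \<open>d\<close>.
\<close>

lemma brk_wedge1: assumes s: "\<sigma> \<in> \<Omega> k" and t: "\<tau> \<in> \<Omega> l" and r: "\<rho> \<in> \<Omega> m"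
  shows "brk (k + l) (\<sigma> \<and>\<^sub>\<Omega> \<tau>) \<rho> = \<sigma> \<and>\<^sub>\<Omega> brk l \<tau> \<rho> + sc ((- 1) ^ (k * l)) (\<tau> \<and>\<^sub>\<Omega> brk k \<sigma> \<rho>)"
proof -
  note st = wedge_Om[OF s t]
  have g2: "graded_derivation (k + l) (\<lambda>_ \<rho>. sc ((- 1) ^ (k * l)) (\<tau> \<and>\<^sub>\<Omega> brk k \<sigma> \<rho>))"
    using gd_scale[OF gd_wedge_left[OF brk_gd[OF s] t]] by (simp only: add.commute)
  show ?thesis
  proof (rule gd_eqI[OF brk_gd[OF st] gd_plus[OF gd_wedge_left[OF brk_gd[OF t] s] g2] _ _ r])
    fix g assume g: "g \<in> \<F>"
    note Hs = H_Om[OF g s] and Ht = H_Om[OF g t]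
    note ds = ext_d_Om[OF s] and dt = ext_d_Om[OF t]
    show "brk (k + l) (\<sigma> \<and>\<^sub>\<Omega> \<tau>) (zero_form g) =
        \<sigma> \<and>\<^sub>\<Omega> brk l \<tau> (zero_form g) + sc ((- 1) ^ (k * l)) (\<tau> \<and>\<^sub>\<Omega> brk k \<sigma> (zero_form g))"
      unfolding brk_zf[OF s g] brk_zf[OF t g] brk_zf[OF st g] H_wedge[OF g s t] wedge_linear
        Om_wedge_commute[OF Hs t] by (simp add: fun_eq_iff)
    have 1: "H g (\<dd> (\<sigma> \<and>\<^sub>\<Omega> \<tau>)) = H g (\<dd> \<sigma>) \<and>\<^sub>\<Omega> \<tau> + \<dd> \<sigma> \<and>\<^sub>\<Omega> H g \<tau>
        + sc ((- 1) ^ k) (H g \<sigma> \<and>\<^sub>\<Omega> \<dd> \<tau> + \<sigma> \<and>\<^sub>\<Omega> H g (\<dd> \<tau>))"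
    proof -
      have m1: "\<dd> \<sigma> \<and>\<^sub>\<Omega> \<tau> \<in> \<Omega> (Suc (k + l))" using wedge_Om[OF ds t] by (simp only: add_Suc)
      have m2: "\<sigma> \<and>\<^sub>\<Omega> \<dd> \<tau> \<in> \<Omega> (Suc (k + l))" using wedge_Om[OF s dt] by (simp only: add_Suc_right)
      show ?thesis unfolding ext_d_wedge[OF s t] H_add[OF g m1 Om_sc[OF m2]] H_sc[OF g m2]
        H_wedge[OF g ds t] H_wedge[OF g s dt] by (rule refl)
    qed
    have 2: "\<dd> (H g (\<sigma> \<and>\<^sub>\<Omega> \<tau>)) = \<dd> (H g \<sigma>) \<and>\<^sub>\<Omega> \<tau> + sc ((- 1) ^ k) (H g \<sigma> \<and>\<^sub>\<Omega> \<dd> \<tau>)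
        + (\<dd> \<sigma> \<and>\<^sub>\<Omega> H g \<tau> + sc ((- 1) ^ k) (\<sigma> \<and>\<^sub>\<Omega> \<dd> (H g \<tau>)))"
      unfolding H_wedge[OF g s t] ext_d_add[OF wedge_Om[OF Hs t] wedge_Om[OF s Ht]]
        ext_d_wedge[OF Hs t] ext_d_wedge[OF s Ht] by (rule refl)
    note c = Om_wedge_commute[OF t H_Om[OF g ds]] Om_wedge_commute[OF t ext_d_Om[OF Hs]]
    show "brk (k + l) (\<sigma> \<and>\<^sub>\<Omega> \<tau>) (df g) =
        \<sigma> \<and>\<^sub>\<Omega> brk l \<tau> (df g) + sc ((- 1) ^ (k * l)) (\<tau> \<and>\<^sub>\<Omega> brk k \<sigma> (df g))"
      unfolding brk_df[OF s g] brk_df[OF t g] brk_df[OF st g] 1 2 wedge_linear c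
      by (cases "even k"; cases "even l") (simp_all add: fun_eq_iff minus_one_power_iff)
  qed
qed

end

locale torsion_free_manifold = contravariant_manifold A \<pi> D for A :: "('m::{t2_space, second_countable_topology}, 'e::real_inner) chart set" and \<pi> D +
  assumes torsion_free: "torsion_free A \<pi> D"
begin

text \<open>
  The only way in which the torsion enters: with \<open>{f, \<cdot>} = D\<^sub>d\<^sub>f\<close> it says that \<open>d\<close> is a
  derivation of the bracket \<open>{f, g}\<close>.
\<close>

lemma torsion_free_df: assumes f: "f \<in> \<F>" and g: "g \<in> \<F>"
  shows "H f (df g) - H g (df f) = df (br f g)"
proof -
  have "D (df f) (df g) - D (df g) (df f) = koszul_bracket A \<pi> (df f) (df g)"
    using torsion_free df_Om1[OF f] df_Om1[OF g] unfolding torsion_free_def by blast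
  then show ?thesis unfolding koszul_bracket_eq K_exact[OF f g]
      H_one_form[OF f df_Om1[OF g]] H_one_form[OF g df_Om1[OF f]] .
qed

text \<open>
  The bracket with a 0-form is the connection, also on forms of higher degree. On \<open>dg\<close> this
  is the vanishing of the torsion.
\<close>

lemma brk_zero_form: assumes f: "f \<in> \<F>" and r: "\<rho> \<in> \<Omega> l" shows "brk 0 (zero_form f) \<rho> = H f \<rho>"
proof -
  note z = zero_form_Om[OF f]
  show ?thesis
  proof (rule gd_eqI[OF brk_gd[OF z] H_gd[OF f] _ _ r])
    fix g assume g: "g \<in> \<F>"
    show "brk 0 (zero_form f) (zero_form g) = H f (zero_form g)"
      unfolding brk_zf[OF z g] H_zero_form[OF f g] H_zero_form[OF g f] fb_swap[OF f g]
      by (auto simp: zero_form_def fun_eq_iff)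
    have "df (br f g) = - df (br g f)"
      unfolding fb_swap[OF f g] by (rule df_minus[OF fb_F])
    then show "brk 0 (zero_form f) (df g) = H f (df g)"
      unfolding brk_df[OF z g] H_zero_form[OF g f] using torsion_free_df[OF f g]
      by (simp add: fun_eq_iff algebra_simps)
  qed
qed

lemma brk_exact: assumes f: "f \<in> \<F>" and r: "\<rho> \<in> \<Omega> l"
  shows "brk 1 (df f) \<rho> = \<dd> (H f \<rho>) - H f (\<dd> \<rho>)"
  using brk_ext_d[OF zero_form_Om[OF f] r]
  unfolding brk_zero_form[OF f r] brk_zero_form[OF f ext_d_Om[OF r]] by (simp add: fun_eq_iff)

text \<open>
  By \<open>brk_wedge1\<close> the right-hand side is, with its degree-dependent sign, a derivation in
  \<open>\<rho>\<close>. On functions and differentials both sides are known from \<open>brk_zero_form\<close> and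
  \<open>brk_ext_d\<close>.
\<close>

lemma brk_swap: assumes s: "\<sigma> \<in> \<Omega> k" and r: "\<rho> \<in> \<Omega> l"
  shows "brk k \<sigma> \<rho> = - sc ((- 1) ^ (k * l)) (brk l \<rho> \<sigma>)"
proof -
  let ?G = "\<lambda>l \<rho>. - sc ((- 1) ^ (k * l)) (brk l \<rho> \<sigma>)"
  have G: "graded_derivation k ?G"
  proof (rule graded_derivationI)
    fix l \<rho> assume r: "\<rho> \<in> \<Omega> l"
    show "?G l \<rho> \<in> \<Omega> (l + k)" by (intro Om_minus Om_sc brk_Om[OF r s])
    show "?G l (\<rho> + \<tau>) = ?G l \<rho> + ?G l \<tau>" if t: "\<tau> \<in> \<Omega> l" for \<tau>
      unfolding brk_add1[OF r t s] by (simp add: fun_eq_iff algebra_simps)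
    show "?G (l + m) (\<rho> \<and>\<^sub>\<Omega> \<tau>) = ?G l \<rho> \<and>\<^sub>\<Omega> \<tau> + sc ((- 1) ^ (k * l)) (\<rho> \<and>\<^sub>\<Omega> ?G m \<tau>)" if t: "\<tau> \<in> \<Omega> m" for m \<tau>
      unfolding brk_wedge1[OF r t s] wedge_linear Om_wedge_commute[OF t brk_Om[OF r s]]
      by (cases "even k"; cases "even l"; cases "even m") (simp_all add: fun_eq_iff minus_one_power_iff)
  qed
  show ?thesis
  proof (rule gd_eqI[OF brk_gd[OF s] G _ _ r])
    fix g assume g: "g \<in> \<F>"
    show "brk k \<sigma> (zero_form g) = ?G 0 (zero_form g)"
      unfolding brk_zf[OF s g] brk_zero_form[OF g s] by (simp add: fun_eq_iff)
    show "brk k \<sigma> (df g) = ?G 1 (df g)"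
      unfolding brk_df[OF s g] brk_exact[OF g s] by (simp add: fun_eq_iff algebra_simps)
  qed
qed

end

section \<open>Metacurvature and the Jacobi identity\<close>

locale flat_manifold = torsion_free_manifold A \<pi> D for A :: "('m::{t2_space, second_countable_topology}, 'e::real_inner) chart set" and \<pi> D +
  assumes flat: "flat A \<pi> D"
begin

text \<open>
  The Jacobi identity for two functions and a form. On functions it is the one of the
  Poisson bracket, on differentials the flatness of \<open>D\<close>.
\<close>

lemma H_flat: assumes f: "f \<in> \<F>" and g: "g \<in> \<F>" and r: "\<rho> \<in> \<Omega> l"
  shows "H f (H g \<rho>) - H g (H f \<rho>) = H (br f g) \<rho>"
proof -
  note fg = fb_F[of f g]
  let ?C = "\<lambda>\<rho>. H f (H g \<rho>) - sc ((- 1) ^ (0 * 0)) (H g (H f \<rho>))"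
  have "?C \<rho> = H (br f g) \<rho>"
  proof (rule gd_eqI[where F = "\<lambda>_. ?C", OF _ _ _ _ r])
    show "graded_derivation (0 + 0) (\<lambda>_. ?C)" by (rule gd_commutator[OF H_gd[OF f] H_gd[OF g]])
    show "graded_derivation (0 + 0) (\<lambda>_. H (br f g))" using H_gd[OF fg] by simp
    fix h assume h: "h \<in> \<F>"
    have "br f (br g h) - br g (br f h)
        = br (br f g) h"
      using fun_cong[OF anchor_df_bracket[OF f g], of h]
      unfolding fb_anchor[OF h] fb_anchor[OF X_F[OF anchor_X[OF df_Om1] h]] fb_anchor[OF fb_F] lie_bracket_apply
        fb_anchor[OF X_F[OF anchor_X[OF df_Om1[OF f]] h]] fb_anchor[OF X_F[OF anchor_X[OF df_Om1[OF g]] h]]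
      by (rule sym)
    then show "?C (zero_form h) = H (br f g) (zero_form h)"
      unfolding H_zero_form[OF f h] H_zero_form[OF g h] H_zero_form[OF fg h]
        H_zero_form[OF f fb_F] H_zero_form[OF g fb_F]
      by (auto simp: zero_form_def fun_eq_iff)
    note d = df_Om1[OF h]
    have "D (df f) (D (df g) (df h)) - D (df g) (D (df f) (df h)) - D (koszul_bracket A \<pi> (df f) (df g)) (df h) = 0"
      using flat df_Om1[OF f] df_Om1[OF g] d unfolding flat_def by blast
    then show "?C (df h) = H (br f g) (df h)"
      unfolding H_one_form[OF f d] H_one_form[OF g d] H_one_form[OF fg d]
        H_one_form[OF f D_Om[OF df_Om1[OF g] d]] H_one_form[OF g D_Om[OF df_Om1[OF f] d]]
        koszul_bracket_eq K_exact[OF f g] by (simp add: fun_eq_iff)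
  qed
  then show ?thesis by (simp add: fun_eq_iff)
qed

definition one_form_brk :: "'m form \<Rightarrow> 'm form \<Rightarrow> 'm form" where
  "one_form_brk \<alpha> \<beta> = (if \<alpha> \<in> \<Omega> 1 \<and> \<beta> \<in> \<Omega> 1 then brk 1 \<alpha> \<beta> else 0)"

lemma one_form_brk_eq: "\<alpha> \<in> \<Omega> 1 \<Longrightarrow> \<beta> \<in> \<Omega> 1 \<Longrightarrow> one_form_brk \<alpha> \<beta> = brk 1 \<alpha> \<beta>"
  by (simp add: one_form_brk_def)

lemma brk1_swap: "\<alpha> \<in> \<Omega> 1 \<Longrightarrow> \<beta> \<in> \<Omega> 1 \<Longrightarrow> brk 1 \<alpha> \<beta> = brk 1 \<beta> \<alpha>"
  using brk_swap[of \<alpha> 1 \<beta> 1] by (simp add: fun_eq_iff)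

lemma brk1_Om: "\<alpha> \<in> \<Omega> 1 \<Longrightarrow> \<beta> \<in> \<Omega> 1 \<Longrightarrow> brk 1 \<alpha> \<beta> \<in> \<Omega> 2"
  using brk_Om[of \<alpha> 1 \<beta> 1] by (simp add: numeral_2_eq_2)

lemma brk1_fmul: assumes f: "f \<in> \<F>" and a: "\<alpha> \<in> \<Omega> 1" and c: "\<beta> \<in> \<Omega> 1"
  shows "brk 1 (f \<cdot> \<alpha>) \<beta> = f \<cdot> brk 1 \<alpha> \<beta> + \<alpha> \<and>\<^sub>\<Omega> H f \<beta>"
  using brk_wedge1[OF zero_form_Om[OF f] a c] brk_zero_form[OF f c] by (simp del: pointwise)

lemma one_form_brk_bilinear: "bilinear_on sc (\<Omega> 1) one_form_brk"
proof (rule bilinear_onI)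
  note e = one_form_brk_eq
  fix x y z assume x: "x \<in> \<Omega> 1" and y: "y \<in> \<Omega> 1" and z: "z \<in> \<Omega> 1"
  show "one_form_brk (x + y) z = one_form_brk x z + one_form_brk y z"
    unfolding e[OF x z] e[OF y z] e[OF Om_add[OF x y] z] by (rule brk_add1[OF x y z])
  show "one_form_brk z (x + y) = one_form_brk z x + one_form_brk z y"
    unfolding e[OF z x] e[OF z y] e[OF z Om_add[OF x y]] by (rule brk_add2[OF z x y])
next
  note e = one_form_brk_eq
  fix c x z assume x: "x \<in> \<Omega> 1" and z: "z \<in> \<Omega> 1"
  show *: "one_form_brk (sc c x) z = sc c (one_form_brk x z)"
    unfolding e[OF x z] e[OF Om_sc[OF x] z] by (rule brk_sc1[OF x z])
  show "one_form_brk z (sc c x) = sc c (one_form_brk z x)"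
    unfolding e[OF z x] e[OF z Om_sc[OF x]] brk1_swap[OF z x] brk1_swap[OF z Om_sc[OF x]] by (rule brk_sc1[OF x z])
qed

lemma brk_is_one_form_bracket: "is_one_form_bracket A \<pi> D one_form_brk"
  unfolding is_one_form_bracket_def
proof (intro conjI ballI allI impI)
  note e = one_form_brk_eq
  show "bilinear_on sc (\<Omega> 1) one_form_brk" by (rule one_form_brk_bilinear)
  fix \<alpha> \<beta> assume a: "\<alpha> \<in> \<Omega> 1" and c: "\<beta> \<in> \<Omega> 1"
  show "one_form_brk \<alpha> \<beta> \<in> \<Omega> 2" unfolding e[OF a c] by (rule brk1_Om[OF a c])
  show "one_form_brk \<alpha> \<beta> = one_form_brk \<beta> \<alpha>" unfolding e[OF a c] e[OF c a] by (rule brk1_swap[OF a c])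
next
  note e = one_form_brk_eq
  fix f \<alpha> \<beta> assume f: "f \<in> \<F>" and a: "\<alpha> \<in> \<Omega> 1" and c: "\<beta> \<in> \<Omega> 1"
  show "one_form_brk (f \<cdot> \<alpha>) \<beta> = f \<cdot> one_form_brk \<alpha> \<beta> + \<alpha> \<and>\<^sub>\<Omega> H f \<beta>"
    unfolding e[OF a c] e[OF Om_fmul[OF f a] c] by (rule brk1_fmul[OF f a c])
next
  note e = one_form_brk_eq
  fix f \<beta> assume f: "f \<in> \<F>" and c: "\<beta> \<in> \<Omega> 1"
  show "\<dd> (H f \<beta>) = one_form_brk (df f) \<beta> + H f (\<dd> \<beta>)"
    unfolding e[OF df_Om1[OF f] c] brk_exact[OF f c] by simp
next
  fix \<alpha> \<beta> assume "\<alpha> \<notin> \<Omega> 1 \<or> \<beta> \<notin> \<Omega> 1"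
  then show "one_form_brk \<alpha> \<beta> = 0" by (auto simp: one_form_brk_def)
qed

lemma one_form_bracket_eq: "one_form_bracket A \<pi> D = one_form_brk"
  by (rule one_form_bracket_unique[OF brk_is_one_form_bracket])

text \<open>
  The metacurvature \<open>M(df, \<beta>, \<gamma>)\<close>, as a function of \<open>f\<close>.
\<close>

definition meta :: "('m \<Rightarrow> real) \<Rightarrow> 'm form \<Rightarrow> 'm form \<Rightarrow> 'm form" where
  "meta f \<beta> \<gamma> = H f (brk 1 \<beta> \<gamma>) - brk 1 (H f \<beta>) \<gamma> - brk 1 (H f \<gamma>) \<beta>"

lemma H_Om1: "f \<in> \<F> \<Longrightarrow> \<beta> \<in> \<Omega> 1 \<Longrightarrow> H f \<beta> \<in> \<Omega> 1" by (rule H_Om)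

lemma meta_Om: assumes f: "f \<in> \<F>" and b: "\<beta> \<in> \<Omega> 1" and c: "\<gamma> \<in> \<Omega> 1" shows "meta f \<beta> \<gamma> \<in> \<Omega> 2"
  unfolding meta_def by (intro Om_diff H_Om brk1_Om H_Om1 f b c)

lemma meta_swap: assumes b: "\<beta> \<in> \<Omega> 1" and c: "\<gamma> \<in> \<Omega> 1" shows "meta f \<beta> \<gamma> = meta f \<gamma> \<beta>"
  unfolding meta_def brk1_swap[OF b c] by simp

lemma meta_add_fun: assumes f: "f \<in> \<F>" and g: "g \<in> \<F>" and b: "\<beta> \<in> \<Omega> 1" and c: "\<gamma> \<in> \<Omega> 1"
  shows "meta (f + g) \<beta> \<gamma> = meta f \<beta> \<gamma> + meta g \<beta> \<gamma>"
proof -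
  show ?thesis unfolding meta_def H_add_fun[OF f g b] H_add_fun[OF f g c] H_add_fun[OF f g brk1_Om[OF b c]]
    brk_add1[OF H_Om1[OF f b] H_Om1[OF g b] c] brk_add1[OF H_Om1[OF f c] H_Om1[OF g c] b] by simp
qed

text \<open>
  The terms without derivatives of the arguments have the form \<open>D\<^sub>d\<^sub>f \<beta> \<and> D\<^sub>d\<^sub>g \<gamma>\<close> and cancel
  because 1-forms anticommute.
\<close>

lemma meta_mult_fun: assumes f: "f \<in> \<F>" and g: "g \<in> \<F>" and b: "\<beta> \<in> \<Omega> 1" and c: "\<gamma> \<in> \<Omega> 1"
  shows "meta (f * g) \<beta> \<gamma> = f \<cdot> meta g \<beta> \<gamma> + g \<cdot> meta f \<beta> \<gamma>"
proof -
  have e: "brk 1 (f \<cdot> H g \<sigma> + g \<cdot> H f \<sigma>) \<tau> =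
      f \<cdot> brk 1 (H g \<sigma>) \<tau> + H g \<sigma> \<and>\<^sub>\<Omega> H f \<tau> + (g \<cdot> brk 1 (H f \<sigma>) \<tau> + H f \<sigma> \<and>\<^sub>\<Omega> H g \<tau>)"
    if s: "\<sigma> \<in> \<Omega> 1" and t: "\<tau> \<in> \<Omega> 1" for \<sigma> \<tau>
    unfolding brk_add1[OF Om_fmul[OF f H_Om1[OF g s]] Om_fmul[OF g H_Om1[OF f s]] t]
      brk1_fmul[OF f H_Om1[OF g s] t] brk1_fmul[OF g H_Om1[OF f s] t] by (rule refl)
  show ?thesis
    unfolding meta_def H_mult_fun[OF f g b] H_mult_fun[OF f g c] H_mult_fun[OF f g brk1_Om[OF b c]]
      e[OF b c] e[OF c b] Om_wedge_commute[OF H_Om1[OF g c] H_Om1[OF f b]] Om_wedge_commute[OF H_Om1[OF f c] H_Om1[OF g b]]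
    by (simp add: fun_eq_iff algebra_simps)
qed

lemma meta_scale_fun: assumes f: "f \<in> \<F>" and b: "\<beta> \<in> \<Omega> 1" and c: "\<gamma> \<in> \<Omega> 1"
  shows "meta ((\<lambda>_. x) * f) \<beta> \<gamma> = (\<lambda>_. x) \<cdot> meta f \<beta> \<gamma>"
proof -
  show ?thesis unfolding meta_def H_scale_fun[OF f b] H_scale_fun[OF f c] H_scale_fun[OF f brk1_Om[OF b c]]
    sc_fmul[symmetric] brk_sc1[OF H_Om1[OF f b] c] brk_sc1[OF H_Om1[OF f c] b]
    by (simp add: fun_eq_iff algebra_simps)
qed

lemma meta_add: assumes f: "f \<in> \<F>" and b: "\<beta> \<in> \<Omega> 1" and b': "\<beta>' \<in> \<Omega> 1" and c: "\<gamma> \<in> \<Omega> 1"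
  shows "meta f (\<beta> + \<beta>') \<gamma> = meta f \<beta> \<gamma> + meta f \<beta>' \<gamma>"
proof -
  show ?thesis unfolding meta_def H_add[OF f b b'] brk_add1[OF b b' c]
    H_add[OF f brk1_Om[OF b c] brk1_Om[OF b' c]] brk_add1[OF H_Om1[OF f b] H_Om1[OF f b'] c]
    brk_add2[OF H_Om1[OF f c] b b'] by simp
qed

text \<open>
  The terms that are not linear over the functions add up to \<open>\<beta>\<close> times the curvature,
  applied to \<open>\<gamma>\<close>.
\<close>

lemma meta_fmul: assumes f: "f \<in> \<F>" and h: "h \<in> \<F>" and b: "\<beta> \<in> \<Omega> 1" and c: "\<gamma> \<in> \<Omega> 1"
  shows "meta f (h \<cdot> \<beta>) \<gamma> = h \<cdot> meta f \<beta> \<gamma>"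
proof -
  let ?n = "br f h"
  have n: "?n \<in> \<F>" by (rule fb_F)
  note fb = H_Om1[OF f b] and fc = H_Om1[OF f c] and hc = H_Om1[OF h c]
  have w: "\<beta> \<and>\<^sub>\<Omega> H h \<gamma> \<in> \<Omega> 2" using wedge_Om[OF b hc] by (simp add: numeral_2_eq_2)
  have 1: "H f (brk 1 (h \<cdot> \<beta>) \<gamma>) = h \<cdot> H f (brk 1 \<beta> \<gamma>) + ?n \<cdot> brk 1 \<beta> \<gamma> + (H f \<beta> \<and>\<^sub>\<Omega> H h \<gamma> + \<beta> \<and>\<^sub>\<Omega> H f (H h \<gamma>))"
    unfolding brk1_fmul[OF h b c] H_add[OF f Om_fmul[OF h brk1_Om[OF b c]] w]
      H_fmul[OF f h brk1_Om[OF b c]] H_wedge[OF f b hc] by (rule refl)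
  have 2: "brk 1 (H f (h \<cdot> \<beta>)) \<gamma> = h \<cdot> brk 1 (H f \<beta>) \<gamma> + H f \<beta> \<and>\<^sub>\<Omega> H h \<gamma> + (?n \<cdot> brk 1 \<beta> \<gamma> + \<beta> \<and>\<^sub>\<Omega> H ?n \<gamma>)"
    unfolding H_fmul[OF f h b] brk_add1[OF Om_fmul[OF h fb] Om_fmul[OF n b] c]
      brk1_fmul[OF h fb c] brk1_fmul[OF n b c] by (rule refl)
  have 3: "brk 1 (H f \<gamma>) (h \<cdot> \<beta>) = h \<cdot> brk 1 (H f \<gamma>) \<beta> + \<beta> \<and>\<^sub>\<Omega> H h (H f \<gamma>)"
    unfolding brk1_swap[OF fc Om_fmul[OF h b]] brk1_swap[OF fc b] by (rule brk1_fmul[OF h b fc])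
  have 4: "H ?n \<gamma> = H f (H h \<gamma>) - H h (H f \<gamma>)" by (rule H_flat[OF f h c, symmetric])
  show ?thesis unfolding meta_def 1 2 3 4 wedge_linear by (simp add: fun_eq_iff algebra_simps)
qed

definition meta_form :: "'m form \<Rightarrow> 'm form \<Rightarrow> 'm vfield list \<Rightarrow> 'm vfield" where
  "meta_form \<beta> \<gamma> = (\<lambda>Xs f. if f \<in> \<F> then meta f \<beta> \<gamma> Xs else 0)"

lemma meta_form_vform: assumes b: "\<beta> \<in> \<Omega> 1" and c: "\<gamma> \<in> \<Omega> 1" shows "vform 2 (meta_form \<beta> \<gamma>)"
  unfolding vform_def
proof (intro conjI allI ballI)
  have e: "meta_form \<beta> \<gamma> Xs f = meta f \<beta> \<gamma> Xs" if "f \<in> \<F>" for f Xs using that by (simp add: meta_form_def)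
  fix Xs show "meta_form \<beta> \<gamma> Xs \<in> \<X>"
  proof (rule vector_fieldI)
    fix f assume f: "f \<in> \<F>"
    show "meta_form \<beta> \<gamma> Xs f \<in> \<F>" unfolding e[OF f] by (rule Om_smooth[OF meta_Om[OF f b c]])
    show "meta_form \<beta> \<gamma> Xs ((\<lambda>_. x) * f) = (\<lambda>_. x) * meta_form \<beta> \<gamma> Xs f" for x
      unfolding e[OF f] e[OF F_mult[OF F_const f]] meta_scale_fun[OF f b c] by (simp add: fun_eq_iff)
    fix g assume g: "g \<in> \<F>"
    show "meta_form \<beta> \<gamma> Xs (f + g) = meta_form \<beta> \<gamma> Xs f + meta_form \<beta> \<gamma> Xs g"
      unfolding e[OF f] e[OF g] e[OF F_add[OF f g]] meta_add_fun[OF f g b c] by simp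
    show "meta_form \<beta> \<gamma> Xs (f * g) = meta_form \<beta> \<gamma> Xs f * g + f * meta_form \<beta> \<gamma> Xs g"
      unfolding e[OF f] e[OF g] e[OF F_mult[OF f g]] meta_mult_fun[OF f g b c]
      by (simp add: fun_eq_iff algebra_simps)
  qed (simp add: meta_form_def)
next
  fix g assume g: "g \<in> \<F>"
  have "(\<lambda>Xs. meta_form \<beta> \<gamma> Xs g) = meta g \<beta> \<gamma>" using g by (simp add: meta_form_def)
  then show "(\<lambda>Xs. meta_form \<beta> \<gamma> Xs g) \<in> \<Omega> 2" using meta_Om[OF g b c] by metis
qed

lemma meta_form_add: assumes "\<beta> \<in> \<Omega> 1" "\<beta>' \<in> \<Omega> 1" "\<gamma> \<in> \<Omega> 1"
  shows "meta_form (\<beta> + \<beta>') \<gamma> = (\<lambda>Xs. meta_form \<beta> \<gamma> Xs + meta_form \<beta>' \<gamma> Xs)"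
  by (rule ext, rule ext) (simp add: meta_form_def meta_add[OF _ assms])

lemma meta_form_fmul: assumes "h \<in> \<F>" "\<beta> \<in> \<Omega> 1" "\<gamma> \<in> \<Omega> 1"
  shows "meta_form (h \<cdot> \<beta>) \<gamma> = (\<lambda>Xs. h \<cdot> meta_form \<beta> \<gamma> Xs)"
  by (rule ext, rule ext, rule ext) (simp add: meta_form_def meta_fmul[OF _ assms])

lemma meta_form_swap: assumes "\<beta> \<in> \<Omega> 1" "\<gamma> \<in> \<Omega> 1" shows "meta_form \<beta> \<gamma> = meta_form \<gamma> \<beta>"
  unfolding meta_form_def meta_swap[OF assms] by (rule refl)

text \<open>
  Being a derivation in \<open>f\<close>, \<open>meta f \<beta> \<gamma>\<close> is a vector-valued 2-form, whose contraction with
  \<open>\<alpha>\<close> extends it from differentials \<open>df\<close> to 1-forms. This shows that the metacurvature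
  exists, so that its definition by a description operator is meaningful.
\<close>

definition metatensor :: "'m form \<Rightarrow> 'm form \<Rightarrow> 'm form \<Rightarrow> 'm form" where
  "metatensor \<alpha> \<beta> \<gamma> = (if \<alpha> \<in> \<Omega> 1 \<and> \<beta> \<in> \<Omega> 1 \<and> \<gamma> \<in> \<Omega> 1 then contr 2 (meta_form \<beta> \<gamma>) \<alpha> else 0)"

lemma metatensor_eq: "\<alpha> \<in> \<Omega> 1 \<Longrightarrow> \<beta> \<in> \<Omega> 1 \<Longrightarrow> \<gamma> \<in> \<Omega> 1 \<Longrightarrow> metatensor \<alpha> \<beta> \<gamma> = contr 2 (meta_form \<beta> \<gamma>) \<alpha>"
  by (simp add: metatensor_def)

lemma metatensor_swap: assumes "\<beta> \<in> \<Omega> 1" "\<gamma> \<in> \<Omega> 1" shows "metatensor \<alpha> \<beta> \<gamma> = metatensor \<alpha> \<gamma> \<beta>"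
  unfolding metatensor_def meta_form_swap[OF assms] using assms by simp

lemma metatensor_df: assumes f: "f \<in> \<F>" and b: "\<beta> \<in> \<Omega> 1" and c: "\<gamma> \<in> \<Omega> 1"
  shows "metatensor (df f) \<beta> \<gamma> = meta f \<beta> \<gamma>"
  unfolding metatensor_eq[OF df_Om1[OF f] b c] contr_df[of f "meta_form \<beta> \<gamma>", OF f vform_X[OF meta_form_vform[OF b c]]]
  using f by (simp add: meta_form_def)

lemma metatensor_linear2: assumes a: "\<alpha> \<in> \<Omega> 1" and c: "\<gamma> \<in> \<Omega> 1" shows "function_linear A (\<lambda>\<beta>. metatensor \<alpha> \<beta> \<gamma>)"
  unfolding function_linear_def
proof (intro conjI ballI)
  note e = metatensor_eq[OF a _ c] and X = vform_X[OF meta_form_vform[OF _ c]]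
  fix \<beta> assume b: "\<beta> \<in> \<Omega> 1"
  show "metatensor \<alpha> (\<beta> + \<beta>') \<gamma> = metatensor \<alpha> \<beta> \<gamma> + metatensor \<alpha> \<beta>' \<gamma>" if b': "\<beta>' \<in> \<Omega> 1" for \<beta>'
    unfolding e[OF b] e[OF b'] e[OF Om_add[OF b b']] meta_form_add[OF b b' c]
    by (rule contr_vadd[of "meta_form \<beta> \<gamma>" "meta_form \<beta>' \<gamma>", OF X[OF b] X[OF b'] a])
next
  note e = metatensor_eq[OF a _ c] and X = vform_X[OF meta_form_vform[OF _ c]]
  fix f \<beta> assume f: "f \<in> \<F>" and b: "\<beta> \<in> \<Omega> 1"
  show "metatensor \<alpha> (f \<cdot> \<beta>) \<gamma> = f \<cdot> metatensor \<alpha> \<beta> \<gamma>"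
    unfolding e[OF b] e[OF Om_fmul[OF f b]] meta_form_fmul[OF f b c]
    by (rule contr_vfmul[of "meta_form \<beta> \<gamma>", OF X[OF b] f a])
qed

lemma metatensor_is_metacurvature: "is_metacurvature A \<pi> D metatensor"
  unfolding is_metacurvature_def
proof (intro conjI ballI allI impI)
  fix \<alpha> \<beta> \<gamma> assume a: "\<alpha> \<in> \<Omega> 1" and b: "\<beta> \<in> \<Omega> 1" and c: "\<gamma> \<in> \<Omega> 1"
  show "metatensor \<alpha> \<beta> \<gamma> \<in> \<Omega> 2"
    unfolding metatensor_eq[OF a b c] using contr_Om[OF meta_form_vform[OF b c], of \<alpha> 0] a by simp
next
  fix \<beta> \<gamma> assume b: "\<beta> \<in> \<Omega> 1" and c: "\<gamma> \<in> \<Omega> 1"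
  show "function_linear A (\<lambda>\<alpha>. metatensor \<alpha> \<beta> \<gamma>)"
    unfolding function_linear_def using metatensor_eq[OF _ b c]
    by (auto simp: contr_add contr_fmul simp del: pointwise)
  show "function_linear A (\<lambda>\<alpha>. metatensor \<beta> \<alpha> \<gamma>)" by (rule metatensor_linear2[OF b c])
  show "function_linear A (\<lambda>\<alpha>. metatensor \<beta> \<gamma> \<alpha>)"
    using metatensor_linear2[OF b c] metatensor_swap[OF c]
    unfolding function_linear_def using Om_add Om_fmul by metis
next
  note e = one_form_brk_eq
  fix f \<beta> \<gamma> assume f: "f \<in> \<F>" and b: "\<beta> \<in> \<Omega> 1" and c: "\<gamma> \<in> \<Omega> 1"
  show "metatensor (df f) \<beta> \<gamma> = H f (one_form_bracket A \<pi> D \<beta> \<gamma>)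
      - one_form_bracket A \<pi> D (H f \<beta>) \<gamma> - one_form_bracket A \<pi> D (H f \<gamma>) \<beta>"
    unfolding metatensor_df[OF f b c] one_form_bracket_eq e[OF b c] e[OF H_Om1[OF f b] c] e[OF H_Om1[OF f c] b]
    by (rule meta_def)
next
  fix \<alpha> \<beta> \<gamma> assume "\<alpha> \<notin> \<Omega> 1 \<or> \<beta> \<notin> \<Omega> 1 \<or> \<gamma> \<notin> \<Omega> 1"
  then show "metatensor \<alpha> \<beta> \<gamma> = 0" by (auto simp: metatensor_def)
qed

end

locale metaflat_manifold = flat_manifold A \<pi> D for A :: "('m::{t2_space, second_countable_topology}, 'e::real_inner) chart set" and \<pi> D +
  assumes meta0: "\<And>\<alpha> \<beta> \<gamma>. \<alpha> \<in> \<Omega> 1 \<Longrightarrow> \<beta> \<in> \<Omega> 1 \<Longrightarrow> \<gamma> \<in> \<Omega> 1 \<Longrightarrow> metacurvature A \<pi> D \<alpha> \<beta> \<gamma> = 0"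
begin

lemma meta_eq_0: assumes f: "f \<in> \<F>" and b: "\<beta> \<in> \<Omega> 1" and c: "\<gamma> \<in> \<Omega> 1" shows "meta f \<beta> \<gamma> = 0"
  using meta0[OF df_Om1[OF f] b c] metacurvature_unique[OF metatensor_is_metacurvature]
    metatensor_df[OF f b c] by metis

text \<open>
  The Jacobi identity for \<open>f, dg\<close> and a form \<open>\<sigma>\<close>. On functions it is flatness, and on
  differentials \<open>dh\<close> it is \<open>M(df, dg, dh) = 0\<close>.
\<close>

lemma brk_derivation_exact: assumes f: "f \<in> \<F>" and g: "g \<in> \<F>" and s: "\<sigma> \<in> \<Omega> k"
  shows "H f (brk 1 (df g) \<sigma>) - brk 1 (df g) (H f \<sigma>) = brk 1 (H f (df g)) \<sigma>"
proof -
  note dg = df_Om1[OF g]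
  let ?C = "\<lambda>\<rho>. H f (brk 1 (df g) \<rho>) - sc ((- 1) ^ (0 * 1)) (brk 1 (df g) (H f \<rho>))"
  have "?C \<sigma> = brk 1 (H f (df g)) \<sigma>"
  proof (rule gd_eqI[where F = "\<lambda>_. ?C", OF _ _ _ _ s])
    show "graded_derivation (0 + 1) (\<lambda>_. ?C)" by (rule gd_commutator[OF H_gd[OF f] brk_gd[OF dg]])
    show "graded_derivation (0 + 1) (\<lambda>_. brk 1 (H f (df g)))" using brk_gd[OF H_Om1[OF f dg]] by simp
    fix h assume h: "h \<in> \<F>"
    show "?C (zero_form h) = brk 1 (H f (df g)) (zero_form h)"
      unfolding H_zero_form[OF f h] brk_zf[OF dg h] brk_zf[OF dg fb_F]
        brk_zf[OF H_Om1[OF f dg] h] H_flat[OF f h dg, symmetric] gd_minus[OF H_gd[OF f] H_Om1[OF h dg]]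
      by (simp add: fun_eq_iff)
    show "?C (df h) = brk 1 (H f (df g)) (df h)"
      using meta_eq_0[OF f dg df_Om1[OF h]]
      unfolding meta_def brk1_swap[OF H_Om1[OF f df_Om1[OF h]] dg] by (simp add: fun_eq_iff algebra_simps)
  qed
  then show ?thesis by (simp add: fun_eq_iff)
qed

text \<open>
  The Jacobi identity for a function and two forms. On functions it is again flatness; on
  differentials, antisymmetry reduces it to \<open>brk_derivation_exact\<close>.
\<close>

lemma brk_derivation: assumes f: "f \<in> \<F>" and s: "\<sigma> \<in> \<Omega> k" and r: "\<rho> \<in> \<Omega> l"
  shows "H f (brk k \<sigma> \<rho>) - brk k \<sigma> (H f \<rho>) = brk k (H f \<sigma>) \<rho>"
proof -
  note Hs = H_Om[OF f s]
  let ?C = "\<lambda>\<rho>. H f (brk k \<sigma> \<rho>) - sc ((- 1) ^ (0 * k)) (brk k \<sigma> (H f \<rho>))"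
  have "?C \<rho> = brk k (H f \<sigma>) \<rho>"
  proof (rule gd_eqI[where F = "\<lambda>_. ?C", OF _ _ _ _ r])
    show "graded_derivation (0 + k) (\<lambda>_. ?C)" by (rule gd_commutator[OF H_gd[OF f] brk_gd[OF s]])
    show "graded_derivation (0 + k) (\<lambda>_. brk k (H f \<sigma>))" using brk_gd[OF Hs] by simp
    fix h assume h: "h \<in> \<F>"
    note dh = df_Om1[OF h]
    show "?C (zero_form h) = brk k (H f \<sigma>) (zero_form h)"
      unfolding H_zero_form[OF f h] brk_zf[OF s h] brk_zf[OF s fb_F]
        brk_zf[OF Hs h] H_flat[OF f h s, symmetric] gd_minus[OF H_gd[OF f] H_Om[OF h s]]
      by (simp add: fun_eq_iff)
    have m: "H f (- sc c \<omega>) = - sc c (H f \<omega>)" if "\<omega> \<in> \<Omega> n" for c \<omega> n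
      unfolding gd_minus[OF H_gd[OF f] Om_sc[OF that]] H_sc[OF f that] by (rule refl)
    show "?C (df h) = brk k (H f \<sigma>) (df h)"
      unfolding brk_swap[OF s dh] brk_swap[OF Hs dh] brk_swap[OF s H_Om1[OF f dh]]
        m[OF brk_Om[OF dh s]] brk_derivation_exact[OF f h s, symmetric] by (simp add: fun_eq_iff algebra_simps)
  qed
  then show ?thesis by (simp add: fun_eq_iff)
qed

text \<open>
  The identity of \<open>brk_derivation\<close>, with the function moved to the last place by
  antisymmetry.
\<close>

lemma brk_jacobi_zf: assumes s: "\<sigma> \<in> \<Omega> k" and t: "\<tau> \<in> \<Omega> l" and g: "g \<in> \<F>"
  shows "brk (k + l) (brk k \<sigma> \<tau>) (zero_form g) =
    brk k \<sigma> (brk l \<tau> (zero_form g)) - sc ((- 1) ^ (k * l)) (brk l \<tau> (brk k \<sigma> (zero_form g)))"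
proof -
  note Hs = H_Om[OF g s] and Ht = H_Om[OF g t]
  have 1: "brk k \<sigma> (- H g \<tau>) = - brk k \<sigma> (H g \<tau>)" by (rule gd_minus[OF brk_gd[OF s] Ht])
  have 2: "brk l \<tau> (- H g \<sigma>) = - brk l \<tau> (H g \<sigma>)" by (rule gd_minus[OF brk_gd[OF t] Hs])
  have 3: "H g (brk k \<sigma> \<tau>) = brk k (H g \<sigma>) \<tau> + brk k \<sigma> (H g \<tau>)"
    unfolding brk_derivation[OF g s t, symmetric] by simp
  show ?thesis
    unfolding brk_zf[OF s g] brk_zf[OF t g] brk_zf[OF brk_Om[OF s t] g] 1 2 3
      brk_swap[OF Hs t] by (simp add: fun_eq_iff algebra_simps)
qed

text \<open>
  Both sides are derivations in \<open>\<rho>\<close>. On functions this is \<open>brk_jacobi_zf\<close>. Applying \<open>d\<close> to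
  that identity, and using it for the pairs \<open>d\<sigma>, \<tau>\<close> and \<open>\<sigma>, d\<tau>\<close>, gives the identity on
  differentials.
\<close>

lemma brk_jacobi: assumes s: "\<sigma> \<in> \<Omega> k" and t: "\<tau> \<in> \<Omega> l" and r: "\<rho> \<in> \<Omega> m"
  shows "brk (k + l) (brk k \<sigma> \<tau>) \<rho> = brk k \<sigma> (brk l \<tau> \<rho>) - sc ((- 1) ^ (k * l)) (brk l \<tau> (brk k \<sigma> \<rho>))"
proof -
  note Om = brk_Om and d = brk_ext_d
  show ?thesis
  proof (rule gd_eqI[OF brk_gd[OF Om[OF s t]] gd_commutator[OF brk_gd[OF s] brk_gd[OF t]] _ _ r])
    fix g assume g: "g \<in> \<F>"
    note z = zero_form_Om[OF g] and ds = ext_d_Om[OF s] and dt = ext_d_Om[OF t]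
    note st = Om[OF s t] and tz = Om[OF t z] and sz = Om[OF s z]
    show "brk (k + l) (brk k \<sigma> \<tau>) (zero_form g) =
        brk k \<sigma> (brk l \<tau> (zero_form g)) - sc ((- 1) ^ (k * l)) (brk l \<tau> (brk k \<sigma> (zero_form g)))"
      by (rule brk_jacobi_zf[OF s t g])
    have m1: "brk (Suc k) (\<dd> \<sigma>) \<tau> \<in> \<Omega> (Suc (k + l))" using Om[OF ds t] by simp
    have m2: "brk k \<sigma> (\<dd> \<tau>) \<in> \<Omega> (Suc (k + l))" using Om[OF s dt] by simp
    have L: "\<dd> (brk (k + l) (brk k \<sigma> \<tau>) (zero_form g)) =
        brk (Suc (k + l)) (brk (Suc k) (\<dd> \<sigma>) \<tau>) (zero_form g) + sc ((- 1) ^ k) (brk (Suc (k + l)) (brk k \<sigma> (\<dd> \<tau>)) (zero_form g))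
        + sc ((- 1) ^ (k + l)) (brk (k + l) (brk k \<sigma> \<tau>) (df g))"
      unfolding d[OF st z] d[OF s t] brk_add1[OF m1 Om_sc[OF m2] z] brk_sc1[OF m2 z] by (rule refl)
    have e: "\<dd> (brk k \<sigma> (brk l \<tau> (zero_form g))) = brk (Suc k) (\<dd> \<sigma>) (brk l \<tau> (zero_form g))
        + sc ((- 1) ^ k) (brk k \<sigma> (brk (Suc l) (\<dd> \<tau>) (zero_form g)) + sc ((- 1) ^ l) (brk k \<sigma> (brk l \<tau> (df g))))"
      if s: "\<sigma> \<in> \<Omega> k" and t: "\<tau> \<in> \<Omega> l" for \<sigma> \<tau> k l
    proof -
      note dt = ext_d_Om[OF t]
      have n1: "brk (Suc l) (\<dd> \<tau>) (zero_form g) \<in> \<Omega> (Suc l)" using Om[OF dt z] by simp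
      have n2: "brk l \<tau> (df g) \<in> \<Omega> (Suc l)" using Om[OF t df_Om1[OF g]] by simp
      have "brk k \<sigma> (sc ((- 1) ^ l) (brk l \<tau> (df g))) = sc ((- 1) ^ l) (brk k \<sigma> (brk l \<tau> (df g)))"
        by (rule gd_sign[OF brk_gd[OF s] n2])
      then show ?thesis unfolding d[OF s Om[OF t z]] d[OF t z] brk_add2[OF s n1 Om_sc[OF n2]] by simp
    qed
    have q: "\<dd> (x - sc c y) = \<dd> x - sc c (\<dd> y)" if "x \<in> \<Omega> n" "y \<in> \<Omega> n" for x y c n
      unfolding ext_d_diff[OF that(1) Om_sc[OF that(2)]] ext_d_sc[OF that(2)] by (rule refl)
    have y: "brk k \<sigma> (brk l \<tau> (zero_form g)) \<in> \<Omega> (k + l)" using Om[OF s tz] by simp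
    have y': "brk l \<tau> (brk k \<sigma> (zero_form g)) \<in> \<Omega> (k + l)" using Om[OF t sz] by (simp add: add.commute)
    have j1: "brk (Suc (k + l)) (brk (Suc k) (\<dd> \<sigma>) \<tau>) (zero_form g) = brk (Suc k) (\<dd> \<sigma>) (brk l \<tau> (zero_form g))
        - sc ((- 1) ^ (Suc k * l)) (brk l \<tau> (brk (Suc k) (\<dd> \<sigma>) (zero_form g)))"
      using brk_jacobi_zf[OF ds t g] by (simp only: add_Suc)
    have j2: "brk (Suc (k + l)) (brk k \<sigma> (\<dd> \<tau>)) (zero_form g) = brk k \<sigma> (brk (Suc l) (\<dd> \<tau>) (zero_form g))
        - sc ((- 1) ^ (k * Suc l)) (brk (Suc l) (\<dd> \<tau>) (brk k \<sigma> (zero_form g)))"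
      using brk_jacobi_zf[OF s dt g] by (simp only: add_Suc_right)
    have "\<dd> (brk (k + l) (brk k \<sigma> \<tau>) (zero_form g)) =
        \<dd> (brk k \<sigma> (brk l \<tau> (zero_form g)) - sc ((- 1) ^ (k * l)) (brk l \<tau> (brk k \<sigma> (zero_form g))))"
      by (rule arg_cong[OF brk_jacobi_zf[OF s t g]])
    then show "brk (k + l) (brk k \<sigma> \<tau>) (df g) =
        brk k \<sigma> (brk l \<tau> (df g)) - sc ((- 1) ^ (k * l)) (brk l \<tau> (brk k \<sigma> (df g)))"
      unfolding L q[OF y y'] e[OF s t] e[OF t s] j1 j2
      by (cases "even k"; cases "even l")
         (simp_all add: fun_eq_iff minus_one_power_iff, (metis minus_diff_eq minus_minus)+)
  qed
qed

end

context manifold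
begin

section \<open>The equivalence\<close>

text \<open>
  The bilinear extension of a family of brackets on homogeneous forms, where the first
  argument of \<open>b k\<close> has degree \<open>k\<close>.
\<close>

definition sum_components :: "(nat \<Rightarrow> 'm form \<Rightarrow> 'm form \<Rightarrow> 'm form) \<Rightarrow> 'm form \<Rightarrow> 'm form \<Rightarrow> 'm form" where
  "sum_components b \<sigma> \<rho> = (if \<sigma> \<in> total \<Omega> \<and> \<rho> \<in> total \<Omega>
     then (\<lambda>Xs. \<Sum>k\<le>length Xs. b k (component k \<sigma>) (component (length Xs - k) \<rho>) Xs) else 0)"

end

context metaflat_manifold
begin

abbreviation "bt \<equiv> sum_components brk"

lemma bt_eq: "\<sigma> \<in> total \<Omega> \<Longrightarrow> \<rho> \<in> total \<Omega> \<Longrightarrow>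
    bt \<sigma> \<rho> = (\<lambda>Xs. \<Sum>k\<le>length Xs. brk k (component k \<sigma>) (component (length Xs - k) \<rho>) Xs)"
  by (simp add: sum_components_def)

lemma bt_homogeneous: assumes s: "\<sigma> \<in> \<Omega> k" and r: "\<rho> \<in> \<Omega> l" shows "bt \<sigma> \<rho> = brk k \<sigma> \<rho>"
proof (rule ext)
  fix Xs :: "'m vfield list"
  let ?n = "length Xs"
  have "brk j (component j \<sigma>) (component (?n - j) \<rho>) Xs = (if j = k then brk k \<sigma> (component (?n - k) \<rho>) Xs else 0)" for j
  proof (cases "j = k")
    case False
    have "brk j 0 \<tau> = 0" if "\<tau> \<in> \<Omega> m" for \<tau> m
      using brk_add1[OF Om_0 Om_0 that, of j] by simp
    then have "brk j 0 (component (?n - j) \<rho>) = 0" using component_Om[OF Om_total[OF r]] by blast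
    then show ?thesis using component_other[OF s False] False by simp
  qed (simp add: component_same[OF s])
  then have "bt \<sigma> \<rho> Xs = (\<Sum>j\<le>?n. if j = k then brk k \<sigma> (component (?n - k) \<rho>) Xs else 0)"
    unfolding bt_eq[OF Om_total[OF s] Om_total[OF r]] by simp
  also have "\<dots> = (if k \<le> ?n then brk k \<sigma> (component (?n - k) \<rho>) Xs else 0)"
    by (subst sum.delta) auto
  also have "\<dots> = brk k \<sigma> \<rho> Xs"
  proof (cases "?n = k + l")
    case True
    then show ?thesis using component_same[OF r] by simp
  next
    case False
    have "brk k \<sigma> 0 = 0" by (rule gd_0[OF brk_gd[OF s]])
    moreover have "component (?n - k) \<rho> = 0" if "k \<le> ?n" by (rule component_other[OF r]) (use that False in simp)
    ultimately have "(if k \<le> ?n then brk k \<sigma> (component (?n - k) \<rho>) Xs else 0) = 0" by simp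
    moreover have "brk k \<sigma> \<rho> Xs = 0" by (rule Om_length[OF brk_Om[OF s r] False])
    ultimately show ?thesis by simp
  qed
  finally show "bt \<sigma> \<rho> Xs = brk k \<sigma> \<rho> Xs" .
qed

lemma bt_add1: assumes s: "\<sigma> \<in> total \<Omega>" and t: "\<tau> \<in> total \<Omega>" and r: "\<rho> \<in> total \<Omega>"
  shows "bt (\<sigma> + \<tau>) \<rho> = bt \<sigma> \<rho> + bt \<tau> \<rho>"
  unfolding bt_eq[OF s r] bt_eq[OF t r] bt_eq[OF total_add[OF s t] r] component_add
    brk_add1[OF component_Om[OF s] component_Om[OF t] component_Om[OF r]]
  by (rule ext) (simp add: sum.distrib)

lemma bt_add2: assumes s: "\<sigma> \<in> total \<Omega>" and t: "\<tau> \<in> total \<Omega>" and r: "\<rho> \<in> total \<Omega>"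
  shows "bt \<rho> (\<sigma> + \<tau>) = bt \<rho> \<sigma> + bt \<rho> \<tau>"
  unfolding bt_eq[OF r s] bt_eq[OF r t] bt_eq[OF r total_add[OF s t]] component_add
    brk_add2[OF component_Om[OF r] component_Om[OF s] component_Om[OF t]]
  by (rule ext) (simp add: sum.distrib)

lemma brk_sc2: assumes s: "\<sigma> \<in> \<Omega> k" and r: "\<rho> \<in> \<Omega> l" shows "brk k \<sigma> (sc c \<rho>) = sc c (brk k \<sigma> \<rho>)"
  unfolding brk_swap[OF s r] brk_swap[OF s Om_sc[OF r]] brk_sc1[OF r s]
  by (simp add: fun_eq_iff)

lemma bt_sc1: assumes s: "\<sigma> \<in> total \<Omega>" and r: "\<rho> \<in> total \<Omega>" shows "bt (sc c \<sigma>) \<rho> = sc c (bt \<sigma> \<rho>)"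
  unfolding bt_eq[OF s r] bt_eq[OF total_sc[OF s] r] component_sc brk_sc1[OF component_Om[OF s] component_Om[OF r]]
  by (rule ext, rule ext) (simp add: sum_fun_apply sum_distrib_left)

lemma bt_sc2: assumes s: "\<sigma> \<in> total \<Omega>" and r: "\<rho> \<in> total \<Omega>" shows "bt \<rho> (sc c \<sigma>) = sc c (bt \<rho> \<sigma>)"
  unfolding bt_eq[OF r s] bt_eq[OF r total_sc[OF s]] component_sc brk_sc2[OF component_Om[OF r] component_Om[OF s]]
  by (rule ext, rule ext) (simp add: sum_fun_apply sum_distrib_left)

lemma bt_Om: assumes s: "\<sigma> \<in> \<Omega> k" and r: "\<rho> \<in> \<Omega> l" shows "bt \<sigma> \<rho> \<in> \<Omega> (k + l)"
  unfolding bt_homogeneous[OF s r] by (rule brk_Om[OF s r])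

lemma bt_total1: assumes s: "\<sigma> \<in> \<Omega> k" and r: "\<rho> \<in> total \<Omega>" shows "bt \<sigma> \<rho> \<in> total \<Omega>"
  using r
proof (induction rule: total_induct)
  case (homogeneous l \<omega>)
  show "bt \<sigma> \<omega> \<in> total \<Omega>" by (rule Om_total[OF bt_Om[OF s homogeneous]])
next
  case (add \<omega> \<tau>)
  show "bt \<sigma> (\<omega> + \<tau>) \<in> total \<Omega>" unfolding bt_add2[OF add(1,2) Om_total[OF s]] by (rule total_add[OF add(3,4)])
qed

lemma bt_swap: assumes s: "\<sigma> \<in> \<Omega> k" and r: "\<rho> \<in> \<Omega> l" shows "bt \<sigma> \<rho> = - sc ((- 1) ^ (k * l)) (bt \<rho> \<sigma>)"
  unfolding bt_homogeneous[OF s r] bt_homogeneous[OF r s] by (rule brk_swap[OF s r])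

lemma bt_jacobi: assumes s: "\<sigma> \<in> \<Omega> k" and t: "\<tau> \<in> \<Omega> l" and r: "\<rho> \<in> total \<Omega>"
  shows "bt (bt \<sigma> \<tau>) \<rho> = bt \<sigma> (bt \<tau> \<rho>) - sc ((- 1) ^ (k * l)) (bt \<tau> (bt \<sigma> \<rho>))"
proof (rule total_induct[where P = "\<lambda>\<rho>. bt (bt \<sigma> \<tau>) \<rho> =
    bt \<sigma> (bt \<tau> \<rho>) - sc ((- 1) ^ (k * l)) (bt \<tau> (bt \<sigma> \<rho>))", OF r])
  fix m \<rho> assume r: "\<rho> \<in> \<Omega> m"
  show "bt (bt \<sigma> \<tau>) \<rho> = bt \<sigma> (bt \<tau> \<rho>) - sc ((- 1) ^ (k * l)) (bt \<tau> (bt \<sigma> \<rho>))"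
    unfolding bt_homogeneous[OF bt_Om[OF s t] r] bt_homogeneous[OF s bt_Om[OF t r]] bt_homogeneous[OF t bt_Om[OF s r]]
    unfolding bt_homogeneous[OF s t] bt_homogeneous[OF t r] bt_homogeneous[OF s r]
    by (rule brk_jacobi[OF s t r])
next
  fix \<rho> \<rho>' assume add: "\<rho> \<in> total \<Omega>" "\<rho>' \<in> total \<Omega>"
    "bt (bt \<sigma> \<tau>) \<rho> = bt \<sigma> (bt \<tau> \<rho>) - sc ((- 1) ^ (k * l)) (bt \<tau> (bt \<sigma> \<rho>))"
    "bt (bt \<sigma> \<tau>) \<rho>' = bt \<sigma> (bt \<tau> \<rho>') - sc ((- 1) ^ (k * l)) (bt \<tau> (bt \<sigma> \<rho>'))"
  note T = Om_total
  show "bt (bt \<sigma> \<tau>) (\<rho> + \<rho>') = bt \<sigma> (bt \<tau> (\<rho> + \<rho>')) - sc ((- 1) ^ (k * l)) (bt \<tau> (bt \<sigma> (\<rho> + \<rho>')))"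
    unfolding bt_add2[OF add(1,2) T[OF bt_Om[OF s t]]] bt_add2[OF add(1,2) T[OF t]] bt_add2[OF add(1,2) T[OF s]]
      bt_add2[OF bt_total1[OF t add(1)] bt_total1[OF t add(2)] T[OF s]]
      bt_add2[OF bt_total1[OF s add(1)] bt_total1[OF s add(2)] T[OF t]] add(3,4)
    by (simp add: fun_eq_iff algebra_simps)
qed

lemma bt_ext_d: assumes s: "\<sigma> \<in> \<Omega> k" and r: "\<rho> \<in> total \<Omega>"
  shows "\<dd> (bt \<sigma> \<rho>) = bt (\<dd> \<sigma>) \<rho> + sc ((- 1) ^ k) (bt \<sigma> (\<dd> \<rho>))"
  using r
proof (induction rule: total_induct)
  case (homogeneous m \<rho>)
  note r = homogeneous
  show "\<dd> (bt \<sigma> \<rho>) = bt (\<dd> \<sigma>) \<rho> + sc ((- 1) ^ k) (bt \<sigma> (\<dd> \<rho>))"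
    unfolding bt_homogeneous[OF s r] bt_homogeneous[OF ext_d_Om[OF s] r] bt_homogeneous[OF s ext_d_Om[OF r]]
    by (rule brk_ext_d[OF s r])
next
  case (add \<rho> \<rho>')
  note T = Om_total
  show "\<dd> (bt \<sigma> (\<rho> + \<rho>')) = bt (\<dd> \<sigma>) (\<rho> + \<rho>') + sc ((- 1) ^ k) (bt \<sigma> (\<dd> (\<rho> + \<rho>')))"
    unfolding bt_add2[OF add(1,2) T[OF s]] bt_add2[OF add(1,2) T[OF ext_d_Om[OF s]]] ext_d_add_total[OF add(1,2)]
      bt_add2[OF ext_d_total[OF add(1)] ext_d_total[OF add(2)] T[OF s]]
      ext_d_add_total[OF bt_total1[OF s add(1)] bt_total1[OF s add(2)]] add(3,4)
    by (simp add: fun_eq_iff algebra_simps)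
qed

lemma bt_wedge: assumes s: "\<sigma> \<in> \<Omega> k" and t: "\<tau> \<in> \<Omega> l" and r: "\<rho> \<in> total \<Omega>"
  shows "bt \<sigma> (\<tau> \<and>\<^sub>\<Omega> \<rho>) = bt \<sigma> \<tau> \<and>\<^sub>\<Omega> \<rho> + sc ((- 1) ^ (k * l)) (\<tau> \<and>\<^sub>\<Omega> bt \<sigma> \<rho>) \<and> \<tau> \<and>\<^sub>\<Omega> \<rho> \<in> total \<Omega>"
  using r
proof (induction rule: total_induct)
  case (homogeneous m \<rho>)
  note r = homogeneous
  have "bt \<sigma> (\<tau> \<and>\<^sub>\<Omega> \<rho>) = bt \<sigma> \<tau> \<and>\<^sub>\<Omega> \<rho> + sc ((- 1) ^ (k * l)) (\<tau> \<and>\<^sub>\<Omega> bt \<sigma> \<rho>)"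
    unfolding bt_homogeneous[OF s r] bt_homogeneous[OF s t] bt_homogeneous[OF s wedge_Om[OF t r]]
    by (rule brk_wedge2[OF s t r])
  then show ?case using Om_total[OF wedge_Om[OF t r]] by (rule conjI)
next
  case (add \<rho> \<rho>')
  have e: "bt \<sigma> (\<tau> \<and>\<^sub>\<Omega> \<rho>) = bt \<sigma> \<tau> \<and>\<^sub>\<Omega> \<rho> + sc ((- 1) ^ (k * l)) (\<tau> \<and>\<^sub>\<Omega> bt \<sigma> \<rho>)" "\<tau> \<and>\<^sub>\<Omega> \<rho> \<in> total \<Omega>"
    "bt \<sigma> (\<tau> \<and>\<^sub>\<Omega> \<rho>') = bt \<sigma> \<tau> \<and>\<^sub>\<Omega> \<rho>' + sc ((- 1) ^ (k * l)) (\<tau> \<and>\<^sub>\<Omega> bt \<sigma> \<rho>')" "\<tau> \<and>\<^sub>\<Omega> \<rho>' \<in> total \<Omega>"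
    using add(3,4) by blast+
  have "bt \<sigma> (\<tau> \<and>\<^sub>\<Omega> (\<rho> + \<rho>')) = bt \<sigma> \<tau> \<and>\<^sub>\<Omega> (\<rho> + \<rho>') + sc ((- 1) ^ (k * l)) (\<tau> \<and>\<^sub>\<Omega> bt \<sigma> (\<rho> + \<rho>'))"
    unfolding wedge_linear bt_add2[OF add(1,2) Om_total[OF s]] bt_add2[OF e(2,4) Om_total[OF s]] e(1,3)
    by (simp add: fun_eq_iff algebra_simps)
  moreover have "\<tau> \<and>\<^sub>\<Omega> (\<rho> + \<rho>') \<in> total \<Omega>" unfolding wedge_linear by (rule total_add[OF e(2,4)])
  ultimately show ?case by (rule conjI)
qed

lemma bt_dg_poisson_algebra: "dg_poisson_algebra sc \<Omega> \<dd> (\<and>\<^sub>\<Omega>) bt"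
  unfolding dg_poisson_algebra_def
proof (intro conjI allI ballI)
  show "graded_vector_space sc \<Omega>" by (rule forms_graded_vector_space)
  show "linear_on sc (total \<Omega>) \<dd>"
    unfolding linear_on_def
  proof (intro conjI allI ballI)
    show "\<dd> (x + y) = \<dd> x + \<dd> y" if "x \<in> total \<Omega>" "y \<in> total \<Omega>" for x y by (rule ext_d_add_total[OF that])
    show "\<dd> (sc c x) = sc c (\<dd> x)" if "x \<in> total \<Omega>" for c x by (rule ext_d_sc'[OF total_smooth[OF that]])
  qed
  show "bilinear_on sc (total \<Omega>) (\<and>\<^sub>\<Omega>)" by (rule bilinear_onI) (rule wedge_linear)+
  show "bilinear_on sc (total \<Omega>) bt" by (rule bilinear_onI) (rule bt_add1 bt_add2 bt_sc1 bt_sc2; assumption)+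
next
  fix x assume "x \<in> total \<Omega>"
  then show "\<dd> (\<dd> x) = 0"
  proof (induction rule: total_induct)
    case (homogeneous k \<omega>)
    show "\<dd> (\<dd> \<omega>) = 0" by (rule ext_d_ext_d[OF homogeneous])
  next
    case (add \<sigma> \<tau>)
    show "\<dd> (\<dd> (\<sigma> + \<tau>)) = 0"
      unfolding ext_d_add_total[OF add(1,2)] ext_d_add_total[OF ext_d_total[OF add(1)] ext_d_total[OF add(2)]] add(3,4)
      by simp
  qed
next
  fix k x y assume x: "x \<in> \<Omega> k" and "y \<in> total \<Omega>"
  have "\<dd> (x \<and>\<^sub>\<Omega> y) = \<dd> x \<and>\<^sub>\<Omega> y + sc ((- 1) ^ k) (x \<and>\<^sub>\<Omega> \<dd> y) \<and> x \<and>\<^sub>\<Omega> y \<in> total \<Omega>"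
    using \<open>y \<in> total \<Omega>\<close>
  proof (induction rule: total_induct)
    case (homogeneous l \<omega>)
    show ?case by (rule conjI[OF ext_d_wedge[OF x homogeneous] Om_total[OF wedge_Om[OF x homogeneous]]])
  next
    case (add \<sigma> \<tau>)
    note e = conjunct1[OF add(3)] conjunct2[OF add(3)] conjunct1[OF add(4)] conjunct2[OF add(4)]
    have "\<dd> (x \<and>\<^sub>\<Omega> (\<sigma> + \<tau>)) = \<dd> x \<and>\<^sub>\<Omega> (\<sigma> + \<tau>) + sc ((- 1) ^ k) (x \<and>\<^sub>\<Omega> \<dd> (\<sigma> + \<tau>))"
      unfolding wedge_linear ext_d_add_total[OF add(1,2)] ext_d_add_total[OF e(2,4)] e(1,3)
      by (simp add: fun_eq_iff algebra_simps)
    moreover have "x \<and>\<^sub>\<Omega> (\<sigma> + \<tau>) \<in> total \<Omega>" unfolding wedge_linear by (rule total_add[OF e(2,4)])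
    ultimately show ?case by (rule conjI)
  qed
  then show "\<dd> (x \<and>\<^sub>\<Omega> y) = \<dd> x \<and>\<^sub>\<Omega> y + sc ((- 1) ^ k) (x \<and>\<^sub>\<Omega> \<dd> y)" by (rule conjunct1)
qed (rule ext_d_Om wedge_Om wedge_assoc Om_wedge_commute bt_Om bt_swap bt_jacobi bt_ext_d conjunct1[OF bt_wedge]; assumption)+

lemma bt_dgp_bracket: "bt \<in> dgp_brackets A"
  unfolding dgp_brackets_def using bt_dg_poisson_algebra by (auto simp: sum_components_def)

lemma bt_corresponds: "corresponds A bt (\<pi>, D)"
  unfolding corresponds_def prod.case
proof (intro conjI ballI)
  fix f assume f: "f \<in> \<F>"
  note z = zero_form_Om[OF f]
  show "bt (zero_form f) (zero_form g) = zero_form (br f g)" if g: "g \<in> \<F>" for g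
    unfolding bt_homogeneous[OF z zero_form_Om[OF g]] brk_zero_form[OF f zero_form_Om[OF g]]
    by (rule H_zero_form[OF f g])
  show "D (df f) \<alpha> = bt (zero_form f) \<alpha>" if a: "\<alpha> \<in> \<Omega> 1" for \<alpha>
    unfolding bt_homogeneous[OF z a] brk_zero_form[OF f a] by (rule H_one_form[OF f a, symmetric])
qed

end

theorem theorem2p3:
  fixes A :: "('m::{t2_space, second_countable_topology}, 'e::real_inner) chart set"
  assumes "smooth_manifold A"
  shows "(\<forall>b \<in> dgp_brackets A. \<exists>!S. S \<in> poisson_connections A \<and> corresponds A b S) \<and>
         (\<forall>S \<in> poisson_connections A. \<exists>!b. b \<in> dgp_brackets A \<and> corresponds A b S)"
proof (intro conjI ballI)
  interpret manifold A by unfold_locales (rule assms)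
  fix b assume "b \<in> dgp_brackets A"
  then interpret dgp_bracket A b by unfold_locales
  show "\<exists>!S. S \<in> poisson_connections A \<and> corresponds A b S"
  proof (rule ex1I)
    show "(bracket_bivector b, bracket_connection b) \<in> poisson_connections A \<and>
        corresponds A b (bracket_bivector b, bracket_connection b)"
      by (rule conjI[OF bracket_poisson_connection bracket_corresponds])
    fix S assume S: "S \<in> poisson_connections A \<and> corresponds A b S"
    obtain \<pi> D where e: "S = (\<pi>, D)" by (cases S)
    show "S = (bracket_bivector b, bracket_connection b)"
      using poisson_connection_unique[of \<pi> D] S unfolding e by blast
  qed
next
  interpret manifold A by unfold_locales (rule assms)
  fix S assume "S \<in> poisson_connections A"
  moreover obtain \<pi> D where e: "S = (\<pi>, D)" by (cases S)
  ultimately have S: "(\<pi>, D) \<in> poisson_connections A" by simp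
  interpret metaflat_manifold A \<pi> D
    by unfold_locales (use S in \<open>auto simp: poisson_connections_def poisson_structure_def\<close>)
  interpret bt: dgp_bracket A bt by unfold_locales (rule bt_dgp_bracket)
  show "\<exists>!b. b \<in> dgp_brackets A \<and> corresponds A b S"
    unfolding e
  proof (rule ex1I)
    show "bt \<in> dgp_brackets A \<and> corresponds A bt (\<pi>, D)"
      by (rule conjI[OF bt_dgp_bracket bt_corresponds])
    show "b = bt" if "b \<in> dgp_brackets A \<and> corresponds A b (\<pi>, D)" for b
      using bt.corresponding_bracket_unique[OF _ bt_corresponds] that by blast
  qed
qed

end
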